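(* Let $T$ be as in the context and assume that, for the integer $k\ge1$ with $(A-\mathrm{Id})^k\ne0$, $(A-\mathrm{Id})^{k+1}=0$, the image $\{\mathbf y(A-\mathrm{Id})^k:\mathbf y\in\mathbb R^d\}$ equals $\mathbb R\mathbf e_d$. Let $\Psi$ be an everywhere positive trigonometric polynomial on $\mathbb T^d$ which is not measurably cohomologous to a constant with respect to $T$, and suppose that the function $\psi_{d-1}$ on $\mathbb T^{d-1}$ defined by $\psi_{d-1}(x_1,\dots,x_{d-1})=\int_0^1\Psi(x_1,\dots,x_d)\,dx_d$ is smoothly cohomologous to a constant with respect to $T_{d-1}$. Then the suspension flow $\{T^\Psi_t\}$ is mixing.
   Context: Let $d\ge 2$, $\mathbb T^d=\mathbb R^d/\mathbb Z^d$ with points as row vectors, $\lambda_d$ Lebesgue probability measure, $\mathbf e_d$ last standard basis vector. $A=(a_{i,j})$ is a $d\times d$ upper triangular unipotent integer matrix, $A\ne\mathrm{Id}$, $\mathbf b\in\mathbb T^d$, $T\mathbf x=\mathbf xA+\mathbf b$, uniquely ergodic. $T_{d-1}$ is the factor on $\mathbb T^{d-1}$: $T_{d-1}\mathbf y=\mathbf y(a_{i,j})_{1\le i,j\le d-1}+(b_1,\dots,b_{d-1})$. $\Psi$ is measurably (resp. smoothly) cohomologous to a constant w.r.t. a map $S$ if $\Psi-\int\Psi=u\circ S-u$ for a measurable (resp. $C^\infty$) $u$. For continuous $\Psi>0$ the suspension flow $\{T^\Psi_t\}$ is the unit-speed vertical flow on $(\mathbb T^d\times\mathbb R)/\sim_\Psi$,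 with $(\mathbf x,\Psi(\mathbf x))\sim(T\mathbf x,0)$; mixing is with respect to the normalized Lebesgue measure on $\{0\le r<\Psi(\mathbf x)\}$. *)

theory Defs
  imports "HOL-Probability.Probability"
begin

text \<open>Model of the torus T^n: points are represented by their unique
  representatives in [0,1)^n, as extensional functions on indices {..<n}
  (index j corresponds to coordinate j+1; the last coordinate e_d is index d-1).\<close>

definition cube :: "nat \<Rightarrow> (nat \<Rightarrow> real) set" where
  "cube n = PiE {..<n} (\<lambda>_. {0..<1})"

definition lam :: "nat \<Rightarrow> (nat \<Rightarrow> real) measure" where
  "lam n = PiM {..<n} (\<lambda>_. restrict_space lborel {0..<1::real})"

definition torus_map :: "nat \<Rightarrow> (nat \<Rightarrow> nat \<Rightarrow> int) \<Rightarrow> (nat \<Rightarrow> real) \<Rightarrow> (nat \<Rightarrow> real) \<Rightarrow> (nat \<Rightarrow> real)" where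
  "torus_map n a b x = restrict (\<lambda>j. frac ((\<Sum>i<n. x i * real_of_int (a i j)) + b j)) {..<n}"

definition invariant_prob :: "nat \<Rightarrow> ((nat \<Rightarrow> real) \<Rightarrow> (nat \<Rightarrow> real)) \<Rightarrow> (nat \<Rightarrow> real) measure \<Rightarrow> bool" where
  "invariant_prob n S \<mu> \<longleftrightarrow> prob_space \<mu> \<and> sets \<mu> = sets (lam n) \<and>
      S \<in> measurable \<mu> \<mu> \<and> distr \<mu> \<mu> S = \<mu>"

definition uniquely_ergodic :: "nat \<Rightarrow> ((nat \<Rightarrow> real) \<Rightarrow> (nat \<Rightarrow> real)) \<Rightarrow> bool" where
  "uniquely_ergodic n S \<longleftrightarrow> (\<exists>!\<mu>. invariant_prob n S \<mu>)"

definition vecmat :: "nat \<Rightarrow> (nat \<Rightarrow> real) \<Rightarrow> (nat \<Rightarrow> nat \<Rightarrow> real) \<Rightarrow> (nat \<Rightarrow> real)" where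
  "vecmat n y M = restrict (\<lambda>j. \<Sum>i<n. y i * M i j) {..<n}"

definition matmul :: "nat \<Rightarrow> (nat \<Rightarrow> nat \<Rightarrow> real) \<Rightarrow> (nat \<Rightarrow> nat \<Rightarrow> real) \<Rightarrow> (nat \<Rightarrow> nat \<Rightarrow> real)" where
  "matmul n M N = (\<lambda>i j. \<Sum>l<n. M i l * N l j)"

fun matpow :: "nat \<Rightarrow> (nat \<Rightarrow> nat \<Rightarrow> real) \<Rightarrow> nat \<Rightarrow> (nat \<Rightarrow> nat \<Rightarrow> real)" where
  "matpow n M 0 = (\<lambda>i j. if i = j then 1 else 0)"
| "matpow n M (Suc k) = matmul n (matpow n M k) M"

definition mat_zero :: "nat \<Rightarrow> (nat \<Rightarrow> nat \<Rightarrow> real) \<Rightarrow> bool" where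
  "mat_zero n M \<longleftrightarrow> (\<forall>i<n. \<forall>j<n. M i j = 0)"

definition minus_id :: "(nat \<Rightarrow> nat \<Rightarrow> int) \<Rightarrow> (nat \<Rightarrow> nat \<Rightarrow> real)" where
  "minus_id a = (\<lambda>i j. real_of_int (a i j) - (if i = j then 1 else 0))"

definition trig_poly :: "nat \<Rightarrow> ((nat \<Rightarrow> real) \<Rightarrow> real) \<Rightarrow> bool" where
  "trig_poly n \<Psi> \<longleftrightarrow> (\<exists>F c. finite F \<and> F \<subseteq> PiE {..<n} (\<lambda>_. (UNIV :: int set)) \<and>
     (\<forall>x\<in>cube n. complex_of_real (\<Psi> x) =
        (\<Sum>m\<in>F. c m * exp (2 * of_real pi * \<i> * of_real (\<Sum>j<n. real_of_int (m j) * x j)))))"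

definition meas_coh_const :: "nat \<Rightarrow> ((nat \<Rightarrow> real) \<Rightarrow> (nat \<Rightarrow> real)) \<Rightarrow> ((nat \<Rightarrow> real) \<Rightarrow> real) \<Rightarrow> bool" where
  "meas_coh_const n S \<Psi> \<longleftrightarrow> (\<exists>u \<in> borel_measurable (lam n).
     AE x in lam n. \<Psi> x - (\<integral>y. \<Psi> y \<partial>lam n) = u (S x) - u x)"

text \<open>C^infinity functions on R^n: all iterated partial derivatives exist and are continuous.
  D js is the iterated partial derivative along the list of directions js.\<close>
definition smooth_Rn :: "nat \<Rightarrow> ((nat \<Rightarrow> real) \<Rightarrow> real) \<Rightarrow> bool" where
  "smooth_Rn n U \<longleftrightarrow> (\<exists>D :: nat list \<Rightarrow> (nat \<Rightarrow> real) \<Rightarrow> real. D [] = U \<and>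
     (\<forall>js. set js \<subseteq> {..<n} \<longrightarrow> continuous_on (PiE {..<n} (\<lambda>_. UNIV)) (D js)) \<and>
     (\<forall>js j x. set js \<subseteq> {..<n} \<and> j < n \<and> x \<in> PiE {..<n} (\<lambda>_. UNIV) \<longrightarrow>
        ((\<lambda>t. D js (x(j := x j + t))) has_real_derivative D (j # js) x) (at 0)))"

text \<open>Smooth functions on T^n = smooth Z^n-periodic functions on R^n (restricted to the cube).\<close>
definition smooth_coh_const :: "nat \<Rightarrow> ((nat \<Rightarrow> real) \<Rightarrow> (nat \<Rightarrow> real)) \<Rightarrow> ((nat \<Rightarrow> real) \<Rightarrow> real) \<Rightarrow> bool" where
  "smooth_coh_const n S \<psi> \<longleftrightarrow> (\<exists>U. smooth_Rn n U \<and>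
     (\<forall>x\<in>PiE {..<n} (\<lambda>_. UNIV). \<forall>j<n. U (x(j := x j + 1)) = U x) \<and>
     (\<forall>y\<in>cube n. \<psi> y - (\<integral>z. \<psi> z \<partial>lam n) = U (S y) - U y))"

definition susp_space :: "nat \<Rightarrow> ((nat \<Rightarrow> real) \<Rightarrow> real) \<Rightarrow> ((nat \<Rightarrow> real) \<times> real) set" where
  "susp_space n \<Psi> = {(x, r). x \<in> cube n \<and> 0 \<le> r \<and> r < \<Psi> x}"

definition birkhoff_sum :: "((nat \<Rightarrow> real) \<Rightarrow> (nat \<Rightarrow> real)) \<Rightarrow> ((nat \<Rightarrow> real) \<Rightarrow> real) \<Rightarrow> nat \<Rightarrow> (nat \<Rightarrow> real) \<Rightarrow> real" where
  "birkhoff_sum S \<Psi> m x = (\<Sum>i<m. \<Psi> ((S ^^ i) x))"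

text \<open>Flow for times t \<ge> 0 (only those matter for mixing).\<close>
definition susp_flow :: "((nat \<Rightarrow> real) \<Rightarrow> (nat \<Rightarrow> real)) \<Rightarrow> ((nat \<Rightarrow> real) \<Rightarrow> real) \<Rightarrow> real \<Rightarrow>
    (nat \<Rightarrow> real) \<times> real \<Rightarrow> (nat \<Rightarrow> real) \<times> real" where
  "susp_flow S \<Psi> t = (\<lambda>(x, r).
     let m = (LEAST m. r + t < birkhoff_sum S \<Psi> (Suc m) x)
     in ((S ^^ m) x, r + t - birkhoff_sum S \<Psi> m x))"

definition susp_measure :: "nat \<Rightarrow> ((nat \<Rightarrow> real) \<Rightarrow> real) \<Rightarrow> ((nat \<Rightarrow> real) \<times> real) measure" where
  "susp_measure n \<Psi> = uniform_measure (lam n \<Otimes>\<^sub>M lborel) (susp_space n \<Psi>)"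

definition susp_mixing :: "nat \<Rightarrow> ((nat \<Rightarrow> real) \<Rightarrow> (nat \<Rightarrow> real)) \<Rightarrow> ((nat \<Rightarrow> real) \<Rightarrow> real) \<Rightarrow> bool" where
  "susp_mixing n S \<Psi> \<longleftrightarrow> (\<forall>A \<in> sets (susp_measure n \<Psi>). \<forall>B \<in> sets (susp_measure n \<Psi>).
     ((\<lambda>t. measure (susp_measure n \<Psi>) (susp_flow S \<Psi> t -` A \<inter> B))
        \<longlongrightarrow> measure (susp_measure n \<Psi>) A * measure (susp_measure n \<Psi>) B) at_top)"

end

theory Submission
  imports Defs "HOL-Real_Asymp.Real_Asymp"
begin

text \<open>Let \<open>p n\<close> be the Birkhoff sums of \<open>\<Psi>\<close> and split \<open>\<Psi>\<close> by the frequency in the last coordinate. The part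
  of last frequency zero is a smooth coboundary up to its mean, so it contributes a bounded error. Since \<open>\<Psi>\<close> is
  not a measurable coboundary, the Birkhoff sums are not tight; as they are trigonometric polynomials of bounded
  degree in the last coordinate, and small translations of \<open>x\<close> move \<open>T\<^sup>n x\<close> along that coordinate (the
  image of \<open>(A - Id)\<^sup>k\<close>), their part \<open>q n\<close> oscillating in it tends to infinity in measure. Hence a vertical fibre is sheared along the flow more and more, and
  integrating by parts over the last coordinate the correlation of a character with the time derivative of
  a smoothed observable tends to zero. So the correlations vary slowly in time, while their
  averages over long time windows converge by unique ergodicity; hence they converge themselves. Measurable sets are
  reached by \<open>L\<^sup>1\<close> approximation.\<close>


section \<open>Characters and Fourier approximation\<close>

text \<open>Three difficulties shape the argument. Failure of tightness only provides single times
  at which the Birkhoff sums are large with high probability, whereas mixing needs all large times;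
  the decoupling of long iterates from their starting point, combined with a second moment argument,
  closes this gap. Next, the return that is active at time \<open>t\<close> varies along a fibre.
  Observables are therefore cut off to heights in an interval of length \<open>m0\<close>, a
  positive lower bound of \<Psi>, so that at most one return contributes at each point, and the
  sublinear growth of \<open>q\<close> (Weyl sums, uniform in the point) forces all returns active
  at time \<open>t\<close> to have nearly the same oscillating part, relative to its size. Finally,
  the shear of a fibre need not be monotone: its derivative is a trigonometric polynomial that may
  vanish, but its degree is at most \<open>D\<close> for every time, and for bounded degree the set
  of small values has small measure uniformly in the coefficients. The smooth coboundary hypothesis
  enters as a bound \<open>CU\<close>, uniform in time and point, on the part of the centred sums
  that does not depend on the last coordinate.\<close>

definition chr :: "nat \<Rightarrow> (nat \<Rightarrow> int) \<Rightarrow> (nat \<Rightarrow> real) \<Rightarrow> complex" where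
  "chr n \<xi> x = cis (2 * pi * (\<Sum>j<n. real_of_int (\<xi> j) * x j))"

lemma norm_chr [simp]: "norm (chr n \<xi> x) = 1"
  by (simp add: chr_def)

lemma chr_add: "chr n (\<lambda>j. \<xi> j + \<eta> j) x = chr n \<xi> x * chr n \<eta> x"
  by (simp add: chr_def cis_mult sum.distrib algebra_simps)

lemma chr_zero: "\<forall>j<n. \<xi> j = 0 \<Longrightarrow> chr n \<xi> x = 1"
  by (simp add: chr_def)

lemma chr_cong: "(\<And>j. j < n \<Longrightarrow> \<xi> j = \<eta> j) \<Longrightarrow> (\<And>j. j < n \<Longrightarrow> x j = y j) \<Longrightarrow> chr n \<xi> x = chr n \<eta> y"
  by (simp add: chr_def)

lemma chr_uminus: "chr n (\<lambda>j. - \<xi> j) x = cnj (chr n \<xi> x)"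
  by (simp add: chr_def sum_negf cis_cnj)

lemma chr_upd:
  assumes "k < n"
  shows "chr n \<xi> (x(k := x k + v)) = chr n \<xi> x * cis (2 * pi * (real_of_int (\<xi> k) * v))"
proof -
  have "(\<Sum>j<n. real_of_int (\<xi> j) * (x(k := x k + v)) j) =
        (\<Sum>j<n. real_of_int (\<xi> j) * x j + (if j = k then real_of_int (\<xi> k) * v else 0))"
    by (rule sum.cong) (auto simp: algebra_simps)
  also have "\<dots> = (\<Sum>j<n. real_of_int (\<xi> j) * x j) + real_of_int (\<xi> k) * v"
    using assms by (simp add: sum.distrib)
  finally show ?thesis by (simp add: chr_def cis_mult algebra_simps)
qed

lemma cis_2pi_int_add: "cis (2 * pi * (r + real_of_int m)) = cis (2 * pi * r)"
proof -
  have "cis (2 * pi * (r + real_of_int m)) = cis (2 * pi * r) * cis (2 * pi * real_of_int m)"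
    by (simp add: cis_mult algebra_simps)
  then show ?thesis by (simp add: cis_multiple_2pi)
qed

text \<open>The reduction modulo one inside \<open>torus_map\<close> and \<open>shift\<close> is
  invisible to characters. Later computations with frequencies can therefore use real coordinates,
  at points that may lie outside the cube.\<close>

lemma chr_mod_int:
  assumes "\<And>j. j < n \<Longrightarrow> \<exists>m::int. y j = x j + real_of_int m"
  shows "chr n \<xi> y = chr n \<xi> x"
proof -
  obtain m :: "nat \<Rightarrow> int" where m: "\<And>j. j < n \<Longrightarrow> y j = x j + real_of_int (m j)"
    using assms by metis
  have "(\<Sum>j<n. real_of_int (\<xi> j) * y j) = (\<Sum>j<n. real_of_int (\<xi> j) * x j) + real_of_int (\<Sum>j<n. \<xi> j * m j)"
    by (simp add: m sum.distrib[symmetric] algebra_simps)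
  then show ?thesis unfolding chr_def by (simp only: cis_2pi_int_add)
qed

lemma space_lam [simp]: "space (lam n) = cube n"
  by (simp add: lam_def space_PiM cube_def space_restrict_space)

lemma prob_space_unit: "prob_space (restrict_space lborel {0..<1::real})"
  by (rule prob_spaceI) (simp add: emeasure_restrict_space space_restrict_space)

lemma prob_space_lam [simp]: "prob_space (lam n)"
  unfolding lam_def by (intro prob_space_PiM prob_space_unit)

lemma measurable_component_lam:
  assumes "i < n"
  shows "(\<lambda>x. x i) \<in> borel_measurable (lam n)"
proof -
  have "(\<lambda>x. x i) \<in> measurable (lam n) (restrict_space lborel {0..<1::real})"
    unfolding lam_def using assms by simp
  moreover have "(\<lambda>x. x) \<in> borel_measurable (restrict_space lborel {0..<1::real})"
    by (simp add: measurable_restrict_space1)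
  ultimately show ?thesis
    using measurable_comp[of "\<lambda>x. x i" "lam n" "restrict_space lborel {0..<1::real}" "\<lambda>x. x" borel] by (simp add: comp_def)
qed

lemma cis_measurable [measurable (raw)]:
  "f \<in> borel_measurable M \<Longrightarrow> (\<lambda>x. cis (f x)) \<in> borel_measurable M"
  using borel_measurable_continuous_onI[of cis] measurable_compose[of f M borel cis borel]
  by (simp add: continuous_on_cis)

lemma chr_measurable [measurable]: "chr n \<xi> \<in> borel_measurable (lam n)"
proof -
  have "(\<lambda>x. \<Sum>j\<in>{..<n}. real_of_int (\<xi> j) * x j) \<in> borel_measurable (lam n)"
    by (intro borel_measurable_sum borel_measurable_times borel_measurable_const measurable_component_lam) simp
  then show ?thesis unfolding chr_def[abs_def] by measurable
qed

lemma has_vector_derivative_cis: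
  "((\<lambda>x. cis (k * x)) has_vector_derivative (\<i> * of_real k * cis (k * x))) (at x within S)"
proof -
  have "((\<lambda>z. exp (\<i> * of_real k * z)) has_field_derivative (\<i> * of_real k * exp (\<i> * of_real k * of_real x))) (at (of_real x))"
    by (auto intro!: derivative_eq_intros)
  from has_vector_derivative_real_field[OF this, of S] show ?thesis
    by (simp add: cis_conv_exp mult.assoc)
qed

lemma cis_sum: "finite I \<Longrightarrow> cis (\<Sum>i\<in>I. f i) = (\<Prod>i\<in>I. cis (f i))"
  by (induction I rule: finite_induct) (auto simp: cis_mult[symmetric])

lemma integral_cis_int:
  assumes "m \<noteq> (0::int)"
  shows "(\<integral>x. cis (2 * pi * (real_of_int m * x)) \<partial>restrict_space lborel {0..<1::real}) = 0"
proof -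
  let ?f = "\<lambda>x. cis (2 * pi * (real_of_int m * x))"
  let ?F = "\<lambda>x. cis (2 * pi * (real_of_int m * x)) / (2 * pi * \<i> * real_of_int m)"
  have "(\<integral>x. ?f x \<partial>restrict_space lborel {0..<1}) = (\<integral>x. indicator {0..<1} x *\<^sub>R ?f x \<partial>lborel)"
    by (subst integral_restrict_space) (auto simp: )
  also have "\<dots> = (\<integral>x. indicator {0..1} x *\<^sub>R ?f x \<partial>lborel)"
  proof (rule integral_cong_AE)
    show "AE x in lborel. indicator {0..<1} x *\<^sub>R ?f x = indicator {0..1} x *\<^sub>R ?f x"
      using AE_lborel_singleton[of "1::real"] by eventually_elim (auto simp: indicator_def)
  qed (measurable)
  also have "\<dots> = ?F 1 - ?F 0"
  proof (rule integral_FTC_atLeastAtMost)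
    fix x :: real
    show "(?F has_vector_derivative ?f x) (at x within {0..1})"
    proof (rule has_vector_derivative_eq_rhs)
      show "(?F has_vector_derivative (\<i> * of_real (2 * pi * real_of_int m) * cis (2 * pi * real_of_int m * x)) / (2 * pi * \<i> * real_of_int m)) (at x within {0..1})"
        using has_vector_derivative_cis[of "2 * pi * real_of_int m", THEN has_vector_derivative_divide, of "2 * pi * \<i> * real_of_int m"]
        by (simp only: mult.assoc)
    qed (use assms in \<open>simp add: mult.assoc\<close>)
  next
    show "continuous_on {0..1} ?f" by (intro continuous_intros)
  qed auto
  also have "\<dots> = 0" by (simp add: cis_multiple_2pi)
  finally show ?thesis .
qed

lemma integral_chr:
  "(\<integral>x. chr n \<xi> x \<partial>lam n) = (if \<forall>j<n. \<xi> j = 0 then 1 else 0)"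
proof (cases "\<forall>j<n. \<xi> j = 0")
  case True
  interpret prob_space "lam n" by simp
  show ?thesis using True prob_space by (simp add: chr_zero)
next
  case False
  then obtain j where j: "j < n" "\<xi> j \<noteq> 0" by auto
  interpret P: prob_space "restrict_space lborel {0..<1::real}" by (rule prob_space_unit)
  interpret product_sigma_finite "\<lambda>_::nat. restrict_space lborel {0..<1::real}" ..
  let ?g = "\<lambda>j x. cis (2 * pi * (real_of_int (\<xi> j) * x))"
  have "(\<integral>x. chr n \<xi> x \<partial>lam n) = (\<integral>x. (\<Prod>j\<in>{..<n}. ?g j (x j)) \<partial>lam n)"
    by (simp add: chr_def sum_distrib_left cis_sum)
  also have "\<dots> = (\<Prod>j\<in>{..<n}. \<integral>x. ?g j x \<partial>restrict_space lborel {0..<1::real})"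
    unfolding lam_def
  proof (rule product_integral_prod)
    fix i
    show "integrable (restrict_space lborel {0..<1::real}) (?g i)"
    proof (rule P.integrable_const_bound[of _ 1])
      show "?g i \<in> borel_measurable (restrict_space lborel {0..<1})"
        by (intro measurable_restrict_space1) measurable
    qed auto
  qed auto
  also have "\<dots> = 0"
    using j integral_cis_int[of "\<xi> j"] by (intro prod_zero) auto
  finally show ?thesis using False by simp
qed

subsection \<open>Trigonometric polynomials\<close>

text \<open>Generated by adding one term at a time, so that no set of frequencies has to be carried
  along; frequencies may repeat. Closure properties and bounds follow by induction over the
  terms.\<close>

inductive tp :: "nat \<Rightarrow> ((nat \<Rightarrow> real) \<Rightarrow> complex) \<Rightarrow> bool" for n where
  tp_zero: "tp n (\<lambda>x. 0)"
| tp_step: "tp n P \<Longrightarrow> tp n (\<lambda>x. P x + c * chr n \<xi> x)"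

lemma tp_chr: "tp n (\<lambda>x. c * chr n \<xi> x)"
  using tp_step[OF tp_zero, of n c \<xi>] by simp

lemma tp_const: "tp n (\<lambda>x. c)"
  using tp_chr[of n c "\<lambda>_. 0"] by (simp add: chr_zero)

lemma tp_add: "tp n Q \<Longrightarrow> tp n P \<Longrightarrow> tp n (\<lambda>x. P x + Q x)"
proof (induction rule: tp.induct)
  case tp_zero then show ?case by simp
next
  case (tp_step Q c \<xi>)
  then show ?case using tp.tp_step[of n "\<lambda>x. P x + Q x" c \<xi>] by (simp add: add.assoc)
qed

lemma tp_mult_chr: "tp n P \<Longrightarrow> tp n (\<lambda>x. P x * (c * chr n \<xi> x))"
proof (induction rule: tp.induct)
  case tp_zero then show ?case by (simp add: tp.tp_zero)
next
  case (tp_step P c' \<eta>)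
  have eq: "(\<lambda>x. (P x + c' * chr n \<eta> x) * (c * chr n \<xi> x)) =
     (\<lambda>x. P x * (c * chr n \<xi> x) + (c * c') * chr n (\<lambda>j. \<eta> j + \<xi> j) x)"
    by (simp add: chr_add algebra_simps)
  show ?case unfolding eq by (rule tp.tp_step[OF tp_step.IH])
qed

lemma tp_mult: "tp n Q \<Longrightarrow> tp n P \<Longrightarrow> tp n (\<lambda>x. P x * Q x)"
proof (induction rule: tp.induct)
  case tp_zero then show ?case by (simp add: tp.tp_zero)
next
  case (tp_step Q c \<xi>)
  show ?case using tp_add[OF tp_mult_chr[OF tp_step.prems, of c \<xi>] tp_step.IH[OF tp_step.prems]]
    by (simp add: distrib_left)
qed

lemma tp_power: "tp n P \<Longrightarrow> tp n (\<lambda>x. P x ^ k)"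
proof (induction k)
  case (Suc k)
  show ?case unfolding power_Suc by (rule tp_mult[OF Suc.IH[OF Suc.prems] Suc.prems])
qed (simp add: tp_const)

lemma tp_bounded: "tp n P \<Longrightarrow> \<exists>B>0. \<forall>x. norm (P x) \<le> B"
proof (induction rule: tp.induct)
  case tp_zero then show ?case by (intro exI[of _ 1]) auto
next
  case (tp_step P c \<xi>)
  then obtain B where "B > 0" "\<And>x. norm (P x) \<le> B" by auto
  then show ?case
    by (intro exI[of _ "B + norm c"]) (auto intro!: norm_triangle_le add_mono simp: norm_mult add_pos_nonneg)
qed

lemma tp_measurable: "tp n P \<Longrightarrow> P \<in> borel_measurable (lam n)"
proof (induction rule: tp.induct)
  case (tp_step P c \<xi>)
  show ?case by (intro borel_measurable_add borel_measurable_times borel_measurable_const chr_measurable tp_step.IH)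
qed simp

section \<open>Density of trigonometric polynomials in the mean, for two measures at once\<close>

locale torus_measures =
  fixes n :: nat and M N :: "(nat \<Rightarrow> real) measure"
  assumes finM: "finite_measure M" and finN: "finite_measure N"
    and setsM: "sets M = sets (lam n)" and setsN: "sets N = sets (lam n)"
begin

text \<open>One trigonometric polynomial has to serve both measures: two measures with equal Fourier
  coefficients are compared through a common approximant of an indicator. Boundedness is included
  because it makes the class closed under products.\<close>

definition ap :: "((nat \<Rightarrow> real) \<Rightarrow> complex) \<Rightarrow> bool" where
  "ap f \<longleftrightarrow> f \<in> borel_measurable (lam n) \<and> (\<exists>B. \<forall>x\<in>cube n. norm (f x) \<le> B) \<and>
    (\<forall>e>0. \<exists>P. tp n P \<and> (\<integral>x. norm (f x - P x) \<partial>M) < e \<and> (\<integral>x. norm (f x - P x) \<partial>N) < e)"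

lemma measM: "borel_measurable M = borel_measurable (lam n)"
  and measN: "borel_measurable N = borel_measurable (lam n)"
  by (intro measurable_cong_sets setsM setsN refl)+

lemma spaceM: "space M = cube n" and spaceN: "space N = cube n"
  using sets_eq_imp_space_eq[OF setsM] sets_eq_imp_space_eq[OF setsN] by auto

lemma bounded_integrable:
  fixes f :: "(nat \<Rightarrow> real) \<Rightarrow> complex"
  assumes "f \<in> borel_measurable (lam n)" "\<And>x. x \<in> cube n \<Longrightarrow> norm (f x) \<le> B"
  shows "integrable M f" "integrable N f"
proof -
  interpret M: finite_measure M by (rule finM)
  interpret N: finite_measure N by (rule finN)
  show "integrable M f" by (rule M.integrable_const_bound[of _ B]) (use assms in \<open>auto simp: measM spaceM\<close>)
  show "integrable N f" by (rule N.integrable_const_bound[of _ B]) (use assms in \<open>auto simp: measN spaceN\<close>)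
qed

lemma ap_integrable: "ap f \<Longrightarrow> integrable M f" "ap f \<Longrightarrow> integrable N f"
  unfolding ap_def by (auto intro: bounded_integrable)

lemma tp_integrable: "tp n P \<Longrightarrow> integrable M P" "tp n P \<Longrightarrow> integrable N P"
  using tp_bounded[of n P] tp_measurable[of n P] bounded_integrable[of P] by blast+

lemma ap_meas: "ap f \<Longrightarrow> f \<in> borel_measurable (lam n)" by (simp add: ap_def)

lemma ap_bound: "ap f \<Longrightarrow> \<exists>B>0. \<forall>x\<in>cube n. norm (f x) \<le> B"
  unfolding ap_def by (metis less_eq_real_def less_max_iff_disj linorder_not_le zero_less_one)

lemma ap_approx:
  assumes "ap f" "e > 0"
  obtains P where "tp n P" "(\<integral>x. norm (f x - P x) \<partial>M) < e" "(\<integral>x. norm (f x - P x) \<partial>N) < e"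
  using assms unfolding ap_def by blast

text \<open>Approximability by members of the class suffices: half of the error is spent on each of
  the two successive approximations.\<close>

lemma apI:
  assumes f: "f \<in> borel_measurable (lam n)" and B: "\<And>x. x \<in> cube n \<Longrightarrow> norm (f x) \<le> B"
    and app: "\<And>e. e > 0 \<Longrightarrow> \<exists>g. ap g \<and> (\<integral>x. norm (f x - g x) \<partial>M) < e \<and> (\<integral>x. norm (f x - g x) \<partial>N) < e"
  shows "ap f"
  unfolding ap_def
proof (intro conjI allI impI)
  show "\<exists>B. \<forall>x\<in>cube n. cmod (f x) \<le> B" using B by auto
next
  fix e :: real assume "e > 0"
  then obtain g where g: "ap g" "(\<integral>x. norm (f x - g x) \<partial>M) < e/2" "(\<integral>x. norm (f x - g x) \<partial>N) < e/2"
    using app[of "e/2"] by auto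
  obtain P where P: "tp n P" "(\<integral>x. norm (g x - P x) \<partial>M) < e/2" "(\<integral>x. norm (g x - P x) \<partial>N) < e/2"
    using g(1) \<open>e > 0\<close> unfolding ap_def by (metis half_gt_zero)
  have tri: "(\<integral>x. norm (f x - P x) \<partial>L) \<le> (\<integral>x. norm (f x - g x) \<partial>L) + (\<integral>x. norm (g x - P x) \<partial>L)"
    if "integrable L f" "integrable L g" "integrable L P" for L
  proof -
    have "(\<integral>x. norm (f x - P x) \<partial>L) \<le> (\<integral>x. norm (f x - g x) + norm (g x - P x) \<partial>L)"
      by (rule integral_mono) (use that in \<open>auto intro: norm_diff_triangle_le[OF order_refl order_refl]\<close>)
    then show ?thesis using that by (simp add: )
  qed
  show "\<exists>P. tp n P \<and> (\<integral>x. norm (f x - P x) \<partial>M) < e \<and> (\<integral>x. norm (f x - P x) \<partial>N) < e"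
    using tri[of M] tri[of N] bounded_integrable[OF f B] ap_integrable[OF g(1)] tp_integrable[OF P(1)] g P
    by (intro exI[of _ P]) force
qed (rule f)

lemma ap_tp: "tp n P \<Longrightarrow> ap P"
  unfolding ap_def using tp_bounded[of n P] tp_measurable[of n P] by (auto intro!: exI[of _ P])

lemma ap_uniform:
  assumes f: "f \<in> borel_measurable (lam n)" and "\<And>e. e > 0 \<Longrightarrow> \<exists>g. ap g \<and> (\<forall>x\<in>cube n. norm (f x - g x) \<le> e)"
  shows "ap f"
proof -
  obtain g where g1: "ap g" "\<forall>x\<in>cube n. norm (f x - g x) \<le> 1"
    using assms(2)[of 1] by auto
  obtain B where "\<forall>x\<in>cube n. norm (g x) \<le> B" using ap_bound[OF g1(1)] by auto
  then have B: "norm (f x) \<le> B + 1" if "x \<in> cube n" for x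
    using that g1(2) norm_triangle_ineq[of "f x - g x" "g x"] by force
  show ?thesis
  proof (rule apI[OF f B])
    fix e :: real assume e: "e > 0"
    \<comment> \<open>The summand 1 keeps the quotient meaningful when both measures vanish and
      makes the product of \<open>d\<close> with either total mass strictly smaller than
      \<open>e\<close>.\<close>
    define d where "d = e / (measure M (space M) + measure N (space N) + 1)"
    have d: "d > 0" using e by (auto simp: d_def intro!: divide_pos_pos add_nonneg_pos)
    have dM: "d * measure M (space M) < e" "d * measure N (space N) < e"
    proof -
      have "d * (measure M (space M) + measure N (space N) + 1) = e"
        unfolding d_def by (simp add: add_nonneg_eq_0_iff)
      moreover have "0 \<le> d * measure M (space M)" "0 \<le> d * measure N (space N)" using d by auto
      ultimately show "d * measure M (space M) < e" "d * measure N (space N) < e"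
        using d by (simp_all only: distrib_left)
    qed
    obtain g where g: "ap g" "\<forall>x\<in>cube n. norm (f x - g x) \<le> d" using assms(2)[OF d] by auto
    interpret M: finite_measure M by (rule finM)
    interpret N: finite_measure N by (rule finN)
    have "(\<integral>x. norm (f x - g x) \<partial>M) \<le> (\<integral>x. d \<partial>M)"
      by (rule integral_mono) (use bounded_integrable[OF f B] ap_integrable[OF g(1)] g in \<open>auto simp: spaceM\<close>)
    moreover have "(\<integral>x. norm (f x - g x) \<partial>N) \<le> (\<integral>x. d \<partial>N)"
      by (rule integral_mono) (use bounded_integrable[OF f B] ap_integrable[OF g(1)] g in \<open>auto simp: spaceN\<close>)
    ultimately show "\<exists>g. ap g \<and> (\<integral>x. norm (f x - g x) \<partial>M) < e \<and> (\<integral>x. norm (f x - g x) \<partial>N) < e"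
      using g dM by (intro exI[of _ g]) (auto simp: mult.commute)
  qed
qed

text \<open>Dominated convergence, with the constant \<open>2 * B\<close> as majorant for both
  finite measures, turns bounded pointwise limits into approximation in both means.\<close>

lemma ap_lim:
  assumes f: "\<And>k. ap (f k)" and B: "\<And>k x. x \<in> cube n \<Longrightarrow> norm (f k x) \<le> B"
    and lim: "\<And>x. x \<in> cube n \<Longrightarrow> (\<lambda>k. f k x) \<longlonglongrightarrow> g x" and g: "g \<in> borel_measurable (lam n)"
  shows "ap g"
proof (rule apI[OF g])
  show Bg: "norm (g x) \<le> B" if "x \<in> cube n" for x
    using lim[OF that] B[OF that] by (intro LIMSEQ_le_const2[OF tendsto_norm]) auto
  fix e :: real assume e: "e > 0"
  have conv: "(\<lambda>k. \<integral>x. norm (g x - f k x) \<partial>L) \<longlonglongrightarrow> (\<integral>x. 0 \<partial>L)"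
    if L: "sets L = sets (lam n)" "finite_measure L" for L
  proof (rule integral_dominated_convergence[where w="\<lambda>x. 2 * B"])
    have ms: "borel_measurable L = borel_measurable (lam n)" by (intro measurable_cong_sets L refl)
    have sp: "space L = cube n" using sets_eq_imp_space_eq[OF L(1)] by simp
    show "(\<lambda>x. norm (g x - f k x)) \<in> borel_measurable L" for k
      unfolding ms using g ap_meas[OF f] by measurable
    show "integrable L (\<lambda>x. 2 * B)" using L(2) by (rule finite_measure.integrable_const)
    show "AE x in L. (\<lambda>k. norm (g x - f k x)) \<longlonglongrightarrow> 0"
    proof (rule AE_I2)
      fix x assume "x \<in> space L"
      then have "(\<lambda>k. norm (g x - f k x)) \<longlonglongrightarrow> norm (g x - g x)" using lim sp by (intro tendsto_intros) auto
      then show "(\<lambda>k. norm (g x - f k x)) \<longlonglongrightarrow> 0" by simp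
    qed
    show "AE x in L. norm (norm (g x - f k x)) \<le> 2 * B" for k
      
    proof (rule AE_I2)
      fix x assume "x \<in> space L"
      then have "norm (g x) \<le> B" "norm (f k x) \<le> B" using Bg B sp by auto
      then show "norm (norm (g x - f k x)) \<le> 2 * B" using norm_triangle_ineq4[of "g x" "f k x"] by simp
    qed
  qed auto
  have "eventually (\<lambda>k. (\<integral>x. norm (g x - f k x) \<partial>M) < e \<and> (\<integral>x. norm (g x - f k x) \<partial>N) < e) sequentially"
    using conv[OF setsM finM] conv[OF setsN finN] e by (intro eventually_conj order_tendstoD) auto
  then show "\<exists>g'. ap g' \<and> (\<integral>x. norm (g x - g' x) \<partial>M) < e \<and> (\<integral>x. norm (g x - g' x) \<partial>N) < e"
    using f by (auto simp: eventually_sequentially)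
qed

lemma ap_cong:
  assumes f: "ap f" and eq: "\<And>x. x \<in> cube n \<Longrightarrow> f x = g x"
  shows "ap g"
proof -
  obtain B where "\<forall>x\<in>cube n. norm (f x) \<le> B" using ap_bound[OF f] by auto
  moreover have "g \<in> borel_measurable (lam n)"
    using ap_meas[OF f] eq by (subst measurable_cong[where g=f]) auto
  ultimately show ?thesis using f eq by (intro ap_lim[of "\<lambda>_. f" B g]) auto
qed

lemma ap_add: assumes f: "ap f" and g: "ap g" shows "ap (\<lambda>x. f x + g x)"
proof -
  obtain B where B1: "B > 0" "\<forall>x\<in>cube n. norm (f x) \<le> B" using ap_bound[OF f] by auto
  obtain C where C1: "C > 0" "\<forall>x\<in>cube n. norm (g x) \<le> C" using ap_bound[OF g] by auto
  note B = B1(2) C1(2)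
  show ?thesis
  proof (rule apI[where B="B+C"])
    show m: "(\<lambda>x. f x + g x) \<in> borel_measurable (lam n)" using ap_meas[OF f] ap_meas[OF g] by measurable
    show bd: "\<And>x. x \<in> cube n \<Longrightarrow> norm (f x + g x) \<le> B + C" using B by (auto intro!: norm_triangle_le add_mono)
    fix e :: real assume e: "e > 0"
    obtain P where P: "tp n P" "(\<integral>x. norm (f x - P x) \<partial>M) < e/2" "(\<integral>x. norm (f x - P x) \<partial>N) < e/2"
      using f e unfolding ap_def by (metis half_gt_zero)
    obtain Q where Q: "tp n Q" "(\<integral>x. norm (g x - Q x) \<partial>M) < e/2" "(\<integral>x. norm (g x - Q x) \<partial>N) < e/2"
      using g e unfolding ap_def by (metis half_gt_zero)
    have tri: "(\<integral>x. norm (f x + g x - (P x + Q x)) \<partial>L) \<le> (\<integral>x. norm (f x - P x) \<partial>L) + (\<integral>x. norm (g x - Q x) \<partial>L)"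
      if "integrable L f" "integrable L g" "integrable L P" "integrable L Q" for L
    proof -
      have "(\<integral>x. norm (f x + g x - (P x + Q x)) \<partial>L) \<le> (\<integral>x. norm (f x - P x) + norm (g x - Q x) \<partial>L)"
        by (rule integral_mono) (use that in \<open>auto intro: norm_diff_triangle_ineq\<close>)
      then show ?thesis using that by simp
    qed
    have "ap (\<lambda>x. P x + Q x)" by (rule ap_tp[OF tp_add[OF Q(1) P(1)]])
    moreover note tri[OF ap_integrable(1)[OF f] ap_integrable(1)[OF g] tp_integrable(1)[OF P(1)] tp_integrable(1)[OF Q(1)]]
      tri[OF ap_integrable(2)[OF f] ap_integrable(2)[OF g] tp_integrable(2)[OF P(1)] tp_integrable(2)[OF Q(1)]] P(2,3) Q(2,3)
    ultimately show "\<exists>h. ap h \<and> (\<integral>x. norm (f x + g x - h x) \<partial>M) < e \<and> (\<integral>x. norm (f x + g x - h x) \<partial>N) < e"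
      by (intro exI[of _ "\<lambda>x. P x + Q x"] conjI) linarith+
  qed
qed

lemma ap_mult: assumes f: "ap f" and g: "ap g" shows "ap (\<lambda>x. f x * g x)"
proof -
  obtain B where B1: "B > 0" "\<forall>x\<in>cube n. norm (f x) \<le> B" using ap_bound[OF f] by auto
  obtain C where C1: "C > 0" "\<forall>x\<in>cube n. norm (g x) \<le> C" using ap_bound[OF g] by auto
  note B = B1(2) C1(2) B1(1) C1(1)
  show ?thesis
  proof (rule apI[where B="B*C"])
    show m: "(\<lambda>x. f x * g x) \<in> borel_measurable (lam n)" using ap_meas[OF f] ap_meas[OF g] by measurable
    show bd: "\<And>x. x \<in> cube n \<Longrightarrow> norm (f x * g x) \<le> B * C" using B by (auto simp: norm_mult intro!: mult_mono)
    fix e :: real assume e: "e > 0"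
    obtain P where P: "tp n P" "(\<integral>x. norm (f x - P x) \<partial>M) < e/(2*C)" "(\<integral>x. norm (f x - P x) \<partial>N) < e/(2*C)"
      by (rule ap_approx[OF f, of "e/(2*C)"]) (use B(4) e in auto)
    \<comment> \<open>\<open>P\<close> is fixed before \<open>Q\<close>: the tolerance for
      \<open>Q\<close> depends on the bound \<open>D\<close> of \<open>P\<close>, because
      \<open>f * g - P * Q\<close> is split as \<open>g * (f - P) + P * (g - Q)\<close>.\<close>
    obtain D where D: "D > 0" "\<And>x. norm (P x) \<le> D" using tp_bounded[OF P(1)] by auto
    obtain Q where Q: "tp n Q" "(\<integral>x. norm (g x - Q x) \<partial>M) < e/(2*D)" "(\<integral>x. norm (g x - Q x) \<partial>N) < e/(2*D)"
      by (rule ap_approx[OF g, of "e/(2*D)"]) (use D(1) e in auto)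
    have tri: "(\<integral>x. norm (f x * g x - (P x * Q x)) \<partial>L) \<le> C * (\<integral>x. norm (f x - P x) \<partial>L) + D * (\<integral>x. norm (g x - Q x) \<partial>L)"
      if L: "integrable L f" "integrable L g" "integrable L P" "integrable L Q" "integrable L (\<lambda>x. f x * g x)"
        "integrable L (\<lambda>x. P x * Q x)" "space L = cube n" for L
    proof -
      have "(\<integral>x. norm (f x * g x - (P x * Q x)) \<partial>L) \<le> (\<integral>x. C * norm (f x - P x) + D * norm (g x - Q x) \<partial>L)"
      proof (rule integral_mono)
        fix x assume "x \<in> space L"
        have "f x * g x - P x * Q x = g x * (f x - P x) + P x * (g x - Q x)" by (simp add: algebra_simps)
        also have "norm \<dots> \<le> norm (g x) * norm (f x - P x) + norm (P x) * norm (g x - Q x)"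
          by (metis norm_mult norm_triangle_ineq)
        also have "\<dots> \<le> C * norm (f x - P x) + D * norm (g x - Q x)"
          using B D \<open>x \<in> space L\<close> L by (intro add_mono mult_right_mono) auto
        finally show "norm (f x * g x - (P x * Q x)) \<le> C * norm (f x - P x) + D * norm (g x - Q x)" .
      qed (use L in auto)
      then show ?thesis using L by simp
    qed
    have "C * (\<integral>x. norm (f x - P x) \<partial>M) + D * (\<integral>x. norm (g x - Q x) \<partial>M) < C * (e/(2*C)) + D * (e/(2*D))"
      using P Q B D by (intro add_strict_mono mult_strict_left_mono)
    moreover have "C * (\<integral>x. norm (f x - P x) \<partial>N) + D * (\<integral>x. norm (g x - Q x) \<partial>N) < C * (e/(2*C)) + D * (e/(2*D))"
      using P Q B D by (intro add_strict_mono mult_strict_left_mono)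
    moreover have "C * (e/(2*C)) + D * (e/(2*D)) = e" using B D by simp
    moreover have "ap (\<lambda>x. P x * Q x)" by (rule ap_tp[OF tp_mult[OF Q(1) P(1)]])
    moreover note
      tri[OF ap_integrable(1)[OF f] ap_integrable(1)[OF g] tp_integrable(1)[OF P(1)] tp_integrable(1)[OF Q(1)]
        bounded_integrable(1)[OF m bd] tp_integrable(1)[OF tp_mult[OF Q(1) P(1)]] spaceM]
      tri[OF ap_integrable(2)[OF f] ap_integrable(2)[OF g] tp_integrable(2)[OF P(1)] tp_integrable(2)[OF Q(1)]
        bounded_integrable(2)[OF m bd] tp_integrable(2)[OF tp_mult[OF Q(1) P(1)]] spaceN]
    ultimately show "\<exists>h. ap h \<and> (\<integral>x. norm (f x * g x - h x) \<partial>M) < e \<and> (\<integral>x. norm (f x * g x - h x) \<partial>N) < e"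
      by (intro exI[of _ "\<lambda>x. P x * Q x"] conjI) linarith+
  qed
qed

lemma ap_const: "ap (\<lambda>x. c)" by (rule ap_tp[OF tp_const])

lemma ap_diff: "ap f \<Longrightarrow> ap g \<Longrightarrow> ap (\<lambda>x. f x - g x)"
  using ap_add[OF _ ap_mult[OF ap_const], of f g "-1"] by simp

lemma ap_sum: "finite I \<Longrightarrow> (\<And>i. i \<in> I \<Longrightarrow> ap (f i)) \<Longrightarrow> ap (\<lambda>x. \<Sum>i\<in>I. f i x)"
proof (induction I rule: finite_induct)
  case (insert i I)
  have "ap (\<lambda>x. f i x + (\<Sum>i\<in>I. f i x))" by (rule ap_add) (use insert in simp_all)
  then show ?case using insert by simp
qed (simp add: ap_const)

lemma ap_prod: "finite I \<Longrightarrow> (\<And>i. i \<in> I \<Longrightarrow> ap (f i)) \<Longrightarrow> ap (\<lambda>x. \<Prod>i\<in>I. f i x)"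
proof (induction I rule: finite_induct)
  case (insert i I)
  have "ap (\<lambda>x. f i x * (\<Prod>i\<in>I. f i x))" by (rule ap_mult) (use insert in simp_all)
  then show ?case using insert by simp
qed (simp add: ap_const)

text \<open>The rescaled cosine takes values in [0,1], the domain of Bernstein polynomials, and its
  superlevel sets are arcs centred at \<theta>.\<close>

lemma tp_cos:
  assumes "i < n"
  shows "tp n (\<lambda>x. complex_of_real ((1 + cos (2 * pi * (x i - \<theta>))) / 2))"
proof -
  let ?e = "\<lambda>j. if j = i then 1 else (0::int)"
  have e: "chr n ?e x = cis (2 * pi * x i)" for x
  proof -
    have "(\<Sum>j<n. real_of_int (?e j) * x j) = (\<Sum>j<n. if j = i then x i else 0)"
      by (rule sum.cong) auto
    then show ?thesis using assms by (simp add: chr_def)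
  qed
  have eq: "complex_of_real ((1 + cos (2 * pi * (x i - \<theta>))) / 2) =
     (1/2 + (cis (- (2 * pi * \<theta>)) / 4) * chr n ?e x) + (cis (2 * pi * \<theta>) / 4) * chr n (\<lambda>j. - ?e j) x" for x
    unfolding chr_uminus e
    by (rule complex_eqI) (simp_all add: cos_diff algebra_simps add_divide_distrib diff_divide_distrib)
  show ?thesis unfolding eq by (intro tp_step tp_const)
qed

text \<open>Bernstein polynomials of \<open>g\<close>, evaluated at the rescaled cosine, are
  trigonometric polynomials that converge uniformly.\<close>

lemma ap_cos_continuous:
  assumes "i < n" and g: "continuous_on {0..1} g"
  shows "ap (\<lambda>x. complex_of_real (g ((1 + cos (2 * pi * (x i - \<theta>))) / 2)))"
proof (rule ap_uniform)
  let ?p = "\<lambda>x::nat\<Rightarrow>real. (1 + cos (2 * pi * (x i - \<theta>))) / 2"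
  have "(1 + c) / 2 \<in> {0..1}" if "-1 \<le> c" "c \<le> 1" for c :: real using that by auto
  then have p01: "?p x \<in> {0..1}" for x by (meson cos_ge_minus_one cos_le_one)
  have [measurable]: "(\<lambda>x. x i) \<in> borel_measurable (lam n)" using assms(1) by (rule measurable_component_lam)
  have pm: "?p \<in> measurable (lam n) (restrict_space borel {0..1})"
    by (rule measurable_restrict_space2) (use p01 in auto)
  have "g \<in> borel_measurable (restrict_space borel {0..1})"
    by (rule borel_measurable_continuous_on_restrict[OF g])
  from measurable_compose[OF pm this]
  show "(\<lambda>x. complex_of_real (g (?p x))) \<in> borel_measurable (lam n)" by measurable
  fix e :: real assume "e > 0"
  from Bernstein_Weierstrass[OF g this] obtain m where
    m: "\<And>y. y \<in> {0..1} \<Longrightarrow> \<bar>g y - (\<Sum>k\<le>m. g (k/m) * Bernstein m k y)\<bar> < e" by blast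
  let ?h = "\<lambda>x. \<Sum>k\<in>{..m}. complex_of_real (g (k/m) * (m choose k)) * (complex_of_real (?p x) ^ k * (1 - complex_of_real (?p x)) ^ (m - k))"
  have h: "?h x = complex_of_real (\<Sum>k\<le>m. g (k/m) * Bernstein m k (?p x))" for x
    by (simp add: Bernstein_def mult.assoc)
  have "(\<lambda>x. 1 + -1 * complex_of_real (?p x)) = (\<lambda>x. 1 - complex_of_real (?p x))"  by (simp only: mult_minus1 add_uminus_conv_diff)
  then have "tp n (\<lambda>x. 1 - complex_of_real (?p x))"
    using tp_add[OF tp_mult[OF tp_cos[OF assms(1)] tp_const, of "-1" \<theta>] tp_const[of n 1]] by (simp only:)
  then have "ap ?h"
    by (intro ap_sum ap_mult ap_const ap_tp tp_power tp_cos assms) auto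
  moreover have "norm (complex_of_real (g (?p x)) - ?h x) \<le> e" for x
    unfolding h of_real_diff[symmetric] norm_of_real using m[OF p01] by (simp add: less_imp_le)
  ultimately show "\<exists>h. ap h \<and> (\<forall>x\<in>cube n. norm (complex_of_real (g (?p x)) - h x) \<le> e)" by blast
qed

lemma ap_arc:
  assumes "i < n"
  shows "ap (\<lambda>x. indicator {x. (1 + cos (2 * pi * (x i - \<theta>))) / 2 > a} x)"
proof (rule ap_lim)
  let ?p = "\<lambda>x::nat\<Rightarrow>real. (1 + cos (2 * pi * (x i - \<theta>))) / 2"
  \<comment> \<open>Ramps of slope \<open>k\<close> starting at level \<open>a\<close>: they vanish
    up to \<open>a\<close> and increase to 1 above it, so the limit is the indicator of the strict
    superlevel set.\<close>
  let ?g = "\<lambda>k::nat. \<lambda>y::real. min 1 (real k * max 0 (y - a))"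
  show "ap (\<lambda>x. complex_of_real (?g k (?p x)))" for k
    by (rule ap_cos_continuous[OF assms]) (intro continuous_intros)
  show "norm (complex_of_real (?g k (?p x))) \<le> 1" for k x
    unfolding norm_of_real by (simp add: abs_le_iff)
  have [measurable]: "(\<lambda>x. x i) \<in> borel_measurable (lam n)" using assms(1) by (rule measurable_component_lam)
  have "(\<lambda>x. (if ?p x > a then 1 else 0)::complex) \<in> borel_measurable (lam n)" by measurable
  then show "(indicator {x. ?p x > a} :: _ \<Rightarrow> complex) \<in> borel_measurable (lam n)"
    by (subst measurable_cong[where g="\<lambda>x. (if ?p x > a then 1 else 0)::complex"]) (auto simp: indicator_def)
  fix x
  show "(\<lambda>k. complex_of_real (?g k (?p x))) \<longlonglongrightarrow> indicator {x. ?p x > a} x"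
  proof (cases "?p x > a")
    case True
    obtain k0 :: nat where k0: "real k0 * (?p x - a) > 1"
      using ex_less_of_nat_mult[of "?p x - a" 1] True by auto
    have "?g k (?p x) = 1" if "k \<ge> k0" for k
    proof -
      have "real k * (?p x - a) \<ge> real k0 * (?p x - a)" using True that by (intro mult_right_mono) auto
      then have "real k * (?p x - a) \<ge> 1" using k0 by linarith
      moreover have "max 0 (?p x - a) = ?p x - a" using True by simp
      ultimately show ?thesis by (simp only: min_def if_True)
    qed
    then have "eventually (\<lambda>k. complex_of_real (?g k (?p x)) = 1) sequentially"
      unfolding eventually_sequentially by auto
    then show ?thesis using True by (simp add: tendsto_eventually)
  next
    case False
    then have "max 0 (?p x - a) = 0" by linarith
    then show ?thesis using False by simp
  qed
qed

lemma ap_half_line: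
  assumes "i < n"
  shows "ap (\<lambda>x. indicator {a<..} (x i))"
proof -
  consider "a < 0" | "0 \<le> a \<and> a < 1" | "1 \<le> a" by linarith
  then show ?thesis
  proof cases
    case 1
    show ?thesis by (rule ap_cong[OF ap_const[of 1]]) (use 1 assms in \<open>force simp: cube_def PiE_iff indicator_def\<close>)
  next
    case 2
    \<comment> \<open>Inside [0,1) the half line above \<open>a\<close> is the open arc from
      \<open>a\<close> to 1, with midpoint \<open>?t\<close>; \<open>?c\<close> is the value of the
      rescaled cosine at its two endpoints.\<close>
    let ?t = "(a + 1) / 2" and ?c = "(1 + cos (pi * (1 - a))) / 2"
    show ?thesis
    proof (rule ap_cong[OF ap_arc[OF assms, where \<theta>="?t" and a="?c"]])
      fix x assume "x \<in> cube n"
      then have x: "0 \<le> x i" "x i < 1" using assms by (auto simp: cube_def PiE_iff)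
      \<comment> \<open>The difference of the cosines factors into two sines. The second is
        nonnegative on the cube, so the sign of the first decides.\<close>
      have "cos (2 * pi * (x i - ?t)) - cos (pi * (1 - a)) =
          2 * sin ((2 * pi * (x i - ?t) + pi * (1 - a)) / 2) * sin ((pi * (1 - a) - 2 * pi * (x i - ?t)) / 2)"
        by (rule cos_diff_cos)
      also have "(2 * pi * (x i - ?t) + pi * (1 - a)) / 2 = pi * (x i - a)" by (simp add: field_simps)
      also have "(pi * (1 - a) - 2 * pi * (x i - ?t)) / 2 = pi * (1 - x i)" by (simp add: field_simps)
      finally have eq: "cos (2 * pi * (x i - ?t)) - cos (pi * (1 - a)) = 2 * sin (pi * (x i - a)) * sin (pi * (1 - x i))" .
      have "?c < (1 + cos (2 * pi * (x i - ?t))) / 2 \<longleftrightarrow> 0 < sin (pi * (x i - a)) * sin (pi * (1 - x i))"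
        using eq by auto
      also have "\<dots> \<longleftrightarrow> a < x i"
      proof
        assume "a < x i"
        then have "sin (pi * (x i - a)) > 0" "sin (pi * (1 - x i)) > 0"
          using 2 x by (auto intro!: sin_gt_zero simp: )
        then show "0 < sin (pi * (x i - a)) * sin (pi * (1 - x i))" by simp
      next
        assume *: "0 < sin (pi * (x i - a)) * sin (pi * (1 - x i))"
        show "a < x i"
        proof (rule ccontr)
          assume "\<not> a < x i"
          then have "0 \<le> sin (pi * (a - x i))" "0 \<le> sin (pi * (1 - x i))"
            using 2 x by (auto intro!: sin_ge_zero)
          moreover have "sin (pi * (x i - a)) = - sin (pi * (a - x i))"
            by (metis minus_diff_eq mult_minus_right sin_minus)
          ultimately have "0 \<le> sin (pi * (a - x i)) * sin (pi * (1 - x i))"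
            "sin (pi * (x i - a)) * sin (pi * (1 - x i)) = - (sin (pi * (a - x i)) * sin (pi * (1 - x i)))"
            by (simp_all only: mult_nonneg_nonneg mult_minus_left)
          then show False using * by linarith
        qed
      qed
      finally show "indicator {x. ?c < (1 + cos (2 * pi * (x i - ?t))) / 2} x = (indicator {a<..} (x i) :: complex)"
        by (auto simp: indicator_def)
    qed
  next
    case 3
    show ?thesis by (rule ap_cong[OF ap_const[of 0]]) (use 3 assms in \<open>force simp: cube_def PiE_iff indicator_def\<close>)
  qed
qed

text \<open>The closure property needed for Dynkin arguments. The partial sums of the indicators are
  again indicators, hence bounded by 1.\<close>

lemma ap_UN:
  fixes A :: "nat \<Rightarrow> 'a set" and h :: "(nat \<Rightarrow> real) \<Rightarrow> 'a"
  assumes disj: "disjoint_family A" and ap: "\<And>i. ap (\<lambda>x. indicator (A i) (h x))"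
  shows "ap (\<lambda>x. indicator (\<Union>i. A i) (h x))"
proof (rule ap_lim)
  show "ap (\<lambda>x. \<Sum>i\<in>{..<k}. indicator (A i) (h x))" for k by (rule ap_sum) (auto intro: ap)
  have eq: "(\<Sum>i<k. indicator (A i) y) = (indicator (\<Union>i<k. A i) y :: complex)" for k y
    by (rule indicator_UN_disjoint[symmetric]) (use disj in \<open>auto simp: disjoint_family_on_def\<close>)
  show "norm (\<Sum>i<k. indicator (A i) (h x) :: complex) \<le> 1" for k x
    unfolding eq by (simp add: indicator_def)
  have lim: "(\<lambda>k. \<Sum>i<k. indicator (A i) (h x) :: complex) \<longlonglongrightarrow> indicator (\<Union>i. A i) (h x)" for x
    unfolding eq by (rule LIMSEQ_indicator_UN)
  then show "(\<lambda>k. \<Sum>i<k. indicator (A i) (h x) :: complex) \<longlonglongrightarrow> indicator (\<Union>i. A i) (h x)" for x .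
  show "(\<lambda>x. indicator (\<Union>i. A i) (h x)::complex) \<in> borel_measurable (lam n)"
    by (rule borel_measurable_LIMSEQ_metric[OF _ lim]) (intro borel_measurable_sum ap_meas ap)
qed

text \<open>Half lines are stable under intersection and generate the Borel sets, and the sets with
  approximable indicator form a Dynkin system.\<close>

lemma ap_coordinate:
  assumes "i < n" and "A \<in> sets (borel :: real measure)"
  shows "ap (\<lambda>x. indicator A (x i))"
proof -
  have gen: "sets (borel :: real measure) = sigma_sets UNIV (range (\<lambda>a. {a<..}))"
  proof -
    have eq: "borel = sigma UNIV (range (\<lambda>a::real. {a<..}))"
      using borel_eq_greaterThan[where 'a=real] by (simp add: greaterThan_def eucl_less_def)
    show ?thesis by (subst eq) (rule sets_measure_of, simp)
  qed
  show ?thesis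
  proof (rule sigma_sets_induct_disjoint[of "range (\<lambda>a::real. {a<..})" UNIV A])
    show "Int_stable (range (\<lambda>a::real. {a<..}))"
    proof (rule Int_stableI_image)
      fix a b :: real
      show "\<exists>c\<in>UNIV. {a<..} \<inter> {b<..} = {c<..}" by (intro bexI[of _ "max a b"]) auto
    qed
    show "A \<in> sigma_sets UNIV (range greaterThan)" using assms gen by simp
    show "ap (\<lambda>x. indicator A (x i))" if "A \<in> range greaterThan" for A
      using that ap_half_line[OF assms(1)] by auto
    show "ap (\<lambda>x. indicator {} (x i))" by (simp add: ap_const)
    show "ap (\<lambda>x. indicator (UNIV - A) (x i))" if "ap (\<lambda>x. indicator A (x i))" for A
      by (rule ap_cong[OF ap_diff[OF ap_const[of 1] that]]) (auto simp: indicator_def)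
  qed (auto intro: ap_UN)
qed

text \<open>A box is a finite conjunction of coordinate conditions, so its indicator is a product of
  approximable functions; a second Dynkin argument passes from boxes to all measurable sets.\<close>

lemma ap_indicator:
  assumes "E \<in> sets (lam n)"
  shows "ap (indicator E)"
proof -
  let ?M = "\<lambda>_::nat. restrict_space lborel {0..<1::real}"
  have gen: "sets (lam n) = sigma_sets (cube n) (prod_algebra {..<n} ?M)"
    unfolding lam_def sets_PiM by (simp add: space_restrict_space cube_def)
  have "ap (\<lambda>x. indicator E x)"
  proof (rule sigma_sets_induct_disjoint[OF Int_stable_prod_algebra, of "{..<n}" ?M "cube n"])
    show "prod_algebra {..<n} ?M \<subseteq> Pow (cube n)"
      using prod_algebra_sets_into_space[of "{..<n}" ?M] by (simp add: space_restrict_space cube_def)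
    show "E \<in> sigma_sets (cube n) (prod_algebra {..<n} ?M)" using assms gen by simp
    show "ap (\<lambda>x. indicator A x)" if A: "A \<in> prod_algebra {..<n} ?M" for A
    proof -
      obtain X where X: "A = PiE {..<n} X" "\<And>i. i < n \<Longrightarrow> X i \<in> sets (restrict_space lborel {0..<1::real})"
        using A by (auto simp: prod_algebra_eq_finite)
      have "ap (\<lambda>x. \<Prod>i\<in>{..<n}. indicator (X i) (x i))"
      proof (rule ap_prod)
        fix i assume "i \<in> {..<n}"
        then have "X i \<in> sets borel" using X(2)[of i] by (auto simp: sets_restrict_space)
        then show "ap (\<lambda>x. indicator (X i) (x i))" using \<open>i \<in> {..<n}\<close> by (intro ap_coordinate) auto
      qed simp
      then show ?thesis
      proof (rule ap_cong)
        fix x assume x: "x \<in> cube n"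
        show "(\<Prod>i<n. indicator (X i) (x i)) = (indicator A x :: complex)"
        proof (cases "x \<in> A")
          case True
          then show ?thesis unfolding X(1) by (simp add: PiE_iff)
        next
          case False
          then obtain i where "i < n" "x i \<notin> X i" using x unfolding X(1) cube_def by (auto simp: PiE_iff)
          then show ?thesis using False by (auto intro!: prod_zero bexI[of _ i])
        qed
      qed
    qed
    show "ap (\<lambda>x. indicator {} x)" by (simp add: ap_const)
    show "ap (\<lambda>x. indicator (cube n - A) x)" if "ap (\<lambda>x. indicator A x)" for A
      by (rule ap_cong[OF ap_diff[OF ap_const[of 1] that]]) (auto simp: indicator_def)
  qed (auto intro: ap_UN)
  then show ?thesis by simp
qed

text \<open>Equal Fourier coefficients mean equal integrals of every trigonometric polynomial, and
  an indicator is close to one such polynomial in the mean of both measures.\<close>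

lemma fourier_unique:
  assumes "\<And>\<xi>. (\<integral>x. chr n \<xi> x \<partial>M) = (\<integral>x. chr n \<xi> x \<partial>N)"
  shows "M = N"
proof (rule measure_eqI)
  show "sets M = sets N" by (simp add: setsM setsN)
  fix E assume "E \<in> sets M"
  then have E: "E \<in> sets (lam n)" by (simp add: setsM)
  interpret M: finite_measure M by (rule finM)
  interpret N: finite_measure N by (rule finN)
  have tpeq: "tp n P \<Longrightarrow> (\<integral>x. P x \<partial>M) = (\<integral>x. P x \<partial>N)" for P
  proof (induction rule: tp.induct)
    case (tp_step P c \<xi>)
    then show ?case using assms[of \<xi>] tp_integrable[OF tp_step.hyps] tp_integrable[OF tp_chr[of n c \<xi>]]
      by simp
  qed simp
  note ap = ap_indicator[OF E]
  have "norm ((\<integral>x. indicator E x \<partial>M) - (\<integral>x. indicator E x \<partial>N) :: complex) \<le> e" if "e > 0" for e :: real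
  proof -
    obtain P where P: "tp n P" "(\<integral>x. norm (indicator E x - P x) \<partial>M) < e/2" "(\<integral>x. norm (indicator E x - P x) \<partial>N) < e/2"
      using ap \<open>e > 0\<close> unfolding ap_def by (metis half_gt_zero)
    have "norm ((\<integral>x. indicator E x \<partial>M) - (\<integral>x. P x \<partial>M)) \<le> (\<integral>x. norm (indicator E x - P x) \<partial>M)"
      using ap_integrable[OF ap] tp_integrable[OF P(1)] by (simp flip: Bochner_Integration.integral_diff)
    moreover have "norm ((\<integral>x. indicator E x \<partial>N) - (\<integral>x. P x \<partial>N)) \<le> (\<integral>x. norm (indicator E x - P x) \<partial>N)"
      using ap_integrable[OF ap] tp_integrable[OF P(1)] by (simp flip: Bochner_Integration.integral_diff)
    ultimately show ?thesis using P tpeq[OF P(1)]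
      by (smt (verit) field_sum_of_halves norm_minus_commute norm_triangle_ineq norm_triangle_sub diff_add_cancel add_diff_eq)
  qed
  then have "norm ((\<integral>x. indicator E x \<partial>M) - (\<integral>x. indicator E x \<partial>N) :: complex) \<le> 0"
    by (rule field_le_epsilon[of _ 0, simplified]) 
  moreover have "(indicator E :: _ \<Rightarrow> complex) = (\<lambda>x. of_real (indicator E x))" by (auto simp: indicator_def)
  ultimately have "measure M (E \<inter> space M) = measure N (E \<inter> space N)" by simp
  then have "measure M E = measure N E"
    using sets.sets_into_space[OF \<open>E \<in> sets M\<close>] by (simp add: spaceM spaceN Int_absorb2)
  then show "emeasure M E = emeasure N E" by (simp add: M.emeasure_eq_measure N.emeasure_eq_measure)
qed

end

section \<open>Ergodicity and Weyl sums of affine unipotent maps\<close>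

text \<open>Sublevel sets of an invariant function are invariant, hence of measure 0 or 1; the
  constant is the infimum of the levels whose sublevel set has full measure.\<close>

lemma ergodic_invariant_const:
  fixes f :: "'a \<Rightarrow> real"
  assumes "prob_space M" and erg: "\<And>E. E \<in> sets M \<Longrightarrow> S -` E \<inter> space M = E \<Longrightarrow> measure M E = 0 \<or> measure M E = 1"
    and S: "S \<in> measurable M M" and f [measurable]: "f \<in> borel_measurable M" and inv: "\<And>x. x \<in> space M \<Longrightarrow> f (S x) = f x"
  shows "\<exists>c. AE x in M. f x = c"
proof -
  interpret prob_space M by fact
  define L where "L q = {x \<in> space M. f x \<le> q}" for q
  have L [measurable]: "L q \<in> sets M" for q unfolding L_def by measurable
  have L01: "measure M (L q) = 0 \<or> measure M (L q) = 1" for q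
  proof (rule erg)
    show "S -` L q \<inter> space M = L q"
      using measurable_space[OF S] inv by (auto simp: L_def)
  qed measurable
  define Q where "Q = {q. measure M (L q) = 1}"
  have up: "q' \<in> Q" if "q \<in> Q" "q \<le> q'" for q q'
  proof -
    have "measure M (L q) \<le> measure M (L q')"
      by (rule finite_measure_mono) (use that in \<open>auto simp: L_def\<close>)
    then show ?thesis using that L01[of q'] by (auto simp: Q_def)
  qed
  have "(\<lambda>n. measure M (L (real n))) \<longlonglongrightarrow> measure M (\<Union>n. L (real n))"
    by (rule finite_Lim_measure_incseq) (auto simp: incseq_def L_def)
  moreover have "(\<Union>n. L (real n)) = space M"
    using real_arch_simple by (auto simp: L_def)
  ultimately have lim1: "(\<lambda>n. measure M (L (real n))) \<longlonglongrightarrow> 1" by (simp add: prob_space)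
  have ne: "Q \<noteq> {}"
  proof
    assume "Q = {}"
    then have "measure M (L (real n)) = 0" for n using L01[of "real n"] by (auto simp: Q_def)
    then show False using lim1 LIMSEQ_unique by fastforce
  qed
  have "(\<lambda>n. measure M (L (- real n))) \<longlonglongrightarrow> measure M (\<Inter>n. L (- real n))"
    by (rule finite_Lim_measure_decseq) (auto simp: decseq_def L_def)
  moreover have "(\<Inter>n. L (- real n)) = {}"
  proof -
    have "\<exists>n. \<not> f x \<le> - real n" for x
      using reals_Archimedean2[of "- f x"] by (auto intro: exI simp: not_le) (metis minus_less_iff)
    then show ?thesis by (auto simp: L_def)
  qed
  ultimately have lim0: "(\<lambda>n. measure M (L (- real n))) \<longlonglongrightarrow> 0" by simp
  have bdd: "bdd_below Q"
  proof -
    obtain n where "measure M (L (- real n)) < 1"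
      using order_tendstoD(2)[OF lim0, of 1] by (auto simp: eventually_sequentially)
    then have "- real n \<notin> Q" by (auto simp: Q_def)
    then have "- real n \<le> q" if "q \<in> Q" for q using up[OF that, of "- real n"] by linarith
    then show ?thesis by (auto simp: bdd_below_def)
  qed
  define c where "c = Inf Q"
  have 1: "AE x in M. f x \<le> c + 1 / real (Suc n)" for n
  proof -
    obtain q where "q \<in> Q" "q < c + 1 / real (Suc n)"
      using cInf_lessD[OF ne, of "c + 1 / real (Suc n)"] unfolding c_def by auto
    then have "c + 1 / real (Suc n) \<in> Q" using up by auto
    then have "AE x in M. x \<in> L (c + 1 / real (Suc n))" by (subst prob_eq_1[symmetric]) (auto simp: Q_def)
    then show ?thesis by eventually_elim (auto simp: L_def)
  qed
  have 2: "AE x in M. c - 1 / real (Suc n) < f x" for n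
  proof -
    have "c - 1 / real (Suc n) \<notin> Q" using cInf_lower[OF _ bdd, of "c - 1 / real (Suc n)"] by (auto simp: c_def)
    then have "measure M (L (c - 1 / real (Suc n))) = 0" using L01 by (auto simp: Q_def)
    then have "AE x in M. x \<notin> L (c - 1 / real (Suc n))" by (subst prob_eq_0[symmetric]) auto
    then show ?thesis using AE_space by eventually_elim (auto simp: L_def)
  qed
  have "AE x in M. \<forall>n. f x \<le> c + 1 / real (Suc n)" "AE x in M. \<forall>n. c - 1 / real (Suc n) < f x"
    using 1 2 by (auto simp: AE_all_countable)
  then have "AE x in M. f x = c"
  proof eventually_elim
    case (elim x)
    show ?case
    proof (rule ccontr)
      assume "f x \<noteq> c"
      then obtain n where "1 / real (Suc n) < \<bar>f x - c\<bar>" using nat_approx_posE[of "\<bar>f x - c\<bar>"] by auto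
      with elim[rule_format, of n] show False by linarith
    qed
  qed
  then show ?thesis by blast
qed

text \<open>Van der Corput: averaging over \<open>H\<close> shifts changes the sum by boundary terms
  only, and Cauchy-Schwarz then introduces the correlations of pairs of shifts. The diagonal pairs
  account for \<open>n\<^sup>2 / H\<close>, the others are bounded by \<open>B\<close>.\<close>

lemma vdc_inequality:
  fixes u :: "nat \<Rightarrow> complex"
  assumes u: "\<And>j. norm (u j) \<le> 1" and H: "H \<ge> 1" and B0: "B \<ge> 0"
    and B: "\<And>h h'. h' < h \<Longrightarrow> h < H \<Longrightarrow> norm (\<Sum>j<n. u (j + h) * cnj (u (j + h'))) \<le> B"
  shows "norm (\<Sum>j<n. u j) \<le> sqrt (real n ^ 2 / real H + real n * B) + real H"
proof -
  \<comment> \<open>Each unit shift exchanges one end term for another, at a cost of at most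
    2.\<close>
  have shift: "norm ((\<Sum>j<n. u (j + h)) - (\<Sum>j<n. u j)) \<le> 2 * real h" for h
  proof (induction h)
    case (Suc h)
    have "(\<Sum>j<n. u (j + Suc h)) - (\<Sum>j<n. u (j + h)) = u (n + h) - u h"
      by (simp flip: sum_subtractf) (use sum_lessThan_telescope[of "\<lambda>j. u (j + h)" n] in simp)
    moreover have "norm (u (n + h) - u h) \<le> 2" using u[of "n+h"] u[of h] norm_triangle_ineq4[of "u (n+h)" "u h"] by linarith
    moreover have "(\<Sum>j<n. u (j + Suc h)) - (\<Sum>j<n. u j) =
      ((\<Sum>j<n. u (j + Suc h)) - (\<Sum>j<n. u (j + h))) + ((\<Sum>j<n. u (j + h)) - (\<Sum>j<n. u j))"
      by simp
    then have "norm ((\<Sum>j<n. u (j + Suc h)) - (\<Sum>j<n. u j)) \<le>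
       norm ((\<Sum>j<n. u (j + Suc h)) - (\<Sum>j<n. u (j + h))) + norm ((\<Sum>j<n. u (j + h)) - (\<Sum>j<n. u j))"
      by (metis norm_triangle_ineq)
    ultimately show ?case using Suc by simp
  qed simp
  let ?S = "\<Sum>j<n. u j"
  let ?D = "\<Sum>j<n. \<Sum>h<H. u (j + h)"
  have "norm (?D - real H * ?S) = norm (\<Sum>h<H. ((\<Sum>j<n. u (j + h)) - ?S))"
    by (subst sum.swap) (simp add: sum_subtractf)
  also have "\<dots> \<le> (\<Sum>h<H. 2 * real h)"
    by (rule sum_norm_le) (use shift in auto)
  also have "\<dots> \<le> real H ^ 2"
    by (induction H) (auto simp: power2_eq_square algebra_simps)
  finally have 1: "norm (?D - real H * ?S) \<le> real H ^ 2" .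
  have cs: "(norm ?D)\<^sup>2 \<le> real n * (\<Sum>j<n. (norm (\<Sum>h<H. u (j + h)))\<^sup>2)"
  proof -
    have "norm ?D \<le> (\<Sum>j<n. norm (\<Sum>h<H. u (j + h)) * 1)" by (simp add: norm_sum)
    then have "(norm ?D)\<^sup>2 \<le> (\<Sum>j<n. norm (\<Sum>h<H. u (j + h)) * 1)\<^sup>2" by (intro power_mono) auto
    also have "\<dots> \<le> (\<Sum>j<n. (norm (\<Sum>h<H. u (j + h)))\<^sup>2) * (\<Sum>j<n. 1\<^sup>2)" by (rule Cauchy_Schwarz_ineq_sum)
    finally show ?thesis by (simp add: mult.commute)
  qed
  have "complex_of_real (\<Sum>j<n. (norm (\<Sum>h<H. u (j + h)))\<^sup>2) = (\<Sum>j<n. (\<Sum>h<H. u (j + h)) * cnj (\<Sum>h<H. u (j + h)))"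
    unfolding of_real_sum by (rule sum.cong[OF refl]) (simp only: complex_norm_square)
  also have "\<dots> = (\<Sum>j<n. \<Sum>h<H. \<Sum>h'<H. u (j + h) * cnj (u (j + h')))"
    by (simp add: cnj_sum sum_product)
  also have "\<dots> = (\<Sum>h<H. \<Sum>h'<H. \<Sum>j<n. u (j + h) * cnj (u (j + h')))"
    by (subst sum.swap, rule sum.cong[OF refl], rule sum.swap)
  finally have eq: "complex_of_real (\<Sum>j<n. (norm (\<Sum>h<H. u (j + h)))\<^sup>2) = (\<Sum>h<H. \<Sum>h'<H. \<Sum>j<n. u (j + h) * cnj (u (j + h')))" .
  have trm: "norm (\<Sum>j<n. u (j + h) * cnj (u (j + h'))) \<le> (if h = h' then real n else 0) + B" if "h < H" "h' < H" for h h'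
  proof -
    consider "h = h'" | "h' < h" | "h < h'" by linarith
    then show ?thesis
    proof cases
      case 1
      have "norm (\<Sum>j<n. u (j + h) * cnj (u (j + h'))) \<le> (\<Sum>j<n. 1)"
        by (rule sum_norm_le) (use u in \<open>auto simp: norm_mult intro!: mult_le_one\<close>)
      then show ?thesis using 1 B0 by simp
    next
      case 2 then show ?thesis using B[OF 2 that(1)] by simp
    next
      case 3
      have "(\<Sum>j<n. u (j + h) * cnj (u (j + h'))) = cnj (\<Sum>j<n. u (j + h') * cnj (u (j + h)))"
        by (simp add: cnj_sum mult.commute)
      then show ?thesis using B[OF 3 that(2)] 3 by (simp del: cnj_sum)
    qed
  qed
  have "(\<Sum>j<n. (norm (\<Sum>h<H. u (j + h)))\<^sup>2) = norm (complex_of_real (\<Sum>j<n. (norm (\<Sum>h<H. u (j + h)))\<^sup>2))"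
    unfolding norm_of_real by (simp add: sum_nonneg)
  also have "\<dots> \<le> (\<Sum>h<H. \<Sum>h'<H. (if h = h' then real n else 0) + B)"
    unfolding eq by (intro sum_norm_le) (use trm in auto)
  also have "\<dots> = real H * real n + real H ^ 2 * B"
    by (simp add: sum.distrib power2_eq_square algebra_simps)
  finally have "(\<Sum>j<n. (norm (\<Sum>h<H. u (j + h)))\<^sup>2) \<le> real H * real n + real H ^ 2 * B" .
  then have "(norm ?D)\<^sup>2 \<le> real n * (real H * real n + real H ^ 2 * B)"
    using cs by (meson mult_left_mono of_nat_0_le_iff order_trans)
  also have "\<dots> = (real H * sqrt (real n ^ 2 / real H + real n * B))\<^sup>2"
    using H B0 by (simp add: power_mult_distrib power2_eq_square field_simps)
  finally have "norm ?D \<le> real H * sqrt (real n ^ 2 / real H + real n * B)"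
    by (rule power2_le_imp_le) (use B0 in auto)
  then have "norm (real H * ?S) \<le> real H * sqrt (real n ^ 2 / real H + real n * B) + real H ^ 2"
    using 1 norm_triangle_ineq2[of "real H * ?S" ?D] by (simp add: norm_minus_commute)
  then have "real H * norm ?S \<le> real H * (sqrt (real n ^ 2 / real H + real n * B) + real H)"
    by (simp add: norm_mult power2_eq_square algebra_simps)
  then show ?thesis using H by simp
qed

text \<open>The dual action on frequencies: composing a character with the torus map yields the
  character of \<open>unip_act n a \<xi>\<close> up to a phase. Entries from \<open>n\<close> on are
  set to zero so that iterates can be compared as functions.\<close>

definition unip_act :: "nat \<Rightarrow> (nat \<Rightarrow> nat \<Rightarrow> int) \<Rightarrow> (nat \<Rightarrow> int) \<Rightarrow> nat \<Rightarrow> int" where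
  "unip_act n a \<xi> = (\<lambda>i. if i < n then \<Sum>j<n. a i j * \<xi> j else 0)"

section \<open>Affine torus maps acting on characters; invariance of Lebesgue measure\<close>

lemma frac_eq_add_int: "\<exists>m::int. frac r = r + real_of_int m"
  by (rule exI[of _ "- \<lfloor>r\<rfloor>"]) (simp add: frac_def)

lemma torus_map_in_cube: "torus_map n a b x \<in> cube n"
  by (auto simp: torus_map_def cube_def PiE_iff frac_ge_0 frac_lt_1)

lemma chr_torus_map:
  "chr n \<xi> (torus_map n a b x) = chr n (unip_act n a \<xi>) x * cis (2 * pi * (\<Sum>j<n. real_of_int (\<xi> j) * b j))"
proof -
  have "chr n \<xi> (torus_map n a b x) = chr n \<xi> (\<lambda>j. (\<Sum>i<n. x i * real_of_int (a i j)) + b j)"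
  proof (rule chr_mod_int)
    fix j assume "j < n"
    then show "\<exists>m::int. torus_map n a b x j = (\<Sum>i<n. x i * real_of_int (a i j)) + b j + real_of_int m"
      using frac_eq_add_int by (simp add: torus_map_def)
  qed
  also have "(\<Sum>j<n. real_of_int (\<xi> j) * ((\<Sum>i<n. x i * real_of_int (a i j)) + b j)) =
    (\<Sum>j<n. \<Sum>i<n. real_of_int (\<xi> j) * x i * real_of_int (a i j)) + (\<Sum>j<n. real_of_int (\<xi> j) * b j)"
    by (simp add: sum.distrib sum_distrib_left algebra_simps)
  then have "chr n \<xi> (\<lambda>j. (\<Sum>i<n. x i * real_of_int (a i j)) + b j) =
    cis (2 * pi * (\<Sum>j<n. \<Sum>i<n. real_of_int (\<xi> j) * x i * real_of_int (a i j))) * cis (2 * pi * (\<Sum>j<n. real_of_int (\<xi> j) * b j))"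
    by (simp add: chr_def cis_mult algebra_simps)
  also have "(\<Sum>j<n. \<Sum>i<n. real_of_int (\<xi> j) * x i * real_of_int (a i j)) =
    (\<Sum>i<n. real_of_int (unip_act n a \<xi> i) * x i)"
    by (subst sum.swap, rule sum.cong) (auto simp: unip_act_def sum_distrib_right sum_distrib_left algebra_simps)
  finally show ?thesis by (simp add: chr_def)
qed

lemma measurable_lamI:
  assumes "\<And>j. j < n \<Longrightarrow> f j \<in> borel_measurable M" "\<And>j x. j < n \<Longrightarrow> x \<in> space M \<Longrightarrow> f j x \<in> {0..<1}"
  shows "(\<lambda>x. \<lambda>j\<in>{..<n}. f j x) \<in> measurable M (lam n)"
  unfolding lam_def
proof (rule measurable_restrict)
  fix j assume "j \<in> {..<n}"
  then show "f j \<in> measurable M (restrict_space lborel {0..<1})"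
    using assms by (intro measurable_restrict_space2) auto
qed

lemma borel_measurable_frac [measurable (raw)]:
  "f \<in> borel_measurable M \<Longrightarrow> (\<lambda>x. frac (f x) :: real) \<in> borel_measurable M"
  unfolding frac_def
  by (intro borel_measurable_diff measurable_compose[OF _ borel_measurable_real_floor])

lemma torus_map_measurable: "torus_map n a b \<in> measurable (lam n) (lam n)"
proof -
  have "(\<lambda>x. \<Sum>i\<in>{..<n}. x i * real_of_int (a i j)) \<in> borel_measurable (lam n)" for j
    by (intro borel_measurable_sum borel_measurable_times borel_measurable_const measurable_component_lam) simp
  then have "(\<lambda>x. \<lambda>j\<in>{..<n}. frac ((\<Sum>i<n. x i * real_of_int (a i j)) + b j)) \<in> measurable (lam n) (lam n)"
    by (intro measurable_lamI) (auto simp: frac_ge_0 frac_lt_1)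
  then show ?thesis by (simp add: torus_map_def[abs_def])
qed

text \<open>If nontrivial characters are sent to multiples of nontrivial ones, the image of Lebesgue
  measure has vanishing nontrivial Fourier coefficients, as Lebesgue measure itself has.\<close>

lemma lam_invariantI:
  assumes S: "S \<in> measurable (lam n) (lam n)"
    and chr: "\<And>\<xi>. \<exists>\<eta> c. (\<forall>x\<in>cube n. chr n \<xi> (S x) = chr n \<eta> x * c) \<and> ((\<exists>j<n. \<xi> j \<noteq> 0) \<longrightarrow> (\<exists>j<n. \<eta> j \<noteq> 0))"
  shows "distr (lam n) (lam n) S = lam n"
proof -
  interpret L: prob_space "lam n" by simp
  interpret D: prob_space "distr (lam n) (lam n) S" using S by (rule L.prob_space_distr)
  interpret torus_measures n "distr (lam n) (lam n) S" "lam n"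
    by unfold_locales (auto simp: D.emeasure_space_1 L.emeasure_space_1)
  show ?thesis
  proof (rule fourier_unique)
    fix \<xi>
    obtain \<eta> c where eta: "\<And>x. x \<in> cube n \<Longrightarrow> chr n \<xi> (S x) = chr n \<eta> x * c" "(\<exists>j<n. \<xi> j \<noteq> 0) \<longrightarrow> (\<exists>j<n. \<eta> j \<noteq> 0)"
      using chr[of \<xi>] by blast
    have eq: "(\<integral>x. chr n \<xi> x \<partial>distr (lam n) (lam n) S) = (\<integral>x. chr n \<xi> (S x) \<partial>lam n)"
      by (rule integral_distr[OF S chr_measurable])
    show "(\<integral>x. chr n \<xi> x \<partial>distr (lam n) (lam n) S) = (\<integral>x. chr n \<xi> x \<partial>lam n)"
    proof (cases "\<forall>j<n. \<xi> j = 0")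
      case True then show ?thesis unfolding eq by (simp add: chr_zero)
    next
      case False
      have "(\<integral>x. chr n \<xi> (S x) \<partial>lam n) = (\<integral>x. chr n \<eta> x * c \<partial>lam n)"
        by (rule Bochner_Integration.integral_cong) (auto simp: eta)
      also have "\<dots> = (\<integral>x. chr n \<eta> x \<partial>lam n) * c" by simp
      also have "\<dots> = 0" using False eta(2) by (auto simp: integral_chr)
      finally show ?thesis using False unfolding eq by (auto simp: integral_chr)
    qed
  qed
qed

text \<open>Reduced modulo one, so that it maps the cube to itself and changes of variables in
  integrals are possible; unreduced translates serve for differentiation later.\<close>

definition shift :: "nat \<Rightarrow> nat \<Rightarrow> real \<Rightarrow> (nat \<Rightarrow> real) \<Rightarrow> nat \<Rightarrow> real" where
  "shift n k v x = (\<lambda>j\<in>{..<n}. if j = k then frac (x j + v) else x j)"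

lemma shift_measurable:
  "(\<lambda>(v, x). shift n k v x) \<in> measurable (borel \<Otimes>\<^sub>M lam n) (lam n)"
proof -
  have "(\<lambda>p. \<lambda>j\<in>{..<n}. if j = k then frac (snd p j + fst p) else snd p j) \<in> measurable (borel \<Otimes>\<^sub>M lam n) (lam n)"
  proof (rule measurable_lamI)
    fix j assume "j < n"
    then have [measurable]: "(\<lambda>p. snd p j) \<in> borel_measurable (borel \<Otimes>\<^sub>M lam n)"
      by (intro measurable_compose[OF measurable_snd] measurable_component_lam)
    show "(\<lambda>p. if j = k then frac (snd p j + fst p) else snd p j) \<in> borel_measurable (borel \<Otimes>\<^sub>M lam n)" by measurable
  next
    fix j and p :: "real \<times> (nat \<Rightarrow> real)"
    assume j: "j < n" and "p \<in> space (borel \<Otimes>\<^sub>M lam n)"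
    then have "snd p \<in> cube n" by (auto simp: space_pair_measure)
    then have "snd p j \<in> {0..<1}" using j unfolding cube_def by (blast dest: PiE_mem)
    then show "(if j = k then frac (snd p j + fst p) else snd p j) \<in> {0..<1}" by (simp add: frac_lt_1)
  qed
  then show ?thesis by (simp add: shift_def split_beta')
qed

lemma shift_measurable1: "shift n k v \<in> measurable (lam n) (lam n)"
  using measurable_compose_Pair1[OF _ shift_measurable, of v n k] by simp

lemma chr_shift: "k < n \<Longrightarrow> chr n \<xi> (shift n k v x) = chr n \<xi> (x(k := x k + v))"
  by (rule chr_mod_int) (use frac_eq_add_int in \<open>auto simp: shift_def intro: exI[of _ 0]\<close>)

lemma distr_shift:
  assumes "k < n"
  shows "distr (lam n) (lam n) (shift n k v) = lam n"
proof (rule lam_invariantI[OF shift_measurable1])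
  fix \<xi>
  show "\<exists>\<eta> c. (\<forall>x\<in>cube n. chr n \<xi> (shift n k v x) = chr n \<eta> x * c) \<and> ((\<exists>j<n. \<xi> j \<noteq> 0) \<longrightarrow> (\<exists>j<n. \<eta> j \<noteq> 0))"
    using assms by (intro exI[of _ \<xi>] exI[of _ "cis (2 * pi * (real_of_int (\<xi> k) * v))"]) (simp add: chr_shift chr_upd)
qed

section \<open>Ergodicity of the affine unipotent map\<close>

locale skew =
  fixes d :: nat and a :: "nat \<Rightarrow> nat \<Rightarrow> int" and b :: "nat \<Rightarrow> real"
  assumes d2: "d \<ge> 2"
    and diag: "\<And>i. i < d \<Longrightarrow> a i i = 1"
    and lower: "\<And>i j. i < d \<Longrightarrow> j < d \<Longrightarrow> j < i \<Longrightarrow> a i j = 0"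
    and ue: "uniquely_ergodic d (torus_map d a b)"
begin

abbreviation "T \<equiv> torus_map d a b"
abbreviation "act \<equiv> unip_act d a"

text \<open>Multiplication of a column of frequencies by \<open>A - Id\<close>, which is strictly
  upper triangular and hence nilpotent.\<close>

definition nil :: "(nat \<Rightarrow> int) \<Rightarrow> nat \<Rightarrow> int" where
  "nil \<xi> = (\<lambda>i. act \<xi> i - (if i < d then \<xi> i else 0))"

lemma act_upper: "i < d \<Longrightarrow> act \<xi> i = \<xi> i + (\<Sum>j\<in>{i<..<d}. a i j * \<xi> j)"
proof -
  assume i: "i < d"
  have "(\<Sum>j<d. a i j * \<xi> j) = (\<Sum>j\<in>insert i {i<..<d}. a i j * \<xi> j)"
    by (rule sum.mono_neutral_right) (use i lower in auto)
  then show ?thesis using i diag by (simp add: unip_act_def)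
qed

lemma nil_upper: "i < d \<Longrightarrow> nil \<xi> i = (\<Sum>j\<in>{i<..<d}. a i j * \<xi> j)"
  using act_upper by (simp add: nil_def)

text \<open>\<open>act\<close> adds to an entry only multiples of later entries, so the last nonzero
  entry of \<xi> survives.\<close>

lemma act_nonzero: "\<exists>j<d. \<xi> j \<noteq> 0 \<Longrightarrow> \<exists>j<d. act \<xi> j \<noteq> 0"
proof -
  assume ex: "\<exists>j<d. \<xi> j \<noteq> 0"
  define i where "i = Max {j. j < d \<and> \<xi> j \<noteq> 0}"
  have "i \<in> {j. j < d \<and> \<xi> j \<noteq> 0}" unfolding i_def by (rule Max_in) (use ex in auto)
  moreover have "\<xi> j = 0" if "j \<in> {i<..<d}" for j
  proof (rule ccontr)
    assume "\<xi> j \<noteq> 0"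
    then have "j \<le> i" unfolding i_def using that by (intro Max_ge) auto
    then show False using that by simp
  qed
  ultimately show ?thesis using act_upper[of i \<xi>] by (intro exI[of _ i]) auto
qed

lemma T_cube: "T x \<in> cube d" by (rule torus_map_in_cube)

lemma Tn_cube: "x \<in> cube d \<Longrightarrow> (T ^^ n) x \<in> cube d"
  by (cases n) (auto simp: T_cube)

lemma T_measurable [measurable]: "T \<in> measurable (lam d) (lam d)" by (rule torus_map_measurable)

lemma Tn_measurable [measurable]: "(T ^^ n) \<in> measurable (lam d) (lam d)"
  by (induction n) (auto intro!: measurable_comp[OF _ T_measurable])

lemma T_invariant: "distr (lam d) (lam d) T = lam d"
proof (rule lam_invariantI[OF T_measurable])
  fix \<xi>
  show "\<exists>\<eta> c. (\<forall>x\<in>cube d. chr d \<xi> (T x) = chr d \<eta> x * c) \<and> ((\<exists>j<d. \<xi> j \<noteq> 0) \<longrightarrow> (\<exists>j<d. \<eta> j \<noteq> 0))"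
    using act_nonzero[of \<xi>] chr_torus_map by blast
qed

lemma Tn_invariant: "distr (lam d) (lam d) (T ^^ n) = lam d"
proof (induction n)
  case 0 show ?case by (simp add: distr_id2)
next
  case (Suc n)
  have "distr (lam d) (lam d) (T ^^ Suc n) = distr (distr (lam d) (lam d) (T ^^ n)) (lam d) T"
    by (simp add: distr_distr)
  then show ?case by (simp only: Suc T_invariant)
qed

lemma measure_Tn: "E \<in> sets (lam d) \<Longrightarrow> measure (lam d) {x \<in> cube d. (T ^^ n) x \<in> E} = measure (lam d) E"
  using measure_distr[OF Tn_measurable, of E n] by (simp add: Tn_invariant vimage_def Int_def conj_commute)

lemma integral_shift:
  fixes f :: "_ \<Rightarrow> 'b::{banach, second_countable_topology}"
  shows "k < d \<Longrightarrow> f \<in> borel_measurable (lam d) \<Longrightarrow> (\<integral>x. f (shift d k v x) \<partial>lam d) = (\<integral>x. f x \<partial>lam d)"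
  using integral_distr[OF shift_measurable1, of f d k v] by (simp add: distr_shift)

lemma measure_shift: "k < d \<Longrightarrow> E \<in> sets (lam d) \<Longrightarrow> measure (lam d) {x \<in> cube d. shift d k v x \<in> E} = measure (lam d) E"
  using measure_distr[OF shift_measurable1, of E d k v] by (simp add: distr_shift vimage_def Int_def conj_commute)

text \<open>An invariant set of intermediate measure would give a second invariant probability,
  namely Lebesgue measure conditioned on it.\<close>

lemma ergodic:
  assumes E: "E \<in> sets (lam d)" and inv: "T -` E \<inter> space (lam d) = E"
  shows "measure (lam d) E = 0 \<or> measure (lam d) E = 1"
proof (rule ccontr)
  assume "\<not> ?thesis"
  then have m: "measure (lam d) E \<noteq> 0" "measure (lam d) E \<noteq> 1" by auto
  interpret prob_space "lam d" by simp
  let ?U = "uniform_measure (lam d) E"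
  have e0: "emeasure (lam d) E \<noteq> 0" using m by (simp add: emeasure_eq_measure)
  have ps: "prob_space ?U" by (rule prob_space_uniform_measure) (use e0 in auto)
  have TU: "T \<in> measurable ?U ?U" by simp
  have "distr ?U ?U T = ?U"
  proof (rule measure_eqI)
    fix A assume "A \<in> sets (distr ?U ?U T)"
    then have A [measurable]: "A \<in> sets (lam d)" by simp
    note E [measurable]
    have TA: "T -` A \<inter> cube d \<in> sets (lam d)" using measurable_sets[OF T_measurable A] by simp
    have "emeasure (distr ?U ?U T) A = emeasure ?U (T -` A \<inter> space (lam d))"
      by (subst emeasure_distr) auto
    also have "\<dots> = emeasure (lam d) (E \<inter> (T -` A \<inter> space (lam d))) / emeasure (lam d) E"
      by (rule emeasure_uniform_measure) (auto simp: TA)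
    also have "E \<inter> (T -` A \<inter> space (lam d)) = T -` (E \<inter> A) \<inter> space (lam d)"
      using inv by auto
    also have "emeasure (lam d) (T -` (E \<inter> A) \<inter> space (lam d)) = emeasure (distr (lam d) (lam d) T) (E \<inter> A)"
      by (subst emeasure_distr) auto
    also have "\<dots> / emeasure (lam d) E = emeasure ?U A" by (simp add: T_invariant)
    finally show "emeasure (distr ?U ?U T) A = emeasure ?U A" .
  qed simp
  then have "invariant_prob d T ?U" using ps TU by (simp add: invariant_prob_def)
  moreover have "invariant_prob d T (lam d)" by (simp add: invariant_prob_def T_invariant)
  ultimately have "?U = lam d" using ue unfolding uniquely_ergodic_def by blast
  then have "measure (lam d) E = measure ?U E" by simp
  also have "\<dots> = 1" using m E by (simp add: measure_uniform_measure e0 emeasure_eq_measure)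
  finally show False using m by simp
qed

lemma invariant_const:
  fixes f :: "(nat \<Rightarrow> real) \<Rightarrow> real"
  assumes "f \<in> borel_measurable (lam d)" "\<And>x. x \<in> cube d \<Longrightarrow> f (T x) = f x"
  shows "\<exists>c. AE x in lam d. f x = c"
  by (rule ergodic_invariant_const[of "lam d" T]) (use ergodic assms in auto)

text \<open>A fixed frequency with trivial phase gives an invariant character; by ergodicity it is
  almost everywhere a constant of modulus 1, yet its integral vanishes.\<close>

lemma fixed_character_phase:
  assumes nz: "\<exists>j<d. \<xi> j \<noteq> 0" and fx: "\<And>j. j < d \<Longrightarrow> act \<xi> j = \<xi> j"
  shows "cis (2 * pi * (\<Sum>j<d. real_of_int (\<xi> j) * b j)) \<noteq> 1"
proof
  assume one: "cis (2 * pi * (\<Sum>j<d. real_of_int (\<xi> j) * b j)) = 1"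
  interpret prob_space "lam d" by simp
  have inv: "chr d \<xi> (T x) = chr d \<xi> x" for x
    unfolding chr_torus_map one using chr_cong[of d "act \<xi>" \<xi> x x] fx by simp
  have [measurable]: "(\<lambda>x. Re (chr d \<xi> x)) \<in> borel_measurable (lam d)" "(\<lambda>x. Im (chr d \<xi> x)) \<in> borel_measurable (lam d)"
    by measurable
  obtain c1 where "AE x in lam d. Re (chr d \<xi> x) = c1"
    using invariant_const[of "\<lambda>x. Re (chr d \<xi> x)"] inv by auto
  moreover obtain c2 where "AE x in lam d. Im (chr d \<xi> x) = c2"
    using invariant_const[of "\<lambda>x. Im (chr d \<xi> x)"] inv by auto
  ultimately have ae: "AE x in lam d. chr d \<xi> x = Complex c1 c2"
    by eventually_elim (simp add: complex_eq_iff)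
  have "(\<integral>x. chr d \<xi> x \<partial>lam d) = (\<integral>x. Complex c1 c2 \<partial>lam d)"
    by (rule integral_cong_AE) (use ae in auto)
  also have "(\<integral>x. chr d \<xi> x \<partial>lam d) = 0" using nz by (auto simp: integral_chr)
  finally have "Complex c1 c2 = 0" using prob_space by simp
  moreover obtain x where "chr d \<xi> x = Complex c1 c2"
    using eventually_happens'[OF ae_filter_bot ae] by auto
  ultimately show False by (metis norm_chr norm_zero zero_neq_one)
qed

lemma chr_Tn: "\<exists>c. norm c = 1 \<and> (\<forall>x. chr d \<xi> ((T ^^ n) x) = chr d ((act ^^ n) \<xi>) x * c)"
proof (induction n arbitrary: \<xi>)
  case 0 show ?case by (intro exI[of _ 1]) simp
next
  case (Suc n)
  obtain c where c: "norm c = 1" "\<And>x. chr d (act \<xi>) ((T ^^ n) x) = chr d ((act ^^ n) (act \<xi>)) x * c"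
    using Suc[of "act \<xi>"] by blast
  have act_Suc: "(act ^^ Suc n) \<xi> = (act ^^ n) (act \<xi>)" by (simp add: funpow_swap1)
  have "chr d \<xi> ((T ^^ Suc n) x) = chr d ((act ^^ Suc n) \<xi>) x * (c * cis (2 * pi * (\<Sum>j<d. real_of_int (\<xi> j) * b j)))" for x
    unfolding act_Suc by (simp add: chr_torus_map c mult.assoc)
  then show ?case using c(1) by (intro exI[of _ "c * cis (2 * pi * (\<Sum>j<d. real_of_int (\<xi> j) * b j))"]) (simp add: norm_mult)
qed

section \<open>Uniform sublinear bounds for character sums along orbits\<close>

definition csum :: "(nat \<Rightarrow> int) \<Rightarrow> nat \<Rightarrow> (nat \<Rightarrow> real) \<Rightarrow> complex" where
  "csum \<xi> n x = (\<Sum>j<n. chr d \<xi> ((T ^^ j) x))"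

text \<open>Sublinear growth, uniform in the starting point. The form \<open>e * n + C\<close> can
  be added and inserted into inequalities without passing to limits.\<close>

definition weyl :: "(nat \<Rightarrow> int) \<Rightarrow> bool" where
  "weyl \<xi> \<longleftrightarrow> (\<forall>e>0. \<exists>C\<ge>0. \<forall>x n. norm (csum \<xi> n x) \<le> e * real n + C)"

text \<open>Van der Corput differencing: the product of a character at lag \<open>h\<close> with the
  conjugate of the same character is, up to a phase, the character of the frequency
  \<open>(act ^^ h) \<xi>\<close> minus \<xi>.\<close>

lemma weyl_vdc:
  assumes W: "\<And>h. h \<ge> 1 \<Longrightarrow> weyl (\<lambda>i. (act ^^ h) \<xi> i - \<xi> i)"
  shows "weyl \<xi>"
  unfolding weyl_def
proof (intro allI impI)
  fix e :: real assume e: "e > 0"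
  \<comment> \<open>Half of \<open>e\<^sup>2\<close> is spent on the diagonal term
    \<open>n\<^sup>2 / H\<close>, the other half on the correlations.\<close>
  define e1 where "e1 = e\<^sup>2 / 2"
  have e1: "e1 > 0" using e by (simp add: e1_def)
  obtain H :: nat where H: "H \<ge> 1" "1 / real H \<le> e1"
  proof -
    obtain m where "1 / real (Suc m) < e1" using nat_approx_posE[OF e1] by auto
    then show ?thesis by (intro that[of "Suc m"]) auto
  qed
  define \<eta> where "\<eta> h = (\<lambda>i. (act ^^ h) \<xi> i - \<xi> i)" for h
  have "\<exists>C\<ge>0. \<forall>x n. norm (csum (\<eta> h) n x) \<le> e1 * real n + C" if "h \<ge> 1" for h
    using W[OF that] e1 unfolding weyl_def \<eta>_def by blast
  then obtain C where C: "\<And>h. h \<ge> 1 \<Longrightarrow> C h \<ge> 0" "\<And>h x n. h \<ge> 1 \<Longrightarrow> norm (csum (\<eta> h) n x) \<le> e1 * real n + C h"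
    by metis
  define K where "K = (\<Sum>h\<in>{1..H}. C h)"
  have K: "K \<ge> 0" "\<And>h. 1 \<le> h \<Longrightarrow> h \<le> H \<Longrightarrow> C h \<le> K"
    unfolding K_def using C(1) by (auto intro!: sum_nonneg member_le_sum)
  have corr: "norm (\<Sum>j<n. chr d \<xi> ((T ^^ (j + h)) x) * cnj (chr d \<xi> ((T ^^ (j + h')) x))) \<le> e1 * real n + K"
    if h: "h' < h" "h < H" for h h' n x
  proof -
    obtain c where c: "norm c = 1" "\<And>x. chr d \<xi> ((T ^^ (h - h')) x) = chr d ((act ^^ (h - h')) \<xi>) x * c"
      using chr_Tn by blast
    have "chr d \<xi> ((T ^^ (j + h)) x) * cnj (chr d \<xi> ((T ^^ (j + h')) x)) = c * chr d (\<eta> (h - h')) ((T ^^ j) ((T ^^ h') x))" for j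
    proof -
      have "(T ^^ (j + h)) x = (T ^^ (h - h')) ((T ^^ (j + h')) x)"
        using h funpow_add[of "h - h'" "j + h'" T] by (simp add: fun_eq_iff add.commute)
      moreover have "(T ^^ (j + h')) x = (T ^^ j) ((T ^^ h') x)" by (simp add: funpow_add)
      moreover have "chr d (\<eta> (h - h')) y = chr d ((act ^^ (h - h')) \<xi>) y * cnj (chr d \<xi> y)" for y
        using chr_add[of d "(act ^^ (h - h')) \<xi>" "\<lambda>j. - \<xi> j" y] by (simp add: \<eta>_def chr_uminus)
      ultimately show ?thesis by (simp add: c)
    qed
    then have "(\<Sum>j<n. chr d \<xi> ((T ^^ (j + h)) x) * cnj (chr d \<xi> ((T ^^ (j + h')) x))) = c * csum (\<eta> (h - h')) n ((T ^^ h') x)"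
      by (simp add: csum_def sum_distrib_left)
    moreover have "1 \<le> h - h'" "h - h' \<le> H" using h by auto
    ultimately show ?thesis
      using c(1) C(2)[of "h - h'" n "(T ^^ h') x"] K(2)[of "h - h'"] by (simp add: norm_mult)
  qed
  have bound: "norm (csum \<xi> n x) \<le> e * real n + (K / e + real H)" for x n
  proof -
    have "norm (csum \<xi> n x) \<le> sqrt (real n ^ 2 / real H + real n * (e1 * real n + K)) + real H"
      unfolding csum_def
      by (rule vdc_inequality) (use corr H K e1 in auto)
    \<comment> \<open>The square of the right-hand side contains
      \<open>e\<^sup>2 * n\<^sup>2\<close> and the cross term \<open>2 * n * K\<close>, which
      dominate the radicand.\<close>
    also have "sqrt (real n ^ 2 / real H + real n * (e1 * real n + K)) \<le> e * real n + K / e"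
    proof (rule real_le_lsqrt)
      have "real n ^ 2 / real H \<le> real n ^ 2 * e1" using mult_left_mono[OF H(2), of "real n ^ 2"] by simp
      then have "real n ^ 2 / real H + real n * (e1 * real n + K) \<le> e\<^sup>2 * real n ^ 2 + real n * K"
      proof -
        have "real n * (e1 * real n + K) = real n ^ 2 * e1 + real n * K"
          by (simp add: power2_eq_square algebra_simps)
        moreover have "e\<^sup>2 * real n ^ 2 = real n ^ 2 * e1 + real n ^ 2 * e1" by (simp add: e1_def)
        ultimately show ?thesis using \<open>real n ^ 2 / real H \<le> real n ^ 2 * e1\<close> by linarith
      qed
      also have "\<dots> \<le> e\<^sup>2 * real n ^ 2 + 2 * (real n * K) + (K/e)\<^sup>2" using K by simp
      also have "\<dots> = (e * real n + K / e)\<^sup>2" using e by (simp add: power2_eq_square field_simps)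
      finally show "real n ^ 2 / real H + real n * (e1 * real n + K) \<le> (e * real n + K / e)\<^sup>2" .
    qed (use e K e1 in auto)
    finally show ?thesis by simp
  qed
  show "\<exists>C\<ge>0. \<forall>x n. norm (csum \<xi> n x) \<le> e * real n + C"
    using bound K e by (intro exI[of _ "K / e + real H"]) auto
qed

text \<open>The orbit values form a geometric progression whose ratio differs from 1, so the sums
  are even bounded.\<close>

lemma weyl_fixed:
  assumes nz: "\<exists>j<d. \<xi> j \<noteq> 0" and fx: "\<And>j. j < d \<Longrightarrow> act \<xi> j = \<xi> j"
  shows "weyl \<xi>"
proof -
  define w where "w = cis (2 * pi * (\<Sum>j<d. real_of_int (\<xi> j) * b j))"
  have w: "w \<noteq> 1" "norm w = 1" using fixed_character_phase[OF assms] by (auto simp: w_def)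
  have step: "chr d \<xi> (T x) = w * chr d \<xi> x" for x
    unfolding chr_torus_map w_def using chr_cong[of d "act \<xi>" \<xi> x x] fx by simp
  have pw: "chr d \<xi> ((T ^^ j) x) = w ^ j * chr d \<xi> x" for j x
    by (induction j) (auto simp: step)
  have "norm (csum \<xi> n x) \<le> 2 / norm (w - 1)" for n x
  proof -
    have "(\<Sum>j<n. w ^ j) = (w ^ n - 1) / (w - 1)" using geometric_sum[OF w(1), of n] by simp
    then have "csum \<xi> n x = (w ^ n - 1) / (w - 1) * chr d \<xi> x"
      unfolding csum_def pw by (simp flip: sum_distrib_right)
    then have "norm (csum \<xi> n x) = norm (w ^ n - 1) / norm (w - 1)" by (simp add: norm_mult norm_divide)
    moreover have "norm (w ^ n - 1) \<le> 2" using norm_triangle_ineq4[of "w ^ n" 1] w by (simp add: norm_power)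
    ultimately show ?thesis using w by (simp add: divide_right_mono)
  qed
  moreover have "e * real n \<ge> 0" if "e > 0" for e n using that by simp
  ultimately have "norm (csum \<xi> n x) \<le> e * real n + 2 / norm (w - 1)" if "e > 0" for e n x
    using that by (smt (verit, ccfv_threshold))
  then show ?thesis unfolding weyl_def
    by (intro allI impI exI[of _ "2 / norm (w - 1)"]) simp
qed

lemma act_eq_nil: "(\<And>i. i \<ge> d \<Longrightarrow> \<xi> i = 0) \<Longrightarrow> act \<xi> = (\<lambda>i. \<xi> i + nil \<xi> i)"
  by (auto simp: nil_def unip_act_def fun_eq_iff)

lemma nil_supp: "i \<ge> d \<Longrightarrow> nil \<xi> i = 0" by (simp add: nil_def unip_act_def)
lemma act_supp: "i \<ge> d \<Longrightarrow> act \<xi> i = 0" by (simp add: unip_act_def)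

lemma act_lin: "act (\<lambda>i. p * \<xi> i + q * \<eta> i) = (\<lambda>i. p * act \<xi> i + q * act \<eta> i)"
  by (auto simp: unip_act_def fun_eq_iff sum.distrib sum_distrib_left algebra_simps)

lemma nil_lin: "nil (\<lambda>i. p * \<xi> i + q * \<eta> i) = (\<lambda>i. p * nil \<xi> i + q * nil \<eta> i)"
  unfolding nil_def act_lin by (auto simp: fun_eq_iff algebra_simps)

lemma nil_pow_lin: "(nil ^^ r) (\<lambda>i. p * \<xi> i + q * \<eta> i) = (\<lambda>i. p * (nil ^^ r) \<xi> i + q * (nil ^^ r) \<eta> i)"
  by (induction r) (auto simp: nil_lin)

lemma nil_pow_supp: "(\<And>i. i \<ge> d \<Longrightarrow> \<xi> i = 0) \<Longrightarrow> i \<ge> d \<Longrightarrow> (nil ^^ r) \<xi> i = 0"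
  by (cases r) (auto simp: nil_supp)

lemma nil_pow_act:
  assumes "\<And>i. i \<ge> d \<Longrightarrow> \<xi> i = 0"
  shows "(nil ^^ r) (act \<xi>) = (\<lambda>i. (nil ^^ r) \<xi> i + (nil ^^ Suc r) \<xi> i)"
  using nil_pow_lin[of r 1 \<xi> 1 "nil \<xi>"] act_eq_nil[OF assms] by (simp add: funpow_swap1)

lemma act_pow_supp: "(\<And>i. i \<ge> d \<Longrightarrow> \<xi> i = 0) \<Longrightarrow> i \<ge> d \<Longrightarrow> (act ^^ h) \<xi> i = 0"
  by (cases h) (auto simp: act_supp)

text \<open>\<open>act\<close> is the identity plus \<open>nil\<close>, and \<xi> is annihilated by
  the power \<open>r + 2\<close> of \<open>nil\<close>: after applying \<open>nil ^^ r\<close>, only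
  the terms of order 0 and 1 in the binomial expansion of \<open>act ^^ h\<close> survive.\<close>

lemma nil_pow_act_pow:
  assumes s: "\<And>i. i \<ge> d \<Longrightarrow> \<xi> i = 0" and z: "(nil ^^ Suc (Suc r)) \<xi> = (\<lambda>_. 0)"
  shows "(nil ^^ r) ((act ^^ h) \<xi>) = (\<lambda>i. (nil ^^ r) \<xi> i + int h * (nil ^^ Suc r) \<xi> i) \<and>
         (nil ^^ Suc r) ((act ^^ h) \<xi>) = (nil ^^ Suc r) \<xi> \<and>
         (nil ^^ Suc (Suc r)) ((act ^^ h) \<xi>) = (\<lambda>_. 0)"
proof (induction h)
  case 0 then show ?case using z by simp
next
  case (Suc h)
  have nil0: "nil (\<lambda>_. 0) = (\<lambda>_. 0)" by (auto simp: nil_def unip_act_def fun_eq_iff)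
  have s': "\<And>i. i \<ge> d \<Longrightarrow> (act ^^ h) \<xi> i = 0" using act_pow_supp s by auto
  have n: "(nil ^^ k) (act ((act ^^ h) \<xi>)) = (\<lambda>i. (nil ^^ k) ((act ^^ h) \<xi>) i + (nil ^^ Suc k) ((act ^^ h) \<xi>) i)" for k
    by (rule nil_pow_act) (rule s')
  have z2: "(nil ^^ Suc (Suc r)) ((act ^^ h) \<xi>) = (\<lambda>_. 0)" using Suc by blast
  have "(nil ^^ Suc (Suc (Suc r))) ((act ^^ h) \<xi>) = nil ((nil ^^ Suc (Suc r)) ((act ^^ h) \<xi>))" by simp
  then have z3: "(nil ^^ Suc (Suc (Suc r))) ((act ^^ h) \<xi>) = (\<lambda>_. 0)" by (simp only: z2 nil0)
  have e: "(act ^^ Suc h) \<xi> = act ((act ^^ h) \<xi>)" by simp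
  have P1: "(nil ^^ r) ((act ^^ h) \<xi>) = (\<lambda>i. (nil ^^ r) \<xi> i + int h * (nil ^^ Suc r) \<xi> i)"
    and P2: "(nil ^^ Suc r) ((act ^^ h) \<xi>) = (nil ^^ Suc r) \<xi>" using Suc by blast+
  show ?case
  proof (intro conjI)
    show "(nil ^^ r) ((act ^^ Suc h) \<xi>) = (\<lambda>i. (nil ^^ r) \<xi> i + int (Suc h) * (nil ^^ Suc r) \<xi> i)"
      unfolding e n[of r] P1 P2 by (simp only: of_nat_Suc distrib_right mult_1 add.assoc add.commute add.left_commute)
    show "(nil ^^ Suc r) ((act ^^ Suc h) \<xi>) = (nil ^^ Suc r) \<xi>"
      unfolding e n[of "Suc r"] P2 z2 by (simp only: add_0_right)
    show "(nil ^^ Suc (Suc r)) ((act ^^ Suc h) \<xi>) = (\<lambda>_. 0)"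
      unfolding e n[of "Suc (Suc r)"] z2 z3 by (simp only: add_0_right)
  qed
qed

text \<open>Induction on the nilpotency degree of \<xi>. The differenced frequency has degree one
  less, because its image under \<open>nil ^^ r\<close> is \<open>h\<close> times the nonzero vector
  \<open>(nil ^^ Suc r) \<xi>\<close>. At the bottom the frequency is fixed.\<close>

lemma weyl_level:
  assumes "\<And>i. i \<ge> d \<Longrightarrow> \<xi> i = 0" "(nil ^^ r) \<xi> \<noteq> (\<lambda>_. 0)" "(nil ^^ Suc r) \<xi> = (\<lambda>_. 0)"
  shows "weyl \<xi>"
  using assms
proof (induction r arbitrary: \<xi>)
  case 0
  then have "\<exists>j. \<xi> j \<noteq> 0" by (auto simp: fun_eq_iff)
  then have "\<exists>j<d. \<xi> j \<noteq> 0" using 0(1) by (meson not_less)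
  moreover have "act \<xi> j = \<xi> j" for j using act_eq_nil[OF 0(1)] 0(3) by simp
  ultimately show ?case by (rule weyl_fixed)
next
  case (Suc r)
  show ?case
  proof (rule weyl_vdc)
    fix h :: nat assume h: "h \<ge> 1"
    let ?\<eta> = "\<lambda>i. (act ^^ h) \<xi> i - \<xi> i"
    note P = nil_pow_act_pow[OF Suc.prems(1) Suc.prems(3), of h]
    have lin: "(nil ^^ k) ?\<eta> = (\<lambda>i. (nil ^^ k) ((act ^^ h) \<xi>) i - (nil ^^ k) \<xi> i)" for k
      using nil_pow_lin[of k 1 "(act ^^ h) \<xi>" "-1" \<xi>] by simp
    have 1: "(nil ^^ r) ?\<eta> = (\<lambda>i. int h * (nil ^^ Suc r) \<xi> i)" unfolding lin using P by simp
    have "(nil ^^ Suc r) ((act ^^ h) \<xi>) = (nil ^^ Suc r) \<xi>" using P by blast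
    then have 2: "(nil ^^ Suc r) ?\<eta> = (\<lambda>_. 0)" unfolding lin by simp
    show "weyl ?\<eta>"
    proof (rule Suc.IH)
      show "(nil ^^ r) ?\<eta> \<noteq> (\<lambda>_. 0)" unfolding 1 using h Suc.prems(2) by (auto simp: fun_eq_iff)
      show "(nil ^^ Suc r) ?\<eta> = (\<lambda>_. 0)" by (rule 2)
      show "\<And>i. d \<le> i \<Longrightarrow> ?\<eta> i = 0" using act_pow_supp Suc.prems(1) by simp
    qed
  qed
qed

lemma nil_pow_zero: "i + r \<ge> d \<Longrightarrow> i < d \<Longrightarrow> (nil ^^ r) \<xi> i = 0 \<or> r = 0"
proof (induction r arbitrary: i)
  case (Suc r)
  show ?case
  proof (cases "r = 0")
    case True
    then have "{i<..<d} = {}" using Suc.prems by auto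
    then show ?thesis using nil_upper[of i \<xi>] Suc.prems True by simp
  next
    case False
    have "(nil ^^ r) \<xi> j = 0" if "j \<in> {i<..<d}" for j using Suc.IH[of j] Suc.prems False that by auto
    then show ?thesis using nil_upper[OF Suc.prems(2), of "(nil ^^ r) \<xi>"] by simp
  qed
qed simp

lemma weyl_nonzero:
  assumes "\<exists>j<d. \<xi> j \<noteq> 0"
  shows "weyl \<xi>"
proof -
  define \<eta> where "\<eta> = (\<lambda>i. if i < d then \<xi> i else 0)"
  have s: "\<And>i. i \<ge> d \<Longrightarrow> \<eta> i = 0" by (simp add: \<eta>_def)
  have "(nil ^^ d) \<eta> = (\<lambda>_. 0)"
  proof
    fix i show "(nil ^^ d) \<eta> i = 0"
    proof (cases "i < d")
      case True then show ?thesis using nil_pow_zero[of i d \<eta>] by auto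
    next
      case False then show ?thesis using nil_pow_supp[of \<eta> i d] s by simp
    qed
  qed
  moreover have "(nil ^^ 0) \<eta> \<noteq> (\<lambda>_. 0)" using assms by (auto simp: \<eta>_def fun_eq_iff)
  \<comment> \<open>The last level before the iterates of \<eta> under \<open>nil\<close> reach
    zero.\<close>
  ultimately obtain r where r: "(nil ^^ r) \<eta> \<noteq> (\<lambda>_. 0)" "(nil ^^ Suc r) \<eta> = (\<lambda>_. 0)"
    using ex_least_nat_less[of "\<lambda>r. (nil ^^ r) \<eta> = (\<lambda>_. 0)" d] by blast
  have "weyl \<eta>" by (rule weyl_level[of \<eta> r]) (fact s r)+
  moreover have "chr d \<eta> = chr d \<xi>" by (auto simp: \<eta>_def intro!: chr_cong)
  ultimately show ?thesis by (simp add: weyl_def csum_def)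
qed

text \<open>Connects the integer action on frequencies with the real matrix powers in which the
  hypothesis on \<open>A - Id\<close> is expressed.\<close>

lemma nil_pow_matpow:
  "i < d \<Longrightarrow> real_of_int ((nil ^^ k) \<xi> i) = (\<Sum>j<d. matpow d (minus_id a) k i j * real_of_int (\<xi> j))"
proof (induction k arbitrary: \<xi>)
  case 0
  have "(\<Sum>j<d. (if i = j then 1 else 0) * real_of_int (\<xi> j)) = (\<Sum>j<d. if j = i then real_of_int (\<xi> j) else 0)"
    by (rule sum.cong) auto
  then show ?case using 0 by simp
next
  case (Suc k)
  have nil: "real_of_int (nil \<xi> l) = (\<Sum>j<d. minus_id a l j * real_of_int (\<xi> j))" if "l < d" for l
  proof -
    have "(\<Sum>j<d. minus_id a l j * real_of_int (\<xi> j)) =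
      (\<Sum>j<d. real_of_int (a l j * \<xi> j) - (if j = l then real_of_int (\<xi> l) else 0))"
      by (rule sum.cong) (auto simp: minus_id_def algebra_simps)
    then show ?thesis using that by (simp add: nil_def unip_act_def sum_subtractf)
  qed
  have "real_of_int ((nil ^^ Suc k) \<xi> i) = real_of_int ((nil ^^ k) (nil \<xi>) i)"
    by (simp add: funpow_swap1)
  also have "\<dots> = (\<Sum>l<d. matpow d (minus_id a) k i l * (\<Sum>j<d. minus_id a l j * real_of_int (\<xi> j)))"
    using Suc nil by simp
  also have "\<dots> = (\<Sum>l<d. \<Sum>j<d. matpow d (minus_id a) k i l * minus_id a l j * real_of_int (\<xi> j))"
    by (simp add: sum_distrib_left mult.assoc)
  also have "\<dots> = (\<Sum>j<d. matpow d (minus_id a) (Suc k) i j * real_of_int (\<xi> j))"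
    by (subst sum.swap) (simp add: matmul_def sum_distrib_right)
  finally show ?case .
qed

text \<open>Binomial expansion of the identity plus \<open>nil\<close>, cut off where
  \<open>nil\<close> vanishes.\<close>

lemma act_pow_binomial:
  assumes "\<And>i. i \<ge> d \<Longrightarrow> \<xi> i = 0" "(nil ^^ Suc k) \<xi> = (\<lambda>_. 0)"
  shows "(act ^^ n) \<xi> i = (\<Sum>l\<le>k. int (n choose l) * (nil ^^ l) \<xi> i)"
  using assms
proof (induction n arbitrary: \<xi>)
  case 0
  have "(\<Sum>l\<le>k. int (0 choose l) * (nil ^^ l) \<xi> i) = (\<Sum>l\<le>k. if l = 0 then \<xi> i else 0)"
    by (rule sum.cong) (auto simp: binomial_eq_0)
  then show ?case by simp
next
  case (Suc n)
  have nilact: "(nil ^^ l) (act \<xi>) = (\<lambda>i. (nil ^^ l) \<xi> i + (nil ^^ Suc l) \<xi> i)" for l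
    by (rule nil_pow_act) (rule Suc.prems(1))
  have nil0: "nil (\<lambda>_. 0) = (\<lambda>_. 0)" by (auto simp: nil_def unip_act_def fun_eq_iff)
  have "(nil ^^ Suc (Suc k)) \<xi> = nil ((nil ^^ Suc k) \<xi>)" by simp
  then have "(nil ^^ Suc (Suc k)) \<xi> = (\<lambda>_. 0)" by (simp only: Suc.prems(2) nil0)
  then have z: "(nil ^^ Suc k) (act \<xi>) = (\<lambda>_. 0)" unfolding nilact Suc.prems(2) by simp
  have "(act ^^ Suc n) \<xi> i = (act ^^ n) (act \<xi>) i" by (simp add: funpow_swap1)
  also have "\<dots> = (\<Sum>l\<le>k. int (n choose l) * (nil ^^ l) (act \<xi>) i)"
    by (rule Suc.IH) (use act_supp z in auto)
  also have "\<dots> = (\<Sum>l\<le>k. int (n choose l) * ((nil ^^ l) \<xi> i + (nil ^^ Suc l) \<xi> i))"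
    by (simp only: nilact)
  \<comment> \<open>Pascal's rule; the last summand is the boundary term of the index shift and
    vanishes by assumption.\<close>
  also have "\<dots> = (\<Sum>l\<le>k. int (Suc n choose l) * (nil ^^ l) \<xi> i) + int (n choose k) * (nil ^^ Suc k) \<xi> i"
    by (induction k) (simp_all add: algebra_simps)
  finally show ?case using Suc.prems(2) by simp
qed

end

section \<open>Growth of the unipotent action and translation of the last coordinate\<close>

lemma choose_ratio_tendsto_0:
  assumes "l < k"
  shows "(\<lambda>n. real (n choose l) / real (n choose k)) \<longlonglongrightarrow> 0"
  using assms
proof (induction k)
  case (Suc k)
  have step: "(\<lambda>n. real (n choose k) / real (n choose Suc k)) \<longlonglongrightarrow> 0"
  proof (rule Lim_transform_eventually)
    show "(\<lambda>n. (real k + 1) / (real n - real k)) \<longlonglongrightarrow> 0" by real_asymp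
    show "eventually (\<lambda>n. (real k + 1) / (real n - real k) = real (n choose k) / real (n choose Suc k)) sequentially"
      using eventually_gt_at_top[of k]
    proof eventually_elim
      case (elim n)
      have "real (Suc k) * real (n choose Suc k) = real (n - k) * real (n choose k)"
        using binomial_absorb_comp[of n k] binomial_absorption[of k "n - 1"] elim
        by (metis Suc_diff_1 of_nat_mult binomial_absorption less_nat_zero_code neq0_conv)
      then show ?case using elim by (simp add: field_simps of_nat_diff)
    qed
  qed
  show ?case
  proof (cases "l = k")
    case False
    then have "(\<lambda>n. real (n choose l) / real (n choose k) * (real (n choose k) / real (n choose Suc k))) \<longlonglongrightarrow> 0 * 0"
      using Suc step by (intro tendsto_mult) auto
    moreover have "eventually (\<lambda>n. real (n choose l) / real (n choose k) * (real (n choose k) / real (n choose Suc k)) = real (n choose l) / real (n choose Suc k)) sequentially"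
      using eventually_ge_at_top[of k] by eventually_elim simp
    ultimately show ?thesis by (simp add: Lim_transform_eventually)
  qed (use step in simp)
qed simp

context skew
begin

text \<open>By the image condition, the \<open>k\<close>-th power of \<open>A - Id\<close> has only
  its last column nonzero. Some row \<open>i\<close> has an entry \<open>v\<close> there, so entry
  \<open>i\<close> of \<open>(act ^^ n) \<xi>\<close> grows like \<open>v * (n choose k)\<close>
  times the last frequency. The inverse of \<open>v * (n choose k)\<close> is the length
  \<open>s n\<close>: moving \<open>x\<close> by \<open>r * s n\<close> in coordinate
  \<open>i\<close> moves its \<open>n\<close>-th iterate asymptotically by \<open>r\<close> in the
  last coordinate.\<close>

lemma last_coordinate_translation:
  assumes "\<exists>k\<ge>1. \<not> mat_zero d (matpow d (minus_id a) k) \<and> mat_zero d (matpow d (minus_id a) (Suc k)) \<and>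
           range (\<lambda>y. vecmat d y (matpow d (minus_id a) k)) =
           range (\<lambda>c::real. restrict (\<lambda>j. if j = d - 1 then c else 0) {..<d})"
  obtains i s where "i < d" "s \<longlonglongrightarrow> (0::real)"
    "\<And>\<xi>. (\<And>i. i \<ge> d \<Longrightarrow> \<xi> i = 0) \<Longrightarrow> (\<lambda>n. s n * real_of_int ((act ^^ n) \<xi> i)) \<longlonglongrightarrow> real_of_int (\<xi> (d - 1))"
proof -
  obtain k where k: "k \<ge> 1" "\<not> mat_zero d (matpow d (minus_id a) k)" "mat_zero d (matpow d (minus_id a) (Suc k))"
     and rg: "range (\<lambda>y. vecmat d y (matpow d (minus_id a) k)) =
           range (\<lambda>c::real. restrict (\<lambda>j. if j = d - 1 then c else 0) {..<d})" using assms by blast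
  let ?N = "matpow d (minus_id a) k"
  have col: "?N i j = 0" if "i < d" "j < d" "j \<noteq> d - 1" for i j
  proof -
    \<comment> \<open>The unit row vector picks out row \<open>i\<close> of the matrix power, which
      must then be a multiple of the last basis vector.\<close>
    let ?e = "\<lambda>l. if l = i then 1 else (0::real)"
    have "vecmat d ?e ?N \<in> range (\<lambda>c::real. restrict (\<lambda>j. if j = d - 1 then c else 0) {..<d})"
      using rg by blast
    then obtain c where "vecmat d ?e ?N = restrict (\<lambda>j. if j = d - 1 then c else 0) {..<d}" by blast
    then have "vecmat d ?e ?N j = 0" using that by simp
    moreover have "vecmat d ?e ?N j = (\<Sum>l<d. if l = i then ?N i j else 0)"
    proof -
      have "vecmat d ?e ?N j = (\<Sum>l<d. ?e l * ?N l j)" using that by (simp add: vecmat_def)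
      also have "\<dots> = (\<Sum>l<d. if l = i then ?N i j else 0)" by (rule sum.cong) auto
      finally show ?thesis .
    qed
    ultimately show ?thesis using that by simp
  qed
  obtain i j where ij: "i < d" "j < d" "?N i j \<noteq> 0" using k(2) unfolding mat_zero_def by blast
  then have "j = d - 1" using col by blast
  with ij have i: "i < d" "?N i (d - 1) \<noteq> 0" by blast+
  define v where "v = ?N i (d - 1)"
  define s where "s n = 1 / (real (n choose k) * v)" for n
  show ?thesis
  proof (rule that[of i s])
    show "i < d" by (rule i(1))
    \<comment> \<open>Since \<open>k\<close> is positive, \<open>n choose 0\<close> is negligible
      against \<open>n choose k\<close>; hence the translation lengths tend to zero.\<close>
    have "(\<lambda>n. real (n choose 0) / real (n choose k) * (1 / v)) \<longlonglongrightarrow> 0 * (1 / v)"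
      using k(1) by (intro tendsto_mult choose_ratio_tendsto_0 tendsto_const) auto
    then show "s \<longlonglongrightarrow> 0" by (simp add: s_def[abs_def])
    fix \<xi> :: "nat \<Rightarrow> int" assume supp: "\<And>i. i \<ge> d \<Longrightarrow> \<xi> i = 0"
    have nz: "(nil ^^ Suc k) \<xi> = (\<lambda>_. 0)"
    proof
      fix i show "(nil ^^ Suc k) \<xi> i = 0"
      proof (cases "i < d")
        case True
        then have "real_of_int ((nil ^^ Suc k) \<xi> i) = 0"
          using nil_pow_matpow[OF True, of "Suc k" \<xi>] k(3) unfolding mat_zero_def by (simp del: matpow.simps funpow.simps)
        then show ?thesis by linarith
      next
        case False then show ?thesis using nil_pow_supp[of \<xi> i "Suc k"] supp by simp
      qed
    qed
    have top: "real_of_int ((nil ^^ k) \<xi> i) = v * real_of_int (\<xi> (d - 1))"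
    proof -
      have "(\<Sum>j<d. ?N i j * real_of_int (\<xi> j)) = (\<Sum>j<d. if j = d - 1 then v * real_of_int (\<xi> (d - 1)) else 0)"
        by (rule sum.cong) (use col i in \<open>auto simp: v_def\<close>)
      then show ?thesis using nil_pow_matpow[OF i(1), of k \<xi>] d2 by simp
    qed
    have "(\<lambda>n. (\<Sum>l<k. real (n choose l) / real (n choose k) * (real_of_int ((nil ^^ l) \<xi> i) / v)) +
         real_of_int (\<xi> (d - 1))) \<longlonglongrightarrow> (\<Sum>l<k. 0 * (real_of_int ((nil ^^ l) \<xi> i) / v)) + real_of_int (\<xi> (d - 1))"
      by (intro tendsto_intros choose_ratio_tendsto_0) auto
    then have lim: "(\<lambda>n. (\<Sum>l<k. real (n choose l) / real (n choose k) * (real_of_int ((nil ^^ l) \<xi> i) / v)) +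
         real_of_int (\<xi> (d - 1))) \<longlonglongrightarrow> real_of_int (\<xi> (d - 1))" by simp
    show "(\<lambda>n. s n * real_of_int ((act ^^ n) \<xi> i)) \<longlonglongrightarrow> real_of_int (\<xi> (d - 1))"
    proof (rule Lim_transform_eventually[OF lim])
      show "eventually (\<lambda>n. (\<Sum>l<k. real (n choose l) / real (n choose k) * (real_of_int ((nil ^^ l) \<xi> i) / v)) + real_of_int (\<xi> (d - 1))
          = s n * real_of_int ((act ^^ n) \<xi> i)) sequentially"
        using eventually_ge_at_top[of k]
      proof eventually_elim
        case (elim n)
        have "real_of_int ((act ^^ n) \<xi> i) = (\<Sum>l<k. real (n choose l) * real_of_int ((nil ^^ l) \<xi> i)) + real (n choose k) * (v * real_of_int (\<xi> (d - 1)))"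
          using act_pow_binomial[of \<xi> k n i, OF supp nz] top by (simp add: lessThan_Suc_atMost[symmetric])
        moreover have "v \<noteq> 0" "real (n choose k) \<noteq> 0" using i elim by (auto simp: v_def)
        ultimately show ?case by (simp add: s_def sum_distrib_left field_simps)
      qed
    qed
  qed
qed

end

section \<open>Tightness and coboundaries\<close>

lemma sum_shift_bound:
  fixes u :: "nat \<Rightarrow> real"
  assumes "\<And>j. \<bar>u j\<bar> \<le> c"
  shows "\<bar>(\<Sum>j<n. u (j + h)) - (\<Sum>j<n. u j)\<bar> \<le> 2 * real h * c"
proof (induction h)
  case (Suc h)
  have "(\<Sum>j<n. u (j + Suc h)) - (\<Sum>j<n. u (j + h)) = u (n + h) - u h"
    by (simp flip: sum_subtractf) (use sum_lessThan_telescope[of "\<lambda>j. u (j + h)" n] in simp)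
  moreover have "\<bar>u (n + h) - u h\<bar> \<le> 2 * c" using assms[of "n + h"] assms[of h] by linarith
  ultimately have "\<bar>(\<Sum>j<n. u (j + Suc h)) - (\<Sum>j<n. u j)\<bar> \<le> 2 * real h * c + 2 * c" using Suc by linarith
  then show ?case by (simp add: algebra_simps)
qed simp

text \<open>Everything is expressed through the Gram matrix of the sequence; the underlying measure
  may be infinite, as it is for the skew product over which the locale is used.\<close>

locale stationary_sequence =
  fixes P :: "'b measure" and V :: "nat \<Rightarrow> 'b \<Rightarrow> real" and c :: real
  assumes int: "\<And>n m. integrable P (\<lambda>z. V n z * V m z)"
    and stat: "\<And>n m. (\<integral>z. V (Suc n) z * V (Suc m) z \<partial>P) = (\<integral>z. V n z * V m z \<partial>P)"
    and bnd: "\<And>n m. \<bar>\<integral>z. V n z * V m z \<partial>P\<bar> \<le> c"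
begin

definition G where "G n m = (\<integral>z. V n z * V m z \<partial>P)"
definition A where "A N z = (\<Sum>n<N. V n z) / real N"
definition q where "q N = (\<integral>z. (A N z)\<^sup>2 \<partial>P)"

lemma c_nonneg: "c \<ge> 0" using bnd[of 0 0] by linarith

lemma G_shift: "G (n + i) (m + i) = G n m"
  by (induction i) (auto simp: G_def stat)

lemma integrable_comb: "integrable P (\<lambda>z. (\<Sum>n<R. w n * V (n + i) z) * (\<Sum>n<R'. w' n * V (n + j) z))"
proof -
  have "(\<lambda>z. (\<Sum>n<R. w n * V (n + i) z) * (\<Sum>n<R'. w' n * V (n + j) z)) =
     (\<lambda>z. \<Sum>n<R. \<Sum>m<R'. (w n * w' m) * (V (n + i) z * V (m + j) z))"
    by (simp add: sum_product algebra_simps)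
  then show ?thesis by (simp add: int)
qed

lemma integral_comb: "(\<integral>z. (\<Sum>n<R. w n * V (n + i) z) * (\<Sum>n<R'. w' n * V (n + j) z) \<partial>P) =
   (\<Sum>n<R. \<Sum>m<R'. w n * w' m * G (n + i) (m + j))"
proof -
  have "(\<lambda>z. (\<Sum>n<R. w n * V (n + i) z) * (\<Sum>n<R'. w' n * V (n + j) z)) =
     (\<lambda>z. \<Sum>n<R. \<Sum>m<R'. (w n * w' m) * (V (n + i) z * V (m + j) z))"
    by (simp add: sum_product algebra_simps)
  then show ?thesis by (simp add: int G_def)
qed

lemma A_comb: "A N z = (\<Sum>n<N. (1 / real N) * V (n + 0) z)"
  by (simp add: A_def sum_divide_distrib)

lemma integrable_AA: "integrable P (\<lambda>z. A N z * A M z)"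
  unfolding A_comb by (rule integrable_comb)

lemma q_eq: "q L = (\<Sum>i<L. \<Sum>j<L. G i j) / (real L)\<^sup>2"
  unfolding q_def A_comb power2_eq_square integral_comb by (simp add: sum_divide_distrib)

text \<open>The translates of a convex combination of the \<^term>\<open>V n\<close> all have the same norm, and their
  averages over a long window are close to \<^term>\<open>A L\<close>; hence \<^term>\<open>A L\<close> almost minimises the norm
  over the convex hull.\<close>

lemma q_convex_hull:
  assumes w: "\<And>n. w n \<ge> 0" "(\<Sum>n<R. w n) = 1" and L: "L \<ge> 1"
  shows "q L \<le> (\<integral>z. (\<Sum>n<R. w n * V n z)\<^sup>2 \<partial>P) + 4 * real R * c / real L"
proof -
  let ?f = "\<lambda>i z. \<Sum>n<R. w n * V (n + i) z"
  have intf: "integrable P (\<lambda>z. (?f i z)\<^sup>2)" for i unfolding power2_eq_square by (rule integrable_comb)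
  have qf: "(\<integral>z. (?f i z)\<^sup>2 \<partial>P) = (\<integral>z. (?f 0 z)\<^sup>2 \<partial>P)" for i
    unfolding power2_eq_square integral_comb G_shift by simp
  let ?g = "\<lambda>z. (\<Sum>i<L. ?f i z) / real L"
  define D where "D n m = (\<Sum>i<L. \<Sum>j<L. G (n + i) (m + j)) / (real L)\<^sup>2" for n m
  have intff: "integrable P (\<lambda>z. ?f i z * ?f j z)" for i j by (rule integrable_comb)
  have geq: "(?g z)\<^sup>2 = (\<Sum>i<L. \<Sum>j<L. ?f i z * ?f j z) / (real L)\<^sup>2" for z
    by (simp add: power_divide power2_eq_square sum_product)
  have "(\<integral>z. (?g z)\<^sup>2 \<partial>P) = (\<Sum>i<L. \<Sum>j<L. \<Sum>n<R. \<Sum>m<R. w n * w m * G (n + i) (m + j)) / (real L)\<^sup>2"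
    unfolding geq by (simp add: intff integral_comb)
  also have "(\<Sum>i<L. \<Sum>j<L. \<Sum>n<R. \<Sum>m<R. w n * w m * G (n + i) (m + j)) = (\<Sum>n<R. \<Sum>m<R. \<Sum>i<L. \<Sum>j<L. w n * w m * G (n + i) (m + j))"
  proof -
    have "(\<Sum>i<L. \<Sum>j<L. \<Sum>n<R. \<Sum>m<R. w n * w m * G (n + i) (m + j)) = (\<Sum>i<L. \<Sum>n<R. \<Sum>m<R. \<Sum>j<L. w n * w m * G (n + i) (m + j))"
      by (rule sum.cong[OF refl], subst sum.swap, rule sum.cong[OF refl], rule sum.swap)
    also have "\<dots> = (\<Sum>n<R. \<Sum>m<R. \<Sum>i<L. \<Sum>j<L. w n * w m * G (n + i) (m + j))"
      by (subst sum.swap, rule sum.cong[OF refl], rule sum.swap)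
    finally show ?thesis .
  qed
  also have "\<dots> / (real L)\<^sup>2 = (\<Sum>n<R. \<Sum>m<R. w n * w m * D n m)"
    by (simp add: D_def sum_distrib_left sum_divide_distrib)
  finally have qg: "(\<integral>z. (?g z)\<^sup>2 \<partial>P) = (\<Sum>n<R. \<Sum>m<R. w n * w m * D n m)" .
  have "(\<integral>z. (?g z)\<^sup>2 \<partial>P) \<le> (\<integral>z. (\<Sum>i<L. (?f i z)\<^sup>2) / real L \<partial>P)"
  proof (rule integral_mono)
    show "integrable P (\<lambda>z. (?g z)\<^sup>2)" unfolding geq by (simp add: intff)
    show "integrable P (\<lambda>z. (\<Sum>i<L. (?f i z)\<^sup>2) / real L)" by (simp add: intf)
    fix z
    have "(\<Sum>i<L. ?f i z * 1)\<^sup>2 \<le> (\<Sum>i<L. (?f i z)\<^sup>2) * (\<Sum>i<L. 1\<^sup>2)" by (rule Cauchy_Schwarz_ineq_sum)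
    then show "(?g z)\<^sup>2 \<le> (\<Sum>i<L. (?f i z)\<^sup>2) / real L"
      using L by (simp add: power_divide power2_eq_square field_simps)
  qed
  also have "\<dots> = (\<integral>z. (?f 0 z)\<^sup>2 \<partial>P)" using L by (simp add: intf qf del: add_0_right)
  finally have le: "(\<Sum>n<R. \<Sum>m<R. w n * w m * D n m) \<le> (\<integral>z. (?f 0 z)\<^sup>2 \<partial>P)" unfolding qg .
  have D0: "D 0 0 = q L" by (simp add: D_def q_eq)
  \<comment> \<open>Moving the two summation windows by \<open>n\<close> and \<open>m\<close>, both
    below \<open>R\<close>, changes the double sum by at most \<open>4 * L * R * c\<close>.\<close>
  have Dclose: "D 0 0 - 4 * real R * c / real L \<le> D n m" if "n < R" "m < R" for n m
  proof -
    have G: "\<bar>G i j\<bar> \<le> c" for i j unfolding G_def by (rule bnd)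
    have "\<bar>(\<Sum>j<L. \<Sum>i<L. G (i + n) (j + m)) - (\<Sum>j<L. \<Sum>i<L. G i (j + m))\<bar> \<le> (\<Sum>j<L. 2 * real n * c)"
      by (subst sum_subtractf[symmetric], rule order_trans[OF sum_abs], intro sum_mono sum_shift_bound G)
    moreover have "\<bar>(\<Sum>i<L. \<Sum>j<L. G i (j + m)) - (\<Sum>i<L. \<Sum>j<L. G i j)\<bar> \<le> (\<Sum>i<L. 2 * real m * c)"
      by (subst sum_subtractf[symmetric], rule order_trans[OF sum_abs], intro sum_mono sum_shift_bound G)
    moreover have "(\<Sum>j<L. \<Sum>i<L. G i (j + m)) = (\<Sum>i<L. \<Sum>j<L. G i (j + m))"
      "(\<Sum>j<L. \<Sum>i<L. G (i + n) (j + m)) = (\<Sum>i<L. \<Sum>j<L. G (n + i) (m + j))"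
      by (subst sum.swap, simp add: add.commute)+
    ultimately have "\<bar>(\<Sum>i<L. \<Sum>j<L. G (n + i) (m + j)) - (\<Sum>i<L. \<Sum>j<L. G i j)\<bar> \<le> real L * (2 * real n * c) + real L * (2 * real m * c)"
      by simp
    also have "\<dots> \<le> real L * (2 * real R * c) + real L * (2 * real R * c)"
      using that c_nonneg by (intro add_mono mult_left_mono mult_right_mono) auto
    finally have "(\<Sum>i<L. \<Sum>j<L. G i j) - 4 * real L * real R * c \<le> (\<Sum>i<L. \<Sum>j<L. G (n + i) (m + j))" by linarith
    then have "((\<Sum>i<L. \<Sum>j<L. G i j) - 4 * real L * real R * c) / (real L)\<^sup>2 \<le> D n m"
      unfolding D_def by (rule divide_right_mono) simp
    moreover have "((\<Sum>i<L. \<Sum>j<L. G i j) - 4 * real L * real R * c) / (real L)\<^sup>2 = D 0 0 - 4 * real R * c / real L"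
      using L by (simp add: D_def diff_divide_distrib power2_eq_square)
    ultimately show ?thesis by simp
  qed
  have "(\<Sum>n<R. \<Sum>m<R. w n * w m * (D 0 0 - 4 * real R * c / real L)) \<le> (\<Sum>n<R. \<Sum>m<R. w n * w m * D n m)"
    by (intro sum_mono mult_left_mono Dclose mult_nonneg_nonneg w) auto
  moreover have "(\<Sum>n<R. \<Sum>m<R. w n * w m * k) = k" for k
  proof -
    have "(\<Sum>n<R. \<Sum>m<R. w n * w m) = 1" using w(2) by (simp flip: sum_product)
    then show ?thesis by (simp flip: sum_distrib_right)
  qed
  ultimately show ?thesis using le D0 by simp
qed

text \<open>Parallelogram identity: the midpoint of two averages is again a convex combination, so
  its square norm is at least the infimum \<open>m\<close>, while the square norms of both averages
  come close to \<open>m\<close>; their distance must be small.\<close>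

lemma q_cauchy:
  assumes e: "e > 0"
  shows "\<exists>N0. \<forall>N\<ge>N0. \<forall>M\<ge>N0. (\<integral>z. (A N z - A M z)\<^sup>2 \<partial>P) < e"
proof -
  define m where "m = Inf (q ` {1..})"
  have q0: "q N \<ge> 0" for N unfolding q_def by simp
  have bdd: "bdd_below (q ` {1..})" using q0 by (intro bdd_belowI[of _ 0]) auto
  have mle: "m \<le> q N" if "N \<ge> 1" for N unfolding m_def using that by (intro cInf_lower bdd) auto
  obtain N1 where N1: "N1 \<ge> 1" "q N1 < m + e / 8"
    using cInf_lessD[of "q ` {1..}" "m + e / 8"] e unfolding m_def by auto
  obtain N0 :: nat where N0: "real N0 > 4 * real N1 * c * 8 / e" "N0 \<ge> 1"
    using reals_Archimedean2[of "max 1 (4 * real N1 * c * 8 / e)"] by (metis max_less_iff_conj of_nat_1 of_nat_less_iff less_imp_le_nat)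
  have up: "q L < m + e / 4" if "L \<ge> N0" for L
  proof -
    have "q L \<le> (\<integral>z. (\<Sum>n<N1. (1 / real N1) * V n z)\<^sup>2 \<partial>P) + 4 * real N1 * c / real L"
      by (rule q_convex_hull) (use N1 that N0 in auto)
    moreover have "(\<integral>z. (\<Sum>n<N1. (1 / real N1) * V n z)\<^sup>2 \<partial>P) = q N1"
      by (simp add: q_def A_comb)
    moreover have "4 * real N1 * c / real L \<le> e / 8"
    proof -
      have "4 * real N1 * c * 8 / e \<le> real L" using N0 that by linarith
      then show ?thesis using e N0 that by (simp add: field_simps)
    qed
    ultimately show ?thesis using N1 by linarith
  qed
  have "(\<integral>z. (A N z - A M z)\<^sup>2 \<partial>P) < e" if NM: "N \<ge> N0" "M \<ge> N0" for N M
  proof -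
    define R where "R = max N M"
    \<comment> \<open>The weights that write the midpoint of \<open>A N\<close> and
      \<open>A M\<close> as one convex combination of length \<open>R\<close>.\<close>
    define w where "w n = (if n < N then 1 / (2 * real N) else 0) + (if n < M then 1 / (2 * real M) else 0)" for n
    have sumif: "(\<Sum>n<R. (if n < K then x else 0) * f n) = x * (\<Sum>n<K. f n)" if "K \<le> R" for K x and f :: "nat \<Rightarrow> real"
    proof -
      have "(\<Sum>n<R. (if n < K then x else 0) * f n) = (\<Sum>n<K. (if n < K then x else 0) * f n)"
        by (rule sum.mono_neutral_right) (use that in auto)
      then show ?thesis by (simp add: sum_distrib_left)
    qed
    have mid: "(\<Sum>n<R. w n * V n z) = (A N z + A M z) / 2" for z
      unfolding w_def distrib_right sum.distrib
      by (subst (1 2) sumif) (auto simp: R_def A_def add_divide_distrib)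
    have w1: "(\<Sum>n<R. w n) = 1"
      using NM N0 sumif[of N "1 / (2 * real N)" "\<lambda>_. 1"] sumif[of M "1 / (2 * real M)" "\<lambda>_. 1"]
      unfolding w_def sum.distrib by (simp add: R_def)
    have lb: "m \<le> (\<integral>z. ((A N z + A M z) / 2)\<^sup>2 \<partial>P)"
    proof (rule field_le_epsilon)
      fix e' :: real assume e': "e' > 0"
      obtain L :: nat where L: "real L > 4 * real R * c / e'" "L \<ge> 1"
        using reals_Archimedean2[of "max 1 (4 * real R * c / e')"] by (metis max_less_iff_conj of_nat_1 of_nat_less_iff less_imp_le_nat)
      have "m \<le> q L" using mle L by simp
      also have "\<dots> \<le> (\<integral>z. (\<Sum>n<R. w n * V n z)\<^sup>2 \<partial>P) + 4 * real R * c / real L"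
        by (rule q_convex_hull) (use w1 L in \<open>auto simp: w_def\<close>)
      also have "4 * real R * c / real L \<le> e'" using L e' by (simp add: field_simps)
      finally show "m \<le> (\<integral>z. ((A N z + A M z) / 2)\<^sup>2 \<partial>P) + e'" unfolding mid by simp
    qed
    have "(\<integral>z. (A N z - A M z)\<^sup>2 \<partial>P) = (\<integral>z. 2 * (A N z * A N z) + 2 * (A M z * A M z) - 4 * ((A N z + A M z) / 2)\<^sup>2 \<partial>P)"
      by (rule Bochner_Integration.integral_cong) (auto simp: power2_eq_square field_simps)
    also have "\<dots> = 2 * q N + 2 * q M - 4 * (\<integral>z. ((A N z + A M z) / 2)\<^sup>2 \<partial>P)"
    proof -
      have "integrable P (\<lambda>z. ((A N z + A M z) / 2)\<^sup>2)"
        unfolding mid[symmetric] power2_eq_square using integrable_comb[where R=R and w=w and i=0 and R'=R and w'=w and j=0] by simp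
      moreover have "(\<integral>z. 2 * f z + 2 * g z - 4 * h z \<partial>P) = 2 * (\<integral>z. f z \<partial>P) + 2 * (\<integral>z. g z \<partial>P) - 4 * (\<integral>z. h z \<partial>P)"
        if "integrable P f" "integrable P g" "integrable P h" for f g h :: "'b \<Rightarrow> real"
        using that by simp
      ultimately show ?thesis using integrable_AA by (simp only: q_def power2_eq_square)
    qed
    also have "\<dots> < e" using lb up[OF NM(1)] up[OF NM(2)] by linarith
    finally show ?thesis .
  qed
  then show ?thesis by blast
qed

end

section \<open>Tight cocycles over ergodic maps are coboundaries\<close>

locale ergodic_cocycle =
  fixes M :: "(nat \<Rightarrow> real) measure" and S :: "(nat \<Rightarrow> real) \<Rightarrow> (nat \<Rightarrow> real)" and \<phi> :: "(nat \<Rightarrow> real) \<Rightarrow> real"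
  assumes ps: "prob_space M"
    and S [measurable]: "S \<in> measurable M M" and inv: "distr M M S = M"
    and erg: "\<And>E. E \<in> sets M \<Longrightarrow> S -` E \<inter> space M = E \<Longrightarrow> measure M E = 0 \<or> measure M E = 1"
    and phi [measurable]: "\<phi> \<in> borel_measurable M"
begin

sublocale prob_space M by (rule ps)

sublocale P: pair_sigma_finite M lborel ..

abbreviation "bs \<equiv> birkhoff_sum S \<phi>"

lemma Spow_measurable [measurable]: "(S ^^ n) \<in> measurable M M"
  by (induction n) (auto intro!: measurable_comp[OF _ S])

lemma bs_measurable [measurable]: "bs n \<in> borel_measurable M"
proof -
  have "(\<lambda>x. \<phi> ((S ^^ i) x)) \<in> borel_measurable M" for i
    by (rule measurable_compose[OF Spow_measurable phi])
  then show ?thesis unfolding birkhoff_sum_def[abs_def] by measurable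
qed

lemma bs_Suc: "bs (Suc n) x = \<phi> x + bs n (S x)"
  unfolding birkhoff_sum_def by (subst sum.lessThan_Suc_shift) (simp add: funpow_swap1)

text \<open>The skew product over \<open>S\<close> on the product with the line. The sign is chosen
  so that composition with it turns the band function \<open>V n\<close>, introduced for tight
  cocycles, into the next one.\<close>

definition \<tau> where "\<tau> = (\<lambda>(x, z). (S x, z - \<phi> x))"

lemma tau_measurable [measurable]: "\<tau> \<in> measurable (M \<Otimes>\<^sub>M lborel) (M \<Otimes>\<^sub>M lborel)"
  unfolding \<tau>_def by measurable

lemma nn_integral_translate:
  assumes [measurable]: "f \<in> borel_measurable borel"
  shows "(\<integral>\<^sup>+z. f (z - c :: real) \<partial>lborel) = (\<integral>\<^sup>+z. f z \<partial>lborel)"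
  using nn_integral_real_affine[of f 1 "- c"] by simp

text \<open>Fubini: translations preserve length in each fibre, and \<open>S\<close> preserves the
  measure on the base.\<close>

lemma distr_tau: "distr (M \<Otimes>\<^sub>M lborel) (M \<Otimes>\<^sub>M lborel) \<tau> = M \<Otimes>\<^sub>M lborel"
proof (rule measure_eqI)
  fix E assume E0: "E \<in> sets (distr (M \<Otimes>\<^sub>M lborel) (M \<Otimes>\<^sub>M lborel) \<tau>)"
  then have E [measurable]: "E \<in> sets (M \<Otimes>\<^sub>M lborel)" by simp
  have "emeasure (distr (M \<Otimes>\<^sub>M lborel) (M \<Otimes>\<^sub>M lborel) \<tau>) E = (\<integral>\<^sup>+p. indicator E p \<partial>distr (M \<Otimes>\<^sub>M lborel) (M \<Otimes>\<^sub>M lborel) \<tau>)"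
    by (rule nn_integral_indicator[OF E0, symmetric])
  also have "\<dots> = (\<integral>\<^sup>+p. indicator E (\<tau> p) \<partial>(M \<Otimes>\<^sub>M lborel))"
    by (rule nn_integral_distr) measurable
  also have "\<dots> = (\<integral>\<^sup>+x. \<integral>\<^sup>+z. indicator E (S x, z - \<phi> x) \<partial>lborel \<partial>M)"
    by (subst lborel.nn_integral_fst[symmetric]) (auto simp: \<tau>_def)
  also have "\<dots> = (\<integral>\<^sup>+x. \<integral>\<^sup>+z. indicator E (S x, z) \<partial>lborel \<partial>M)"
  proof (rule nn_integral_cong)
    fix x assume x: "x \<in> space M"
    then have "S x \<in> space M" by (rule measurable_space[OF S])
    then have "(\<lambda>z. indicator E (S x, z) :: ennreal) \<in> borel_measurable borel" by measurable
    then show "(\<integral>\<^sup>+z. indicator E (S x, z - \<phi> x) \<partial>lborel) = (\<integral>\<^sup>+z. indicator E (S x, z) \<partial>lborel)"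
      by (rule nn_integral_translate)
  qed
  also have "\<dots> = (\<integral>\<^sup>+x. \<integral>\<^sup>+z. indicator E (x, z) \<partial>lborel \<partial>distr M M S)"
    by (rule nn_integral_distr[symmetric]) measurable
  also have "\<dots> = (\<integral>\<^sup>+x. \<integral>\<^sup>+z. indicator E (x, z) \<partial>lborel \<partial>M)" by (simp add: inv)
  also have "\<dots> = emeasure (M \<Otimes>\<^sub>M lborel) E"
    by (subst lborel.nn_integral_fst) (measurable, rule nn_integral_indicator[OF E])
  finally show "emeasure (distr (M \<Otimes>\<^sub>M lborel) (M \<Otimes>\<^sub>M lborel) \<tau>) E = emeasure (M \<Otimes>\<^sub>M lborel) E" .
qed simp

end

locale tight_cocycle = ergodic_cocycle +
  fixes K \<eta> :: real
  assumes K: "K > 0" and \<eta>: "\<eta> > 0" and tight: "\<And>n. measure M {x \<in> space M. \<bar>bs n x\<bar> \<le> K} \<ge> \<eta>"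
begin

text \<open>The band of half-width \<open>K\<close> around the graph of the \<open>n\<close>-th
  Birkhoff sum; equivalently, the horizontal band pulled back by the \<open>n\<close>-th iterate of
  \<tau>.\<close>

definition V :: "nat \<Rightarrow> (nat \<Rightarrow> real) \<times> real \<Rightarrow> real" where
  "V n = (\<lambda>(x, z). indicator {-K..K} (z - bs n x))"

lemma V_measurable [measurable]: "V n \<in> borel_measurable (M \<Otimes>\<^sub>M lborel)"
  unfolding V_def by measurable

lemma V_Suc: "V (Suc n) p = V n (\<tau> p)"
  by (cases p) (simp add: V_def \<tau>_def bs_Suc algebra_simps)

lemma V_01: "0 \<le> V n p" "V n p \<le> 1"
  by (auto simp: V_def split_beta indicator_def)

lemma nn_V: "(\<integral>\<^sup>+p. ennreal (V n p) \<partial>(M \<Otimes>\<^sub>M lborel)) = ennreal (2 * K)"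
proof -
  have "(\<integral>\<^sup>+p. ennreal (V n p) \<partial>(M \<Otimes>\<^sub>M lborel)) = (\<integral>\<^sup>+x. \<integral>\<^sup>+z. ennreal (V n (x, z)) \<partial>lborel \<partial>M)"
    by (subst lborel.nn_integral_fst) auto
  also have "\<dots> = (\<integral>\<^sup>+x. ennreal (2 * K) \<partial>M)"
  proof (rule nn_integral_cong)
    fix x
    have "(\<integral>\<^sup>+z. ennreal (V n (x, z)) \<partial>lborel) = (\<integral>\<^sup>+z. indicator {-K..K} (z - bs n x) \<partial>lborel)"
      by (intro nn_integral_cong) (auto simp: V_def indicator_def)
    also have "\<dots> = (\<integral>\<^sup>+z. indicator {-K..K} z \<partial>lborel)"
      by (rule nn_integral_translate) auto
    also have "\<dots> = ennreal (2 * K)" using K by (subst nn_integral_indicator) auto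
    finally show "(\<integral>\<^sup>+z. ennreal (V n (x, z)) \<partial>lborel) = ennreal (2 * K)" .
  qed
  also have "\<dots> = ennreal (2 * K)" by (simp add: emeasure_space_1)
  finally show ?thesis .
qed

lemma integrable_V: "integrable (M \<Otimes>\<^sub>M lborel) (V n)"
  by (rule integrableI_nonneg) (auto simp: V_01 nn_V)

lemma integral_V: "(\<integral>p. V n p \<partial>(M \<Otimes>\<^sub>M lborel)) = 2 * K"
  using K by (subst integral_eq_nn_integral) (auto simp: V_01 nn_V)

lemma integrable_VV: "integrable (M \<Otimes>\<^sub>M lborel) (\<lambda>p. V n p * V m p)"
  by (rule Bochner_Integration.integrable_bound[OF integrable_V[of n]])
    (auto simp: V_01 abs_mult intro!: mult_left_le)

sublocale stationary_sequence "M \<Otimes>\<^sub>M lborel" V "2 * K"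
proof
  show "integrable (M \<Otimes>\<^sub>M lborel) (\<lambda>z. V n z * V m z)" for n m by (rule integrable_VV)
  show "(\<integral>z. V (Suc n) z * V (Suc m) z \<partial>(M \<Otimes>\<^sub>M lborel)) = (\<integral>z. V n z * V m z \<partial>(M \<Otimes>\<^sub>M lborel))" for n m
  proof -
    have "(\<integral>z. V n z * V m z \<partial>(M \<Otimes>\<^sub>M lborel)) = (\<integral>z. V n z * V m z \<partial>distr (M \<Otimes>\<^sub>M lborel) (M \<Otimes>\<^sub>M lborel) \<tau>)"
      by (simp only: distr_tau)
    also have "\<dots> = (\<integral>z. V n (\<tau> z) * V m (\<tau> z) \<partial>(M \<Otimes>\<^sub>M lborel))"
      by (rule integral_distr) measurable
    finally show ?thesis by (simp add: V_Suc)
  qed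
  show "\<bar>\<integral>z. V n z * V m z \<partial>(M \<Otimes>\<^sub>M lborel)\<bar> \<le> 2 * K" for n m
  proof -
    have "(\<integral>z. V n z * V m z \<partial>(M \<Otimes>\<^sub>M lborel)) \<le> (\<integral>z. V n z \<partial>(M \<Otimes>\<^sub>M lborel))"
      by (rule integral_mono[OF integrable_VV integrable_V]) (auto intro!: mult_left_le V_01)
    moreover have "0 \<le> (\<integral>z. V n z * V m z \<partial>(M \<Otimes>\<^sub>M lborel))" by (simp add: V_01)
    ultimately show ?thesis by (simp add: integral_V)
  qed
qed

text \<open>Where the Birkhoff sum is at most \<open>K\<close> in modulus, the two intervals of
  length \<open>2 * K\<close> overlap in an interval of length at least \<open>K\<close>; by
  tightness this happens on a set of measure at least \<eta>.\<close>

lemma G_ge0: "K * \<eta> \<le> G n 0"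
proof -
  let ?E = "{x \<in> space M. \<bar>bs n x\<bar> \<le> K}"
  have "ennreal (K * \<eta>) \<le> ennreal K * emeasure M ?E"
    using tight[of n] K by (simp add: emeasure_eq_measure ennreal_mult'[symmetric] \<eta>)
  also have "\<dots> = (\<integral>\<^sup>+x. ennreal K * indicator ?E x \<partial>M)"
    by (rule nn_integral_cmult_indicator[symmetric]) measurable
  also have "\<dots> \<le> (\<integral>\<^sup>+x. \<integral>\<^sup>+z. ennreal (V n (x, z) * V 0 (x, z)) \<partial>lborel \<partial>M)"
  proof (rule nn_integral_mono)
    fix x
    show "ennreal K * indicator ?E x \<le> (\<integral>\<^sup>+z. ennreal (V n (x, z) * V 0 (x, z)) \<partial>lborel)"
    proof (cases "x \<in> ?E")
      case True
      \<comment> \<open>The half of the horizontal band on the side of the Birkhoff sum; it lies in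
        both bands.\<close>
      define I where "I = (if bs n x \<ge> 0 then {0..K} else {-K..0})"
      have "ennreal K * indicator ?E x = (\<integral>\<^sup>+z. indicator I z \<partial>lborel)"
        using True K by (auto simp: I_def nn_integral_indicator)
      also have "\<dots> \<le> (\<integral>\<^sup>+z. ennreal (V n (x, z) * V 0 (x, z)) \<partial>lborel)"
        by (rule nn_integral_mono) (use True in \<open>auto simp: I_def V_def indicator_def birkhoff_sum_def split: if_splits\<close>)
      finally show ?thesis .
    qed simp
  qed
  also have "\<dots> = (\<integral>\<^sup>+p. ennreal (V n p * V 0 p) \<partial>(M \<Otimes>\<^sub>M lborel))"
    by (subst lborel.nn_integral_fst) auto
  also have "\<dots> = ennreal (G n 0)"
    unfolding G_def by (rule nn_integral_eq_integral[OF integrable_VV]) (auto simp: V_01)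
  finally show ?thesis using K \<eta> by (simp add: ennreal_le_iff2) (metis G_def V_01(1) integral_nonneg mult_pos_pos not_le mult_nonneg_nonneg)
qed

lemma G_ge: "K * \<eta> \<le> G n m"
proof (cases "m \<le> n")
  case True then show ?thesis using G_ge0[of "n - m"] G_shift[of "n - m" m 0] by simp
next
  case False
  have "G n m = G m n" by (simp add: G_def mult.commute)
  then show ?thesis using False G_ge0[of "m - n"] G_shift[of "m - n" n 0] by simp
qed

text \<open>Keeps the averages away from zero, so that their limit function is not trivial.\<close>

lemma q_ge: "N \<ge> 1 \<Longrightarrow> K * \<eta> \<le> q N"
proof -
  assume N: "N \<ge> 1"
  have "(\<Sum>i<N. \<Sum>j<N. K * \<eta>) \<le> (\<Sum>i<N. \<Sum>j<N. G i j)" by (intro sum_mono G_ge)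
  then show ?thesis using N by (simp add: q_eq field_simps power2_eq_square)
qed

lemma A_measurable [measurable]: "A N \<in> borel_measurable (M \<Otimes>\<^sub>M lborel)"
  unfolding A_def[abs_def] by measurable

lemma A_01: "0 \<le> A N p" "A N p \<le> 1"
proof -
  show "0 \<le> A N p" by (simp add: A_def sum_nonneg V_01)
  have "(\<Sum>n<N. V n p) \<le> (\<Sum>n<N. 1)" by (intro sum_mono V_01)
  then show "A N p \<le> 1" by (simp add: A_def divide_le_eq)
qed

text \<open>Telescoping. Averages over long windows are almost invariant at every point, with no
  exceptional set.\<close>

lemma A_tau: "\<bar>A N (\<tau> p) - A N p\<bar> \<le> 2 / real N"
proof (cases "N = 0")
  case False
  have "A N (\<tau> p) = (\<Sum>n<N. V (Suc n) p) / real N" by (simp add: A_def V_Suc)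
  moreover have "(\<Sum>n<N. V (Suc n) p) - (\<Sum>n<N. V n p) = V N p - V 0 p"
    using sum_lessThan_telescope[of "\<lambda>n. V n p" N] by (simp flip: sum_subtractf)
  ultimately have "A N (\<tau> p) - A N p = (V N p - V 0 p) / real N"
    unfolding A_def[of N p] by (metis diff_divide_distrib)
  moreover have "\<bar>V N p - V 0 p\<bar> \<le> 2" using V_01[of N p] V_01[of 0 p] by linarith
  ultimately show ?thesis using False by (simp add: divide_right_mono)
qed (simp add: A_def)

text \<open>Along a fast subsequence the averages converge in \<open>L\<^sup>2\<close>, and their pointwise upper limit is an exactly
  invariant function with finite positive norm.\<close>

lemma invariant_function:
  "\<exists>h. h \<in> borel_measurable (M \<Otimes>\<^sub>M lborel) \<and> (\<forall>p. 0 \<le> h p \<and> h p \<le> (1::real)) \<and> (\<forall>p. h (\<tau> p) = h p) \<and>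
     0 < (\<integral>\<^sup>+p. ennreal ((h p)\<^sup>2) \<partial>(M \<Otimes>\<^sub>M lborel)) \<and> (\<integral>\<^sup>+p. ennreal ((h p)\<^sup>2) \<partial>(M \<Otimes>\<^sub>M lborel)) < \<infinity>"
proof -
  \<comment> \<open>Small enough that \<open>8 * \<delta>\<close>, the bound on the averages that
    would follow from a vanishing limit, stays below \<open>K * \<eta>\<close>.\<close>
  define \<delta> where "\<delta> = K * \<eta> / 32"
  have d: "\<delta> > 0" using K \<eta> by (simp add: \<delta>_def)
  have "\<exists>N0. \<forall>N\<ge>N0. \<forall>m\<ge>N0. (\<integral>z. (A N z - A m z)\<^sup>2 \<partial>(M \<Otimes>\<^sub>M lborel)) < \<delta> / 4 ^ i" for i :: nat
    by (rule q_cauchy) (use d in auto)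
  then have "\<exists>N0. \<forall>i::nat. \<forall>N\<ge>N0 i. \<forall>m\<ge>N0 i. (\<integral>z. (A N z - A m z)\<^sup>2 \<partial>(M \<Otimes>\<^sub>M lborel)) < \<delta> / 4 ^ i"
    by (intro choice allI)
  then obtain N0 where N0: "\<And>i N m. N \<ge> N0 i \<Longrightarrow> m \<ge> N0 i \<Longrightarrow> (\<integral>z. (A N z - A m z)\<^sup>2 \<partial>(M \<Otimes>\<^sub>M lborel)) < \<delta> / 4 ^ i"
    by blast
  \<comment> \<open>The sum makes \<open>r\<close> monotone and at least \<open>N0 i\<close>; the
    term \<open>Suc i\<close> forces the windows to infinity.\<close>
  define r where "r i = (\<Sum>j\<le>i. N0 j) + Suc i" for i
  have rmono: "r i \<le> r (Suc i)" "r i \<ge> N0 i" "r i \<ge> Suc i" for i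
    using member_le_sum[of i "{..i}" N0] by (auto simp: r_def)
  have diff: "(\<integral>z. (A (r (Suc i)) z - A (r i) z)\<^sup>2 \<partial>(M \<Otimes>\<^sub>M lborel)) < \<delta> / 4 ^ i" for i
    by (rule N0) (use rmono[of i] order_trans in blast)+
  \<comment> \<open>The weights \<open>2 ^ i\<close> lose against the decay \<open>4 ^ i\<close> of
    the square distances, so \<open>D\<close> has small integral; by Cauchy-Schwarz it bounds all
    deviations from the first average at once.\<close>
  define D where "D p = (\<Sum>i. ennreal (2 ^ i * (A (r (Suc i)) p - A (r i) p)\<^sup>2))" for p
  have D_meas [measurable]: "D \<in> borel_measurable (M \<Otimes>\<^sub>M lborel)" unfolding D_def[abs_def] by measurable
  have int_sq: "integrable (M \<Otimes>\<^sub>M lborel) (\<lambda>z. (A m z - A n z)\<^sup>2)" for m n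
  proof -
    have eq: "(A m z - A n z)\<^sup>2 = A m z * A m z + A n z * A n z - 2 * (A m z * A n z)" for z
      by (simp add: power2_eq_square algebra_simps)
    show ?thesis unfolding eq by (intro Bochner_Integration.integrable_add Bochner_Integration.integrable_diff integrable_mult_right integrable_AA)
  qed
  have intD: "(\<integral>\<^sup>+p. D p \<partial>(M \<Otimes>\<^sub>M lborel)) \<le> ennreal (2 * \<delta>)"
  proof -
    have "(\<integral>\<^sup>+p. D p \<partial>(M \<Otimes>\<^sub>M lborel)) = (\<Sum>i. \<integral>\<^sup>+p. ennreal (2 ^ i * (A (r (Suc i)) p - A (r i) p)\<^sup>2) \<partial>(M \<Otimes>\<^sub>M lborel))"
      unfolding D_def by (rule nn_integral_suminf) measurable
    also have "\<dots> \<le> (\<Sum>i. ennreal (\<delta> * (1/2) ^ i))"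
    proof (intro suminf_le summableI)
      fix i
      have "(\<integral>\<^sup>+p. ennreal (2 ^ i * (A (r (Suc i)) p - A (r i) p)\<^sup>2) \<partial>(M \<Otimes>\<^sub>M lborel)) = ennreal (\<integral>p. 2 ^ i * (A (r (Suc i)) p - A (r i) p)\<^sup>2 \<partial>(M \<Otimes>\<^sub>M lborel))"
        by (rule nn_integral_eq_integral) (use int_sq in auto)
      also have "\<dots> \<le> ennreal (2 ^ i * (\<delta> / 4 ^ i))"
        using mult_left_mono[OF less_imp_le[OF diff[of i]], of "2 ^ i"] by (intro ennreal_leI) simp
      also have "2 ^ i * (\<delta> / 4 ^ i) = \<delta> * (1/2) ^ i"
        by (simp add: power_divide power_mult_distrib[symmetric] field_simps)
      finally show "(\<integral>\<^sup>+p. ennreal (2 ^ i * (A (r (Suc i)) p - A (r i) p)\<^sup>2) \<partial>(M \<Otimes>\<^sub>M lborel)) \<le> ennreal (\<delta> * (1/2) ^ i)" .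
    qed
    also have "\<dots> = ennreal (\<Sum>i. \<delta> * (1/2) ^ i)"
      by (rule suminf_ennreal2) (use d in \<open>auto intro: summable_mult\<close>)
    also have "(\<Sum>i. \<delta> * (1/2) ^ i) = 2 * \<delta>"
      using suminf_geometric[of "1/2::real"] by (simp add: suminf_mult)
    finally show ?thesis .
  qed
  have close: "ennreal ((A (r j) p - A (r 0) p)\<^sup>2) \<le> 2 * D p" for j p
  proof -
    define f where "f i = A (r (Suc i)) p - A (r i) p" for i
    have "A (r j) p - A (r 0) p = (\<Sum>i<j. f i)"
      unfolding f_def by (rule sum_lessThan_telescope[symmetric])
    also have "\<dots> = (\<Sum>i<j. sqrt ((1/2) ^ i) * (sqrt (2 ^ i) * f i))"
      by (rule sum.cong) (auto simp flip: real_sqrt_mult power_mult_distrib simp: mult.assoc[symmetric])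
    finally have "(A (r j) p - A (r 0) p)\<^sup>2 \<le> (\<Sum>i<j. (sqrt ((1/2) ^ i))\<^sup>2) * (\<Sum>i<j. (sqrt (2 ^ i) * f i)\<^sup>2)"
      using Cauchy_Schwarz_ineq_sum[of "\<lambda>i. sqrt ((1/2) ^ i)" "\<lambda>i. sqrt (2 ^ i) * f i" "{..<j}"] by simp
    also have "\<dots> = (\<Sum>i<j. (1/2) ^ i) * (\<Sum>i<j. 2 ^ i * (f i)\<^sup>2)"
      by (simp add: power_mult_distrib)
    also have "\<dots> \<le> 2 * (\<Sum>i<j. 2 ^ i * (f i)\<^sup>2)"
    proof (rule mult_right_mono)
      show "(\<Sum>i<j. (1/2) ^ i) \<le> (2::real)" using geometric_sum[of "1/2::real" j] by simp
    qed (auto intro: sum_nonneg)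
    finally have "ennreal ((A (r j) p - A (r 0) p)\<^sup>2) \<le> ennreal (2 * (\<Sum>i<j. 2 ^ i * (f i)\<^sup>2))" by (rule ennreal_leI)
    also have "\<dots> = 2 * (\<Sum>i<j. ennreal (2 ^ i * (f i)\<^sup>2))"
      by (subst ennreal_mult) (auto intro: sum_nonneg simp: sum_ennreal)
    also have "\<dots> \<le> 2 * D p" unfolding D_def f_def by (intro mult_left_mono sum_le_suminf) auto
    finally show ?thesis .
  qed
  \<comment> \<open>The upper limit exists at every point, so invariance under \<tau> holds
    everywhere and not only almost everywhere.\<close>
  define H where "H p = limsup (\<lambda>i. ereal (A (r i) p))" for p
  have H_meas [measurable]: "H \<in> borel_measurable (M \<Otimes>\<^sub>M lborel)" unfolding H_def[abs_def] by measurable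
  have H01: "0 \<le> H p" "H p \<le> 1" for p
  proof -
    show "H p \<le> 1" unfolding H_def by (rule Limsup_bounded) (auto simp: A_01)
    show "0 \<le> H p" unfolding H_def by (rule le_Limsup) (auto simp: A_01)
  qed
  have Hinv: "H (\<tau> p) = H p" for p
  proof -
    have "(\<lambda>i. 2 / real (Suc i)) \<longlonglongrightarrow> 0" by (rule lim_const_over_n[of 2, THEN LIMSEQ_Suc])
    have "(\<lambda>i. A (r i) (\<tau> p) - A (r i) p) \<longlonglongrightarrow> 0"
    proof (rule Lim_null_comparison[OF always_eventually \<open>(\<lambda>i. 2 / real (Suc i)) \<longlonglongrightarrow> 0\<close>], rule allI)
      fix i
      have "2 / real (r i) \<le> 2 / real (Suc i)" using rmono(3)[of i] by (intro divide_left_mono) auto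
      then show "norm (A (r i) (\<tau> p) - A (r i) p) \<le> 2 / real (Suc i)" using A_tau[of "r i" p] by simp
    qed
    then have "(\<lambda>i. ereal (A (r i) (\<tau> p) - A (r i) p)) \<longlonglongrightarrow> ereal 0" by (intro tendsto_ereal)
    then have "limsup (\<lambda>i. ereal (A (r i) (\<tau> p) - A (r i) p) + ereal (A (r i) p)) = ereal 0 + limsup (\<lambda>i. ereal (A (r i) p))"
      by (rule ereal_limsup_lim_add) simp
    then show ?thesis by (simp add: H_def zero_ereal_def[symmetric])
  qed
  define h where "h p = real_of_ereal (H p)" for p
  have hH: "ereal (h p) = H p" for p
  proof -
    have "\<bar>H p\<bar> \<noteq> \<infinity>" using H01[of p] by auto
    then show ?thesis by (simp add: h_def ereal_real)
  qed
  have h_meas [measurable]: "h \<in> borel_measurable (M \<Otimes>\<^sub>M lborel)" unfolding h_def[abs_def] by measurable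
  have h01: "0 \<le> h p" "h p \<le> 1" for p using H01[of p] by (auto simp flip: hH)
  have hclose: "ennreal ((h p - A (r 0) p)\<^sup>2) \<le> 2 * D p" for p
  proof (cases "D p = \<infinity>")
    case False
    define e where "e = sqrt (enn2real (2 * D p))"
    have fin: "2 * D p \<noteq> \<infinity>" using False by (simp add: ennreal_mult_eq_top_iff)
    have "(A (r j) p - A (r 0) p)\<^sup>2 \<le> enn2real (2 * D p)" for j
      using close[of j p] fin by (metis enn2real_ennreal enn2real_mono zero_le_power2 less_top infinity_ennreal_def)
    then have "\<bar>A (r j) p - A (r 0) p\<bar> \<le> e" for j
      unfolding e_def by (metis real_sqrt_abs real_sqrt_le_mono)
    then have "A (r 0) p - e \<le> A (r j) p" "A (r j) p \<le> A (r 0) p + e" for j by (smt (verit))+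
    then have "ereal (A (r 0) p - e) \<le> H p" "H p \<le> ereal (A (r 0) p + e)"
      unfolding H_def by (auto intro!: le_Limsup Limsup_bounded)
    then have "\<bar>h p - A (r 0) p\<bar> \<le> e" by (simp flip: hH)
    then have "(h p - A (r 0) p)\<^sup>2 \<le> e\<^sup>2" by (metis abs_ge_zero power2_abs power_mono)
    also have "e\<^sup>2 = enn2real (2 * D p)" by (simp add: e_def)
    finally have "ennreal ((h p - A (r 0) p)\<^sup>2) \<le> ennreal (enn2real (2 * D p))" by (rule ennreal_leI)
    moreover have "ennreal (enn2real (2 * D p)) = 2 * D p"
      using fin by (intro ennreal_enn2real) (simp add: less_top)
    ultimately show ?thesis by (simp only:)
  qed (simp add: ennreal_mult_eq_top_iff)
  have nnA: "(\<integral>\<^sup>+p. ennreal ((A n p)\<^sup>2) \<partial>(M \<Otimes>\<^sub>M lborel)) = ennreal (q n)" for n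
    unfolding q_def by (rule nn_integral_eq_integral) (auto simp: power2_eq_square integrable_AA)
  have sq: "ennreal (x\<^sup>2) \<le> 2 * ennreal (y\<^sup>2) + 2 * ennreal ((x - y)\<^sup>2)" for x y :: real
  proof -
    have "x\<^sup>2 \<le> 2 * y\<^sup>2 + 2 * (x - y)\<^sup>2" using sum_squares_bound[of x "2*y"] by (simp add: power2_eq_square algebra_simps)
    then have "ennreal (x\<^sup>2) \<le> ennreal (2 * y\<^sup>2 + 2 * (x - y)\<^sup>2)" by (rule ennreal_leI)
    also have "\<dots> = 2 * ennreal (y\<^sup>2) + 2 * ennreal ((x - y)\<^sup>2)"
      by (simp add: ennreal_plus ennreal_mult)
    finally show ?thesis .
  qed
  have "(\<integral>\<^sup>+p. ennreal ((h p)\<^sup>2) \<partial>(M \<Otimes>\<^sub>M lborel)) \<le> (\<integral>\<^sup>+p. 2 * ennreal ((A (r 0) p)\<^sup>2) + 2 * (2 * D p) \<partial>(M \<Otimes>\<^sub>M lborel))"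
    by (intro nn_integral_mono order_trans[OF sq add_left_mono[OF mult_left_mono[OF hclose]]]) simp
  also have "\<dots> = 2 * ennreal (q (r 0)) + 2 * (2 * (\<integral>\<^sup>+p. D p \<partial>(M \<Otimes>\<^sub>M lborel)))"
    by (subst nn_integral_add) (auto simp: nn_integral_cmult nnA)
  also have "\<dots> \<le> 2 * ennreal (q (r 0)) + 2 * (2 * ennreal (2 * \<delta>))" by (intro add_left_mono mult_left_mono intD) auto
  also have "\<dots> < \<infinity>" by (simp add: ennreal_mult_less_top less_top[symmetric] ennreal_add_eq_top ennreal_mult_eq_top_iff)
  finally have fin: "(\<integral>\<^sup>+p. ennreal ((h p)\<^sup>2) \<partial>(M \<Otimes>\<^sub>M lborel)) < \<infinity>" .
  have pos: "(\<integral>\<^sup>+p. ennreal ((h p)\<^sup>2) \<partial>(M \<Otimes>\<^sub>M lborel)) \<noteq> 0"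
  proof
    assume zero: "(\<integral>\<^sup>+p. ennreal ((h p)\<^sup>2) \<partial>(M \<Otimes>\<^sub>M lborel)) = 0"
    have "ennreal (q (r 0)) \<le> (\<integral>\<^sup>+p. 2 * ennreal ((h p)\<^sup>2) + 2 * (2 * D p) \<partial>(M \<Otimes>\<^sub>M lborel))"
      unfolding nnA[symmetric]
    proof (intro nn_integral_mono)
      fix p
      show "ennreal ((A (r 0) p)\<^sup>2) \<le> 2 * ennreal ((h p)\<^sup>2) + 2 * (2 * D p)"
      proof -
        have "ennreal ((A (r 0) p - h p)\<^sup>2) \<le> 2 * D p" using hclose[of p] by (simp only: power2_commute)
        then have "2 * ennreal ((A (r 0) p - h p)\<^sup>2) \<le> 2 * (2 * D p)" by (intro mult_left_mono) auto
        then show ?thesis using sq[of "A (r 0) p" "h p"] by (meson add_left_mono order_trans)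
      qed
    qed
    also have "\<dots> = 2 * (2 * (\<integral>\<^sup>+p. D p \<partial>(M \<Otimes>\<^sub>M lborel)))"
      by (subst nn_integral_add) (auto simp: nn_integral_cmult zero)
    also have "\<dots> \<le> 2 * (2 * ennreal (2 * \<delta>))" by (intro mult_left_mono intD) auto
    also have "\<dots> = ennreal (8 * \<delta>)"
    proof -
      have "ennreal (4 * (2 * \<delta>)) = 4 * ennreal (2 * \<delta>)" using ennreal_mult'[of 4 "2 * \<delta>"] by simp
      then show ?thesis by (simp flip: mult.assoc)
    qed
    finally have "q (r 0) \<le> 8 * \<delta>" using d by (simp add: ennreal_le_iff)
    moreover have "K * \<eta> \<le> q (r 0)" by (rule q_ge) (use rmono(3)[of 0] in simp)
    ultimately show False using mult_pos_pos[OF K \<eta>] unfolding \<delta>_def by linarith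
  qed
  show ?thesis
    using h_meas h01 Hinv fin pos by (intro exI[of _ h]) (auto simp: h_def zero_less_iff_neq_zero)
qed

text \<open>On almost every fibre the square of the invariant function is a density of finite mass,
  and the density over \<open>S x\<close> is that over \<open>x\<close> translated by minus \<phi>.
  The mass is invariant, hence a constant \<open>c\<close>; the median \<open>u\<close> of the
  density is translated by the same amount, so minus \<open>u\<close> is a transfer
  function.\<close>

lemma coboundary: "\<exists>u\<in>borel_measurable M. AE x in M. \<phi> x = u (S x) - u x"
proof -
  obtain h where h [measurable]: "h \<in> borel_measurable (M \<Otimes>\<^sub>M lborel)" and h01: "\<And>p. 0 \<le> h p" "\<And>p. h p \<le> (1::real)"
    and hinv: "\<And>p. h (\<tau> p) = h p"
    and J0: "0 < (\<integral>\<^sup>+p. ennreal ((h p)\<^sup>2) \<partial>(M \<Otimes>\<^sub>M lborel))" and J1: "(\<integral>\<^sup>+p. ennreal ((h p)\<^sup>2) \<partial>(M \<Otimes>\<^sub>M lborel)) < \<infinity>"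
    using invariant_function by blast
  define w where "w x = (\<integral>\<^sup>+z. ennreal ((h (x, z))\<^sup>2) \<partial>lborel)" for x
  define W where "W x y = (\<integral>\<^sup>+z. ennreal ((h (x, z))\<^sup>2) * indicator {..y} z \<partial>lborel)" for x y
  have w_meas [measurable]: "w \<in> borel_measurable M" unfolding w_def[abs_def] by measurable
  have W_meas [measurable]: "(\<lambda>x. W x y) \<in> borel_measurable M" for y unfolding W_def[abs_def] by measurable
  have sec [measurable]: "(\<lambda>z. h (x, z)) \<in> borel_measurable borel" if "x \<in> space M" for x
    using that by measurable
  have hinv': "h (x, z) = h (S x, z - \<phi> x)" for x z using hinv[of "(x, z)"] by (simp add: \<tau>_def)
  have w_inv: "w (S x) = w x" if "x \<in> space M" for x
  proof -
    have [measurable]: "(\<lambda>z. h (S x, z)) \<in> borel_measurable borel" by (rule sec[OF measurable_space[OF S that]])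
    have "w x = (\<integral>\<^sup>+z. ennreal ((h (S x, z - \<phi> x))\<^sup>2) \<partial>lborel)" unfolding w_def by (subst hinv') simp
    also have "\<dots> = w (S x)" unfolding w_def
      by (rule nn_integral_translate[of "\<lambda>z. ennreal ((h (S x, z))\<^sup>2)"]) measurable
    finally show ?thesis by simp
  qed
  have W_inv: "W (S x) (y - \<phi> x) = W x y" if "x \<in> space M" for x y
  proof -
    have [measurable]: "(\<lambda>z. h (S x, z)) \<in> borel_measurable borel" by (rule sec[OF measurable_space[OF S that]])
    have "W x y = (\<integral>\<^sup>+z. ennreal ((h (S x, z - \<phi> x))\<^sup>2) * indicator {..y - \<phi> x} (z - \<phi> x) \<partial>lborel)"
      unfolding W_def by (subst hinv') (simp add: indicator_def)
    also have "\<dots> = W (S x) (y - \<phi> x)" unfolding W_def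
      by (rule nn_integral_translate[of "\<lambda>z. ennreal ((h (S x, z))\<^sup>2) * indicator {..y - \<phi> x} z"]) measurable
    finally show ?thesis by simp
  qed
  have int_w: "(\<integral>\<^sup>+x. w x \<partial>M) = (\<integral>\<^sup>+p. ennreal ((h p)\<^sup>2) \<partial>(M \<Otimes>\<^sub>M lborel))"
    unfolding w_def by (subst lborel.nn_integral_fst) auto
  have wfin: "AE x in M. w x \<noteq> \<infinity>" by (rule nn_integral_PInf_AE) (use int_w J1 in auto)
  obtain c where c: "AE x in M. enn2real (w x) = c"
    using ergodic_invariant_const[OF ps erg S, of "\<lambda>x. enn2real (w x)"] w_inv by auto
  have wc: "AE x in M. w x = ennreal c"
    using wfin c by eventually_elim (auto simp: less_top)
  have "(\<integral>\<^sup>+x. w x \<partial>M) = (\<integral>\<^sup>+x. ennreal c \<partial>M)" by (rule nn_integral_cong_AE[OF wc])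
  then have "ennreal c = (\<integral>\<^sup>+p. ennreal ((h p)\<^sup>2) \<partial>(M \<Otimes>\<^sub>M lborel))" using int_w by (simp add: emeasure_space_1)
  then have cpos: "c > 0" using J0 by (metis ennreal_eq_0_iff not_le less_irrefl)
  \<comment> \<open>The levels below which at least half of the mass lies; the median is their
    infimum.\<close>
  define X where "X x = {y. W x y \<ge> ennreal (c / 2)}" for x
  define u where "u x = (if w x = ennreal c then Inf (X x) else 0)" for x
  have W_mono: "W x y \<le> W x y'" if "y \<le> y'" for x y y'
    unfolding W_def by (intro nn_integral_mono mult_left_mono) (use that in \<open>auto simp: indicator_def\<close>)
  \<comment> \<open>Describing \<open>u\<close> by a condition on \<open>W\<close> yields both its
    measurability and its equivariance under \<open>S\<close>.\<close>
  have u_le: "u x \<le> y \<longleftrightarrow> W x y \<ge> ennreal (c / 2)" if x: "x \<in> space M" and wx: "w x = ennreal c" for x y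
  proof -
    have [measurable]: "(\<lambda>z. h (x, z)) \<in> borel_measurable borel" by (rule sec[OF x])
    have "X x \<noteq> {}"
    proof
      assume "X x = {}"
      then have "\<not> W x y \<ge> ennreal (c / 2)" for y by (auto simp: X_def)
      then have small: "W x (real n) \<le> ennreal (c / 2)" for n by (simp add: not_le less_imp_le)
      have "w x = (\<integral>\<^sup>+z. (SUP n. ennreal ((h (x, z))\<^sup>2) * indicator {..real n} z) \<partial>lborel)"
        unfolding w_def
      proof (rule nn_integral_cong)
        fix z :: real
        show "ennreal ((h (x, z))\<^sup>2) = (SUP n. ennreal ((h (x, z))\<^sup>2) * indicator {..real n} z)"
        proof (rule antisym)
          obtain n where "z \<le> real n" using real_arch_simple by blast
          then show "ennreal ((h (x, z))\<^sup>2) \<le> (SUP n. ennreal ((h (x, z))\<^sup>2) * indicator {..real n} z)"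
            by (intro SUP_upper2[of n]) auto
          show "(SUP n. ennreal ((h (x, z))\<^sup>2) * indicator {..real n} z) \<le> ennreal ((h (x, z))\<^sup>2)"
            by (intro SUP_least) (auto simp: indicator_def)
        qed
      qed
      also have "\<dots> = (SUP n. W x (real n))" unfolding W_def
        by (rule nn_integral_monotone_convergence_SUP) (auto simp: incseq_def le_fun_def indicator_def)
      also have "\<dots> \<le> ennreal (c / 2)" by (intro SUP_least small)
      finally show False using wx cpos by (simp add: ennreal_le_iff)
    qed
    moreover have "bdd_below (X x)"
    proof -
      have "(INF n. W x (- real n)) = (\<integral>\<^sup>+z. (INF n. ennreal ((h (x, z))\<^sup>2) * indicator {..- real n} z) \<partial>lborel)"
        unfolding W_def
      proof (rule nn_integral_monotone_convergence_INF_decseq[symmetric])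
        show "decseq (\<lambda>n z. ennreal ((h (x, z))\<^sup>2) * indicator {..- real n} z)"
          by (intro decseq_SucI le_funI mult_left_mono) (auto simp: indicator_def)
        have "(\<integral>\<^sup>+z. ennreal ((h (x, z))\<^sup>2) * indicator {..- real 0} z \<partial>lborel) \<le> w x"
          unfolding w_def by (intro nn_integral_mono) (auto simp: indicator_def)
        then show "(\<integral>\<^sup>+z. ennreal ((h (x, z))\<^sup>2) * indicator {..- real 0} z \<partial>lborel) < \<infinity>"
          using wx by (metis ennreal_less_top infinity_ennreal_def le_less_trans)
      qed measurable
      also have "\<dots> = (\<integral>\<^sup>+(z::real). 0 \<partial>lborel)"
      proof (rule nn_integral_cong)
        fix z :: real
        obtain n :: nat where "- z < real n" using reals_Archimedean2 by blast
        then have z0: "ennreal ((h (x, z))\<^sup>2) * indicator {..- real n} z = 0" by (auto simp: indicator_def)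
        have "(INF n. ennreal ((h (x, z))\<^sup>2) * indicator {..- real n} z) \<le> ennreal ((h (x, z))\<^sup>2) * indicator {..- real n} z"
          by (rule INF_lower) simp
        then have "(INF n. ennreal ((h (x, z))\<^sup>2) * indicator {..- real n} z) \<le> 0" by (simp only: z0)
        then show "(INF n. ennreal ((h (x, z))\<^sup>2) * indicator {..- real n} z) = 0" by simp
      qed
      finally have "(INF n. W x (- real n)) < ennreal (c / 2)" using cpos by simp
      then obtain n where n: "W x (- real n) < ennreal (c / 2)" by (auto simp: INF_less_iff)
      have "- real n \<le> y" if "y \<in> X x" for y
      proof (rule ccontr)
        assume "\<not> - real n \<le> y"
        then have "W x y \<le> W x (- real n)" by (intro W_mono) auto
        then show False using n that by (auto simp: X_def)
      qed
      then show ?thesis by (auto simp: bdd_below_def)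
    qed
    ultimately have ne: "X x \<noteq> {}" and bd: "bdd_below (X x)" by auto
    show ?thesis
    proof
      assume "W x y \<ge> ennreal (c / 2)"
      then have "y \<in> X x" by (simp add: X_def)
      then show "u x \<le> y" using wx bd by (simp add: u_def cInf_lower)
    next
      assume le: "u x \<le> y"
      \<comment> \<open>Right continuity of \<open>W\<close>: since \<open>h\<close> is at most 1,
        an interval of length \<open>e\<close> carries mass at most \<open>e\<close>. Hence the
        infimum is attained.\<close>
      show "W x y \<ge> ennreal (c / 2)"
      proof (rule ennreal_le_epsilon)
        fix e :: real assume e: "e > 0"
        then have "Inf (X x) < y + e" using le wx by (simp add: u_def)
        then obtain y' where y': "y' \<in> X x" "y' < y + e" using cInf_lessD[OF ne] by auto
        have "ennreal (c / 2) \<le> W x (y + e)" using y' W_mono[of y' "y + e" x] by (auto simp: X_def intro: order_trans)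
        also have "\<dots> \<le> (\<integral>\<^sup>+z. ennreal ((h (x, z))\<^sup>2) * indicator {..y} z + indicator {y<..y+e} z \<partial>lborel)"
          unfolding W_def
          by (intro nn_integral_mono) (use h01 e in \<open>auto simp: indicator_def power_le_one ennreal_le_1\<close>)
        also have "\<dots> = W x y + ennreal e"
          unfolding W_def using e by (subst nn_integral_add) (auto simp: nn_integral_indicator)
        finally show "ennreal (c / 2) \<le> W x y + ennreal e" .
      qed
    qed
  qed
  have u_meas: "u \<in> borel_measurable M"
  proof (rule borel_measurableI_le)
    fix y
    have "{x \<in> space M. u x \<le> y} = {x \<in> space M. w x = ennreal c \<and> W x y \<ge> ennreal (c / 2)} \<union> {x \<in> space M. w x \<noteq> ennreal c \<and> 0 \<le> y}"
      using u_le by (auto simp: u_def)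
    also have "\<dots> \<in> sets M" by measurable
    finally show "{x \<in> space M. u x \<le> y} \<in> sets M" .
  qed
  have "AE x in M. \<phi> x = - u (S x) - (- u x)"
    using wc AE_space
  proof eventually_elim
    case (elim x)
    have Sx: "S x \<in> space M" "w (S x) = ennreal c" using measurable_space[OF S] w_inv elim by auto
    have "u (S x) \<le> y \<longleftrightarrow> u x - \<phi> x \<le> y" for y
      using u_le[OF Sx, of y] W_inv[of x "y + \<phi> x"] u_le[of x "y + \<phi> x"] elim by (simp add: algebra_simps)
    then have "u (S x) = u x - \<phi> x" by (metis order_antisym order_refl)
    then show ?case by simp
  qed
  then show ?thesis using u_meas by (intro bexI[of _ "\<lambda>x. - u x"]) auto
qed

end

section \<open>Spreading of Birkhoff sums\<close>

text \<open>Small values at \<open>n + 1\<close> separated nodes bound a polynomial of degree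
  \<open>n\<close> on the unit disc. Subtracting the value at the last node and dividing out its
  linear factor leaves a quotient that is at most \<open>2 * \<delta> / \<rho>\<close> at the other
  nodes, so each degree costs a factor \<open>1 + 4 / \<rho>\<close>.\<close>

lemma poly_bound_separated:
  fixes c :: "nat \<Rightarrow> complex"
  assumes "\<rho> > 0" "\<delta> \<ge> 0" "\<And>i. i \<le> n \<Longrightarrow> norm (z i) \<le> 1"
    "\<And>i j. i < j \<Longrightarrow> j \<le> n \<Longrightarrow> norm (z i - z j) \<ge> \<rho>"
    "\<And>i. i \<le> n \<Longrightarrow> norm (\<Sum>k\<le>n. c k * z i ^ k) \<le> \<delta>" "norm w \<le> 1"
  shows "norm (\<Sum>k\<le>n. c k * w ^ k) \<le> \<delta> * (1 + 4 / \<rho>) ^ n"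
  using assms(2-)
proof (induction n arbitrary: c \<delta>)
  case 0
  then show ?case using "0.prems"(4)[of 0] by simp
next
  case (Suc n)
  let ?a = "z (Suc n)"
  let ?Q = "\<lambda>w. \<Sum>k\<le>Suc n. c k * w ^ k"
  obtain b where b: "\<And>w. ?Q w = (w - ?a) * (\<Sum>k<Suc n. b k * w ^ k) + ?Q ?a"
    using polyfun_linear_factor[of c "Suc n" ?a] by blast
  let ?r = "\<lambda>w. \<Sum>k\<le>n. b k * w ^ k"
  have b': "?Q w = (w - ?a) * ?r w + ?Q ?a" for w using b[of w] by (simp only: lessThan_Suc_atMost)
  have r: "norm (?r (z i)) \<le> 2 * \<delta> / \<rho>" if "i \<le> n" for i
  proof -
    have sep: "norm (z i - ?a) \<ge> \<rho>" using Suc.prems(3)[of i "Suc n"] that by simp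
    have "norm (z i - ?a) * norm (?r (z i)) = norm (?Q (z i) - ?Q ?a)" using b'[of "z i"] by (metis add_diff_cancel_right' norm_mult)
    also have "\<dots> \<le> 2 * \<delta>"
      using norm_triangle_ineq4[of "?Q (z i)" "?Q ?a"] Suc.prems(4)[of i] Suc.prems(4)[of "Suc n"] that by linarith
    finally have "\<rho> * norm (?r (z i)) \<le> 2 * \<delta>" using sep by (meson mult_right_mono norm_ge_zero order_trans)
    then show ?thesis using assms(1) by (simp add: field_simps)
  qed
  have "norm (?r w) \<le> 2 * \<delta> / \<rho> * (1 + 4 / \<rho>) ^ n"
    by (rule Suc.IH) (use Suc.prems assms(1) r in auto)
  moreover have "norm (w - ?a) \<le> 2" using norm_triangle_ineq4[of w ?a] Suc.prems(2)[of "Suc n"] Suc.prems(5) by simp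
  ultimately have "norm (w - ?a) * norm (?r w) \<le> 2 * (2 * \<delta> / \<rho> * (1 + 4 / \<rho>) ^ n)" by (intro mult_mono) auto
  moreover have "norm (?Q w) \<le> norm (w - ?a) * norm (?r w) + norm (?Q ?a)" using b'[of w] by (metis norm_mult norm_triangle_ineq)
  moreover have "norm (?Q ?a) \<le> \<delta> * (1 + 4 / \<rho>) ^ n"
  proof -
    have "norm (?Q ?a) \<le> \<delta> * 1" using Suc.prems(4)[of "Suc n"] by simp
    also have "\<dots> \<le> \<delta> * (1 + 4 / \<rho>) ^ n" using Suc.prems(1) assms(1) by (intro mult_left_mono one_le_power) auto
    finally show ?thesis .
  qed
  ultimately have "norm (?Q w) \<le> 2 * (2 * \<delta> / \<rho> * (1 + 4 / \<rho>) ^ n) + \<delta> * (1 + 4 / \<rho>) ^ n" by linarith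
  also have "\<dots> = \<delta> * (1 + 4 / \<rho>) ^ Suc n" by (simp add: algebra_simps)
  finally show ?case .
qed

text \<open>Greedy choice: the intervals of radius \<open>r\<close> around the points chosen so far
  have too little total length to cover the set.\<close>

lemma separated_points:
  assumes A: "A \<in> sets lborel" "A \<subseteq> {0..1}" and r: "r > 0" and m: "measure lborel A > 2 * r * real n"
  shows "\<exists>s::nat \<Rightarrow> real. (\<forall>i\<le>n. s i \<in> A) \<and> (\<forall>i j. i < j \<longrightarrow> j \<le> n \<longrightarrow> \<bar>s i - s j\<bar> \<ge> r)"
  using m
proof (induction n)
  case 0
  then have "A \<noteq> {}" by auto
  then show ?case by (intro exI[of _ "\<lambda>_. SOME x. x \<in> A"]) (auto intro: someI_ex)
next
  case (Suc n)
  have "2 * r * real n \<le> 2 * r * real (Suc n)" using r by (intro mult_left_mono) auto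
  then have "2 * r * real n < measure lborel A" using Suc.prems by linarith
  from Suc.IH[OF this]
  obtain s where s: "\<And>i. i \<le> n \<Longrightarrow> s i \<in> A" "\<And>i j. i < j \<Longrightarrow> j \<le> n \<Longrightarrow> \<bar>s i - s j\<bar> \<ge> r"
    by blast
  let ?U = "\<Union>i\<in>{..n}. {s i - r<..<s i + r}"
  have "\<not> A \<subseteq> ?U"
  proof
    assume sub: "A \<subseteq> ?U"
    have "emeasure lborel A \<le> emeasure lborel ?U" by (rule emeasure_mono[OF sub]) auto
    also have "\<dots> \<le> (\<Sum>i\<in>{..n}. emeasure lborel {s i - r<..<s i + r})" by (rule emeasure_subadditive_finite) auto
    also have "\<dots> = (\<Sum>i\<in>{..n}. ennreal (2 * r))" using r by (intro sum.cong) auto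
    also have "\<dots> = ennreal (2 * r * real (Suc n))" using r by (subst sum_ennreal) (auto simp: mult.commute)
    finally have "measure lborel A \<le> 2 * r * real (Suc n)" unfolding measure_def using r by (intro enn2real_leI) auto
    then show False using Suc.prems by simp
  qed
  then obtain x where x: "x \<in> A" "x \<notin> ?U" by blast
  have far: "\<bar>s i - x\<bar> \<ge> r" if "i \<le> n" for i
  proof (rule ccontr)
    assume "\<not> r \<le> \<bar>s i - x\<bar>"
    then have "x \<in> {s i - r<..<s i + r}" by auto
    then show False using x that by auto
  qed
  show ?case
    by (rule exI[of _ "s(Suc n := x)"]) (use s x far in \<open>auto simp: le_Suc_eq\<close>)
qed

text \<open>On [0,1] the sine is at least half its argument. Distances up to 1/8 keep the angle
  below 1, and \<open>pi > 3\<close> turns the resulting bound \<open>pi * \<bar>s - t\<bar>\<close>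
  into the constant 3.\<close>

lemma chord_lower_bound:
  assumes "\<bar>s - t\<bar> \<le> 1 / 8"
  shows "3 * \<bar>s - t\<bar> \<le> norm (cis (2 * pi * s) - cis (2 * pi * t))"
proof -
  have half_sin: "x / 2 \<le> sin x" if "0 \<le> x" "x \<le> 1" for x :: real
  proof -
    have "sin 0 - 0 / 2 \<le> sin x - x / 2"
    proof (rule DERIV_nonneg_imp_nondecreasing[OF that(1), of "\<lambda>x. sin x - x / 2"])
      fix y :: real assume y: "0 \<le> y" "y \<le> x"
      have "cos (pi / 3) \<le> cos y" by (rule cos_monotone_0_pi_le) (use y that pi_gt3 in auto)
      then have "cos y - 1 / 2 \<ge> 0" by (simp add: cos_60)
      moreover have "((\<lambda>x. sin x - x / 2) has_real_derivative cos y - 1 / 2) (at y)"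
        by (auto intro!: derivative_eq_intros)
      ultimately show "\<exists>D. ((\<lambda>x. sin x - x / 2) has_real_derivative D) (at y) \<and> 0 \<le> D" by blast
    qed
    then show ?thesis by simp
  qed
  define x where "x = 2 * pi * \<bar>s - t\<bar>"
  have x: "0 \<le> x" "x \<le> 1"
  proof -
    have "2 * pi * \<bar>s - t\<bar> \<le> 2 * pi * (1 / 8)" using assms by (intro mult_left_mono) auto
    also have "\<dots> \<le> 1" using pi_less_4 by simp
    finally show "x \<le> 1" by (simp add: x_def)
  qed (simp add: x_def)
  have "cis (2 * pi * s) - cis (2 * pi * t) = cis (2 * pi * t) * (cis (2 * pi * (s - t)) - 1)"
    by (simp add: algebra_simps cis_mult)
  then have "norm (cis (2 * pi * s) - cis (2 * pi * t)) = norm (cis (2 * pi * (s - t)) - 1)" by (simp add: norm_mult)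
  moreover have "\<bar>Im (cis (2 * pi * (s - t)) - 1)\<bar> \<le> norm (cis (2 * pi * (s - t)) - 1)" by (rule abs_Im_le_cmod)
  moreover have sinx: "sin x \<ge> 0" using half_sin[OF x] x by linarith
  moreover have "\<bar>Im (cis (2 * pi * (s - t)) - 1)\<bar> = sin x"
  proof (cases "s \<ge> t")
    case True
    then show ?thesis using sinx by (simp add: x_def)
  next
    case False
    then have "sin (2 * pi * (s - t)) = - sin x" by (simp add: x_def) (metis minus_diff_eq mult_minus_right sin_minus)
    then show ?thesis using sinx by simp
  qed
  ultimately have "x / 2 \<le> norm (cis (2 * pi * s) - cis (2 * pi * t))" using half_sin[OF x] by linarith
  moreover have "3 * \<bar>s - t\<bar> \<le> x / 2" using pi_gt3 by (simp add: x_def mult_right_mono)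
  ultimately show ?thesis by linarith
qed

definition trig_sum :: "nat \<Rightarrow> (int \<Rightarrow> complex) \<Rightarrow> real \<Rightarrow> complex" where
  "trig_sum D g s = (\<Sum>m\<in>{- int D..int D}. g m * cis (2 * pi * (real_of_int m * s)))"

lemma trig_sum_measurable [measurable]: "trig_sum D g \<in> borel_measurable borel"
  unfolding trig_sum_def[abs_def] by measurable

lemma trig_sum_coeff_le:
  assumes b: "\<And>s. norm (trig_sum D g s) \<le> C" and k: "k \<in> {- int D..int D}"
  shows "norm (g k) \<le> C"
proof -
  let ?U = "restrict_space lborel {0..<1::real}"
  interpret U: prob_space ?U by (rule prob_space_unit)
  have meas: "(\<lambda>s. trig_sum D g s * cis (2 * pi * (real_of_int (- k) * s))) \<in> borel_measurable ?U"
    by (intro measurable_restrict_space1) measurable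
  have intc: "integrable ?U (\<lambda>s. cis (2 * pi * (real_of_int m * s)))" for m :: int
    by (rule U.integrable_const_bound[of _ 1]) (auto intro!: measurable_restrict_space1)
  have "trig_sum D g s * cis (2 * pi * (real_of_int (- k) * s)) = (\<Sum>m\<in>{- int D..int D}. g m * cis (2 * pi * (real_of_int (m - k) * s)))" for s
    unfolding trig_sum_def sum_distrib_right
    by (rule sum.cong) (simp_all add: mult.assoc cis_mult left_diff_distrib right_diff_distrib)
  then have "(\<integral>s. trig_sum D g s * cis (2 * pi * (real_of_int (- k) * s)) \<partial>?U) = (\<Sum>m\<in>{- int D..int D}. g m * (\<integral>s. cis (2 * pi * (real_of_int (m - k) * s)) \<partial>?U))"
    using intc by (simp del: of_int_diff)
  also have "\<dots> = (\<Sum>m\<in>{- int D..int D}. if m = k then g k else 0)"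
  proof (rule sum.cong[OF refl])
    fix m
    show "g m * (\<integral>s. cis (2 * pi * (real_of_int (m - k) * s)) \<partial>?U) = (if m = k then g k else 0)"
      using integral_cis_int[of "m - k"] U.prob_space by (cases "m = k") auto
  qed
  also have "\<dots> = g k" using k by simp
  finally have "norm (g k) = norm (\<integral>s. trig_sum D g s * cis (2 * pi * (real_of_int (- k) * s)) \<partial>?U)" by simp
  also have "\<dots> \<le> (\<integral>s. norm (trig_sum D g s * cis (2 * pi * (real_of_int (- k) * s))) \<partial>?U)"
    by (rule integral_norm_bound)
  also have "\<dots> \<le> (\<integral>s. C \<partial>?U)"
    by (rule integral_mono') (use b in \<open>auto simp: norm_mult intro: order_trans[OF norm_ge_zero]\<close>)
  also have "\<dots> = C" using U.prob_space by simp
  finally show ?thesis .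
qed

text \<open>The constant depends on the degree and on \<omega> only. A sublevel set of measure at
  least \<omega> would contain \<open>2 * D + 1\<close> separated points within one eighth of the
  circle; smallness at these spreads to the whole circle and then to every coefficient.\<close>

lemma sublevel_estimate:
  assumes w: "\<omega> > 0"
  obtains C where "C > 0"
    "\<And>g \<delta> k. \<delta> \<ge> 0 \<Longrightarrow> k \<in> {- int D..int D} \<Longrightarrow> norm (g k) > C * \<delta> \<Longrightarrow>
       measure lborel {s \<in> {0..<1}. norm (trig_sum D g s) \<le> \<delta>} < \<omega>"
proof -
  define n where "n = 2 * D"
  \<comment> \<open>Chosen so that a set of measure \<open>\<omega> / 8\<close> contains
    \<open>n + 1\<close> points at mutual distance \<open>r\<close>; the circle is cut into eight
    arcs because the chord bound is for distances up to 1/8.\<close>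
  define r where "r = \<omega> / (32 * (real n + 1))"
  have r: "r > 0" using w by (simp add: r_def)
  \<comment> \<open>The growth factor for nodes on the unit circle with separation
    \<open>3 * r\<close>, the 3 coming from the chord bound.\<close>
  define C where "C = (1 + 4 / (3 * r)) ^ n"
  have C: "C > 0" using r by (simp add: C_def add_pos_pos)
  show ?thesis
  proof (rule that[OF C])
    fix g :: "int \<Rightarrow> complex" and \<delta> :: real and k :: int
    assume d: "\<delta> \<ge> 0" and k: "k \<in> {- int D..int D}" and big: "norm (g k) > C * \<delta>"
    let ?E = "{s \<in> {0..<1}. norm (trig_sum D g s) \<le> \<delta>}"
    let ?I = "\<lambda>i. {real i / 8..<(real i + 1) / 8}"
    have Em [measurable]: "?E \<in> sets borel" by measurable
    show "measure lborel ?E < \<omega>"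
    proof (rule ccontr)
      assume "\<not> measure lborel ?E < \<omega>"
      then have Ew: "measure lborel ?E \<ge> \<omega>" by simp
      have finE: "emeasure lborel A < \<infinity>" if "A \<subseteq> {0..1::real}" for A
      proof -
        have "emeasure lborel A \<le> emeasure lborel {0..1::real}" by (rule emeasure_mono[OF that]) simp
        then show ?thesis by (simp add: less_top[symmetric]) (metis ennreal_one_less_top le_less_trans less_top top.not_eq_extremum)
      qed
      have cover: "?E \<subseteq> (\<Union>i\<in>{..<8}. ?E \<inter> ?I i)"
      proof
        fix s assume s: "s \<in> ?E"
        define i where "i = nat \<lfloor>8 * s\<rfloor>"
        have "real i = of_int \<lfloor>8 * s\<rfloor>" using s by (simp add: i_def)
        then have "real i \<le> 8 * s" "8 * s < real i + 1" by linarith+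
        moreover have "i < 8" using calculation s by auto
        ultimately show "s \<in> (\<Union>i\<in>{..<8}. ?E \<inter> ?I i)" using s by (auto intro!: bexI[of _ i] simp: field_simps)
      qed
      have "measure lborel ?E \<le> measure lborel (\<Union>i\<in>{..<8}. ?E \<inter> ?I i)"
        by (rule measure_mono_fmeasurable[OF cover]) (auto intro!: fmeasurable_UN fmeasurableI finE)
      also have "\<dots> \<le> (\<Sum>i\<in>{..<8}. measure lborel (?E \<inter> ?I i))"
        by (rule measure_UNION_le) auto
      finally have sum8: "\<omega> \<le> (\<Sum>i\<in>{..<8::nat}. measure lborel (?E \<inter> ?I i))" using Ew by linarith
      have "\<exists>i\<in>{..<8::nat}. measure lborel (?E \<inter> ?I i) \<ge> \<omega> / 8"
      proof (rule ccontr)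
        assume "\<not> ?thesis"
        then have "(\<Sum>i\<in>{..<8::nat}. measure lborel (?E \<inter> ?I i)) < (\<Sum>i\<in>{..<8::nat}. \<omega> / 8)"
          by (intro sum_strict_mono) (auto simp: not_le lessThan_empty_iff)
        then show False using sum8 by simp
      qed
      then obtain i where i: "measure lborel (?E \<inter> ?I i) \<ge> \<omega> / 8" by blast
      have "2 * r * real n < \<omega> / 8" using w by (simp add: r_def field_simps add_pos_nonneg)
      then have dense: "2 * r * real n < measure lborel (?E \<inter> ?I i)" using i by linarith
      have sets: "?E \<inter> ?I i \<in> sets lborel" by (simp add: Em)
      have sub: "?E \<inter> ?I i \<subseteq> {0..1}" by auto
      obtain s where s: "\<And>j. j \<le> n \<Longrightarrow> s j \<in> ?E \<inter> ?I i" "\<And>j l. j < l \<Longrightarrow> l \<le> n \<Longrightarrow> \<bar>s j - s l\<bar> \<ge> r"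
        using separated_points[OF sets sub r dense] by blast
      let ?z = "\<lambda>j. cis (2 * pi * s j)"
      \<comment> \<open>Multiplying by the exponential of frequency \<open>D\<close> turns the
        symmetric sum into an ordinary polynomial of degree \<open>n\<close> without changing the
        modulus.\<close>
      let ?c = "\<lambda>l::nat. g (int l - int D)"
      have poly: "(\<Sum>l\<le>n. ?c l * cis (2 * pi * t) ^ l) = cis (2 * pi * (real D * t)) * trig_sum D g t" for t
      proof -
        have "trig_sum D g t = (\<Sum>l\<in>{..n}. g (int l - int D) * cis (2 * pi * (real_of_int (int l - int D) * t)))"
          unfolding trig_sum_def
          by (rule sum.reindex_bij_witness[of _ "\<lambda>l. int l - int D" "\<lambda>m. nat (m + int D)"]) (auto simp: n_def)
        also have "cis (2 * pi * (real D * t)) * \<dots> = (\<Sum>l\<le>n. ?c l * cis (2 * pi * t) ^ l)"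
          unfolding sum_distrib_left
        proof (rule sum.cong[OF refl])
          fix l
          have "cis (2 * pi * (real D * t)) * cis (2 * pi * (real_of_int (int l - int D) * t)) = cis (2 * pi * t) ^ l"
            unfolding Complex.DeMoivre cis_mult by (rule arg_cong[where f=cis]) (simp add: algebra_simps)
          then show "cis (2 * pi * (real D * t)) * (?c l * cis (2 * pi * (real_of_int (int l - int D) * t))) = ?c l * cis (2 * pi * t) ^ l"
            by (metis mult.left_commute)
        qed
        finally show ?thesis by simp
      qed
      have "norm (\<Sum>l\<le>n. ?c l * w ^ l) \<le> \<delta> * C" if "norm w \<le> 1" for w
        unfolding C_def
      proof (rule poly_bound_separated[where z="?z"])
        show "norm (?z j - ?z l) \<ge> 3 * r" if "j < l" "l \<le> n" for j l
        proof -
          have "s j \<in> ?I i" "s l \<in> ?I i" using s(1)[of j] s(1)[of l] that by auto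
          then have "real i / 8 \<le> s j" "s j < real i / 8 + 1 / 8" "real i / 8 \<le> s l" "s l < real i / 8 + 1 / 8"
            by (simp_all add: add_divide_distrib)
          then have "\<bar>s j - s l\<bar> \<le> 1 / 8" by (intro abs_leI) linarith+
          then show ?thesis by (rule order_trans[OF _ chord_lower_bound, rotated]) (use s(2)[OF that] in simp)
        qed
        show "norm (\<Sum>l\<le>n. ?c l * ?z j ^ l) \<le> \<delta>" if "j \<le> n" for j
          unfolding poly using s(1)[OF that] by (simp add: norm_mult)
      qed (use r d that in auto)
      then have "norm (\<Sum>l\<le>n. ?c l * cis (2 * pi * t) ^ l) \<le> \<delta> * C" for t by simp
      then have "norm (trig_sum D g t) \<le> \<delta> * C" for t
        unfolding poly by (simp add: norm_mult)
      then have "norm (g k) \<le> \<delta> * C" by (rule trig_sum_coeff_le[OF _ k])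
      then show False using big by (simp add: mult.commute)
    qed
  qed
qed

lemma norm_cis_diff_le: "norm (cis s - cis t) \<le> \<bar>s - t\<bar>"
proof -
  have "cis s - cis t = cis t * (cis (s - t) - 1)" by (simp add: algebra_simps cis_mult)
  then have "norm (cis s - cis t) = norm (cis (s - t) - 1)" by (simp add: norm_mult)
  also have "\<dots> = 2 * \<bar>sin ((s - t) / 2)\<bar>" using dist_exp_i_1[of "s - t"] by (simp add: cis_conv_exp)
  also have "\<dots> \<le> 2 * \<bar>(s - t) / 2\<bar>" by (intro mult_left_mono abs_sin_x_le_abs_x) simp
  finally show ?thesis by simp
qed

text \<open>The analytic data extracted from the hypotheses. The expansion of \<Psi> is required at
  all points, not only in the cube, because translates in the last coordinate are differentiated.
  The number \<open>c\<close> is the mean, \<open>CU\<close> bounds the deviation of the terms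
  without last frequency, and \<open>i0\<close>, \<open>sh\<close> provide small translations that
  move long iterates in the last direction.\<close>

locale trig_suspension = skew +
  fixes F :: "(nat \<Rightarrow> int) set" and cf :: "(nat \<Rightarrow> int) \<Rightarrow> complex" and \<Psi> :: "(nat \<Rightarrow> real) \<Rightarrow> real"
    and c m0 CU :: real and i0 :: nat and sh :: "nat \<Rightarrow> real"
  assumes finF: "finite F" and suppF: "\<And>\<xi> i. \<xi> \<in> F \<Longrightarrow> i \<ge> d \<Longrightarrow> \<xi> i = 0"
    and Psi: "\<And>x. complex_of_real (\<Psi> x) = (\<Sum>\<xi>\<in>F. cf \<xi> * chr d \<xi> x)"
    and Psi_lower: "\<And>x. \<Psi> x \<ge> m0" and m0: "m0 > 0"
    and cf0: "c = (\<integral>x. \<Psi> x \<partial>lam d)"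
    and const_part: "\<And>n x. norm ((\<Sum>\<xi>\<in>{\<xi>\<in>F. \<xi> (d - 1) = 0}. cf \<xi> * csum \<xi> n x) - complex_of_real (real n * c)) \<le> CU"
    and not_coh: "\<not> meas_coh_const d (torus_map d a b) \<Psi>"
    and i0: "i0 < d" and sh: "sh \<longlonglongrightarrow> 0"
    and sh_last: "\<And>\<xi>. (\<And>i. i \<ge> d \<Longrightarrow> \<xi> i = 0) \<Longrightarrow> (\<lambda>n. sh n * real_of_int ((unip_act d a ^^ n) \<xi> i0)) \<longlonglongrightarrow> real_of_int (\<xi> (d - 1))"
begin

section \<open>Birkhoff sums as trigonometric polynomials in the last coordinate\<close>

abbreviation p :: "nat \<Rightarrow> (nat \<Rightarrow> real) \<Rightarrow> real" where "p \<equiv> birkhoff_sum T \<Psi>"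

text \<open>Not reduced modulo one, in contrast to \<open>shift\<close>, so that it depends smoothly
  on \<open>s\<close>.\<close>

definition mv :: "(nat \<Rightarrow> real) \<Rightarrow> real \<Rightarrow> nat \<Rightarrow> real" where
  "mv x s = x(d - 1 := x (d - 1) + s)"

definition D :: nat where "D = (\<Sum>\<xi>\<in>F. nat \<bar>\<xi> (d - 1)\<bar>)"

text \<open>The \<open>m\<close>-th Fourier coefficient of the \<open>n\<close>-th Birkhoff sum
  along the circle through \<open>x\<close> in the last direction.\<close>

definition g :: "nat \<Rightarrow> (nat \<Rightarrow> real) \<Rightarrow> int \<Rightarrow> complex" where
  "g n x m = (\<Sum>\<xi>\<in>{\<xi>\<in>F. \<xi> (d - 1) = m}. cf \<xi> * csum \<xi> n x)"

text \<open>Size of the oscillating part: it measures the shear after \<open>n\<close> returns and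
  is constant along the circle in the last direction.\<close>

definition q :: "nat \<Rightarrow> (nat \<Rightarrow> real) \<Rightarrow> real" where
  "q n x = (\<Sum>m\<in>{- int D..int D} - {0}. norm (g n x m))"

definition sn :: "nat \<Rightarrow> (nat \<Rightarrow> real) \<Rightarrow> real" where
  "sn n x = p n x - real n * c"

lemma CU: "CU \<ge> 0" using const_part[of 0 undefined] norm_ge_zero order_trans by blast

lemma d1: "d - 1 < d" using d2 by simp

lemma F_D: "\<xi> \<in> F \<Longrightarrow> \<xi> (d - 1) \<in> {- int D..int D}"
proof -
  assume "\<xi> \<in> F"
  then have "nat \<bar>\<xi> (d - 1)\<bar> \<le> D"
    unfolding D_def using finF by (intro member_le_sum) auto
  then show ?thesis by auto
qed

lemma p_eq: "complex_of_real (p n x) = (\<Sum>\<xi>\<in>F. cf \<xi> * csum \<xi> n x)"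
proof -
  have "complex_of_real (p n x) = (\<Sum>i<n. \<Sum>\<xi>\<in>F. cf \<xi> * chr d \<xi> ((T ^^ i) x))"
    by (simp add: birkhoff_sum_def Psi)
  also have "\<dots> = (\<Sum>\<xi>\<in>F. cf \<xi> * csum \<xi> n x)"
    by (subst sum.swap) (simp add: csum_def sum_distrib_left)
  finally show ?thesis .
qed

lemma sum_by_last: "(\<Sum>m\<in>{- int D..int D}. \<Sum>\<xi>\<in>{\<xi>\<in>F. \<xi> (d - 1) = m}. f \<xi>) = (\<Sum>\<xi>\<in>F. f \<xi> :: complex)"
  by (rule sum.group) (use finF F_D in auto)

text \<open>Triangularity: iteration leaves the last frequency alone, so the degree in the last
  coordinate stays at most \<open>D\<close> for all times.\<close>

lemma act_last: "act \<xi> (d - 1) = \<xi> (d - 1)"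
proof -
  have "{d - 1<..<d} = {}" by auto
  then show ?thesis using act_upper[OF d1, of \<xi>] by simp
qed

lemma act_pow_last: "(act ^^ n) \<xi> (d - 1) = \<xi> (d - 1)"
  by (induction n) (auto simp: act_last simp del: One_nat_def)

lemma chr_Tn_upd:
  assumes "k < d"
  shows "chr d \<xi> ((T ^^ n) (x(k := x k + s))) = chr d \<xi> ((T ^^ n) x) * cis (2 * pi * (real_of_int ((act ^^ n) \<xi> k) * s))"
  using chr_Tn[of \<xi> n] chr_upd[OF assms] by (auto simp: algebra_simps)

lemma chr_Tn_mv: "chr d \<xi> ((T ^^ n) (mv x s)) = chr d \<xi> ((T ^^ n) x) * cis (2 * pi * (real_of_int (\<xi> (d - 1)) * s))"
  unfolding mv_def chr_Tn_upd[OF d1] act_pow_last ..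

lemma chr_mv: "chr d \<xi> (mv x s) = chr d \<xi> x * cis (2 * pi * (real_of_int (\<xi> (d - 1)) * s))"
  using chr_Tn_mv[of \<xi> 0] by simp

lemma csum_mv: "csum \<xi> n (mv x s) = csum \<xi> n x * cis (2 * pi * (real_of_int (\<xi> (d - 1)) * s))"
  by (simp add: csum_def chr_Tn_mv sum_distrib_right)

lemma g_mv: "g n (mv x s) m = g n x m * cis (2 * pi * (real_of_int m * s))"
  by (auto simp: g_def csum_mv sum_distrib_right mult.assoc intro!: sum.cong)

lemma q_mv: "q n (mv x s) = q n x"
  by (simp add: q_def g_mv norm_mult)

lemma p_g: "complex_of_real (p n x) = (\<Sum>m\<in>{- int D..int D}. g n x m)"
  unfolding g_def sum_by_last p_eq ..

lemma p_mv: "complex_of_real (p n (mv x s)) = trig_sum D (g n x) s"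
  unfolding p_g g_mv trig_sum_def ..

lemma const_part_g: "norm (g n x 0 - complex_of_real (real n * c)) \<le> CU"
  unfolding g_def by (rule const_part)

lemma sn_le_q: "\<bar>sn n x\<bar> \<le> q n x + CU"
proof -
  have "complex_of_real (sn n x) = (g n x 0 - complex_of_real (real n * c)) + (\<Sum>m\<in>{- int D..int D} - {0}. g n x m)"
    using p_g[of n x] sum.remove[of "{- int D..int D}" 0 "g n x"] by (simp add: sn_def)
  then have "norm (complex_of_real (sn n x)) \<le> CU + q n x"
    unfolding q_def by (simp only:) (intro norm_triangle_le add_mono const_part_g norm_sum)
  then show ?thesis unfolding norm_of_real by linarith
qed

lemma Psi_measurable [measurable]: "\<Psi> \<in> borel_measurable (lam d)"
proof -
  have "\<Psi> = (\<lambda>x. Re (\<Sum>\<xi>\<in>F. cf \<xi> * chr d \<xi> x))" using Psi by (metis Re_complex_of_real)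
  then show ?thesis by (simp only:) measurable
qed

lemma csum_measurable [measurable]: "csum \<xi> n \<in> borel_measurable (lam d)"
proof -
  have "(\<lambda>x. chr d \<xi> ((T ^^ j) x)) \<in> borel_measurable (lam d)" for j
    by (rule measurable_compose[OF Tn_measurable chr_measurable])
  then show ?thesis unfolding csum_def[abs_def] by measurable
qed

lemma g_measurable [measurable]: "(\<lambda>x. g n x m) \<in> borel_measurable (lam d)"
  unfolding g_def by measurable

lemma q_measurable [measurable]: "q n \<in> borel_measurable (lam d)"
  unfolding q_def[abs_def] by measurable

lemma p_measurable [measurable]: "p n \<in> borel_measurable (lam d)"
proof -
  have "(\<lambda>x. \<Psi> ((T ^^ j) x)) \<in> borel_measurable (lam d)" for j
    by (rule measurable_compose[OF Tn_measurable Psi_measurable])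
  then show ?thesis unfolding birkhoff_sum_def[abs_def] by measurable
qed

lemma sn_measurable [measurable]: "sn n \<in> borel_measurable (lam d)"
  unfolding sn_def[abs_def] by measurable

lemma p_add: "p (n + m) x = p n x + p m ((T ^^ n) x)"
proof -
  have "{..<n + m} = {..<n} \<union> (\<lambda>i. i + n) ` {..<m}"
  proof safe
    fix i assume "i < n + m" "i \<notin> (\<lambda>i. i + n) ` {..<m}"
    then show "i < n" by (metis add.commute image_eqI le_add_diff_inverse2 lessThan_iff less_diff_conv2 not_less)
  qed auto
  then have "p (n + m) x = (\<Sum>i<n. \<Psi> ((T ^^ i) x)) + (\<Sum>i\<in>(\<lambda>i. i + n) ` {..<m}. \<Psi> ((T ^^ i) x))"
    unfolding birkhoff_sum_def by (simp only:) (subst sum.union_disjoint, auto)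
  also have "(\<Sum>i\<in>(\<lambda>i. i + n) ` {..<m}. \<Psi> ((T ^^ i) x)) = p m ((T ^^ n) x)"
    unfolding birkhoff_sum_def by (subst sum.reindex) (auto simp: funpow_add intro!: inj_onI)
  finally show ?thesis by (simp add: birkhoff_sum_def)
qed

lemma sn_add: "sn (n + m) x = sn n x + sn m ((T ^^ n) x)"
  unfolding sn_def p_add by (simp add: algebra_simps)

text \<open>Comparing the two ways of splitting the sum of length \<open>n + j\<close> trades the
  variation of a long sum over \<open>j\<close> steps for the variation over \<open>n\<close> steps
  of a sum of the fixed length \<open>j\<close>.\<close>

lemma sn_cocycle: "sn n ((T ^^ j) x) - sn n x = sn j ((T ^^ n) x) - sn j x"
  using sn_add[of n j x] sn_add[of j n x, unfolded add.commute[of j n]] by linarith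

section \<open>From failure of tightness to divergence in measure\<close>

lemma sn_bounded: "\<bar>sn n x\<bar> \<le> real n * ((\<Sum>\<xi>\<in>F. norm (cf \<xi>)) + \<bar>c\<bar>)"
proof -
  have "\<bar>\<Psi> y\<bar> \<le> (\<Sum>\<xi>\<in>F. norm (cf \<xi>))" for y
  proof -
    have "norm (complex_of_real (\<Psi> y)) \<le> (\<Sum>\<xi>\<in>F. norm (cf \<xi> * chr d \<xi> y))" unfolding Psi by (rule norm_sum)
    then show ?thesis by (simp add: norm_mult)
  qed
  then have "\<bar>p n x\<bar> \<le> (\<Sum>i<n. \<Sum>\<xi>\<in>F. norm (cf \<xi>))"
    unfolding birkhoff_sum_def by (intro order_trans[OF sum_abs] sum_mono)
  then have "\<bar>p n x\<bar> \<le> real n * (\<Sum>\<xi>\<in>F. norm (cf \<xi>))" by simp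
  moreover have "\<bar>real n * c\<bar> = real n * \<bar>c\<bar>" by (simp add: abs_mult)
  ultimately show ?thesis unfolding sn_def distrib_left by linarith
qed

text \<open>Otherwise the centred cocycle would be tight and \<Psi> a measurable coboundary up to
  its mean. The argument gives a single time, not all large ones.\<close>

lemma exists_good_time:
  assumes "K > 0" "\<eta> > 0"
  shows "\<exists>n. measure (lam d) {x \<in> cube d. \<bar>sn n x\<bar> \<le> K} < \<eta>"
proof (rule ccontr)
  assume "\<not> ?thesis"
  then have t: "\<eta> \<le> measure (lam d) {x \<in> cube d. \<bar>sn n x\<bar> \<le> K}" for n by (simp add: not_less)
  have bs: "birkhoff_sum T (\<lambda>x. \<Psi> x - c) n x = sn n x" for n x
    by (simp add: birkhoff_sum_def sn_def sum_subtractf)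
  interpret tc: tight_cocycle "lam d" T "\<lambda>x. \<Psi> x - c" K \<eta>
  proof (intro tight_cocycle.intro ergodic_cocycle.intro tight_cocycle_axioms.intro)
    show "\<eta> \<le> measure (lam d) {x \<in> space (lam d). \<bar>birkhoff_sum T (\<lambda>x. \<Psi> x - c) n x\<bar> \<le> K}" for n
      unfolding bs using t[of n] by simp
    show "(\<lambda>x. \<Psi> x - c) \<in> borel_measurable (lam d)" by measurable
  qed (rule prob_space_lam T_measurable T_invariant ergodic assms | assumption)+
  show False using tc.coboundary not_coh unfolding meas_coh_const_def cf0 by simp
qed

text \<open>The times are chosen one after another: the next one makes the sum large even after an
  error of \<open>S * B\<close>, which bounds the contribution of the first \<open>J a\<close> terms
  for each earlier time.\<close>

lemma good_differences:
  assumes "K > 0" "\<eta> > 0" "\<eta> < 1"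
  shows "\<exists>J::nat \<Rightarrow> nat. \<forall>b<L. \<forall>a<b. J a < J b \<and> measure (lam d) {x \<in> cube d. \<bar>sn (J b - J a) x\<bar> \<le> K} < \<eta>"
proof (induction L)
  case (Suc L)
  then obtain J where J: "\<And>a b. b < L \<Longrightarrow> a < b \<Longrightarrow> J a < J b \<and> measure (lam d) {x \<in> cube d. \<bar>sn (J b - J a) x\<bar> \<le> K} < \<eta>"
    by blast
  interpret prob_space "lam d" by simp
  define B where "B = (\<Sum>\<xi>\<in>F. norm (cf \<xi>)) + \<bar>c\<bar>"
  have B: "B \<ge> 0" unfolding B_def by (intro add_nonneg_nonneg sum_nonneg) auto
  define S where "S = (\<Sum>a<L. J a)"
  obtain n where n: "measure (lam d) {x \<in> cube d. \<bar>sn n x\<bar> \<le> K + real S * B} < \<eta>"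
    using exists_good_time[of "K + real S * B" \<eta>] assms B by (auto simp: add_pos_nonneg)
  \<comment> \<open>For times up to \<open>S\<close> the sum never exceeds \<open>S * B\<close>, so
    the set in question would be the whole space.\<close>
  have large: "n > S"
  proof (rule ccontr)
    assume "\<not> n > S"
    then have "\<bar>sn n x\<bar> \<le> K + real S * B" for x
    proof -
      have "real n * B \<le> real S * B" using \<open>\<not> n > S\<close> B by (intro mult_right_mono) auto
      then show ?thesis using sn_bounded[of n x] assms unfolding B_def[symmetric] by linarith
    qed
    then have "{x \<in> cube d. \<bar>sn n x\<bar> \<le> K + real S * B} = space (lam d)" by auto
    then show False using n assms prob_space by simp
  qed
  have good: "J a < n \<and> measure (lam d) {x \<in> cube d. \<bar>sn (n - J a) x\<bar> \<le> K} < \<eta>" if "a < L" for a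
  proof
    have le: "J a \<le> S" unfolding S_def using that by (intro member_le_sum) auto
    then show lt: "J a < n" using large by simp
    let ?E = "{x \<in> cube d. \<bar>sn (n - J a) x\<bar> \<le> K}"
    have E [measurable]: "?E \<in> sets (lam d)" by (simp only: space_lam[symmetric]) measurable
    have "measure (lam d) ?E = measure (lam d) {x \<in> cube d. (T ^^ J a) x \<in> ?E}" by (rule measure_Tn[OF E, symmetric])
    also have "\<dots> \<le> measure (lam d) {x \<in> cube d. \<bar>sn n x\<bar> \<le> K + real S * B}"
    proof (rule finite_measure_mono)
      show "{x \<in> cube d. (T ^^ J a) x \<in> ?E} \<subseteq> {x \<in> cube d. \<bar>sn n x\<bar> \<le> K + real S * B}"
      proof safe
        fix x assume "\<bar>sn (n - J a) ((T ^^ J a) x)\<bar> \<le> K"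
        moreover have "sn n x = sn (J a) x + sn (n - J a) ((T ^^ J a) x)" using sn_add[of "J a" "n - J a" x] lt by simp
        moreover have "real (J a) * B \<le> real S * B" using le B by (intro mult_right_mono) auto
        ultimately show "\<bar>sn n x\<bar> \<le> K + real S * B" using sn_bounded[of "J a" x] unfolding B_def[symmetric] by linarith
      qed
      show "{x \<in> cube d. \<bar>sn n x\<bar> \<le> K + real S * B} \<in> sets (lam d)" by (simp only: space_lam[symmetric]) measurable
    qed
    finally show "measure (lam d) ?E < \<eta>" using n by simp
  qed
  show ?case
    by (rule exI[of _ "J(L := n)"]) (use J good in \<open>auto simp: less_Suc_eq\<close>)
qed simp

text \<open>Translating by \<open>s * sh n\<close> in the coordinate \<open>i0\<close> hardly moves \<open>x\<close> but moves \<open>T\<^sup>n x\<close> by about \<open>s\<close>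
  in the last coordinate, so \<open>T\<^sup>n x\<close> decouples from \<open>x\<close> in that direction.\<close>

lemma translation_limit:
  assumes "e > 0"
  shows "\<exists>n0. \<forall>n\<ge>n0. \<forall>x. \<forall>s\<in>{0..<1}.
     \<bar>sn j ((T ^^ n) (shift d i0 (s * sh n) x)) - sn j (mv ((T ^^ n) x) s)\<bar> \<le> e \<and> \<bar>sn j (shift d i0 (s * sh n) x) - sn j x\<bar> \<le> e"
proof -
  \<comment> \<open>\<open>A1\<close> and \<open>A2\<close> bound the two errors uniformly in
    \<open>x\<close> and \<open>s\<close>; the first tends to zero because \<open>act ^^ l\<close>
    leaves the last frequency unchanged.\<close>
  define A1 where "A1 n = (\<Sum>\<xi>\<in>F. norm (cf \<xi>) * (\<Sum>l<j. 2 * pi * \<bar>sh n * real_of_int ((act ^^ n) ((act ^^ l) \<xi>) i0) - real_of_int (\<xi> (d - 1))\<bar>))" for n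
  define A2 where "A2 n = (\<Sum>\<xi>\<in>F. norm (cf \<xi>) * (\<Sum>l<j. 2 * pi * \<bar>real_of_int ((act ^^ l) \<xi> i0) * sh n\<bar>))" for n
  have "A1 \<longlonglongrightarrow> (\<Sum>\<xi>\<in>F. norm (cf \<xi>) * (\<Sum>l<j. 2 * pi * \<bar>real_of_int (\<xi> (d - 1)) - real_of_int (\<xi> (d - 1))\<bar>))"
    unfolding A1_def
  proof (intro tendsto_sum tendsto_mult tendsto_rabs tendsto_diff tendsto_const)
    fix \<xi> l assume "\<xi> \<in> F" "l \<in> {..<j}"
    have "(\<lambda>n. sh n * real_of_int ((act ^^ n) ((act ^^ l) \<xi>) i0)) \<longlonglongrightarrow> real_of_int ((act ^^ l) \<xi> (d - 1))"
      by (rule sh_last) (use act_pow_supp suppF \<open>\<xi> \<in> F\<close> in auto)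
    then show "(\<lambda>n. sh n * real_of_int ((act ^^ n) ((act ^^ l) \<xi>) i0)) \<longlonglongrightarrow> real_of_int (\<xi> (d - 1))" by (simp only: act_pow_last)
  qed
  then have A1: "A1 \<longlonglongrightarrow> 0" by simp
  have "A2 \<longlonglongrightarrow> (\<Sum>\<xi>\<in>F. norm (cf \<xi>) * (\<Sum>l<j. 2 * pi * \<bar>real_of_int ((act ^^ l) \<xi> i0) * 0\<bar>))"
    unfolding A2_def by (intro tendsto_sum tendsto_mult tendsto_rabs tendsto_const sh)
  then have A2: "A2 \<longlonglongrightarrow> 0" by simp
  have sn_diff: "\<bar>sn j y - sn j y'\<bar> \<le> (\<Sum>\<xi>\<in>F. norm (cf \<xi>) * (\<Sum>l<j. norm (chr d \<xi> ((T ^^ l) y) - chr d \<xi> ((T ^^ l) y'))))" for y y'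
  proof -
    have "complex_of_real (sn j y - sn j y') = (\<Sum>\<xi>\<in>F. cf \<xi> * (csum \<xi> j y - csum \<xi> j y'))"
      by (simp add: sn_def p_eq right_diff_distrib sum_subtractf)
    then have "\<bar>sn j y - sn j y'\<bar> = norm (\<Sum>\<xi>\<in>F. cf \<xi> * (csum \<xi> j y - csum \<xi> j y'))" by (metis norm_of_real)
    also have "\<dots> \<le> (\<Sum>\<xi>\<in>F. norm (cf \<xi>) * norm (csum \<xi> j y - csum \<xi> j y'))"
      by (rule order_trans[OF norm_sum]) (simp add: norm_mult)
    also have "\<dots> \<le> (\<Sum>\<xi>\<in>F. norm (cf \<xi>) * (\<Sum>l<j. norm (chr d \<xi> ((T ^^ l) y) - chr d \<xi> ((T ^^ l) y'))))"
      by (intro sum_mono mult_left_mono) (auto simp: csum_def sum_subtractf[symmetric] intro: norm_sum)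
    finally show ?thesis .
  qed
  have chr_sh: "chr d \<xi> ((T ^^ l) (shift d i0 v x)) = chr d \<xi> ((T ^^ l) x) * cis (2 * pi * (real_of_int ((act ^^ l) \<xi> i0) * v))" for \<xi> l v x
  proof -
    obtain w where "\<And>x. chr d \<xi> ((T ^^ l) x) = chr d ((act ^^ l) \<xi>) x * w" using chr_Tn by blast
    then show ?thesis by (simp add: chr_shift[OF i0] chr_upd[OF i0] mult.assoc mult.commute mult.left_commute)
  qed
  have b1: "\<bar>sn j ((T ^^ n) (shift d i0 (s * sh n) x)) - sn j (mv ((T ^^ n) x) s)\<bar> \<le> A1 n" if s: "s \<in> {0..<1}" for n x s
  proof (rule order_trans[OF sn_diff], unfold A1_def, intro sum_mono mult_left_mono)
    fix \<xi> l assume "\<xi> \<in> F" "l \<in> {..<j}"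
    have e1: "chr d \<xi> ((T ^^ l) ((T ^^ n) (shift d i0 (s * sh n) x))) = chr d \<xi> ((T ^^ (l + n)) x) * cis (2 * pi * (real_of_int ((act ^^ n) ((act ^^ l) \<xi>) i0) * (s * sh n)))"
    proof -
      have "(act ^^ (l + n)) \<xi> = (act ^^ n) ((act ^^ l) \<xi>)" by (metis add.commute comp_apply funpow_add)
      then show ?thesis using chr_sh[of \<xi> "l + n" "s * sh n" x] by (simp add: funpow_add[of l n T])
    qed
    have e2: "chr d \<xi> ((T ^^ l) (mv ((T ^^ n) x) s)) = chr d \<xi> ((T ^^ (l + n)) x) * cis (2 * pi * (real_of_int (\<xi> (d - 1)) * s))"
      by (simp add: chr_Tn_mv funpow_add)
    have "norm (chr d \<xi> ((T ^^ l) ((T ^^ n) (shift d i0 (s * sh n) x))) - chr d \<xi> ((T ^^ l) (mv ((T ^^ n) x) s))) \<le>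
      \<bar>2 * pi * (real_of_int ((act ^^ n) ((act ^^ l) \<xi>) i0) * (s * sh n)) - 2 * pi * (real_of_int (\<xi> (d - 1)) * s)\<bar>"
      unfolding e1 e2 right_diff_distrib[symmetric, of "chr d \<xi> ((T ^^ (l + n)) x)"] norm_mult norm_chr mult_1
      by (rule norm_cis_diff_le)
    also have "\<dots> = s * (2 * pi * \<bar>sh n * real_of_int ((act ^^ n) ((act ^^ l) \<xi>) i0) - real_of_int (\<xi> (d - 1))\<bar>)"
    proof -
      have "2 * pi * (real_of_int ((act ^^ n) ((act ^^ l) \<xi>) i0) * (s * sh n)) - 2 * pi * (real_of_int (\<xi> (d - 1)) * s) =
        (s * (2 * pi)) * (sh n * real_of_int ((act ^^ n) ((act ^^ l) \<xi>) i0) - real_of_int (\<xi> (d - 1)))" by (simp add: algebra_simps)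
      moreover have "\<bar>(s * (2 * pi)) * X\<bar> = s * (2 * pi * \<bar>X\<bar>)" for X using s by (simp add: abs_mult)
      ultimately show ?thesis by (simp only:)
    qed
    also have "\<dots> \<le> 2 * pi * \<bar>sh n * real_of_int ((act ^^ n) ((act ^^ l) \<xi>) i0) - real_of_int (\<xi> (d - 1))\<bar>"
      using s by (intro mult_left_le_one_le) auto
    finally show "norm (chr d \<xi> ((T ^^ l) ((T ^^ n) (shift d i0 (s * sh n) x))) - chr d \<xi> ((T ^^ l) (mv ((T ^^ n) x) s))) \<le>
      2 * pi * \<bar>sh n * real_of_int ((act ^^ n) ((act ^^ l) \<xi>) i0) - real_of_int (\<xi> (d - 1))\<bar>" .
  qed auto
  have b2: "\<bar>sn j (shift d i0 (s * sh n) x) - sn j x\<bar> \<le> A2 n" if s: "s \<in> {0..<1}" for n x s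
  proof (rule order_trans[OF sn_diff], unfold A2_def, intro sum_mono mult_left_mono)
    fix \<xi> l assume "\<xi> \<in> F" "l \<in> {..<j}"
    have "chr d \<xi> ((T ^^ l) (shift d i0 (s * sh n) x)) - chr d \<xi> ((T ^^ l) x) =
      chr d \<xi> ((T ^^ l) x) * (cis (2 * pi * (real_of_int ((act ^^ l) \<xi> i0) * (s * sh n))) - cis 0)"
      unfolding chr_sh by (simp add: algebra_simps)
    then have "norm (chr d \<xi> ((T ^^ l) (shift d i0 (s * sh n) x)) - chr d \<xi> ((T ^^ l) x)) \<le> \<bar>2 * pi * (real_of_int ((act ^^ l) \<xi> i0) * (s * sh n))\<bar>"
      using norm_cis_diff_le[of "2 * pi * (real_of_int ((act ^^ l) \<xi> i0) * (s * sh n))" 0] by (simp add: norm_mult)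
    also have "\<dots> = s * (2 * pi * \<bar>real_of_int ((act ^^ l) \<xi> i0) * sh n\<bar>)" using s by (simp add: abs_mult)
    also have "\<dots> \<le> 2 * pi * \<bar>real_of_int ((act ^^ l) \<xi> i0) * sh n\<bar>" using s by (intro mult_left_le_one_le) auto
    finally show "norm (chr d \<xi> ((T ^^ l) (shift d i0 (s * sh n) x)) - chr d \<xi> ((T ^^ l) x)) \<le> 2 * pi * \<bar>real_of_int ((act ^^ l) \<xi> i0) * sh n\<bar>" .
  qed auto
  have "eventually (\<lambda>n. A1 n < e \<and> A2 n < e) sequentially"
    using A1 A2 assms by (intro eventually_conj order_tendstoD) auto
  then obtain n0 where "\<And>n. n \<ge> n0 \<Longrightarrow> A1 n < e \<and> A2 n < e" unfolding eventually_sequentially by blast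
  then show ?thesis using b1 b2 by (intro exI[of _ n0]) (meson less_imp_le order_trans)
qed

end

context trig_suspension
begin

text \<open>Lebesgue measure is invariant under the translations by \<open>s * sh n\<close>, which
  allows averaging over \<open>s\<close>. Up to the translation errors, the difference becomes a
  trigonometric polynomial in \<open>s\<close> whose constant term is \<open>- sn j x\<close> up to
  \<open>CU\<close>; where \<open>\<bar>sn j x\<bar>\<close> exceeds \<open>K\<close>, it is small
  only for a set of \<open>s\<close> of measure below \<beta>.\<close>

lemma decoupling:
  assumes C: "C > 0" and \<beta>: "\<beta> > 0"
  obtains K where "K > 0"
    "\<And>j. \<exists>n0. \<forall>n\<ge>n0. measure (lam d) {x \<in> cube d. \<bar>sn j ((T ^^ n) x) - sn j x\<bar> \<le> C} \<le>
       measure (lam d) {x \<in> cube d. \<bar>sn j x\<bar> \<le> K} + \<beta>"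
proof -
  obtain Cs where Cs: "Cs > 0" "\<And>g \<delta> k. \<delta> \<ge> 0 \<Longrightarrow> k \<in> {- int D..int D} \<Longrightarrow> norm (g k) > Cs * \<delta> \<Longrightarrow>
       measure lborel {s \<in> {0..<1}. norm (trig_sum D g s) \<le> \<delta>} < \<beta>"
    by (rule sublevel_estimate[OF \<beta>, of D]) (rule that, assumption+)
  \<comment> \<open>\<open>C + 2\<close> allows for two translation errors of size 1,
    \<open>Cs\<close> is the constant of the sublevel estimate, and \<open>CU\<close> bounds the
    constant Fourier coefficient of the centred sum.\<close>
  define K where "K = CU + Cs * (C + 2)"
  have K: "K > 0" unfolding K_def using CU Cs C by (intro add_nonneg_pos mult_pos_pos) auto
  show ?thesis
  proof (rule that[OF K])
    fix j
    interpret L: prob_space "lam d" by simp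
    let ?U = "restrict_space lborel {0..<1::real}"
    interpret U: prob_space ?U by (rule prob_space_unit)
    interpret PU: pair_prob_space ?U "lam d" ..
    obtain n0 where n0: "\<And>n x s. n \<ge> n0 \<Longrightarrow> s \<in> {0..<1} \<Longrightarrow> \<bar>sn j ((T ^^ n) (shift d i0 (s * sh n) x)) - sn j (mv ((T ^^ n) x) s)\<bar> \<le> 1"
      "\<And>n x s. n \<ge> n0 \<Longrightarrow> s \<in> {0..<1} \<Longrightarrow> \<bar>sn j (shift d i0 (s * sh n) x) - sn j x\<bar> \<le> 1"
      using translation_limit[of 1 j] by (auto simp: Ball_def)
    have "measure (lam d) {x \<in> cube d. \<bar>sn j ((T ^^ n) x) - sn j x\<bar> \<le> C} \<le> measure (lam d) {x \<in> cube d. \<bar>sn j x\<bar> \<le> K} + \<beta>"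
      if n: "n \<ge> n0" for n
    proof -
      let ?A = "{x \<in> cube d. \<bar>sn j ((T ^^ n) x) - sn j x\<bar> \<le> C}"
      \<comment> \<open>Coefficients in \<open>s\<close> of the translated difference; the centring
        and the value at \<open>x\<close> affect frequency zero only.\<close>
      define G where "G x m = g j ((T ^^ n) x) m - (if m = 0 then complex_of_real (real j * c + sn j x) else 0)" for x m
      have G: "trig_sum D (G x) s = complex_of_real (sn j (mv ((T ^^ n) x) s) - sn j x)" for x s
      proof -
        have "trig_sum D (G x) s = trig_sum D (g j ((T ^^ n) x)) s - (\<Sum>m\<in>{- int D..int D}. if m = 0 then complex_of_real (real j * c + sn j x) else 0)"
          unfolding trig_sum_def G_def sum_subtractf[symmetric] by (rule sum.cong) (auto simp: algebra_simps)
        then show ?thesis unfolding p_mv[symmetric] by (simp add: sn_def)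
      qed
      have snT [measurable]: "(\<lambda>x. sn j ((T ^^ n) x)) \<in> borel_measurable (lam d)"
        by (rule measurable_compose[OF Tn_measurable sn_measurable])
      have gT [measurable]: "(\<lambda>x. g j ((T ^^ n) x) m) \<in> borel_measurable (lam d)" for m
        by (rule measurable_compose[OF Tn_measurable g_measurable])
      have A [measurable]: "?A \<in> sets (lam d)" by (simp only: space_lam[symmetric]) measurable
      have Gm [measurable]: "(\<lambda>x. G x m) \<in> borel_measurable (lam d)" for m
        unfolding G_def by measurable
      let ?B = "{z \<in> space (?U \<Otimes>\<^sub>M lam d). norm (trig_sum D (G (snd z)) (fst z)) \<le> C + 2}"
      have fstm [measurable]: "fst \<in> borel_measurable (?U \<Otimes>\<^sub>M lam d)"
        by (rule measurable_compose[OF measurable_fst]) (simp add: measurable_restrict_space1)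
      have B [measurable]: "?B \<in> sets (?U \<Otimes>\<^sub>M lam d)"
        unfolding trig_sum_def by measurable
      have "ennreal (measure (lam d) ?A) \<le> emeasure (lam d) (Pair s -` ?B)" if s: "s \<in> space ?U" for s
      proof -
        have s01: "s \<in> {0..<1}" using s by (simp add: space_restrict_space)
        have "measure (lam d) ?A = measure (lam d) {x \<in> cube d. shift d i0 (s * sh n) x \<in> ?A}"
          by (rule measure_shift[OF i0 A, symmetric])
        also have "\<dots> \<le> measure (lam d) (Pair s -` ?B)"
        proof (rule L.finite_measure_mono)
          show "Pair s -` ?B \<in> sets (lam d)" using B by (rule sets_Pair1)
          show "{x \<in> cube d. shift d i0 (s * sh n) x \<in> ?A} \<subseteq> Pair s -` ?B"
          proof (rule subsetI)
            fix x assume "x \<in> {x \<in> cube d. shift d i0 (s * sh n) x \<in> ?A}"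
            then have x: "x \<in> cube d" and le: "\<bar>sn j ((T ^^ n) (shift d i0 (s * sh n) x)) - sn j (shift d i0 (s * sh n) x)\<bar> \<le> C" by auto
            have "\<bar>sn j (mv ((T ^^ n) x) s) - sn j x\<bar> \<le> C + 2" using le n0(1)[OF n s01, of x] n0(2)[OF n s01, of x] by linarith
            then show "x \<in> Pair s -` ?B" using x s by (simp add: G space_pair_measure norm_of_real del: of_real_diff)
          qed
        qed
        finally show ?thesis by (simp add: L.emeasure_eq_measure)
      qed
      then have "(\<integral>\<^sup>+s. ennreal (measure (lam d) ?A) \<partial>?U) \<le> (\<integral>\<^sup>+s. emeasure (lam d) (Pair s -` ?B) \<partial>?U)"
        by (rule nn_integral_mono)
      also have "\<dots> = emeasure (?U \<Otimes>\<^sub>M lam d) ?B" by (rule L.emeasure_pair_measure_alt[OF B, symmetric])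
      also have "\<dots> = (\<integral>\<^sup>+x. emeasure ?U ((\<lambda>s. (s, x)) -` ?B) \<partial>lam d)" by (rule PU.emeasure_pair_measure_alt2[OF B])
      also have "\<dots> \<le> (\<integral>\<^sup>+x. indicator {x \<in> cube d. \<bar>sn j x\<bar> \<le> K} x + ennreal \<beta> \<partial>lam d)"
      proof (rule nn_integral_mono)
        fix x assume x: "x \<in> space (lam d)"
        show "emeasure ?U ((\<lambda>s. (s, x)) -` ?B) \<le> indicator {x \<in> cube d. \<bar>sn j x\<bar> \<le> K} x + ennreal \<beta>"
        proof (cases "\<bar>sn j x\<bar> \<le> K")
          case True
          have "emeasure ?U ((\<lambda>s. (s, x)) -` ?B) \<le> 1" by (rule U.emeasure_le_1)
          also have "\<dots> \<le> indicator {x \<in> cube d. \<bar>sn j x\<bar> \<le> K} x + ennreal \<beta>" using True x by simp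
          finally show ?thesis .
        next
          case False
          have "norm (G x 0) > Cs * (C + 2)"
          proof -
            have "complex_of_real (sn j x) = (g j ((T ^^ n) x) 0 - complex_of_real (real j * c)) - G x 0" by (simp add: G_def)
            then have "\<bar>sn j x\<bar> \<le> CU + norm (G x 0)"
              by (metis norm_of_real norm_triangle_le_diff add_right_mono const_part_g)
            then show ?thesis using False unfolding K_def by linarith
          qed
          then have "measure lborel {s \<in> {0..<1}. norm (trig_sum D (G x) s) \<le> C + 2} < \<beta>"
            using Cs(2)[of "C + 2" 0 "G x"] C by auto
          moreover have "(\<lambda>s. (s, x)) -` ?B = {s \<in> {0..<1}. norm (trig_sum D (G x) s) \<le> C + 2}"
            using x by (auto simp: space_pair_measure space_restrict_space)
          moreover have "emeasure ?U {s \<in> {0..<1}. norm (trig_sum D (G x) s) \<le> C + 2} = ennreal (measure lborel {s \<in> {0..<1}. norm (trig_sum D (G x) s) \<le> C + 2})"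
          proof -
            let ?Z = "{s \<in> {0..<1}. norm (trig_sum D (G x) s) \<le> C + 2}"
            have 1: "emeasure ?U ?Z = emeasure lborel ?Z"
              by (rule emeasure_restrict_space) auto
            have "emeasure lborel ?Z \<le> emeasure lborel {0..<1::real}"
              by (rule emeasure_mono) auto
            also have "\<dots> < \<infinity>" by simp
            finally have "emeasure lborel ?Z \<noteq> \<infinity>" by simp
            then show ?thesis unfolding 1 by (intro emeasure_eq_ennreal_measure) simp
          qed
          ultimately show ?thesis by (simp add: add_increasing less_imp_le ennreal_leI)
        qed
      qed
      also have "\<dots> = emeasure (lam d) {x \<in> cube d. \<bar>sn j x\<bar> \<le> K} + ennreal \<beta>"
      proof -
        have "{x \<in> cube d. \<bar>sn j x\<bar> \<le> K} \<in> sets (lam d)" by (simp only: space_lam[symmetric]) measurable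
        then show ?thesis using L.emeasure_space_1 by (subst nn_integral_add) auto
      qed
      also have "\<dots> = ennreal (measure (lam d) {x \<in> cube d. \<bar>sn j x\<bar> \<le> K} + \<beta>)"
        using \<beta> by (simp add: L.emeasure_eq_measure)
      finally have "ennreal (measure (lam d) ?A) \<le> ennreal (measure (lam d) {x \<in> cube d. \<bar>sn j x\<bar> \<le> K} + \<beta>)"
        using U.emeasure_space_1 by (simp del: ennreal_plus)
      then show ?thesis using \<beta> by (subst (asm) ennreal_le_iff) (auto intro: add_nonneg_nonneg)
    qed
    then show "\<exists>n0. \<forall>n\<ge>n0. measure (lam d) {x \<in> cube d. \<bar>sn j ((T ^^ n) x) - sn j x\<bar> \<le> C} \<le>
       measure (lam d) {x \<in> cube d. \<bar>sn j x\<bar> \<le> K} + \<beta>" by blast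
  qed
qed

end

context trig_suspension
begin

text \<open>A set \<open>E\<close> of measure \<open>e\<close> has many preimages under the times \<open>J a\<close>; if all of them overlapped only in
  small sets, the second moment of their overlap count would be smaller than the square of the first.\<close>

lemma sn_spreads:
  assumes C: "C > 0" and e: "e > 0"
  shows "\<exists>n1. \<forall>n\<ge>n1. measure (lam d) {x \<in> cube d. \<bar>sn n x\<bar> \<le> C} < e"
proof -
  interpret L: prob_space "lam d" by simp
  \<comment> \<open>\<open>2 * \<beta>\<close> and \<open>1 / N\<close> each use up at most a third
    of \<open>e\<^sup>2\<close>, which leaves room for a contradiction; the bound 1/2 keeps \<beta>
    below 1, as \<open>good_differences\<close> requires.\<close>
  define \<beta> where "\<beta> = min (1/2) (e\<^sup>2 / 6)"
  have b: "\<beta> > 0" "\<beta> < 1" "2 * \<beta> \<le> e\<^sup>2 / 3" using e by (auto simp: \<beta>_def min_def)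
  obtain N :: nat where N: "N \<ge> 1" "1 / real N < e\<^sup>2 / 3"
  proof -
    have "e\<^sup>2 / 3 > 0" using e by simp
    then obtain m where "1 / real (Suc m) < e\<^sup>2 / 3" using nat_approx_posE by blast
    then show ?thesis by (intro that[of "Suc m"]) auto
  qed
  have C2: "2 * C > 0" using C by simp
  obtain K where K: "K > 0" and dec: "\<And>j. \<exists>n0. \<forall>n\<ge>n0. measure (lam d) {x \<in> cube d. \<bar>sn j ((T ^^ n) x) - sn j x\<bar> \<le> 2 * C} \<le>
       measure (lam d) {x \<in> cube d. \<bar>sn j x\<bar> \<le> K} + \<beta>"
    by (rule decoupling[OF C2 b(1)]) (rule that, assumption+)
  obtain J :: "nat \<Rightarrow> nat" where J: "\<And>a b. b < N \<Longrightarrow> a < b \<Longrightarrow> J a < J b"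
      "\<And>a b. b < N \<Longrightarrow> a < b \<Longrightarrow> measure (lam d) {x \<in> cube d. \<bar>sn (J b - J a) x\<bar> \<le> K} < \<beta>"
    using good_differences[OF K b(1,2), of N] by blast
  have "\<exists>n0. \<forall>j. \<forall>n\<ge>n0 j. measure (lam d) {x \<in> cube d. \<bar>sn j ((T ^^ n) x) - sn j x\<bar> \<le> 2 * C} \<le>
       measure (lam d) {x \<in> cube d. \<bar>sn j x\<bar> \<le> K} + \<beta>"
    using dec by (intro choice allI)
  then obtain n0 where n0: "\<And>j n. n \<ge> n0 j \<Longrightarrow> measure (lam d) {x \<in> cube d. \<bar>sn j ((T ^^ n) x) - sn j x\<bar> \<le> 2 * C} \<le>
       measure (lam d) {x \<in> cube d. \<bar>sn j x\<bar> \<le> K} + \<beta>"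
    by blast
  \<comment> \<open>The sum dominates each of the finitely many thresholds that occur for pairs of
    times.\<close>
  define n1 where "n1 = (\<Sum>b<N. \<Sum>a<b. n0 (J b - J a))"
  have n1: "n0 (J b - J a) \<le> n1" if "b < N" "a < b" for a b
  proof -
    have "n0 (J b - J a) \<le> (\<Sum>a<b. n0 (J b - J a))" using that by (intro member_le_sum) auto
    also have "\<dots> \<le> n1" unfolding n1_def using that by (intro member_le_sum) auto
    finally show ?thesis .
  qed
  have "measure (lam d) {x \<in> cube d. \<bar>sn n x\<bar> \<le> C} < e" if n: "n \<ge> n1" for n
  proof (rule ccontr)
    let ?E = "{x \<in> cube d. \<bar>sn n x\<bar> \<le> C}"
    assume "\<not> measure (lam d) ?E < e"
    then have Ee: "e \<le> measure (lam d) ?E" by simp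
    have E [measurable]: "?E \<in> sets (lam d)" by (simp only: space_lam[symmetric]) measurable
    define P where "P a = {x \<in> cube d. (T ^^ J a) x \<in> ?E}" for a
    have Psets [measurable]: "P a \<in> sets (lam d)" for a
    proof -
      have "P a = (T ^^ J a) -` ?E \<inter> space (lam d)" by (auto simp: P_def)
      then show ?thesis using measurable_sets[OF Tn_measurable E] by simp
    qed
    have mP: "measure (lam d) (P a) = measure (lam d) ?E" for a
      unfolding P_def by (rule measure_Tn[OF E])
    have snT [measurable]: "(\<lambda>x. sn j ((T ^^ n) x)) \<in> borel_measurable (lam d)" for j n
      by (rule measurable_compose[OF Tn_measurable sn_measurable])
    have pair: "measure (lam d) (P a \<inter> P b') \<le> 2 * \<beta>" if ab: "a < b'" "b' < N" for a b'
    proof -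
      let ?j = "J b' - J a"
      have Jab: "J a < J b'" using J(1) ab by blast
      let ?Q = "{x \<in> cube d. \<bar>sn ?j ((T ^^ n) x) - sn ?j x\<bar> \<le> 2 * C}"
      have Q [measurable]: "?Q \<in> sets (lam d)" by (simp only: space_lam[symmetric]) measurable
      have QT: "{x \<in> cube d. (T ^^ J a) x \<in> ?Q} \<in> sets (lam d)"
      proof -
        have "{x \<in> cube d. (T ^^ J a) x \<in> ?Q} = (T ^^ J a) -` ?Q \<inter> space (lam d)" by auto
        then show ?thesis using measurable_sets[OF Tn_measurable Q] by simp
      qed
      have "P a \<inter> P b' \<subseteq> {x \<in> cube d. (T ^^ J a) x \<in> ?Q}"
      proof
        fix x assume x: "x \<in> P a \<inter> P b'"
        let ?y = "(T ^^ J a) x"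
        have "(T ^^ J b') x = (T ^^ ?j) ?y" using Jab funpow_add[of ?j "J a" T] by simp
        then have "\<bar>sn n ?y\<bar> \<le> C" "\<bar>sn n ((T ^^ ?j) ?y)\<bar> \<le> C" using x by (auto simp: P_def)
        then have "\<bar>sn n ((T ^^ ?j) ?y) - sn n ?y\<bar> \<le> 2 * C" by linarith
        \<comment> \<open>The cocycle identity replaces sums of length \<open>n\<close> by sums of
          the fixed length \<open>?j\<close>, to which decoupling applies.\<close>
        then have "\<bar>sn ?j ((T ^^ n) ?y) - sn ?j ?y\<bar> \<le> 2 * C" unfolding sn_cocycle .
        moreover have "x \<in> cube d" "?y \<in> cube d" using x by (auto simp: P_def)
        ultimately show "x \<in> {x \<in> cube d. (T ^^ J a) x \<in> ?Q}" by simp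
      qed
      then have "measure (lam d) (P a \<inter> P b') \<le> measure (lam d) {x \<in> cube d. (T ^^ J a) x \<in> ?Q}"
        by (rule L.finite_measure_mono[OF _ QT])
      also have "\<dots> = measure (lam d) ?Q" by (rule measure_Tn[OF Q])
      also have "\<dots> \<le> measure (lam d) {x \<in> cube d. \<bar>sn ?j x\<bar> \<le> K} + \<beta>"
        by (rule n0) (use n1[OF ab(2,1)] n in simp)
      also have "\<dots> \<le> 2 * \<beta>" using J(2)[OF ab(2,1)] by simp
      finally show ?thesis .
    qed
    have all: "measure (lam d) (P a \<inter> P b') \<le> (if a = b' then 1 else 0) + 2 * \<beta>" if ab: "a < N" "b' < N" for a b'
    proof -
      consider "a = b'" | "a < b'" | "b' < a" by linarith
      then show ?thesis
      proof cases
        case 1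
        have "measure (lam d) (P a \<inter> P b') \<le> 1" by (rule L.prob_le_1)
        moreover have "(if a = b' then 1 else 0) = (1::real)" using 1 by simp
        ultimately show ?thesis using b(1) by linarith
      next
        case 2 then show ?thesis using pair[OF 2 ab(2)] by simp
      next
        case 3 then show ?thesis using pair[OF 3 ab(1)] by (simp add: Int_commute)
      qed
    qed
    \<comment> \<open>Counts the preimages containing \<open>x\<close>. Its mean is \<open>N\<close>
      times the measure of \<open>?E\<close>, its second moment the sum of all pair
      overlaps.\<close>
    define X where "X x = (\<Sum>a<N. indicator (P a) x :: real)" for x
    have int1: "integrable (lam d) (indicator A :: _ \<Rightarrow> real)" if "A \<in> sets (lam d)" for A
      using that by (simp add: less_top[symmetric])
    have EX: "(\<integral>x. X x \<partial>lam d) = real N * measure (lam d) ?E"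
      unfolding X_def using int1[OF Psets] sets.sets_into_space[OF Psets] by (simp add: mP Int_absorb2)
    have X2: "(X x)\<^sup>2 = (\<Sum>a<N. \<Sum>b'<N. indicator (P a \<inter> P b') x)" for x
      by (simp add: X_def power2_eq_square sum_product indicator_inter_arith)
    have int2: "integrable (lam d) (\<lambda>x. (X x)\<^sup>2)"
      unfolding X2 by (intro Bochner_Integration.integrable_sum int1) measurable
    have "(\<integral>x. (X x)\<^sup>2 \<partial>lam d) = (\<Sum>a<N. \<Sum>b'<N. measure (lam d) (P a \<inter> P b'))"
    proof -
      have "(P a \<inter> P b') \<inter> cube d = P a \<inter> P b'" for a b' by (auto simp: P_def)
      then show ?thesis unfolding X2 using int1 by simp
    qed
    also have "\<dots> \<le> (\<Sum>a<N. \<Sum>b'<N. (if a = b' then 1 else 0) + 2 * \<beta>)"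
      by (intro sum_mono all) auto
    also have "\<dots> = real N + real N ^ 2 * (2 * \<beta>)"
      by (simp add: sum.distrib power2_eq_square algebra_simps)
    finally have EX2: "(\<integral>x. (X x)\<^sup>2 \<partial>lam d) \<le> real N + real N ^ 2 * (2 * \<beta>)" .
    define mu where "mu = real N * measure (lam d) ?E"
    have intX: "integrable (lam d) X" unfolding X_def using int1[OF Psets] by simp
    have "0 \<le> (\<integral>x. (X x - mu)\<^sup>2 \<partial>lam d)" by simp
    also have "(\<integral>x. (X x - mu)\<^sup>2 \<partial>lam d) = (\<integral>x. (X x)\<^sup>2 - 2 * mu * X x + mu\<^sup>2 \<partial>lam d)"
      by (simp add: power2_diff algebra_simps)
    also have "\<dots> = (\<integral>x. (X x)\<^sup>2 \<partial>lam d) - mu\<^sup>2"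
      using int2 intX EX L.prob_space unfolding mu_def[symmetric] by (simp add: power2_eq_square)
    finally have "mu\<^sup>2 \<le> real N + real N ^ 2 * (2 * \<beta>)" using EX2 by linarith
    moreover have "(real N * e)\<^sup>2 \<le> mu\<^sup>2" unfolding mu_def using Ee e by (intro power_mono mult_left_mono) auto
    ultimately have "real N ^ 2 * e\<^sup>2 \<le> real N + real N ^ 2 * (2 * \<beta>)" by (simp add: power_mult_distrib)
    also have "\<dots> = real N ^ 2 * (1 / real N + 2 * \<beta>)" using N(1) by (simp add: field_simps power2_eq_square)
    finally have "e\<^sup>2 \<le> 1 / real N + 2 * \<beta>" using N(1) by simp
    then show False using N(2) b(3) e zero_less_power2[of e] by linarith
  qed
  then show ?thesis by blast
qed

text \<open>The centred sum is bounded by \<open>q\<close> up to \<open>CU\<close>, so a small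
  \<open>q\<close> forces a small centred sum.\<close>

lemma q_spreads:
  assumes "e > 0"
  shows "\<exists>n1. \<forall>n\<ge>n1. measure (lam d) {x \<in> cube d. q n x \<le> C} < e"
proof -
  interpret L: prob_space "lam d" by simp
  have pos: "\<bar>C\<bar> + CU + 1 > 0" using CU by linarith
  obtain n1 where n1: "\<And>n. n \<ge> n1 \<Longrightarrow> measure (lam d) {x \<in> cube d. \<bar>sn n x\<bar> \<le> \<bar>C\<bar> + CU + 1} < e"
    using sn_spreads[OF pos assms] by blast
  have "measure (lam d) {x \<in> cube d. q n x \<le> C} \<le> measure (lam d) {x \<in> cube d. \<bar>sn n x\<bar> \<le> \<bar>C\<bar> + CU + 1}" for n
  proof (rule L.finite_measure_mono)
    show "{x \<in> cube d. \<bar>sn n x\<bar> \<le> \<bar>C\<bar> + CU + 1} \<in> sets (lam d)" by (simp only: space_lam[symmetric]) measurable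
    show "{x \<in> cube d. q n x \<le> C} \<subseteq> {x \<in> cube d. \<bar>sn n x\<bar> \<le> \<bar>C\<bar> + CU + 1}"
    proof (rule subsetI)
      fix x assume "x \<in> {x \<in> cube d. q n x \<le> C}"
      then show "x \<in> {x \<in> cube d. \<bar>sn n x\<bar> \<le> \<bar>C\<bar> + CU + 1}" using sn_le_q[of n x] by auto
    qed
  qed
  then show ?thesis using n1 by (meson le_less_trans)
qed

end

section \<open>Decay of smoothed correlations\<close>

abbreviation uI :: "real measure" where "uI \<equiv> restrict_space lborel {0..<1}"

interpretation uI: prob_space uI by (rule prob_space_unit)

lemma uI_measurable: "f \<in> borel_measurable borel \<Longrightarrow> f \<in> borel_measurable uI"
  by (intro measurable_restrict_space1) simp

lemma uI_integrable_continuous: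
  fixes f :: "real \<Rightarrow> 'b::{banach, second_countable_topology}"
  assumes "continuous_on UNIV f"
  shows "integrable uI f"
proof -
  have "bounded (f ` {0..1})"
    by (intro compact_imp_bounded compact_continuous_image continuous_on_subset[OF assms]) auto
  then obtain B where B: "\<And>x. x \<in> {0..1} \<Longrightarrow> norm (f x) \<le> B" unfolding bounded_iff by blast
  show ?thesis
  proof (rule uI.integrable_const_bound[of _ B])
    show "f \<in> borel_measurable uI" using assms by (intro uI_measurable borel_measurable_continuous_onI)
  qed (use B in \<open>auto simp: space_restrict_space\<close>)
qed

lemma uI_FTC_periodic:
  fixes F f :: "real \<Rightarrow> complex"
  assumes F: "\<And>s. (F has_vector_derivative f s) (at s)" and f: "continuous_on UNIV f" and per: "F 1 = F 0"
  shows "(\<integral>s. f s \<partial>uI) = 0"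
proof -
  have [measurable]: "f \<in> borel_measurable borel" using f by (rule borel_measurable_continuous_onI)
  have "(\<integral>s. f s \<partial>uI) = (\<integral>s. indicator {0..<1} s *\<^sub>R f s \<partial>lborel)"
    by (subst integral_restrict_space) auto
  also have "\<dots> = (\<integral>s. indicator {0..1} s *\<^sub>R f s \<partial>lborel)"
  proof (rule integral_cong_AE)
    show "AE x in lborel. indicator {0..<1} x *\<^sub>R f x = indicator {0..1} x *\<^sub>R f x"
      using AE_lborel_singleton[of "1::real"] by eventually_elim (auto simp: indicator_def)
  qed measurable
  also have "\<dots> = F 1 - F 0"
    by (rule integral_FTC_atLeastAtMost)
      (use F f in \<open>auto intro: has_vector_derivative_at_within continuous_on_subset\<close>)
  finally show ?thesis using per by simp
qed

text \<open>Integration by parts with the regularised weight \<open>P1 / (P1\<^sup>2 + A\<^sup>2)\<close> in place of \<open>1 / P1\<close>,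
  which would be singular at critical points of \<open>P\<close>.\<close>

lemma oscillatory_identity:
  fixes P P1 P2 k k1 :: "real \<Rightarrow> real" and \<mu> :: int and t A :: real
  assumes P: "\<And>s. (P has_real_derivative P1 s) (at s)" and P1: "\<And>s. (P1 has_real_derivative P2 s) (at s)"
    and P2: "continuous_on UNIV P2" and per: "P 1 = P 0" "P1 1 = P1 0"
    and k: "\<And>r. (k has_real_derivative k1 r) (at r)" and k1: "continuous_on UNIV k1" and A: "A > 0"
  defines "E \<equiv> \<lambda>s. cis (2 * pi * (real_of_int \<mu> * s)) *
     ((\<i> * of_real (2 * pi * real_of_int \<mu>) * of_real (P1 s / ((P1 s)\<^sup>2 + A\<^sup>2)) + of_real (P2 s * (A\<^sup>2 - (P1 s)\<^sup>2) / ((P1 s)\<^sup>2 + A\<^sup>2)\<^sup>2)) * of_real (k (t - P s))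
       + of_real (k1 (t - P s) * (A\<^sup>2 / ((P1 s)\<^sup>2 + A\<^sup>2))))"
  shows "(\<integral>s. cis (2 * pi * (real_of_int \<mu> * s)) * of_real (k1 (t - P s)) \<partial>uI) = (\<integral>s. E s \<partial>uI)" and "continuous_on UNIV E"
proof -
  have cP: "continuous_on UNIV P" "continuous_on UNIV P1" "continuous_on UNIV k"
    using DERIV_continuous_on[of UNIV P P1] DERIV_continuous_on[of UNIV P1 P2] DERIV_continuous_on[of UNIV k k1] P P1 k
    by simp_all
  have nz: "(P1 s)\<^sup>2 + A\<^sup>2 \<noteq> 0" for s using A by (simp add: sum_power2_eq_zero_iff)
  have ckP: "continuous_on UNIV (\<lambda>s. k (t - P s))" "continuous_on UNIV (\<lambda>s. k1 (t - P s))"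
    by (intro continuous_on_compose2[OF cP(3)] continuous_on_compose2[OF k1] continuous_intros cP; simp)+
  show cE: "continuous_on UNIV E"
    unfolding E_def by (intro continuous_intros cP P2 ckP) (use A in \<open>auto simp: sum_power2_eq_zero_iff\<close>)
  let ?c = "\<lambda>s. cis (2 * pi * (real_of_int \<mu> * s))"
  let ?w = "\<lambda>s. P1 s / ((P1 s)\<^sup>2 + A\<^sup>2)"
  let ?v = "\<lambda>s. ?w s * k (t - P s)"
  have w: "(?w has_real_derivative (P2 s * (A\<^sup>2 - (P1 s)\<^sup>2) / ((P1 s)\<^sup>2 + A\<^sup>2)\<^sup>2)) (at s)" for s
  proof -
    have "(?w has_real_derivative ((P2 s * ((P1 s)\<^sup>2 + A\<^sup>2) - P1 s * (2 * P1 s * P2 s)) / (((P1 s)\<^sup>2 + A\<^sup>2) * ((P1 s)\<^sup>2 + A\<^sup>2)))) (at s)"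
      by (rule DERIV_divide[OF P1]) (use A in \<open>auto intro!: derivative_eq_intros P1 simp: sum_power2_eq_zero_iff\<close>)
    moreover have "(P2 s * ((P1 s)\<^sup>2 + A\<^sup>2) - P1 s * (2 * P1 s * P2 s)) / (((P1 s)\<^sup>2 + A\<^sup>2) * ((P1 s)\<^sup>2 + A\<^sup>2)) = P2 s * (A\<^sup>2 - (P1 s)\<^sup>2) / ((P1 s)\<^sup>2 + A\<^sup>2)\<^sup>2"
      by (simp add: power2_eq_square algebra_simps)
    ultimately show ?thesis by simp
  qed
  have kP: "((\<lambda>s. k (t - P s)) has_real_derivative (k1 (t - P s) * (- P1 s))) (at s)" for s
  proof -
    have "((\<lambda>s. t - P s) has_real_derivative (- P1 s)) (at s)"
      by (auto intro!: derivative_eq_intros P)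
    from DERIV_chain2[OF k this] show ?thesis .
  qed
  have v: "(?v has_real_derivative (P2 s * (A\<^sup>2 - (P1 s)\<^sup>2) / ((P1 s)\<^sup>2 + A\<^sup>2)\<^sup>2 * k (t - P s) + k1 (t - P s) * (- P1 s) * ?w s)) (at s)" for s
    by (rule DERIV_mult[OF w kP])
  have cc: "(?c has_vector_derivative (\<i> * of_real (2 * pi * real_of_int \<mu>) * ?c s)) (at s)" for s
    using has_vector_derivative_cis[of "2 * pi * real_of_int \<mu>" s UNIV] by (simp add: mult.assoc)
  let ?F = "\<lambda>s. ?c s * of_real (?v s)"
  have F: "(?F has_vector_derivative (E s - ?c s * of_real (k1 (t - P s)))) (at s)" for s
  proof -
    have "((\<lambda>s. complex_of_real (?v s)) has_vector_derivative of_real (P2 s * (A\<^sup>2 - (P1 s)\<^sup>2) / ((P1 s)\<^sup>2 + A\<^sup>2)\<^sup>2 * k (t - P s) + k1 (t - P s) * (- P1 s) * ?w s)) (at s)"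
      by (rule has_vector_derivative_of_real) (use v in \<open>simp add: has_real_derivative_iff_has_vector_derivative\<close>)
    from has_vector_derivative_mult[OF cc this]
    have D: "(?F has_vector_derivative (?c s * of_real (P2 s * (A\<^sup>2 - (P1 s)\<^sup>2) / ((P1 s)\<^sup>2 + A\<^sup>2)\<^sup>2 * k (t - P s) + k1 (t - P s) * (- P1 s) * ?w s)
       + \<i> * of_real (2 * pi * real_of_int \<mu>) * ?c s * of_real (?v s))) (at s)" .
    \<comment> \<open>The derivative of \<open>k (t - P s)\<close> is
      \<open>- P1 s * k1 (t - P s)\<close>; multiplied by the weight it returns \<open>- k1\<close>
      up to a remainder that is small where \<open>P1\<close> is large compared with
      \<open>A\<close>.\<close>
    have "P1 s * ?w s = 1 - A\<^sup>2 / ((P1 s)\<^sup>2 + A\<^sup>2)" using nz[of s] by (simp add: field_simps power2_eq_square)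
    then have "k1 (t - P s) * (- P1 s) * ?w s = - k1 (t - P s) + k1 (t - P s) * (A\<^sup>2 / ((P1 s)\<^sup>2 + A\<^sup>2))"
      by (simp only: mult_minus_right mult_minus_left mult.assoc right_diff_distrib mult_1_right)
    then have "?c s * of_real (P2 s * (A\<^sup>2 - (P1 s)\<^sup>2) / ((P1 s)\<^sup>2 + A\<^sup>2)\<^sup>2 * k (t - P s) + k1 (t - P s) * (- P1 s) * ?w s)
       + \<i> * of_real (2 * pi * real_of_int \<mu>) * ?c s * of_real (?v s) = E s - ?c s * of_real (k1 (t - P s))"
      unfolding E_def by (simp only: of_real_add of_real_mult of_real_minus) (simp add: algebra_simps)
    then show ?thesis using D by simp
  qed
  have cK: "continuous_on UNIV (\<lambda>s. ?c s * of_real (k1 (t - P s)))" by (intro continuous_intros ckP)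
  have "(\<integral>s. E s - ?c s * of_real (k1 (t - P s)) \<partial>uI) = 0"
  proof (rule uI_FTC_periodic[OF F])
    show "continuous_on UNIV (\<lambda>s. E s - ?c s * of_real (k1 (t - P s)))" by (intro continuous_on_diff cE cK)
    show "?F 1 = ?F 0" using per by (simp add: cis_multiple_2pi)
  qed
  then show "(\<integral>s. ?c s * of_real (k1 (t - P s)) \<partial>uI) = (\<integral>s. E s \<partial>uI)"
    using uI_integrable_continuous[OF cE] uI_integrable_continuous[OF cK] by simp
qed

definition dcoef :: "(int \<Rightarrow> complex) \<Rightarrow> int \<Rightarrow> complex" where
  "dcoef g m = \<i> * of_real (2 * pi * real_of_int m) * g m"

lemma trig_sum_has_derivative:
  "(trig_sum D g has_vector_derivative trig_sum D (dcoef g) s) (at s)"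
proof -
  have "((\<lambda>s. \<Sum>m\<in>{- int D..int D}. g m * cis (2 * pi * (real_of_int m * s))) has_vector_derivative
     (\<Sum>m\<in>{- int D..int D}. g m * (\<i> * of_real (2 * pi * real_of_int m) * cis (2 * pi * (real_of_int m * s))))) (at s)"
  proof (intro has_vector_derivative_sum has_vector_derivative_mult_right)
    fix m
    show "((\<lambda>s. cis (2 * pi * (real_of_int m * s))) has_vector_derivative \<i> * of_real (2 * pi * real_of_int m) * cis (2 * pi * (real_of_int m * s))) (at s)"
      using has_vector_derivative_cis[of "2 * pi * real_of_int m" s UNIV] by (simp add: mult.assoc)
  qed
  then show ?thesis by (simp add: trig_sum_def[abs_def] dcoef_def mult_ac)
qed

lemma trig_sum_continuous: "continuous_on UNIV (trig_sum D g)"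
  unfolding trig_sum_def[abs_def] by (intro continuous_intros)

lemma trig_sum_periodic: "trig_sum D g 1 = trig_sum D g 0"
  by (simp add: trig_sum_def cis_multiple_2pi)

text \<open>Real values force a real derivative: the imaginary part vanishes identically, hence so
  does its derivative.\<close>

lemma trig_sum_real_derivative:
  assumes "\<And>s. trig_sum D g s = of_real (P s)"
  shows "(P has_real_derivative Re (trig_sum D (dcoef g) s)) (at s)" "Im (trig_sum D (dcoef g) s) = 0"
proof -
  have R: "((\<lambda>s. Re (trig_sum D g s)) has_vector_derivative Re (trig_sum D (dcoef g) s)) (at s)"
    and I: "((\<lambda>s. Im (trig_sum D g s)) has_vector_derivative Im (trig_sum D (dcoef g) s)) (at s)"
    using bounded_linear.has_vector_derivative[OF bounded_linear_Re trig_sum_has_derivative]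
      bounded_linear.has_vector_derivative[OF bounded_linear_Im trig_sum_has_derivative] by auto
  show "(P has_real_derivative Re (trig_sum D (dcoef g) s)) (at s)"
    using R assms by (simp add: has_real_derivative_iff_has_vector_derivative)
  have "((\<lambda>s. 0::real) has_vector_derivative Im (trig_sum D (dcoef g) s)) (at s)" using I assms by simp
  then show "Im (trig_sum D (dcoef g) s) = 0"
    using vector_derivative_unique_at[OF _ has_vector_derivative_const] by blast
qed

text \<open>Frequency zero disappears under differentiation, so the oscillating coefficients alone
  control the derivative.\<close>

lemma norm_trig_sum_dcoef_le:
  assumes "\<And>m. m \<in> {- int D..int D} - {0} \<Longrightarrow> norm (g m) \<le> h m"
  shows "norm (trig_sum D (dcoef g) s) \<le> 2 * pi * real D * (\<Sum>m\<in>{- int D..int D} - {0}. h m)"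
proof -
  have "norm (trig_sum D (dcoef g) s) = norm (\<Sum>m\<in>{- int D..int D} - {0}. dcoef g m * cis (2 * pi * (real_of_int m * s)))"
    unfolding trig_sum_def using sum.remove[of "{- int D..int D}" 0 "\<lambda>m. dcoef g m * cis (2 * pi * (real_of_int m * s))"]
    by (simp add: dcoef_def)
  also have "\<dots> \<le> (\<Sum>m\<in>{- int D..int D} - {0}. 2 * pi * real D * h m)"
  proof (rule sum_norm_le)
    fix m assume m: "m \<in> {- int D..int D} - {0}"
    then have "\<bar>real_of_int m\<bar> \<le> real D" by (auto simp: abs_le_iff)
    then have "2 * pi * \<bar>real_of_int m\<bar> * norm (g m) \<le> 2 * pi * real D * h m"
      using assms[OF m] by (intro mult_mono) auto
    then show "norm (dcoef g m * cis (2 * pi * (real_of_int m * s))) \<le> 2 * pi * real D * h m"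
      by (simp add: dcoef_def norm_mult abs_mult)
  qed
  finally show ?thesis by (simp add: sum_distrib_left)
qed

context trig_suspension
begin

section \<open>Sublinear growth and the returns active at a given time\<close>

lemma csum_add: "csum \<xi> (n + m) x = csum \<xi> n x + csum \<xi> m ((T ^^ n) x)"
proof (induction m)
  case (Suc m)
  have "(T ^^ (n + m)) x = (T ^^ m) ((T ^^ n) x)" using funpow_add[of m n T] by (simp add: add.commute)
  then show ?case using Suc by (simp add: csum_def)
qed (simp add: csum_def)

lemma g_add: "g (n + m) x k = g n x k + g m ((T ^^ n) x) k"
  by (simp add: g_def csum_add sum.distrib distrib_left)

text \<open>Weyl sums for the finitely many frequencies whose last entry is nonzero.\<close>

lemma q_sublinear:
  assumes e: "e > 0"
  obtains C where "C \<ge> 0" "\<And>n x. q n x \<le> e * real n + C"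
proof -
  let ?F = "{\<xi>\<in>F. \<xi> (d - 1) \<noteq> 0}"
  define S where "S = (\<Sum>\<xi>\<in>?F. norm (cf \<xi>)) + 1"
  have S: "S > 0" unfolding S_def by (intro add_nonneg_pos sum_nonneg) auto
  have "\<exists>C\<ge>0. \<forall>x n. norm (csum \<xi> n x) \<le> e / S * real n + C" if "\<xi> \<in> ?F" for \<xi>
  proof -
    have "weyl \<xi>" by (rule weyl_nonzero) (use that d1 in blast)
    then show ?thesis unfolding weyl_def using e S by (meson divide_pos_pos)
  qed
  then have "\<exists>C. \<forall>\<xi>\<in>?F. C \<xi> \<ge> 0 \<and> (\<forall>x n. norm (csum \<xi> n x) \<le> e / S * real n + C \<xi>)"
    by (intro bchoice ballI)
  then obtain C where C: "\<And>\<xi>. \<xi> \<in> ?F \<Longrightarrow> C \<xi> \<ge> 0" "\<And>\<xi> x n. \<xi> \<in> ?F \<Longrightarrow> norm (csum \<xi> n x) \<le> e / S * real n + C \<xi>"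
    by blast
  show ?thesis
  proof (rule that[of "\<Sum>\<xi>\<in>?F. norm (cf \<xi>) * C \<xi>"])
    show "0 \<le> (\<Sum>\<xi>\<in>?F. norm (cf \<xi>) * C \<xi>)" by (intro sum_nonneg mult_nonneg_nonneg C) auto
    fix n x
    have "q n x \<le> (\<Sum>m\<in>{- int D..int D} - {0}. \<Sum>\<xi>\<in>{\<xi>\<in>?F. \<xi> (d - 1) = m}. norm (cf \<xi>) * norm (csum \<xi> n x))"
      unfolding q_def
    proof (rule sum_mono)
      fix m assume "m \<in> {- int D..int D} - {0}"
      then have "{\<xi>\<in>?F. \<xi> (d - 1) = m} = {\<xi>\<in>F. \<xi> (d - 1) = m}" by auto
      then show "norm (g n x m) \<le> (\<Sum>\<xi>\<in>{\<xi>\<in>?F. \<xi> (d - 1) = m}. norm (cf \<xi>) * norm (csum \<xi> n x))"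
        unfolding g_def using norm_sum[of "\<lambda>\<xi>. cf \<xi> * csum \<xi> n x" "{\<xi>\<in>F. \<xi> (d - 1) = m}"] by (simp add: norm_mult)
    qed
    also have "\<dots> = (\<Sum>\<xi>\<in>?F. norm (cf \<xi>) * norm (csum \<xi> n x))"
    proof (rule sum.group)
      show "(\<lambda>\<xi>. \<xi> (d - 1)) ` ?F \<subseteq> {- int D..int D} - {0}"
      proof (rule image_subsetI)
        fix \<xi> assume "\<xi> \<in> ?F"
        then show "\<xi> (d - 1) \<in> {- int D..int D} - {0}" using F_D[of \<xi>] by simp
      qed
      show "finite ?F" using finF by simp
    qed simp
    also have "\<dots> \<le> (\<Sum>\<xi>\<in>?F. norm (cf \<xi>) * (e / S * real n + C \<xi>))"
      by (intro sum_mono mult_left_mono C(2)) auto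
    also have "\<dots> = e / S * real n * (\<Sum>\<xi>\<in>?F. norm (cf \<xi>)) + (\<Sum>\<xi>\<in>?F. norm (cf \<xi>) * C \<xi>)"
    proof -
      have "(\<Sum>\<xi>\<in>?F. norm (cf \<xi>) * (r + C \<xi>)) = r * (\<Sum>\<xi>\<in>?F. norm (cf \<xi>)) + (\<Sum>\<xi>\<in>?F. norm (cf \<xi>) * C \<xi>)" for r
        by (simp add: distrib_left sum.distrib sum_distrib_left mult.commute)
      then show ?thesis .
    qed
    also have "e / S * real n * (\<Sum>\<xi>\<in>?F. norm (cf \<xi>)) \<le> e / S * real n * S"
      using e S by (intro mult_left_mono) (auto simp: S_def)
    also have "\<dots> = e * real n" using S by simp
    finally show "q n x \<le> e * real n + (\<Sum>\<xi>\<in>?F. norm (cf \<xi>) * C \<xi>)" by simp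
  qed
qed

definition dq :: "nat \<Rightarrow> nat \<Rightarrow> (nat \<Rightarrow> real) \<Rightarrow> real" where
  "dq n n' x = (\<Sum>m\<in>{- int D..int D} - {0}. norm (g n x m - g n' x m))"

text \<open>By the cocycle property, the change of the coefficients between two times is the
  coefficient vector of the time difference at a later point of the orbit; hence it is sublinear in
  that difference.\<close>

lemma dq_eq: "dq n n' x = q (if n' \<le> n then n - n' else n' - n) ((T ^^ min n n') x)"
proof (cases "n' \<le> n")
  case True
  then show ?thesis using g_add[of n' "n - n'" x] by (simp add: dq_def q_def min_def)
next
  case False
  then show ?thesis using g_add[of n "n' - n" x] by (simp add: dq_def q_def min_def)
qed

lemma q_triangle: "q n x \<le> q n' x + dq n n' x"
  unfolding q_def dq_def sum.distrib[symmetric] by (intro sum_mono) (metis norm_triangle_sub)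

lemma c_pos: "c > 0"
proof -
  interpret L: prob_space "lam d" by simp
  have "\<bar>\<Psi> x\<bar> \<le> (\<Sum>\<xi>\<in>F. norm (cf \<xi>))" for x
  proof -
    have "norm (complex_of_real (\<Psi> x)) \<le> (\<Sum>\<xi>\<in>F. norm (cf \<xi> * chr d \<xi> x))" unfolding Psi by (rule norm_sum)
    then show ?thesis by (simp add: norm_mult)
  qed
  then have "integrable (lam d) \<Psi>" by (intro L.integrable_const_bound[of _ "\<Sum>\<xi>\<in>F. norm (cf \<xi>)"]) auto
  then have "(\<integral>x. m0 \<partial>lam d) \<le> (\<integral>x. \<Psi> x \<partial>lam d)" by (intro integral_mono Psi_lower) auto
  then show ?thesis using m0 L.prob_space unfolding cf0 by simp
qed

text \<open>If the sum of length \<open>n\<close> is near \<open>t\<close>, then \<open>n\<close>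
  differs from \<open>t / c\<close> by at most a multiple of \<open>q n x\<close>, up to constants,
  and \<open>dq\<close> is a small multiple of that difference. After absorption of
  \<open>dq\<close>, all such \<open>n\<close> have almost the coefficients of the reference time,
  relative to their size.\<close>

lemma relevant_times:
  assumes e: "e > 0"
  obtains Q where "Q > 0" "\<And>t x s n. t \<ge> 0 \<Longrightarrow> q (nat \<lfloor>t / c\<rfloor>) x \<ge> Q \<Longrightarrow> \<bar>t - p n (mv x s)\<bar> \<le> m0 \<Longrightarrow>
     dq n (nat \<lfloor>t / c\<rfloor>) x \<le> e * q (nat \<lfloor>t / c\<rfloor>) x"
proof -
  note c = c_pos
  \<comment> \<open>The bound \<open>c / 2\<close> allows the absorption, the bound
    \<open>e * c / 4\<close> yields the factor \<open>e / 2\<close> at the end.\<close>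
  define e1 where "e1 = min (c / 2) (e * c / 4)"
  have e1: "e1 > 0" "e1 \<le> c / 2" "e1 * (2 / c) \<le> e / 2" using e c by (auto simp: e1_def min_def field_simps)
  obtain C1 where C1: "C1 \<ge> 0" "\<And>n x. q n x \<le> e1 * real n + C1" using q_sublinear[OF e1(1)] by blast
  define C2 where "C2 = C1 + CU + m0 + c"
  have C2: "C2 > 0" using C1 CU m0 c by (simp add: C2_def)
  \<comment> \<open>For \<open>q\<close> of this size the additive constants cost at most another
    \<open>e / 2\<close> times \<open>q\<close>.\<close>
  define Q where "Q = 2 / e * (e / 2 * C2 + C1) + 1"
  have Q: "Q > 0" unfolding Q_def using e C2 C1 by (auto intro!: add_nonneg_pos mult_nonneg_nonneg add_nonneg_nonneg)
  show ?thesis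
  proof (rule that[OF Q])
    fix t s :: real and x n
    assume t: "t \<ge> 0" and big: "q (nat \<lfloor>t / c\<rfloor>) x \<ge> Q" and near: "\<bar>t - p n (mv x s)\<bar> \<le> m0"
    define n0 where "n0 = nat \<lfloor>t / c\<rfloor>"
    define \<Delta> where "\<Delta> = \<bar>real n - real n0\<bar>"
    have n0: "\<bar>t - real n0 * c\<bar> \<le> c"
    proof -
      have "real n0 = of_int \<lfloor>t / c\<rfloor>" using t c by (simp add: n0_def)
      then have "real n0 \<le> t / c" "t / c < real n0 + 1" by linarith+
      then have "real n0 * c \<le> t" "t < real n0 * c + c" using c by (auto simp: field_simps)
      then show ?thesis by linarith
    qed
    have dq: "dq n n0 x \<le> e1 * \<Delta> + C1"
    proof -
      have "dq n n0 x \<le> e1 * real (if n0 \<le> n then n - n0 else n0 - n) + C1" unfolding dq_eq by (rule C1(2))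
      moreover have "real (if n0 \<le> n then n - n0 else n0 - n) = \<Delta>" by (auto simp: \<Delta>_def of_nat_diff)
      ultimately show ?thesis by simp
    qed
    have "\<bar>p n (mv x s) - real n * c\<bar> \<le> q n x + CU" using sn_le_q[of n "mv x s"] by (simp add: sn_def q_mv)
    then have "\<bar>real n * c - real n0 * c\<bar> \<le> q n x + CU + m0 + c" using near n0 by linarith
    moreover have "\<bar>real n * c - real n0 * c\<bar> = \<Delta> * c" using c by (simp add: \<Delta>_def abs_mult left_diff_distrib[symmetric])
    ultimately have "\<Delta> * c \<le> q n0 x + (e1 * \<Delta> + C1) + CU + m0 + c" using q_triangle[of n x n0] dq by linarith
    moreover have "e1 * \<Delta> \<le> c / 2 * \<Delta>" using e1 by (intro mult_right_mono) (auto simp: \<Delta>_def)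
    ultimately have "c / 2 * \<Delta> \<le> q n0 x + C2" unfolding C2_def by (simp add: algebra_simps)
    then have D: "\<Delta> \<le> 2 / c * (q n0 x + C2)" using c by (simp add: field_simps)
    have "dq n n0 x \<le> e1 * (2 / c * (q n0 x + C2)) + C1"
      using dq mult_left_mono[OF D, of e1] e1 by linarith
    also have "e1 * (2 / c * (q n0 x + C2)) \<le> e / 2 * (q n0 x + C2)"
      using mult_right_mono[OF e1(3), of "q n0 x + C2"] big Q C2 by (simp add: n0_def mult.assoc)
    finally have "dq n n0 x \<le> e / 2 * q n0 x + (e / 2 * C2 + C1)" by (simp add: algebra_simps)
    moreover have "e / 2 * C2 + C1 \<le> e / 2 * q n0 x"
    proof -
      have "2 / e * (e / 2 * C2 + C1) \<le> q n0 x" using big unfolding Q_def n0_def[symmetric] by linarith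
      then have "e / 2 * (2 / e * (e / 2 * C2 + C1)) \<le> e / 2 * q n0 x" using e by (intro mult_left_mono) auto
      then show ?thesis using e by simp
    qed
    ultimately show "dq n (nat \<lfloor>t / c\<rfloor>) x \<le> e * q (nat \<lfloor>t / c\<rfloor>) x" unfolding n0_def[symmetric] by linarith
  qed
qed

end

context trig_suspension
begin

section \<open>Renewal sums and averaging over the last coordinate\<close>

lemma p_Suc: "p (Suc n) x = p n x + \<Psi> ((T ^^ n) x)"
  by (simp add: birkhoff_sum_def)

lemma p_mono: "n < n' \<Longrightarrow> p n x + m0 \<le> p n' x"
proof (induction n' rule: less_induct)
  case (less n')
  then obtain m where m: "n' = Suc m" by (cases n') auto
  show ?case
  proof (cases "n = m")
    case True then show ?thesis using Psi_lower[of "(T ^^ m) x"] m by (simp add: p_Suc)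
  next
    case False
    then have "p n x + m0 \<le> p m x" using less m by auto
    then show ?thesis using Psi_lower[of "(T ^^ m) x"] m m0 by (simp add: p_Suc)
  qed
qed

lemma p_lower: "real n * m0 \<le> p n x"
proof (induction n)
  case (Suc n)
  then show ?case using Psi_lower[of "(T ^^ n) x"] by (simp add: p_Suc algebra_simps)
qed (simp add: birkhoff_sum_def)

text \<open>Birkhoff sums increase by at least \<open>m0\<close> at each step, so at most one of
  them lies in the open interval of length \<open>m0\<close> below \<open>t\<close>.\<close>

lemma hit_sum_le:
  fixes f :: "nat \<Rightarrow> 'b::real_normed_vector"
  assumes K: "K \<ge> 0" and hit: "\<And>n. n < N \<Longrightarrow> 0 < t - p n x \<Longrightarrow> t - p n x < m0 \<Longrightarrow> norm (f n) \<le> K"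
    and miss: "\<And>n. n < N \<Longrightarrow> \<not> (0 < t - p n x \<and> t - p n x < m0) \<Longrightarrow> f n = 0"
  shows "(\<Sum>n<N. norm (f n)) \<le> K"
proof (cases "\<exists>n<N. 0 < t - p n x \<and> t - p n x < m0")
  case True
  then obtain n where n: "n < N" "0 < t - p n x" "t - p n x < m0" by blast
  have "f m = 0" if "m < N" "m \<noteq> n" for m
  proof (rule miss[OF that(1)])
    show "\<not> (0 < t - p m x \<and> t - p m x < m0)"
    proof (cases "m < n")
      case True then show ?thesis using p_mono[of m n x] n by linarith
    next
      case False
      then have "n < m" using that by simp
      then show ?thesis using p_mono[of n m x] n by linarith
    qed
  qed
  then have "(\<Sum>n<N. norm (f n)) = (\<Sum>m<N. if m = n then norm (f n) else 0)"
    by (intro sum.cong) auto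
  also have "\<dots> = norm (f n)" using n by simp
  finally show ?thesis using hit[OF n] by simp
next
  case False
  then have "f n = 0" if "n < N" for n using miss that by blast
  then show ?thesis using K by simp
qed

text \<open>For \<open>f\<close> supported in \<open>{0<..<m0}\<close>: the observable
  \<open>chr d \<xi>\<close> times \<open>f\<close> of the height, evaluated after flow time
  \<open>t\<close> from height 0 over \<open>x\<close>. The number of terms suffices because the
  \<open>n\<close>-th Birkhoff sum is at least \<open>n * m0\<close>.\<close>

definition ren :: "(real \<Rightarrow> real) \<Rightarrow> (nat \<Rightarrow> int) \<Rightarrow> real \<Rightarrow> (nat \<Rightarrow> real) \<Rightarrow> complex" where
  "ren f \<xi> t x = (\<Sum>n<nat \<lceil>t / m0\<rceil>. chr d \<xi> ((T ^^ n) x) * of_real (f (t - p n x)))"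

lemma ren_measurable:
  assumes [measurable]: "f \<in> borel_measurable borel"
  shows "ren f \<xi> t \<in> borel_measurable (lam d)"
proof -
  have [measurable]: "(\<lambda>x. chr d \<xi> ((T ^^ n) x)) \<in> borel_measurable (lam d)" for n
    by (rule measurable_compose[OF Tn_measurable chr_measurable])
  show ?thesis unfolding ren_def[abs_def] by measurable
qed

lemma ren_bound:
  assumes "\<And>r. r \<le> 0 \<or> r \<ge> m0 \<Longrightarrow> f r = 0" "\<And>r. \<bar>f r\<bar> \<le> K"
  shows "norm (ren f \<xi> t x) \<le> K"
proof -
  have "K \<ge> 0" using assms(2)[of 0] by linarith
  have "norm (ren f \<xi> t x) \<le> (\<Sum>n<nat \<lceil>t / m0\<rceil>. norm (chr d \<xi> ((T ^^ n) x) * complex_of_real (f (t - p n x))))"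
    unfolding ren_def by (rule norm_sum)
  also have "\<dots> \<le> K"
  proof (rule hit_sum_le[where t=t and x=x, OF \<open>K \<ge> 0\<close>])
    fix n
    show "norm (chr d \<xi> ((T ^^ n) x) * complex_of_real (f (t - p n x))) \<le> K" using assms(2) by (simp add: norm_mult)
    assume "\<not> (0 < t - p n x \<and> t - p n x < m0)"
    then have "f (t - p n x) = 0" using assms(1)[of "t - p n x"] by linarith
    then show "chr d \<xi> ((T ^^ n) x) * complex_of_real (f (t - p n x)) = 0" by simp
  qed
  finally show ?thesis .
qed

lemma chr_shift_mv: "chr d \<xi> ((T ^^ n) (shift d (d - 1) s x)) = chr d \<xi> ((T ^^ n) (mv x s))"
proof -
  obtain w where w: "\<And>x. chr d \<xi> ((T ^^ n) x) = chr d ((act ^^ n) \<xi>) x * w" using chr_Tn by blast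
  show ?thesis unfolding w chr_shift[OF d1] mv_def ..
qed

lemma p_shift_mv: "p n (shift d (d - 1) s x) = p n (mv x s)"
proof -
  have "complex_of_real (p n (shift d (d - 1) s x)) = complex_of_real (p n (mv x s))"
    unfolding p_eq csum_def by (simp only: chr_shift_mv)
  then show ?thesis by (simp only: of_real_eq_iff)
qed

lemma ren_shift_mv: "ren f \<xi> t (shift d (d - 1) s x) = ren f \<xi> t (mv x s)"
  unfolding ren_def by (simp only: chr_shift_mv p_shift_mv)

text \<open>Lebesgue measure is invariant under translations in the last coordinate, so the
  integrand may be replaced by its average over the circle in that direction.\<close>

lemma average_last_coordinate:
  assumes [measurable]: "f \<in> borel_measurable borel"
    and f: "\<And>r. r \<le> 0 \<or> r \<ge> m0 \<Longrightarrow> f r = 0" "\<And>r. \<bar>f r\<bar> \<le> K"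
  shows "(\<integral>x. chr d \<zeta> x * ren f \<xi> t x \<partial>lam d) = (\<integral>x. (\<integral>s. chr d \<zeta> (mv x s) * ren f \<xi> t (mv x s) \<partial>uI) \<partial>lam d)"
proof -
  interpret L: prob_space "lam d" by simp
  interpret PU: pair_prob_space uI "lam d" ..
  let ?h = "\<lambda>x. chr d \<zeta> x * ren f \<xi> t x"
  have hm [measurable]: "?h \<in> borel_measurable (lam d)" using ren_measurable[OF assms(1)] by measurable
  have hs: "?h (shift d (d - 1) s x) = ?h (mv x s)" for s x
  proof -
    have "chr d \<zeta> (shift d (d - 1) s x) = chr d \<zeta> (mv x s)" using chr_shift_mv[of \<zeta> 0 s x] by simp
    then show ?thesis by (simp only: ren_shift_mv)
  qed
  have hb: "norm (?h x) \<le> K" for x using ren_bound[OF f] by (simp add: norm_mult)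
  have meas: "(\<lambda>(s, x). ?h (mv x s)) \<in> borel_measurable (uI \<Otimes>\<^sub>M lam d)"
  proof -
    have "(\<lambda>z. (fst z, snd z)) \<in> measurable (uI \<Otimes>\<^sub>M lam d) (borel \<Otimes>\<^sub>M lam d)"
      by (intro measurable_Pair measurable_snd measurable_compose[OF measurable_fst] measurable_restrict_space1) simp
    from measurable_compose[OF measurable_compose[OF this shift_measurable[of d "d - 1"]] hm]
    have "(\<lambda>z. ?h (shift d (d - 1) (fst z) (snd z))) \<in> borel_measurable (uI \<Otimes>\<^sub>M lam d)" by (simp add: split_beta')
    then show ?thesis unfolding hs by (simp add: split_beta')
  qed
  have int: "integrable (uI \<Otimes>\<^sub>M lam d) (\<lambda>(s, x). ?h (mv x s))"
    by (rule PU.integrable_const_bound[of _ K]) (use hb meas in \<open>auto\<close>)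
  have "(\<integral>x. (\<integral>s. ?h (mv x s) \<partial>uI) \<partial>lam d) = (\<integral>s. (\<integral>x. ?h (mv x s) \<partial>lam d) \<partial>uI)"
    by (rule PU.Fubini_integral[OF int])
  also have "\<dots> = (\<integral>s. (\<integral>x. ?h x \<partial>lam d) \<partial>uI)"
  proof (rule Bochner_Integration.integral_cong[OF refl])
    fix s
    have "(\<integral>x. ?h (mv x s) \<partial>lam d) = (\<integral>x. ?h (shift d (d - 1) s x) \<partial>lam d)" by (simp only: hs)
    also have "\<dots> = (\<integral>x. ?h x \<partial>lam d)" by (rule integral_shift[OF d1 hm])
    finally show "(\<integral>x. ?h (mv x s) \<partial>lam d) = (\<integral>x. ?h x \<partial>lam d)" .
  qed
  also have "\<dots> = (\<integral>x. ?h x \<partial>lam d)" using prob_space.prob_space[OF prob_space_unit] by simp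
  finally show ?thesis by simp
qed

end

text \<open>A continuously differentiable height profile supported between 0 and \<open>m0\<close>,
  so that the renewal sums of \<open>k\<close> and of its derivative \<open>k1\<close> have at most
  one nonzero term.\<close>

locale cutoff = trig_suspension +
  fixes k k1 :: "real \<Rightarrow> real" and B B1 :: real
  assumes k_deriv: "\<And>r. (k has_real_derivative k1 r) (at r)" and k1_cont: "continuous_on UNIV k1"
    and k_zero: "\<And>r. r \<le> 0 \<or> r \<ge> m0 \<Longrightarrow> k r = 0" and k1_zero: "\<And>r. r \<le> 0 \<or> r \<ge> m0 \<Longrightarrow> k1 r = 0"
    and k_bound: "\<And>r. \<bar>k r\<bar> \<le> B" and k1_bound: "\<And>r. \<bar>k1 r\<bar> \<le> B1"
begin

lemma B_nonneg: "B \<ge> 0" "B1 \<ge> 0" using k_bound[of 0] k1_bound[of 0] by linarith+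

lemma weight_bounds:
  fixes P1 P2 A :: real
  assumes A: "A > 0"
  shows "\<bar>P1 / (P1\<^sup>2 + A\<^sup>2)\<bar> \<le> 1 / A" "\<bar>P2 * (A\<^sup>2 - P1\<^sup>2) / (P1\<^sup>2 + A\<^sup>2)\<^sup>2\<bar> \<le> \<bar>P2\<bar> / A\<^sup>2"
    "\<bar>A\<^sup>2 / (P1\<^sup>2 + A\<^sup>2)\<bar> \<le> 1" "h > 0 \<Longrightarrow> \<bar>P1\<bar> \<ge> h \<Longrightarrow> \<bar>A\<^sup>2 / (P1\<^sup>2 + A\<^sup>2)\<bar> \<le> A\<^sup>2 / h\<^sup>2"
proof -
  have A2: "A\<^sup>2 > 0" using A by simp
  then have pos: "P1\<^sup>2 + A\<^sup>2 > 0" by (simp add: add_nonneg_pos)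
  have "\<bar>P1\<bar> * A \<le> P1\<^sup>2 + A\<^sup>2"
  proof -
    have "2 * \<bar>P1\<bar> * A \<le> \<bar>P1\<bar>\<^sup>2 + A\<^sup>2" by (rule sum_squares_bound)
    moreover have "0 \<le> \<bar>P1\<bar> * A" using A by simp
    ultimately show ?thesis by simp
  qed
  then show "\<bar>P1 / (P1\<^sup>2 + A\<^sup>2)\<bar> \<le> 1 / A" using pos A by (simp add: abs_divide divide_simps mult.commute)
  have "\<bar>P2 * (A\<^sup>2 - P1\<^sup>2) / (P1\<^sup>2 + A\<^sup>2)\<^sup>2\<bar> = \<bar>P2\<bar> * \<bar>A\<^sup>2 - P1\<^sup>2\<bar> / (P1\<^sup>2 + A\<^sup>2)\<^sup>2"
    by (simp add: abs_mult)
  also have "\<dots> \<le> \<bar>P2\<bar> * (P1\<^sup>2 + A\<^sup>2) / (P1\<^sup>2 + A\<^sup>2)\<^sup>2"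
    by (intro divide_right_mono mult_left_mono) (auto simp: abs_le_iff)
  also have "\<dots> = \<bar>P2\<bar> / (P1\<^sup>2 + A\<^sup>2)" using pos by (simp add: power2_eq_square[of "P1\<^sup>2 + A\<^sup>2"])
  also have "\<dots> \<le> \<bar>P2\<bar> / A\<^sup>2" using A2 pos by (intro divide_left_mono mult_pos_pos) auto
  finally show "\<bar>P2 * (A\<^sup>2 - P1\<^sup>2) / (P1\<^sup>2 + A\<^sup>2)\<^sup>2\<bar> \<le> \<bar>P2\<bar> / A\<^sup>2" .
  show "\<bar>A\<^sup>2 / (P1\<^sup>2 + A\<^sup>2)\<bar> \<le> 1" using pos by (simp add: divide_le_eq)
  assume h: "h > 0" "\<bar>P1\<bar> \<ge> h"
  then have "h\<^sup>2 \<le> P1\<^sup>2 + A\<^sup>2" using power_mono[of h "\<bar>P1\<bar>" 2] by (simp add: add_increasing2)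
  then show "\<bar>A\<^sup>2 / (P1\<^sup>2 + A\<^sup>2)\<bar> \<le> A\<^sup>2 / h\<^sup>2" using pos h by (simp add: divide_left_mono)
qed

text \<open>Integration by parts with regularisation \<open>A = \<beta> * q0\<close> proportional to
  the shear: the terms with \<open>k\<close> are of order \<open>1 / q0\<close>, and the remainder
  with \<open>k1\<close> is small except where the reference derivative is at most
  \<open>h * q0\<close>, a set of measure below \<omega>. One exceptional set serves all active
  returns, since their derivatives differ from the reference by at most
  \<open>h / 2 * q0\<close>.\<close>

lemma shear_estimate:
  assumes e: "\<epsilon> > 0"
  obtains Q where "Q > 0" "\<And>t x. t \<ge> 0 \<Longrightarrow> q (nat \<lfloor>t / c\<rfloor>) x \<ge> Q \<Longrightarrow>
     norm (\<integral>s. chr d \<zeta> (mv x s) * ren k1 \<xi> t (mv x s) \<partial>uI) \<le> \<epsilon>"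
proof -
  \<comment> \<open>The exceptional set then costs at most a quarter of \<epsilon>.\<close>
  define \<omega> where "\<omega> = \<epsilon> / (4 * (B1 + 1))"
  have w: "\<omega> > 0" "B1 * \<omega> \<le> \<epsilon> / 4" using e B_nonneg by (auto simp: \<omega>_def field_simps)
  obtain Cs where Cs: "Cs > 0" "\<And>g \<delta> k. \<delta> \<ge> 0 \<Longrightarrow> k \<in> {- int D..int D} \<Longrightarrow> norm (g k) > Cs * \<delta> \<Longrightarrow>
       measure lborel {s \<in> {0..<1}. norm (trig_sum D g s) \<le> \<delta>} < \<omega>"
    by (rule sublevel_estimate[OF w(1), of D]) (rule that, assumption+)
  \<comment> \<open>Small enough that a coefficient of size \<open>q0 / (D + 1)\<close> beats the
    threshold \<open>Cs * h * q0\<close> of the sublevel estimate.\<close>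
  define h where "h = 1 / (Cs * (real D + 1) + 1)"
  have h0: "Cs * (real D + 1) + 1 > 0" using Cs(1) by (intro add_nonneg_pos mult_nonneg_nonneg) auto
  have h: "h > 0" "Cs * h * (real D + 1) < 1" using h0 by (auto simp: h_def field_simps)
  \<comment> \<open>Off the exceptional set the remainder is at most the square of the ratio of
    \<beta> to \<open>h / 2\<close>, which does not exceed \<omega>.\<close>
  define \<beta> where "\<beta> = h / 2 * min 1 \<omega>"
  have b: "\<beta> > 0" using h w by (simp add: \<beta>_def)
  have bh: "B1 * (\<beta>\<^sup>2 / (h / 2)\<^sup>2) \<le> \<epsilon> / 4"
  proof -
    have "\<beta>\<^sup>2 / (h / 2)\<^sup>2 = (min 1 \<omega>)\<^sup>2" using h by (simp add: \<beta>_def power_mult_distrib power_divide)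
    also have "\<dots> = min 1 \<omega> * min 1 \<omega>" by (simp add: power2_eq_square)
    also have "\<dots> \<le> 1 * \<omega>" using w by (intro mult_mono) auto
    finally have "B1 * (\<beta>\<^sup>2 / (h / 2)\<^sup>2) \<le> B1 * \<omega>" using B_nonneg by (intro mult_left_mono) auto
    then show ?thesis using w by linarith
  qed
  \<comment> \<open>Makes the derivatives of active returns agree up to \<open>h / 2 * q0\<close>;
    being at most 1, it also keeps their \<open>q\<close> below or equal to
    \<open>2 * q0\<close>.\<close>
  define e1 where "e1 = min 1 (h / (4 * pi * real D + 1))"
  have den: "4 * pi * real D + 1 > 0" by (intro add_nonneg_pos) auto
  have e1: "e1 > 0" "e1 \<le> 1" "2 * pi * real D * e1 \<le> h / 2"
  proof -
    show "e1 > 0" "e1 \<le> 1" using h den by (auto simp: e1_def)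
    have "2 * pi * real D * e1 \<le> 2 * pi * real D * (h / (4 * pi * real D + 1))"
      by (intro mult_left_mono) (auto simp: e1_def)
    also have "\<dots> \<le> h / 2" using h den by (simp add: field_simps)
    finally show "2 * pi * real D * e1 \<le> h / 2" .
  qed
  obtain Qr where Qr: "Qr > 0" "\<And>t x s n. t \<ge> 0 \<Longrightarrow> q (nat \<lfloor>t / c\<rfloor>) x \<ge> Qr \<Longrightarrow> \<bar>t - p n (mv x s)\<bar> \<le> m0 \<Longrightarrow>
     dq n (nat \<lfloor>t / c\<rfloor>) x \<le> e1 * q (nat \<lfloor>t / c\<rfloor>) x"
    by (rule relevant_times[OF e1(1)]) (rule that, assumption+)
  define \<mu> where "\<mu> = \<zeta> (d - 1) + \<xi> (d - 1)"
  define Kd where "Kd = (2 * pi * real D)\<^sup>2"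
  \<comment> \<open>Numerator of the terms of order \<open>1 / q0\<close>: the frequency \<mu> comes
    with \<open>1 / A\<close>, the second derivative, at most \<open>2 * Kd * q0\<close>, with the
    inverse square of \<open>A\<close>.\<close>
  define K where "K = B * (2 * pi * \<bar>real_of_int \<mu>\<bar> / \<beta> + 2 * Kd / \<beta>\<^sup>2)"
  have K: "K \<ge> 0" unfolding K_def Kd_def using B_nonneg b by (intro mult_nonneg_nonneg add_nonneg_nonneg) auto
  define Q where "Q = max Qr (4 * K / \<epsilon>) + 1"
  have Q: "Q > 0" using Qr(1) unfolding Q_def by linarith
  show ?thesis
  proof (rule that[OF Q])
    fix t :: real and x
    assume t: "t \<ge> 0" and big: "q (nat \<lfloor>t / c\<rfloor>) x \<ge> Q"
    define n0 where "n0 = nat \<lfloor>t / c\<rfloor>"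
    define q0 where "q0 = q n0 x"
    have q0: "q0 > 0" "q0 \<ge> Qr" "K / q0 \<le> \<epsilon> / 4"
    proof -
      show "q0 > 0" "q0 \<ge> Qr" using big Q unfolding q0_def n0_def Q_def by linarith+
      have "4 * K / \<epsilon> \<le> q0" using big unfolding q0_def n0_def Q_def by linarith
      then show "K / q0 \<le> \<epsilon> / 4" using e \<open>q0 > 0\<close> by (simp add: field_simps)
    qed
    define A where "A = \<beta> * q0"
    have A: "A > 0" using b q0 by (simp add: A_def)
    define P where "P n s = p n (mv x s)" for n s
    define P1 where "P1 n s = Re (trig_sum D (dcoef (g n x)) s)" for n s
    define P2 where "P2 n s = Re (trig_sum D (dcoef (dcoef (g n x))) s)" for n s
    have tP: "trig_sum D (g n x) s = of_real (P n s)" for n s by (simp add: P_def p_mv)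
    have dP: "(P n has_real_derivative P1 n s) (at s)" for n s
      unfolding P1_def by (rule trig_sum_real_derivative(1)[OF tP])
    have tP1: "trig_sum D (dcoef (g n x)) s = of_real (P1 n s)" for n s
      using trig_sum_real_derivative(2)[OF tP, of n s] by (simp add: P1_def complex_eq_iff)
    have dP1: "(P1 n has_real_derivative P2 n s) (at s)" for n s
      unfolding P2_def by (rule trig_sum_real_derivative(1)[OF tP1])
    have cP2: "continuous_on UNIV (P2 n)" for n
      unfolding P2_def[abs_def] by (intro continuous_on_Re trig_sum_continuous)
    have per: "P n 1 = P n 0" "P1 n 1 = P1 n 0" for n
    proof -
      have "complex_of_real (P n 1) = complex_of_real (P n 0)" unfolding tP[symmetric] by (rule trig_sum_periodic)
      then show "P n 1 = P n 0" by simp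
      show "P1 n 1 = P1 n 0" unfolding P1_def by (simp only: trig_sum_periodic)
    qed
    define E where "E n s = cis (2 * pi * (real_of_int \<mu> * s)) *
     ((\<i> * of_real (2 * pi * real_of_int \<mu>) * of_real (P1 n s / ((P1 n s)\<^sup>2 + A\<^sup>2)) + of_real (P2 n s * (A\<^sup>2 - (P1 n s)\<^sup>2) / ((P1 n s)\<^sup>2 + A\<^sup>2)\<^sup>2)) * of_real (k (t - P n s))
       + of_real (k1 (t - P n s) * (A\<^sup>2 / ((P1 n s)\<^sup>2 + A\<^sup>2))))" for n s
    have osc: "(\<integral>s. cis (2 * pi * (real_of_int \<mu> * s)) * of_real (k1 (t - P n s)) \<partial>uI) = (\<integral>s. E n s \<partial>uI)"
      and cE: "continuous_on UNIV (E n)" for n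
      unfolding E_def[abs_def]
      using oscillatory_identity[OF dP[of n] dP1[of n] cP2[of n] per(1)[of n] per(2)[of n] k_deriv k1_cont A, of \<mu> t]
      by simp_all
    have cPn: "continuous_on UNIV (P n)" for n using DERIV_continuous_on[of UNIV "P n" "P1 n"] dP by simp
    have ck: "continuous_on UNIV (\<lambda>s. cis (2 * pi * (real_of_int \<mu> * s)) * complex_of_real (k1 (t - P n s)))" for n
      by (intro continuous_intros continuous_on_compose2[OF k1_cont] cPn) auto
    let ?N = "nat \<lceil>t / m0\<rceil>"
    define al where "al n = chr d \<zeta> x * chr d \<xi> ((T ^^ n) x)" for n
    have nal: "norm (al n) = 1" for n by (simp add: al_def norm_mult)
    have integrand: "chr d \<zeta> (mv x s) * ren k1 \<xi> t (mv x s) = (\<Sum>n<?N. al n * (cis (2 * pi * (real_of_int \<mu> * s)) * of_real (k1 (t - P n s))))" for s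
    proof -
      have "cis (2 * pi * (real_of_int (\<zeta> (d - 1)) * s)) * cis (2 * pi * (real_of_int (\<xi> (d - 1)) * s)) = cis (2 * pi * (real_of_int \<mu> * s))"
        by (simp add: \<mu>_def cis_mult algebra_simps)
      then show ?thesis
        unfolding ren_def sum_distrib_left chr_mv chr_Tn_mv al_def P_def
        by (intro sum.cong refl) (simp add: mult_ac flip: \<open>_ = cis (2 * pi * (real_of_int \<mu> * s))\<close>)
    qed
    have "(\<integral>s. chr d \<zeta> (mv x s) * ren k1 \<xi> t (mv x s) \<partial>uI) = (\<Sum>n<?N. al n * (\<integral>s. cis (2 * pi * (real_of_int \<mu> * s)) * of_real (k1 (t - P n s)) \<partial>uI))"
      unfolding integrand using uI_integrable_continuous[OF ck] by simp
    also have "\<dots> = (\<integral>s. (\<Sum>n<?N. al n * E n s) \<partial>uI)"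
      unfolding osc using uI_integrable_continuous[OF cE] by simp
    finally have eq: "(\<integral>s. chr d \<zeta> (mv x s) * ren k1 \<xi> t (mv x s) \<partial>uI) = (\<integral>s. (\<Sum>n<?N. al n * E n s) \<partial>uI)" .
    \<comment> \<open>Defined through the reference time \<open>n0\<close> alone, hence the same for
      every return.\<close>
    let ?bad = "{s \<in> {0..<1}. norm (trig_sum D (dcoef (g n0 x)) s) \<le> h * q0}"
    have bound: "norm (\<Sum>n<?N. al n * E n s) \<le> \<epsilon> / 2 + B1 * indicator ?bad s" if s: "s \<in> {0..<1}" for s
    proof -
      have "norm (\<Sum>n<?N. al n * E n s) \<le> (\<Sum>n<?N. norm (E n s))"
        by (rule order_trans[OF norm_sum]) (simp add: norm_mult nal)
      also have "\<dots> \<le> \<epsilon> / 2 + B1 * indicator ?bad s"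
      proof (rule hit_sum_le[where t=t and x="mv x s"])
        show "0 \<le> \<epsilon> / 2 + B1 * indicator ?bad s" using e B_nonneg by simp
        fix n assume "n < ?N"
        {
          assume "\<not> (0 < t - p n (mv x s) \<and> t - p n (mv x s) < m0)"
          then have "k (t - P n s) = 0" "k1 (t - P n s) = 0"
            using k_zero[of "t - P n s"] k1_zero[of "t - P n s"] unfolding P_def by linarith+
          then show "E n s = 0" by (simp add: E_def)
        }
        assume hit: "0 < t - p n (mv x s)" "t - p n (mv x s) < m0"
        have dqn: "dq n n0 x \<le> e1 * q0"
          unfolding q0_def n0_def by (rule Qr(2)[of t x n s]) (use t hit q0(2) in \<open>auto simp: q0_def n0_def\<close>)
        have qn: "q n x \<le> 2 * q0"
        proof -
          have "e1 * q0 \<le> 1 * q0" using e1 q0 by (intro mult_right_mono) auto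
          then show ?thesis using q_triangle[of n x n0] dqn unfolding q0_def by linarith
        qed
        have P2b: "\<bar>P2 n s\<bar> \<le> 2 * Kd * q0"
        proof -
          have "\<bar>P2 n s\<bar> \<le> norm (trig_sum D (dcoef (dcoef (g n x))) s)" unfolding P2_def by (rule abs_Re_le_cmod)
          also have "\<dots> \<le> 2 * pi * real D * (\<Sum>m\<in>{- int D..int D} - {0}. 2 * pi * real D * norm (g n x m))"
          proof (rule norm_trig_sum_dcoef_le)
            fix m assume "m \<in> {- int D..int D} - {0}"
            then have "\<bar>real_of_int m\<bar> \<le> real D" by (auto simp: abs_le_iff)
            then show "norm (dcoef (g n x) m) \<le> 2 * pi * real D * norm (g n x m)"
              by (simp add: dcoef_def norm_mult abs_mult mult_right_mono)
          qed
          also have "\<dots> = Kd * q n x" by (simp add: Kd_def q_def sum_distrib_left power2_eq_square mult_ac)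
          also have "\<dots> \<le> Kd * (2 * q0)" using qn by (intro mult_left_mono) (auto simp: Kd_def)
          finally show ?thesis by simp
        qed
        have P1d: "\<bar>P1 n s - P1 n0 s\<bar> \<le> h / 2 * q0"
        proof -
          have "complex_of_real (P1 n s - P1 n0 s) = trig_sum D (dcoef (\<lambda>m. g n x m - g n0 x m)) s"
            unfolding of_real_diff tP1[symmetric] by (simp add: trig_sum_def dcoef_def sum_subtractf[symmetric] algebra_simps)
          then have "\<bar>P1 n s - P1 n0 s\<bar> = norm (trig_sum D (dcoef (\<lambda>m. g n x m - g n0 x m)) s)" by (metis norm_of_real)
          also have "\<dots> \<le> 2 * pi * real D * dq n n0 x" unfolding dq_def by (rule norm_trig_sum_dcoef_le) simp
          also have "\<dots> \<le> 2 * pi * real D * (e1 * q0)" using dqn by (intro mult_left_mono) auto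
          also have "\<dots> = (2 * pi * real D * e1) * q0" by simp
          also have "\<dots> \<le> h / 2 * q0" using e1(3) q0 by (intro mult_right_mono) auto
          finally show ?thesis .
        qed
        let ?w = "P1 n s / ((P1 n s)\<^sup>2 + A\<^sup>2)" and ?w1 = "P2 n s * (A\<^sup>2 - (P1 n s)\<^sup>2) / ((P1 n s)\<^sup>2 + A\<^sup>2)\<^sup>2"
          and ?r = "A\<^sup>2 / ((P1 n s)\<^sup>2 + A\<^sup>2)"
        have "norm (E n s) \<le> (2 * pi * \<bar>real_of_int \<mu>\<bar> * \<bar>?w\<bar> + \<bar>?w1\<bar>) * \<bar>k (t - P n s)\<bar> + \<bar>k1 (t - P n s)\<bar> * \<bar>?r\<bar>"
        proof -
          have "norm (E n s) \<le> norm ((\<i> * of_real (2 * pi * real_of_int \<mu>) * of_real ?w + of_real ?w1) * complex_of_real (k (t - P n s))) + norm (complex_of_real (k1 (t - P n s) * ?r))"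
            unfolding E_def norm_mult norm_cis mult_1 by (rule order_trans[OF norm_triangle_ineq]) (simp add: norm_mult)
          moreover have "norm (\<i> * of_real (2 * pi * real_of_int \<mu>) * of_real ?w + complex_of_real ?w1) \<le> 2 * pi * \<bar>real_of_int \<mu>\<bar> * \<bar>?w\<bar> + \<bar>?w1\<bar>"
          proof -
            have "\<bar>2 * pi * real_of_int \<mu>\<bar> = 2 * pi * \<bar>real_of_int \<mu>\<bar>" by (simp add: abs_mult)
            then show ?thesis
              by (intro order_trans[OF norm_triangle_ineq])
                (simp only: norm_mult[of "\<i> * _"] norm_mult[of \<i>] norm_ii norm_of_real mult_1 order_refl)
          qed
          ultimately show ?thesis
            unfolding norm_mult norm_of_real abs_mult[of "k1 _"] by (smt (verit, best) abs_ge_zero mult_right_mono)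
        qed
        also have "\<dots> \<le> (2 * pi * \<bar>real_of_int \<mu>\<bar> * (1 / A) + 2 * Kd * q0 / A\<^sup>2) * B + B1 * \<bar>?r\<bar>"
        proof (intro add_mono mult_mono k_bound k1_bound mult_left_mono weight_bounds(1)[OF A])
          show "\<bar>?w1\<bar> \<le> 2 * Kd * q0 / A\<^sup>2"
            using weight_bounds(2)[OF A, of "P2 n s" "P1 n s"] divide_right_mono[OF P2b, of "A\<^sup>2"] by simp
        qed (use A q0 B_nonneg in \<open>auto simp: Kd_def\<close>)
        also have "(2 * pi * \<bar>real_of_int \<mu>\<bar> * (1 / A) + 2 * Kd * q0 / A\<^sup>2) * B = K / q0"
          using b q0 by (simp add: K_def A_def power2_eq_square field_simps)
        finally have En: "norm (E n s) \<le> \<epsilon> / 4 + B1 * \<bar>?r\<bar>" using q0(3) by linarith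
        show "norm (E n s) \<le> \<epsilon> / 2 + B1 * indicator ?bad s"
        proof (cases "s \<in> ?bad")
          case True
          have "B1 * \<bar>?r\<bar> \<le> B1 * 1" by (intro mult_left_mono weight_bounds(3)[OF A] B_nonneg)
          then show ?thesis using En True e by simp
        next
          case False
          then have "\<bar>P1 n0 s\<bar> > h * q0" using s tP1[of n0 s] by simp
          then have P1n: "\<bar>P1 n s\<bar> \<ge> h / 2 * q0" using P1d by linarith
          have "\<bar>?r\<bar> \<le> A\<^sup>2 / (h / 2 * q0)\<^sup>2" by (rule weight_bounds(4)[OF A _ P1n]) (use h q0 in simp)
          also have "\<dots> = \<beta>\<^sup>2 / (h / 2)\<^sup>2" using q0 by (simp add: A_def power_mult_distrib power_divide)
          finally have "B1 * \<bar>?r\<bar> \<le> B1 * (\<beta>\<^sup>2 / (h / 2)\<^sup>2)" by (intro mult_left_mono B_nonneg)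
          moreover have "B1 * indicator ?bad s = 0" using False by simp
          ultimately show ?thesis using En bh by linarith
        qed
      qed
      finally show ?thesis .
    qed
    have badm: "measure lborel ?bad < \<omega>"
    proof -
      \<comment> \<open>There are \<open>2 * D\<close> oscillating coefficients with sum
        \<open>q0\<close>, so one of them exceeds the share \<open>q0 / (2 * D + 1)\<close>.\<close>
      have "\<exists>m\<in>{- int D..int D} - {0}. norm (g n0 x m) > q0 / (2 * real D + 1)"
      proof (rule ccontr)
        assume "\<not> ?thesis"
        then have "q0 \<le> (\<Sum>m\<in>{- int D..int D} - {0}. q0 / (2 * real D + 1))"
          unfolding q0_def q_def by (intro sum_mono) (auto simp: not_less)
        also have "\<dots> = 2 * real D * (q0 / (2 * real D + 1))" by (simp add: card_Diff_singleton)
        also have "\<dots> < q0" using q0 by (simp add: field_simps)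
        finally show False by simp
      qed
      then obtain m where m: "m \<in> {- int D..int D}" "m \<noteq> 0" "norm (g n0 x m) > q0 / (2 * real D + 1)" by blast
      have "Cs * (h * q0) < q0 / (real D + 1)"
        using mult_strict_right_mono[OF h(2) q0(1)] by (simp add: field_simps)
      also have "q0 / (real D + 1) \<le> 2 * (q0 / (2 * real D + 1))" using q0 by (simp add: field_simps)
      also have "\<dots> \<le> 2 * pi * \<bar>real_of_int m\<bar> * norm (g n0 x m)"
      proof -
        have "1 * 1 \<le> pi * \<bar>real_of_int m\<bar>" using m(2) pi_gt3 by (intro mult_mono) linarith+
        then have "1 * (q0 / (2 * real D + 1)) \<le> pi * \<bar>real_of_int m\<bar> * norm (g n0 x m)"
          using m(3) q0 by (intro mult_mono) auto
        then show ?thesis by linarith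
      qed
      also have "\<dots> = norm (dcoef (g n0 x) m)" by (simp add: dcoef_def norm_mult abs_mult)
      finally show ?thesis by (intro Cs(2)[OF _ m(1)]) (use h q0 in auto)
    qed
    have badsets: "?bad \<in> sets borel" by measurable
    have badU: "?bad \<in> sets uI" using badsets by (auto simp: sets_restrict_space_iff)
    have mU: "measure uI ?bad = measure lborel ?bad" by (rule measure_restrict_space) auto
    have intb: "integrable uI (\<lambda>s. \<epsilon> / 2 + B1 * indicator ?bad s)"
      using badU by (intro Bochner_Integration.integrable_add integrable_mult_right integrable_real_indicator) (auto simp: uI.emeasure_eq_measure)
    have "norm (\<integral>s. (\<Sum>n<?N. al n * E n s) \<partial>uI) \<le> (\<integral>s. \<epsilon> / 2 + B1 * indicator ?bad s \<partial>uI)"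
    proof (rule order_trans[OF integral_norm_bound integral_mono])
      show "integrable uI (\<lambda>s. norm (\<Sum>n<?N. al n * E n s))" using uI_integrable_continuous[OF cE] by simp
    qed (use bound intb in \<open>auto simp: space_restrict_space\<close>)
    also have "\<dots> = \<epsilon> / 2 + B1 * measure uI ?bad"
    proof -
      have "integrable uI (indicator ?bad :: real \<Rightarrow> real)" using badU by (intro integrable_real_indicator) (auto simp: uI.emeasure_eq_measure)
      moreover have "?bad \<inter> space uI = ?bad" by (auto simp: space_restrict_space)
      ultimately show ?thesis using uI.prob_space by simp
    qed
    also have "\<dots> \<le> \<epsilon> / 2 + B1 * \<omega>" using badm mU B_nonneg by (intro add_left_mono mult_left_mono) auto
    also have "\<dots> \<le> \<epsilon>" using w e by linarith
    finally show "norm (\<integral>s. chr d \<zeta> (mv x s) * ren k1 \<xi> t (mv x s) \<partial>uI) \<le> \<epsilon>" unfolding eq .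
  qed
qed

text \<open>Off a set of small measure \<open>q\<close> is large and the fibre integral is small; on
  that set the renewal sum is still bounded by \<open>B1\<close>.\<close>

lemma correlation_derivative_small:
  assumes e: "\<epsilon> > 0"
  obtains t1 where "t1 \<ge> 0" "\<And>t. t \<ge> t1 \<Longrightarrow> norm (\<integral>x. chr d \<zeta> x * ren k1 \<xi> t x \<partial>lam d) \<le> \<epsilon>"
proof -
  interpret L: prob_space "lam d" by simp
  have e2: "\<epsilon> / 2 > 0" using e by simp
  obtain Q where Q: "Q > 0" "\<And>t x. t \<ge> 0 \<Longrightarrow> q (nat \<lfloor>t / c\<rfloor>) x \<ge> Q \<Longrightarrow>
     norm (\<integral>s. chr d \<zeta> (mv x s) * ren k1 \<xi> t (mv x s) \<partial>uI) \<le> \<epsilon> / 2"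
    by (rule shear_estimate[OF e2, of \<zeta> \<xi>]) (rule that, assumption+)
  have "\<epsilon> / (2 * (B1 + 1)) > 0" using e B_nonneg by simp
  then obtain n1 where n1: "\<And>n. n \<ge> n1 \<Longrightarrow> measure (lam d) {x \<in> cube d. q n x \<le> Q} < \<epsilon> / (2 * (B1 + 1))"
    using q_spreads by blast
  show ?thesis
  proof (rule that[of "c * real (Suc n1)"])
    show "0 \<le> c * real (Suc n1)" using c_pos by simp
    fix t assume t: "t \<ge> c * real (Suc n1)"
    have t0: "t \<ge> 0" using t c_pos by (meson mult_nonneg_nonneg of_nat_0_le_iff order_trans less_imp_le)
    define n0 where "n0 = nat \<lfloor>t / c\<rfloor>"
    have "real (Suc n1) \<le> t / c" using t c_pos by (simp add: field_simps)
    then have n0: "n0 \<ge> n1" unfolding n0_def by (simp add: le_nat_floor nat_le_iff le_floor_iff)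
    let ?J = "\<lambda>x. \<integral>s. chr d \<zeta> (mv x s) * ren k1 \<xi> t (mv x s) \<partial>uI"
    let ?bad = "{x \<in> cube d. q n0 x \<le> Q}"
    have bad: "?bad \<in> sets (lam d)" by (simp only: space_lam[symmetric]) measurable
    have J: "norm (?J x) \<le> \<epsilon> / 2 + B1 * indicator ?bad x" if x: "x \<in> cube d" for x
    proof (cases "x \<in> ?bad")
      case True
      have "norm (?J x) \<le> (\<integral>s. norm (chr d \<zeta> (mv x s) * ren k1 \<xi> t (mv x s)) \<partial>uI)" by (rule integral_norm_bound)
      also have "\<dots> \<le> (\<integral>s. B1 \<partial>uI)"
        by (rule integral_mono') (use ren_bound[of k1 B1, OF k1_zero k1_bound] B_nonneg in \<open>auto simp: norm_mult\<close>)
      also have "\<dots> = B1" using prob_space.prob_space[OF prob_space_unit] by simp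
      finally show ?thesis using True e by simp
    next
      case False
      then have "q n0 x \<ge> Q" using x by simp
      then show ?thesis using Q(2)[OF t0, of x] False unfolding n0_def by simp
    qed
    have intb: "integrable (lam d) (\<lambda>x. \<epsilon> / 2 + B1 * indicator ?bad x)"
      using bad by (intro Bochner_Integration.integrable_add integrable_mult_right integrable_real_indicator) (auto simp: L.emeasure_eq_measure)
    have k1m: "k1 \<in> borel_measurable borel" using k1_cont by (rule borel_measurable_continuous_onI)
    have "norm (\<integral>x. chr d \<zeta> x * ren k1 \<xi> t x \<partial>lam d) = norm (\<integral>x. ?J x \<partial>lam d)"
      by (subst average_last_coordinate[OF k1m k1_zero k1_bound]) auto
    also have "\<dots> \<le> (\<integral>x. norm (?J x) \<partial>lam d)" by (rule integral_norm_bound)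
    also have "\<dots> \<le> (\<integral>x. \<epsilon> / 2 + B1 * indicator ?bad x \<partial>lam d)"
    proof (rule integral_mono'[OF intb])
      show "0 \<le> \<epsilon> / 2 + B1 * indicator ?bad x" for x using e B_nonneg by simp
    qed (use J in auto)
    also have "\<dots> = \<epsilon> / 2 + B1 * measure (lam d) ?bad"
    proof -
      have "integrable (lam d) (indicator ?bad :: _ \<Rightarrow> real)" using bad by (intro integrable_real_indicator) (auto simp: L.emeasure_eq_measure)
      moreover have "?bad \<inter> space (lam d) = ?bad" by auto
      ultimately show ?thesis using L.prob_space by simp
    qed
    also have "\<dots> \<le> \<epsilon> / 2 + B1 * (\<epsilon> / (2 * (B1 + 1)))" using n1[OF n0] B_nonneg by (intro add_left_mono mult_left_mono) auto
    also have "\<dots> \<le> \<epsilon>" using e B_nonneg by (simp add: field_simps)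
    finally show "norm (\<integral>x. chr d \<zeta> x * ren k1 \<xi> t x \<partial>lam d) \<le> \<epsilon>" .
  qed
qed

end

text \<open>Subtracting the linear function with the same increment makes the primitive
  periodic.\<close>

lemma uI_FTC:
  fixes F f :: "real \<Rightarrow> complex"
  assumes F: "\<And>s. (F has_vector_derivative f s) (at s)" and f: "continuous_on UNIV f"
  shows "(\<integral>s. f s \<partial>uI) = F 1 - F 0"
proof -
  let ?D = "F 1 - F 0"
  have "(\<integral>s. f s - ?D \<partial>uI) = 0"
  proof (rule uI_FTC_periodic[of "\<lambda>s. F s - s *\<^sub>R ?D"])
    show "((\<lambda>s. F s - s *\<^sub>R ?D) has_vector_derivative f s - ?D) (at s)" for s
      by (auto intro!: derivative_eq_intros F)
    show "continuous_on UNIV (\<lambda>s. f s - ?D)" by (intro continuous_intros f)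
  qed simp
  then show ?thesis using uI_integrable_continuous[OF f] prob_space.prob_space[OF prob_space_unit] by simp
qed

context trig_suspension
begin

section \<open>Time averages of renewal sums\<close>

lemma ren_eq:
  assumes "\<And>r. r \<le> 0 \<Longrightarrow> f r = 0" and N: "nat \<lceil>t / m0\<rceil> \<le> N"
  shows "ren f \<xi> t x = (\<Sum>n<N. chr d \<xi> ((T ^^ n) x) * of_real (f (t - p n x)))"
  unfolding ren_def
proof (rule sum.mono_neutral_left)
  show "\<forall>n\<in>{..<N} - {..<nat \<lceil>t / m0\<rceil>}. chr d \<xi> ((T ^^ n) x) * complex_of_real (f (t - p n x)) = 0"
  proof
    fix n assume "n \<in> {..<N} - {..<nat \<lceil>t / m0\<rceil>}"
    then have "t / m0 \<le> real n" by (simp add: nat_le_iff ceiling_le_iff)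
    then have "t \<le> p n x" using p_lower[of n x] m0 by (simp add: field_simps)
    then show "chr d \<xi> ((T ^^ n) x) * complex_of_real (f (t - p n x)) = 0" using assms(1)[of "t - p n x"] by simp
  qed
qed (use N in auto)

definition M1 :: real where "M1 = (\<Sum>\<xi>\<in>F. norm (cf \<xi>))"

lemma Psi_upper: "\<Psi> x \<le> M1"
proof -
  have "norm (complex_of_real (\<Psi> x)) \<le> (\<Sum>\<xi>\<in>F. norm (cf \<xi> * chr d \<xi> x))" unfolding Psi by (rule norm_sum)
  then show ?thesis by (simp add: norm_mult M1_def)
qed

lemma M1_pos: "M1 > 0" using Psi_lower Psi_upper m0 by (meson less_le_trans order_trans)

lemma sn_sublinear:
  assumes "e > 0"
  obtains C where "C \<ge> 0" "\<And>n x. \<bar>sn n x\<bar> \<le> e * real n + C"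
proof -
  obtain C where C: "C \<ge> 0" "\<And>n x. q n x \<le> e * real n + C" by (rule q_sublinear[OF assms]) (rule that, assumption+)
  have CU: "CU \<ge> 0" using const_part[of 0] order_trans[OF norm_ge_zero] by blast
  show ?thesis
  proof (rule that[of "C + CU"])
    show "\<bar>sn n x\<bar> \<le> e * real n + (C + CU)" for n x using sn_le_q[of n x] C(2)[of n x] by linarith
  qed (use C CU in simp)
qed

text \<open>Strict monotonicity of the Birkhoff sums makes the returns before time \<open>t\<close>
  an initial segment; the overshoot is at most one value of \<Psi>.\<close>

lemma first_passage:
  assumes "t \<ge> 0"
  obtains n where "\<And>m. m < n \<longleftrightarrow> p m x < t" "t \<le> p n x" "p n x \<le> t + M1"
proof -
  define n where "n = (LEAST n. t \<le> p n x)"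
  obtain N :: nat where "t / m0 \<le> real N" using real_arch_simple by blast
  then have "t \<le> p N x" using p_lower[of N x] m0 by (simp add: field_simps)
  then have n: "t \<le> p n x" unfolding n_def by (rule LeastI)
  have below: "p m x < t" if "m < n" for m using not_less_Least[of m "\<lambda>n. t \<le> p n x"] that by (simp add: n_def)
  have "p n x \<le> t + M1"
  proof (cases n)
    case 0 then show ?thesis using assms M1_pos by (simp add: birkhoff_sum_def)
  next
    case (Suc m)
    then show ?thesis using below[of m] Psi_upper[of "(T ^^ m) x"] by (simp add: p_Suc)
  qed
  moreover have "m < n \<longleftrightarrow> p m x < t" for m
  proof
    assume "p m x < t"
    show "m < n"
    proof (rule ccontr)
      assume "\<not> m < n"
      then have "p n x \<le> p m x" using p_mono[of n m x] m0 by (cases "m = n") auto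
      then show False using n \<open>p m x < t\<close> by simp
    qed
  qed (rule below)
  ultimately show ?thesis using n that by blast
qed

text \<open>Over a stretch of flow time \<open>L\<close> the number of returns is
  \<open>L / c\<close> up to a sublinear error, and nontrivial characters sum to a sublinear amount.
  There are at most \<open>(L + M1) / m0\<close> returns, which converts bounds in \<open>n\<close>
  into bounds in \<open>L\<close>.\<close>

lemma csum_count_limit:
  assumes e: "e > 0"
  obtains C where "C \<ge> 0" "\<And>x L n. L > 0 \<Longrightarrow> \<bar>p n x - L\<bar> \<le> M1 \<Longrightarrow>
    norm (csum \<xi> n x - (if \<forall>j<d. \<xi> j = 0 then of_real (L / c) else 0)) \<le> e * L + C"
proof -
  \<comment> \<open>The factor \<open>m0\<close> pays for the conversion from \<open>n\<close> to
    \<open>L\<close>, the factor \<open>c\<close> for the division by \<open>c\<close>.\<close>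
  define e1 where "e1 = min e (e * c) * m0"
  have e1: "e1 > 0" "e1 / m0 \<le> e" "e1 / m0 / c \<le> e"
    using e c_pos m0 by (auto simp: e1_def min_def field_simps)
  have count: "real n \<le> (L + M1) / m0" if "\<bar>p n x - L\<bar> \<le> M1" for n x L
    using p_lower[of n x] that m0 by (simp add: field_simps)
  show ?thesis
  proof (cases "\<forall>j<d. \<xi> j = 0")
    case True
    obtain C where C: "C \<ge> 0" "\<And>n x. \<bar>sn n x\<bar> \<le> e1 * real n + C" by (rule sn_sublinear[OF e1(1)]) (rule that, assumption+)
    define C' where "C' = (e1 * (M1 / m0) + C + M1) / c"
    have C': "C' \<ge> 0" unfolding C'_def using e1 M1_pos m0 C c_pos by (intro divide_nonneg_pos add_nonneg_nonneg mult_nonneg_nonneg) auto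
    show ?thesis
    proof (rule that[OF C'])
      fix x L n assume L: "L > 0" "\<bar>p n x - L\<bar> \<le> M1"
      have "csum \<xi> n x = of_real (real n)" using True by (simp add: csum_def chr_zero)
      then have "norm (csum \<xi> n x - (if \<forall>j<d. \<xi> j = 0 then of_real (L / c) else 0)) = \<bar>real n - L / c\<bar>"
        by (simp only: if_P[OF True] of_real_diff[symmetric] norm_of_real)
      also have "\<dots> = \<bar>real n * c - L\<bar> / c" using c_pos by (simp add: field_simps abs_divide[symmetric] flip: abs_of_pos)
      also have "\<dots> \<le> (e1 * ((L + M1) / m0) + C + M1) / c"
      proof (rule divide_right_mono)
        have "e1 * real n \<le> e1 * ((L + M1) / m0)" using count[OF L(2)] e1 by (intro mult_left_mono) auto
        then show "\<bar>real n * c - L\<bar> \<le> e1 * ((L + M1) / m0) + C + M1"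
          using C(2)[of n x] L(2) unfolding sn_def by linarith
      qed (use c_pos in simp)
      also have "\<dots> = e1 / m0 / c * L + C'" by (simp add: C'_def add_divide_distrib distrib_left)
      also have "\<dots> \<le> e * L + C'" using e1(3) L by (intro add_right_mono mult_right_mono) auto
      finally show "norm (csum \<xi> n x - (if \<forall>j<d. \<xi> j = 0 then of_real (L / c) else 0)) \<le> e * L + C'" .
    qed
  next
    case False
    then have "weyl \<xi>" by (intro weyl_nonzero) auto
    then obtain C where C: "C \<ge> 0" "\<And>x n. norm (csum \<xi> n x) \<le> e1 * real n + C"
      using e1(1) unfolding weyl_def by blast
    have C': "e1 * (M1 / m0) + C \<ge> 0" using e1 M1_pos m0 C by (intro add_nonneg_nonneg mult_nonneg_nonneg) auto
    show ?thesis
    proof (rule that[OF C'])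
      fix x L n assume L: "L > 0" "\<bar>p n x - L\<bar> \<le> M1"
      have "norm (csum \<xi> n x) \<le> e1 * ((L + M1) / m0) + C"
        using C(2)[of n x] mult_left_mono[OF count[OF L(2)], of e1] e1 by linarith
      also have "\<dots> = e1 / m0 * L + (e1 * (M1 / m0) + C)" by (simp add: add_divide_distrib distrib_left)
      also have "\<dots> \<le> e * L + (e1 * (M1 / m0) + C)" using e1(2) L by (intro add_right_mono mult_right_mono) auto
      finally show "norm (csum \<xi> n x - (if \<forall>j<d. \<xi> j = 0 then of_real (L / c) else 0)) \<le> e * L + (e1 * (M1 / m0) + C)"
        using False by (simp only: if_False diff_zero)
    qed
  qed
qed

end

context cutoff
begin

definition Kint :: real where "Kint = (\<integral>r. k r \<partial>lborel)"

text \<open>The total contribution of one return to the time integral over a window of length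
  \<open>L\<close>; \<open>u\<close> is the height relative to that return at the start of the
  window.\<close>

definition kwin :: "real \<Rightarrow> real \<Rightarrow> real" where
  "kwin u L = (\<integral>z. indicator {u..<u + L} z * k z \<partial>lborel)"

lemma k_cont: "continuous_on UNIV k"
  using DERIV_continuous_on[of UNIV k k1] k_deriv by simp

lemma k_measurable [measurable]: "k \<in> borel_measurable borel" and k1_measurable [measurable]: "k1 \<in> borel_measurable borel"
  using k_cont k1_cont by (auto intro: borel_measurable_continuous_onI)

lemma k_nonzero: "k r \<noteq> 0 \<Longrightarrow> 0 < r \<and> r < m0" using k_zero[of r] by force

lemma kwin_bound: "\<bar>kwin u L\<bar> \<le> B * m0"
proof -
  have "\<bar>kwin u L\<bar> \<le> (\<integral>z. \<bar>indicator {u..<u + L} z * k z\<bar> \<partial>lborel)"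
    unfolding kwin_def by (rule integral_abs_bound)
  also have "\<dots> \<le> (\<integral>z. B * indicator {0..m0} z \<partial>lborel)"
  proof (rule integral_mono')
    fix z
    show "\<bar>indicator {u..<u + L} z * k z\<bar> \<le> B * indicator {0..m0} z"
      using k_bound[of z] k_zero[of z] B_nonneg by (auto simp: indicator_def)
    show "integrable lborel (\<lambda>z. B * indicator {0..m0} z)"
      by (intro integrable_mult_right integrable_real_indicator) (use m0 in auto)
  qed (use B_nonneg in auto)
  also have "\<dots> = B * m0" using m0 by simp
  finally show ?thesis .
qed

lemma Kint_bound: "\<bar>Kint\<bar> \<le> B * m0"
proof -
  have "Kint = kwin 0 m0"
    unfolding Kint_def kwin_def by (rule Bochner_Integration.integral_cong) (use k_nonzero in \<open>simp_all add: indicator_def, meson less_eq_real_def\<close>)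
  then show ?thesis using kwin_bound by simp
qed

lemma kwin_eq:
  assumes "L > 0"
  shows "u \<le> 0 \<Longrightarrow> m0 \<le> u + L \<Longrightarrow> kwin u L = Kint" "u \<ge> m0 \<Longrightarrow> kwin u L = 0" "u + L \<le> 0 \<Longrightarrow> kwin u L = 0"
proof -
  show "kwin u L = Kint" if "u \<le> 0" "m0 \<le> u + L"
    unfolding Kint_def kwin_def proof (rule Bochner_Integration.integral_cong)
    fix z show "indicator {u..<u + L} z * k z = k z" using k_nonzero[of z] that by (cases "k z = 0") (auto simp: indicator_def)
  qed simp
  have z: "kwin u L = (\<integral>z. 0 \<partial>(lborel :: real measure))" if "u \<ge> m0 \<or> u + L \<le> 0"
    unfolding kwin_def proof (rule Bochner_Integration.integral_cong)
    fix z show "indicator {u..<u + L} z * k z = 0" using k_nonzero[of z] that by (cases "k z = 0") (auto simp: indicator_def)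
  qed simp
  show "u \<ge> m0 \<Longrightarrow> kwin u L = 0" "u + L \<le> 0 \<Longrightarrow> kwin u L = 0" using z by auto
qed

lemma k_window: "L > 0 \<Longrightarrow> L * (\<integral>s. k (u + L * s) \<partial>uI) = kwin u L"
proof -
  assume L: "L > 0"
  have "(\<integral>s. k (u + L * s) \<partial>uI) = (\<integral>s. indicator {0..<1} s *\<^sub>R k (u + L * s) \<partial>lborel)"
    by (subst integral_restrict_space) auto
  also have "\<dots> = (\<integral>s. indicator {u..<u + L} (u + L * s) * k (u + L * s) \<partial>lborel)"
    by (rule Bochner_Integration.integral_cong) (use L in \<open>auto simp: indicator_def zero_le_mult_iff\<close>)
  finally show ?thesis
    using lborel_integral_real_affine[of L "\<lambda>z. indicator {u..<u + L} z * k z" u] L by (simp add: kwin_def)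
qed

definition Av :: "(nat \<Rightarrow> int) \<Rightarrow> real \<Rightarrow> real \<Rightarrow> (nat \<Rightarrow> real) \<Rightarrow> complex" where
  "Av \<xi> L t x = (\<integral>s. ren k \<xi> (t + L * s) x \<partial>uI)"

lemma ren_interval:
  fixes f :: "real \<Rightarrow> real" and t L s :: real
  assumes "\<And>r. r \<le> 0 \<Longrightarrow> f r = 0" "L > 0" "s \<in> {0..1}"
  shows "ren f \<xi> (t + L * s) x = (\<Sum>n<nat \<lceil>(t + L) / m0\<rceil>. chr d \<xi> ((T ^^ n) x) * of_real (f (t + L * s - p n x)))"
proof (rule ren_eq[OF assms(1)])
  have "t + L * s \<le> t + L" using assms by (simp add: mult_left_le)
  then have "(t + L * s) / m0 \<le> (t + L) / m0" using m0 by (intro divide_right_mono) auto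
  then show "nat \<lceil>(t + L * s) / m0\<rceil> \<le> nat \<lceil>(t + L) / m0\<rceil>" by (intro nat_mono ceiling_mono)
qed

text \<open>After exchanging sum and time integral, each return inside the window contributes
  \<open>Kint\<close>. Only a return whose bump straddles a window end can contribute differently,
  and there is at most one at each end; what remains is a character sum over the returns in the
  window.\<close>

lemma Av_limit:
  assumes e: "e > 0"
  obtains C where "C \<ge> 0" "\<And>t x L. t \<ge> 0 \<Longrightarrow> L > 0 \<Longrightarrow>
    norm (of_real L * Av \<xi> L t x - (if \<forall>j<d. \<xi> j = 0 then of_real (L * Kint / c) else 0)) \<le> e * L + C"
proof -
  have e1: "e / (\<bar>Kint\<bar> + 1) > 0" using e by simp
  obtain C where C: "C \<ge> 0" "\<And>x L n. L > 0 \<Longrightarrow> \<bar>p n x - L\<bar> \<le> M1 \<Longrightarrow>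
    norm (csum \<xi> n x - (if \<forall>j<d. \<xi> j = 0 then of_real (L / c) else 0)) \<le> e / (\<bar>Kint\<bar> + 1) * L + C"
    by (rule csum_count_limit[OF e1, of \<xi>]) (rule that, assumption+)
  \<comment> \<open>The last term stands for the two window ends, each with at most one exceptional
    return of deviation at most \<open>2 * B * m0\<close>.\<close>
  define C' where "C' = \<bar>Kint\<bar> * C + 4 * (B * m0)"
  have C': "C' \<ge> 0" using C B_nonneg m0 by (simp add: C'_def)
  show ?thesis
  proof (rule that[OF C'])
    fix t L :: real and x assume t: "t \<ge> 0" and L: "L > 0"
    let ?N = "nat \<lceil>(t + L) / m0\<rceil>"
    let ?chi = "\<lambda>n. chr d \<xi> ((T ^^ n) x)"
    have "Av \<xi> L t x = (\<integral>s. (\<Sum>n<?N. ?chi n * of_real (k (t + L * s - p n x))) \<partial>uI)"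
      unfolding Av_def
      by (rule Bochner_Integration.integral_cong) (use ren_interval[of k L _ \<xi> t x] k_zero L in \<open>auto simp: space_restrict_space\<close>)
    also have "\<dots> = (\<Sum>n<?N. ?chi n * of_real (\<integral>s. k ((t - p n x) + L * s) \<partial>uI))"
    proof -
      have "integrable uI (\<lambda>s. k (t + L * s - p n x))" for n
        by (intro uI_integrable_continuous continuous_on_compose2[OF k_cont] continuous_intros) auto
      then show ?thesis by (simp add: algebra_simps)
    qed
    finally have "of_real L * Av \<xi> L t x = (\<Sum>n<?N. ?chi n * of_real (L * (\<integral>s. k ((t - p n x) + L * s) \<partial>uI)))"
      by (simp add: sum_distrib_left mult_ac)
    then have LAv: "of_real L * Av \<xi> L t x = (\<Sum>n<?N. ?chi n * of_real (kwin (t - p n x) L))"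
      by (simp only: k_window[OF L])
    obtain n1 where n1: "\<And>m. m < n1 \<longleftrightarrow> p m x < t" "t \<le> p n1 x" "p n1 x \<le> t + M1"
      by (rule first_passage[OF t]) (rule that, assumption+)
    have tL: "t + L \<ge> 0" using t L by simp
    obtain n2 where n2: "\<And>m. m < n2 \<longleftrightarrow> p m x < t + L" "t + L \<le> p n2 x" "p n2 x \<le> t + L + M1"
      by (rule first_passage[OF tL]) (rule that, assumption+)
    have n12: "n1 \<le> n2"
    proof (rule ccontr)
      assume "\<not> n1 \<le> n2"
      then have "p n2 x < t" using n1(1)[of n2] by simp
      then show False using n2(2) L by simp
    qed
    have n2N: "n2 \<le> ?N"
    proof (rule ccontr)
      assume "\<not> n2 \<le> ?N"
      then have "p ?N x < t + L" using n2(1)[of ?N] by simp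
      moreover have "(t + L) / m0 \<le> real ?N" by (rule real_nat_ceiling_ge)
      then have "t + L \<le> real ?N * m0" using m0 by (simp add: field_simps)
      ultimately show False using p_lower[of ?N x] by linarith
    qed
    let ?in = "\<lambda>n. if n1 \<le> n \<and> n < n2 then Kint else 0"
    define \<delta> where "\<delta> n = kwin (t - p n x) L - ?in n" for n
    have inwin: "n1 \<le> n \<longleftrightarrow> t \<le> p n x" "n < n2 \<longleftrightarrow> p n x < t + L" for n
      using n1(1)[of n] n2(1)[of n] by linarith+
    \<comment> \<open>\<open>\<delta>1\<close> collects the return at the left end,
      \<open>\<delta>2\<close> the rest, to which only a return at the right end
      contributes.\<close>
    define \<delta>1 where "\<delta>1 n = (if 0 < t - p n x \<and> t - p n x < m0 then ?chi n * of_real (\<delta> n) else 0)" for n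
    define \<delta>2 where "\<delta>2 n = (if 0 < t - p n x \<and> t - p n x < m0 then 0 else ?chi n * of_real (\<delta> n))" for n
    have db: "norm (?chi n * of_real (\<delta> n)) \<le> 2 * (B * m0)" for n
    proof -
      have "\<bar>\<delta> n\<bar> \<le> 2 * (B * m0)"
        using kwin_bound[of "t - p n x" L] Kint_bound unfolding \<delta>_def by (auto split: if_splits)
      then show ?thesis by (simp add: norm_mult)
    qed
    have Bm: "0 \<le> 2 * (B * m0)" using B_nonneg m0 by simp
    have s1: "(\<Sum>n<?N. norm (\<delta>1 n)) \<le> 2 * (B * m0)"
      by (rule hit_sum_le[where t=t and x=x, OF Bm]) (use db in \<open>auto simp: \<delta>1_def\<close>)
    have s2: "(\<Sum>n<?N. norm (\<delta>2 n)) \<le> 2 * (B * m0)"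
    proof (rule hit_sum_le[where t="t + L" and x=x, OF Bm])
      show "norm (\<delta>2 n) \<le> 2 * (B * m0)" for n using db[of n] Bm by (simp add: \<delta>2_def)
      fix n assume miss: "\<not> (0 < t + L - p n x \<and> t + L - p n x < m0)"
      show "\<delta>2 n = 0"
      proof (cases "0 < t - p n x \<and> t - p n x < m0")
        case False
        consider "p n x \<ge> t + L" | "p n x + m0 \<le> t" | "t \<le> p n x" "p n x + m0 \<le> t + L"
          using False miss by linarith
        then have "\<delta> n = 0"
        proof cases
          case 1
          then have "\<not> n < n2" using inwin(2) by simp
          then show ?thesis using kwin_eq(3)[OF L, of "t - p n x"] 1 by (simp add: \<delta>_def)
        next
          case 2
          then have "\<not> n1 \<le> n" using inwin(1)[of n] m0 by simp
          then show ?thesis using kwin_eq(2)[OF L, of "t - p n x"] 2 by (simp add: \<delta>_def)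
        next
          case 3
          then have "n1 \<le> n" "n < n2" using inwin[of n] m0 by auto
          then show ?thesis using kwin_eq(1)[OF L, of "t - p n x"] 3 by (simp add: \<delta>_def)
        qed
        then show ?thesis by (simp add: \<delta>2_def)
      qed (simp add: \<delta>2_def)
    qed
    have "(\<Sum>n<?N. ?chi n * of_real (?in n)) = of_real Kint * csum \<xi> (n2 - n1) ((T ^^ n1) x)"
    proof -
      have "(\<Sum>n<?N. ?chi n * of_real (?in n)) = (\<Sum>n\<in>{n1..<n2}. ?chi n * of_real Kint)"
        by (rule sum.mono_neutral_cong_right) (use n2N in auto)
      also have "\<dots> = (\<Sum>n\<in>{0..<n2 - n1}. ?chi (n + n1) * of_real Kint)"
        using sum.shift_bounds_nat_ivl[of "\<lambda>n. ?chi n * of_real Kint" 0 n1 "n2 - n1"] n12 by simp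
      finally show ?thesis by (simp add: csum_def funpow_add sum_distrib_left mult.commute atLeast0LessThan)
    qed
    moreover have "(\<Sum>n<?N. ?chi n * of_real (kwin (t - p n x) L)) = (\<Sum>n<?N. ?chi n * of_real (?in n)) + ((\<Sum>n<?N. \<delta>1 n) + (\<Sum>n<?N. \<delta>2 n))"
      unfolding sum.distrib[symmetric] by (rule sum.cong) (auto simp: \<delta>1_def \<delta>2_def \<delta>_def algebra_simps)
    ultimately have LAv2: "of_real L * Av \<xi> L t x = of_real Kint * csum \<xi> (n2 - n1) ((T ^^ n1) x) + ((\<Sum>n<?N. \<delta>1 n) + (\<Sum>n<?N. \<delta>2 n))"
      unfolding LAv by simp
    have "p n2 x = p n1 x + p (n2 - n1) ((T ^^ n1) x)" using p_add[of n1 "n2 - n1" x] n12 by simp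
    then have "\<bar>p (n2 - n1) ((T ^^ n1) x) - L\<bar> \<le> M1" using n1(2,3) n2(2,3) by linarith
    note cs = C(2)[OF L this]
    let ?v = "if \<forall>j<d. \<xi> j = 0 then of_real (L / c) else (0::complex)"
    have "(if \<forall>j<d. \<xi> j = 0 then of_real (L * Kint / c) else 0) = of_real Kint * ?v" by auto
    then have "of_real L * Av \<xi> L t x - (if \<forall>j<d. \<xi> j = 0 then of_real (L * Kint / c) else 0) =
       of_real Kint * (csum \<xi> (n2 - n1) ((T ^^ n1) x) - ?v) + ((\<Sum>n<?N. \<delta>1 n) + (\<Sum>n<?N. \<delta>2 n))"
      unfolding LAv2 by (simp only: right_diff_distrib) simp
    also have "norm \<dots> \<le> \<bar>Kint\<bar> * (e / (\<bar>Kint\<bar> + 1) * L + C) + (2 * (B * m0) + 2 * (B * m0))"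
    proof (intro norm_triangle_le add_mono)
      show "norm (complex_of_real Kint * (csum \<xi> (n2 - n1) ((T ^^ n1) x) - ?v)) \<le> \<bar>Kint\<bar> * (e / (\<bar>Kint\<bar> + 1) * L + C)"
        unfolding norm_mult norm_of_real by (rule mult_left_mono[OF cs]) simp
      show "norm (\<Sum>n<?N. \<delta>1 n) \<le> 2 * (B * m0)" by (rule order_trans[OF norm_sum s1])
      show "norm (\<Sum>n<?N. \<delta>2 n) \<le> 2 * (B * m0)" by (rule order_trans[OF norm_sum s2])
    qed
    also have "\<bar>Kint\<bar> * (e / (\<bar>Kint\<bar> + 1) * L + C) \<le> e * L + \<bar>Kint\<bar> * C"
    proof -
      have "\<bar>Kint\<bar> * (e / (\<bar>Kint\<bar> + 1)) \<le> e" using e by (simp add: field_simps)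
      then have "\<bar>Kint\<bar> * (e / (\<bar>Kint\<bar> + 1)) * L \<le> e * L" using L by (intro mult_right_mono) auto
      then show ?thesis by (simp add: distrib_left mult.assoc)
    qed
    finally show "norm (of_real L * Av \<xi> L t x - (if \<forall>j<d. \<xi> j = 0 then of_real (L * Kint / c) else 0)) \<le> e * L + C'"
      by (simp add: C'_def)
  qed
qed

end

context cutoff
begin

text \<open>Integration by parts in time with the weight \<open>1 - s\<close>, which vanishes at the
  far end: a function is its mean over a window minus a weighted integral of its derivative. This
  combines converging averages with slow variation.\<close>

lemma ren_interval_derivative:
  assumes t: "L > 0"
  shows "ren k \<xi> t x = Av \<xi> L t x - (\<integral>s. of_real (L * (1 - s)) * ren k1 \<xi> (t + L * s) x \<partial>uI)"
proof -
  let ?N = "nat \<lceil>(t + L) / m0\<rceil>"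
  let ?chi = "\<lambda>n. chr d \<xi> ((T ^^ n) x)"
  let ?R = "\<lambda>f s. \<Sum>n<?N. ?chi n * of_real (f (t + L * s - p n x))"
  let ?F = "\<lambda>s. of_real (1 - s) * ?R k s"
  have ck: "continuous_on UNIV (\<lambda>s. k (t + L * s - p n x))" "continuous_on UNIV (\<lambda>s. k1 (t + L * s - p n x))" for n
    by (intro continuous_on_compose2[OF k_cont] continuous_on_compose2[OF k1_cont] continuous_intros; simp)+
  have c1: "continuous_on UNIV (?R k)" and c2: "continuous_on UNIV (\<lambda>s. of_real (L * (1 - s)) * ?R k1 s)"
    by (intro continuous_intros ck)+
  have kd: "((\<lambda>s. k (t + L * s - p n x)) has_real_derivative L * k1 (t + L * s - p n x)) (at s)" for n s
  proof -
    have "((\<lambda>s. t + L * s - p n x) has_real_derivative L) (at s)" by (auto intro!: derivative_eq_intros)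
    from DERIV_chain2[OF k_deriv this] show ?thesis by (simp only: mult.commute)
  qed
  have kv: "((\<lambda>s. complex_of_real (k (t + L * s - p n x))) has_vector_derivative of_real (L * k1 (t + L * s - p n x))) (at s)" for n s
    using kd by (intro has_vector_derivative_of_real) (simp add: has_real_derivative_iff_has_vector_derivative)
  have Rd: "(?R k has_vector_derivative (\<Sum>n<?N. ?chi n * of_real (L * k1 (t + L * s - p n x)))) (at s)" for s
    by (intro has_vector_derivative_sum has_vector_derivative_mult_right kv)
  have one: "((\<lambda>s. complex_of_real (1 - s)) has_vector_derivative of_real (- 1)) (at s)" for s
    by (intro has_vector_derivative_of_real) (auto intro!: derivative_eq_intros simp: has_real_derivative_iff_has_vector_derivative[symmetric])
  have Fd: "(?F has_vector_derivative of_real (L * (1 - s)) * ?R k1 s - ?R k s) (at s)" for s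
  proof -
    have "of_real (1 - s) * (\<Sum>n<?N. ?chi n * complex_of_real (L * k1 (t + L * s - p n x))) + of_real (- 1) * ?R k s
       = of_real (L * (1 - s)) * ?R k1 s - ?R k s"
      by (simp add: sum_distrib_left sum_negf mult_ac)
    then show ?thesis using has_vector_derivative_mult[OF one Rd, of s] by metis
  qed
  have "(\<integral>s. of_real (L * (1 - s)) * ?R k1 s - ?R k s \<partial>uI) = ?F 1 - ?F 0"
    by (rule uI_FTC[OF Fd]) (rule continuous_on_diff[OF c2 c1])
  also have "?F 1 - ?F 0 = - ?R k 0" by simp
  finally have *: "(\<integral>s. of_real (L * (1 - s)) * ?R k1 s - ?R k s \<partial>uI) = - ?R k 0" .
  have alg: "a = - b \<Longrightarrow> a = y - z \<Longrightarrow> b = z - y" for a b y z :: complex by (metis minus_diff_eq minus_minus)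
  note *
  moreover have "(\<integral>s. of_real (L * (1 - s)) * ?R k1 s - ?R k s \<partial>uI) = (\<integral>s. of_real (L * (1 - s)) * ?R k1 s \<partial>uI) - (\<integral>s. ?R k s \<partial>uI)"
    by (rule Bochner_Integration.integral_diff[OF uI_integrable_continuous[OF c2] uI_integrable_continuous[OF c1]])
  ultimately have "?R k 0 = (\<integral>s. ?R k s \<partial>uI) - (\<integral>s. of_real (L * (1 - s)) * ?R k1 s \<partial>uI)"
    by (rule alg)
  moreover have "(\<integral>s. ?R k s \<partial>uI) = Av \<xi> L t x"
    unfolding Av_def
    by (rule Bochner_Integration.integral_cong) (use ren_interval[of k L _ \<xi> t x] k_zero t in \<open>auto simp: space_restrict_space\<close>)
  moreover have "(\<integral>s. of_real (L * (1 - s)) * ?R k1 s \<partial>uI) = (\<integral>s. of_real (L * (1 - s)) * ren k1 \<xi> (t + L * s) x \<partial>uI)"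
    by (rule Bochner_Integration.integral_cong) (use ren_interval[of k1 L _ \<xi> t x] k1_zero t in \<open>auto simp: space_restrict_space\<close>)
  moreover have "?R k 0 = ren k \<xi> t x" using ren_interval[of k L 0 \<xi> t x] k_zero t by simp
  ultimately show ?thesis by simp
qed

lemma ren_joint_measurable:
  assumes [measurable]: "f \<in> borel_measurable borel" and f0: "\<And>r. r \<le> 0 \<Longrightarrow> f r = 0" and L: "L > 0"
  shows "(\<lambda>z. ren f \<xi> (t + L * fst z) (snd z)) \<in> borel_measurable (uI \<Otimes>\<^sub>M lam d)"
proof -
  have [measurable]: "fst \<in> borel_measurable (uI \<Otimes>\<^sub>M lam d)"
    by (rule measurable_compose[OF measurable_fst]) (rule measurable_restrict_space1, simp)
  have [measurable]: "(\<lambda>z. chr d \<xi> ((T ^^ n) (snd z))) \<in> borel_measurable (uI \<Otimes>\<^sub>M lam d)" for n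
    by (rule measurable_compose[OF measurable_snd measurable_compose[OF Tn_measurable chr_measurable]])
  have [measurable]: "(\<lambda>z. p n (snd z)) \<in> borel_measurable (uI \<Otimes>\<^sub>M lam d)" for n
    by (rule measurable_compose[OF measurable_snd p_measurable])
  have "(\<lambda>z. \<Sum>n<nat \<lceil>(t + L) / m0\<rceil>. chr d \<xi> ((T ^^ n) (snd z)) * complex_of_real (f (t + L * fst z - p n (snd z))))
      \<in> borel_measurable (uI \<Otimes>\<^sub>M lam d)" by measurable
  then show ?thesis
    by (rule measurable_cong[THEN iffD2, rotated])
      (use ren_interval[OF f0 L] in \<open>auto simp: space_pair_measure space_restrict_space\<close>)
qed

text \<open>The window length is fixed first, long enough for the time averages to be within
  \<open>e / 2\<close> of the limit. Only then is the time taken large, so that the derivative of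
  the correlation, multiplied by the window length, is at most \<open>e / 4\<close>.\<close>

lemma correlation_limit:
  "((\<lambda>t. \<integral>x. chr d \<zeta> x * ren k \<xi> t x \<partial>lam d) \<longlongrightarrow>
     of_real (if \<forall>j<d. \<xi> j = 0 then Kint / c else 0) * (\<integral>x. chr d \<zeta> x \<partial>lam d)) at_top"
proof (rule tendstoI)
  fix e :: real assume e: "e > 0"
  interpret Ld: prob_space "lam d" by simp
  interpret PU: pair_prob_space uI "lam d" ..
  let ?V = "complex_of_real (if \<forall>j<d. \<xi> j = 0 then Kint / c else 0)"
  have e4: "e / 4 > 0" using e by simp
  obtain C where C: "C \<ge> 0" "\<And>t x L. t \<ge> 0 \<Longrightarrow> L > 0 \<Longrightarrow>
    norm (of_real L * Av \<xi> L t x - (if \<forall>j<d. \<xi> j = 0 then of_real (L * Kint / c) else 0)) \<le> e / 4 * L + C"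
    by (rule Av_limit[OF e4, of \<xi>]) (rule that, assumption+)
  \<comment> \<open>Makes the additive constant \<open>C\<close> at most
    \<open>e / 4 * L\<close>.\<close>
  define L where "L = 4 * C / e + 1"
  have L: "L > 0" "C \<le> e / 4 * L" using C e by (auto simp: L_def field_simps add_nonneg_pos)
  have e4L: "e / (4 * L) > 0" using e L by simp
  obtain t1 where t1: "t1 \<ge> 0" "\<And>t. t \<ge> t1 \<Longrightarrow> norm (\<integral>x. chr d \<zeta> x * ren k1 \<xi> t x \<partial>lam d) \<le> e / (4 * L)"
    by (rule correlation_derivative_small[OF e4L, of \<zeta> \<xi>]) (rule that, assumption+)
  have "dist (\<integral>x. chr d \<zeta> x * ren k \<xi> t x \<partial>lam d) (?V * (\<integral>x. chr d \<zeta> x \<partial>lam d)) < e" if t: "t \<ge> t1" for t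
  proof -
    have t0: "t \<ge> 0" using t t1 by simp
    let ?h = "\<lambda>s x. of_real (L * (1 - s)) * (chr d \<zeta> x * ren k1 \<xi> (t + L * s) x)"
    have k1r: "k1 r = 0" if "r \<le> 0" for r using k1_zero that by blast
    have "(\<lambda>z. ?h (fst z) (snd z)) \<in> borel_measurable (uI \<Otimes>\<^sub>M lam d)"
    proof -
      note [measurable] = ren_joint_measurable[OF k1_measurable k1r L(1), of \<xi> t]
      have [measurable]: "fst \<in> borel_measurable (uI \<Otimes>\<^sub>M lam d)"
        by (rule measurable_compose[OF measurable_fst]) (rule measurable_restrict_space1, simp)
      show ?thesis by measurable
    qed
    moreover have "norm (?h s x) \<le> L * B1" if "s \<in> {0..<1}" for s x
    proof -
      have "\<bar>L * (1 - s)\<bar> \<le> L" using that L by (simp add: abs_mult)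
      then have "\<bar>L * (1 - s)\<bar> * norm (ren k1 \<xi> (t + L * s) x) \<le> L * B1"
        using ren_bound[of k1 B1 \<xi> "t + L * s" x, OF k1_zero k1_bound] L by (intro mult_mono) auto
      then show ?thesis by (simp only: norm_mult norm_of_real norm_chr mult_1)
    qed
    ultimately have int: "integrable (uI \<Otimes>\<^sub>M lam d) (\<lambda>(s, x). ?h s x)"
      by (intro PU.integrable_const_bound[of _ "L * B1"])
        (auto simp: split_beta' space_pair_measure space_restrict_space intro!: AE_I2)
    have hI: "integrable (lam d) (\<lambda>x. \<integral>s. ?h s x \<partial>uI)" using PU.integrable_snd[OF int] by simp
    have rI: "integrable (lam d) (\<lambda>x. chr d \<zeta> x * ren k \<xi> t x)"
      by (rule Ld.integrable_const_bound[of _ B])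
        (use ren_bound[of k B, OF k_zero k_bound] ren_measurable[OF k_measurable] in \<open>auto simp: norm_mult\<close>)
    have cI: "integrable (lam d) (\<lambda>x. ?V * chr d \<zeta> x)" by (intro integrable_mult_right Ld.integrable_const_bound[of _ 1]) auto
    have split: "chr d \<zeta> x * ren k \<xi> t x = chr d \<zeta> x * Av \<xi> L t x - (\<integral>s. ?h s x \<partial>uI)" for x
    proof -
      have "(\<integral>s. ?h s x \<partial>uI) = (\<integral>s. chr d \<zeta> x * (of_real (L * (1 - s)) * ren k1 \<xi> (t + L * s) x) \<partial>uI)" by (simp add: mult_ac)
      also have "\<dots> = chr d \<zeta> x * (\<integral>s. of_real (L * (1 - s)) * ren k1 \<xi> (t + L * s) x \<partial>uI)"
        by simp
      finally show ?thesis unfolding ren_interval_derivative[OF L(1), of \<xi> t x] by (simp add: right_diff_distrib)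
    qed
    have AI: "integrable (lam d) (\<lambda>x. chr d \<zeta> x * Av \<xi> L t x)"
      using Bochner_Integration.integrable_add[OF rI hI] unfolding split by simp
    have diff_eq: "(\<integral>x. chr d \<zeta> x * ren k \<xi> t x \<partial>lam d) - ?V * (\<integral>x. chr d \<zeta> x \<partial>lam d)
       = (\<integral>x. chr d \<zeta> x * Av \<xi> L t x - ?V * chr d \<zeta> x \<partial>lam d) - (\<integral>x. (\<integral>s. ?h s x \<partial>uI) \<partial>lam d)"
      using AI hI cI by (simp add: split)
    have "norm ((\<integral>x. chr d \<zeta> x * Av \<xi> L t x - ?V * chr d \<zeta> x \<partial>lam d) - (\<integral>x. (\<integral>s. ?h s x \<partial>uI) \<partial>lam d)) \<le> e / 2 + e / 4"
    proof (rule order_trans[OF norm_triangle_ineq4] , rule add_mono)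
      have "norm (\<integral>x. chr d \<zeta> x * Av \<xi> L t x - ?V * chr d \<zeta> x \<partial>lam d) \<le> (\<integral>x. norm (chr d \<zeta> x * Av \<xi> L t x - ?V * chr d \<zeta> x) \<partial>lam d)"
        by (rule integral_norm_bound)
      also have "\<dots> \<le> (\<integral>x. e / 2 \<partial>lam d)"
      proof (rule integral_mono')
        fix x
        have "L * norm (chr d \<zeta> x * Av \<xi> L t x - ?V * chr d \<zeta> x) = norm (of_real L * Av \<xi> L t x - of_real L * ?V)"
        proof -
          have "of_real L * Av \<xi> L t x - of_real L * ?V = of_real L * (Av \<xi> L t x - ?V)" by (simp only: right_diff_distrib)
          moreover have "chr d \<zeta> x * Av \<xi> L t x - ?V * chr d \<zeta> x = chr d \<zeta> x * (Av \<xi> L t x - ?V)"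
            by (simp only: right_diff_distrib mult.commute)
          ultimately show ?thesis using L by (simp add: norm_mult)
        qed
        also have "of_real L * ?V = (if \<forall>j<d. \<xi> j = 0 then of_real (L * Kint / c) else 0)" by auto
        also have "norm (of_real L * Av \<xi> L t x - \<dots>) \<le> e / 4 * L + C" by (rule C(2)[OF t0 L(1)])
        also have "\<dots> \<le> e / 4 * L + e / 4 * L" using L(2) by linarith
        also have "\<dots> = L * (e / 2)" by simp
        finally show "norm (chr d \<zeta> x * Av \<xi> L t x - ?V * chr d \<zeta> x) \<le> e / 2" using L(1) by simp
      qed (use e in auto)
      also have "\<dots> = e / 2" using Ld.prob_space by simp
      finally show "norm (\<integral>x. chr d \<zeta> x * Av \<xi> L t x - ?V * chr d \<zeta> x \<partial>lam d) \<le> e / 2" .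
      have swap: "(\<integral>x. (\<integral>s. ?h s x \<partial>uI) \<partial>lam d) = (\<integral>s. (\<integral>x. ?h s x \<partial>lam d) \<partial>uI)"
        by (rule PU.Fubini_integral[OF int])
      have "norm (\<integral>s. (\<integral>x. ?h s x \<partial>lam d) \<partial>uI) \<le> (\<integral>s. norm (\<integral>x. ?h s x \<partial>lam d) \<partial>uI)" by (rule integral_norm_bound)
      also have "\<dots> \<le> (\<integral>s. e / 4 \<partial>uI)"
      proof (rule integral_mono')
        fix s assume "s \<in> space uI"
        then have s: "0 \<le> s" "s < 1" by (auto simp: space_restrict_space)
        have "t + L * s \<ge> t1" using t s L by (simp add: add_increasing2)
        then have 1: "norm (\<integral>x. chr d \<zeta> x * ren k1 \<xi> (t + L * s) x \<partial>lam d) \<le> e / (4 * L)" by (rule t1(2))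
        have 2: "\<bar>L * (1 - s)\<bar> \<le> L" using L s by (simp add: abs_mult)
        have "(\<integral>x. ?h s x \<partial>lam d) = of_real (L * (1 - s)) * (\<integral>x. chr d \<zeta> x * ren k1 \<xi> (t + L * s) x \<partial>lam d)"
          by (rule integral_mult_right_zero)
        then have "norm (\<integral>x. ?h s x \<partial>lam d) = \<bar>L * (1 - s)\<bar> * norm (\<integral>x. chr d \<zeta> x * ren k1 \<xi> (t + L * s) x \<partial>lam d)"
          by (simp only: norm_mult norm_of_real)
        also have "\<dots> \<le> L * (e / (4 * L))" by (rule mult_mono[OF 2 1]) (use L in auto)
        finally have "norm (\<integral>x. ?h s x \<partial>lam d) \<le> L * (e / (4 * L))" .
        then show "norm (\<integral>x. ?h s x \<partial>lam d) \<le> e / 4" using L by simp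
      qed (use e in auto)
      also have "\<dots> = e / 4" using prob_space.prob_space[OF prob_space_unit] by simp
      finally show "norm (\<integral>x. (\<integral>s. ?h s x \<partial>uI) \<partial>lam d) \<le> e / 4" unfolding swap .
    qed
    then show ?thesis unfolding dist_norm diff_eq using e by linarith
  qed
  then show "\<forall>\<^sub>F t in at_top. dist (\<integral>x. chr d \<zeta> x * ren k \<xi> t x \<partial>lam d) (?V * (\<integral>x. chr d \<zeta> x \<partial>lam d)) < e"
    unfolding eventually_at_top_linorder by blast
qed

text \<open>Renewal sums are bounded by \<open>B\<close> uniformly in time, so the limit passes from
  trigonometric polynomials to indicators by approximation in the mean.\<close>

lemma correlation_limit_set:
  assumes E [measurable]: "E \<in> sets (lam d)"
  shows "((\<lambda>t. \<integral>x. indicator E x * ren k \<xi> t x \<partial>lam d) \<longlongrightarrow>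
     of_real (measure (lam d) E) * of_real (if \<forall>j<d. \<xi> j = 0 then Kint / c else 0)) at_top"
proof -
  interpret Ld: prob_space "lam d" by simp
  interpret TM: torus_measures d "lam d" "lam d" by unfold_locales auto
  let ?V = "complex_of_real (if \<forall>j<d. \<xi> j = 0 then Kint / c else 0)"
  let ?I = "\<lambda>f t. \<integral>x. f x * ren k \<xi> t x \<partial>lam d"
  have bI: "integrable (lam d) (\<lambda>x. f x * ren k \<xi> t x)" if "integrable (lam d) f" for f :: "_ \<Rightarrow> complex" and t
  proof (rule Bochner_Integration.integrable_bound[of _ "\<lambda>x. B * norm (f x)"])
    show "integrable (lam d) (\<lambda>x. B * norm (f x))" using that by simp
    show "(\<lambda>x. f x * ren k \<xi> t x) \<in> borel_measurable (lam d)"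
      using that ren_measurable[OF k_measurable, of \<xi> t] by (intro borel_measurable_times) auto
    show "AE x in lam d. norm (f x * ren k \<xi> t x) \<le> norm (B * norm (f x))"
      using ren_bound[of k B \<xi> t, OF k_zero k_bound] B_nonneg
      by (auto simp: norm_mult abs_mult mult.commute[of B] intro!: mult_left_mono)
  qed
  have ci: "integrable (lam d) (chr d \<zeta>)" for \<zeta> by (rule Ld.integrable_const_bound[of _ 1]) auto
  have lim_chr: "(?I P \<longlongrightarrow> ?V * (\<integral>x. P x \<partial>lam d)) at_top" if P: "tp d P" for P
    using P
  proof induction
    case tp_zero then show ?case by simp
  next
    case (tp_step P w \<zeta>)
    have PI: "integrable (lam d) P" by (rule TM.tp_integrable(1)[OF tp_step.hyps])
    have "?I (\<lambda>x. P x + w * chr d \<zeta> x) = (\<lambda>t. ?I P t + w * ?I (chr d \<zeta>) t)"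
    proof
      fix t
      have "?I (\<lambda>x. P x + w * chr d \<zeta> x) t = (\<integral>x. P x * ren k \<xi> t x + w * (chr d \<zeta> x * ren k \<xi> t x) \<partial>lam d)"
        by (simp add: distrib_right mult.assoc)
      also have "\<dots> = ?I P t + w * ?I (chr d \<zeta>) t"
        using bI[OF PI, of t] bI[OF ci, of \<zeta> t] by simp
      finally show "?I (\<lambda>x. P x + w * chr d \<zeta> x) t = ?I P t + w * ?I (chr d \<zeta>) t" .
    qed
    moreover have "?V * (\<integral>x. P x + w * chr d \<zeta> x \<partial>lam d) = ?V * (\<integral>x. P x \<partial>lam d) + w * (?V * (\<integral>x. chr d \<zeta> x \<partial>lam d))"
      using PI ci[of \<zeta>] by (simp add: distrib_left mult.left_commute)
    ultimately show ?case using tendsto_add[OF tp_step.IH tendsto_mult_left[OF correlation_limit[of \<zeta> \<xi>], of w]] by (simp only:)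
  qed
  have EI: "integrable (lam d) (indicator E :: _ \<Rightarrow> complex)"
    by (rule Ld.integrable_const_bound[of _ 1]) (auto simp: indicator_def)
  have intE: "(\<integral>x. indicator E x \<partial>lam d) = complex_of_real (measure (lam d) E)"
  proof -
    have "(\<integral>x. complex_of_real (indicator E x) \<partial>lam d) = complex_of_real (measure (lam d) E)"
      unfolding integral_complex_of_real using sets.sets_into_space[OF E] by (simp add: Int_absorb2)
    then show ?thesis by (simp add: of_real_indicator)
  qed
  have "(?I (indicator E) \<longlongrightarrow> ?V * complex_of_real (measure (lam d) E)) at_top"
  proof (rule tendstoI)
    fix e :: real assume e: "e > 0"
    define \<delta> where "\<delta> = e / (2 * (B + norm ?V + 1))"
    have den: "B + norm ?V + 1 > 0" using B_nonneg by (intro add_nonneg_pos add_nonneg_nonneg) auto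
    then have \<delta>: "\<delta> > 0" "\<delta> * (B + norm ?V) \<le> e / 2" using e by (auto simp: \<delta>_def field_simps)
    obtain P where P: "tp d P" "(\<integral>x. norm (indicator E x - P x) \<partial>lam d) < \<delta>"
      using TM.ap_approx[OF TM.ap_indicator[OF E] \<delta>(1)] by metis
    have PI: "integrable (lam d) P" by (rule TM.tp_integrable(1)[OF P(1)])
    have dI: "integrable (lam d) (\<lambda>x. indicator E x - P x)" using EI PI by simp
    have "\<forall>\<^sub>F t in at_top. dist (?I P t) (?V * (\<integral>x. P x \<partial>lam d)) < e / 2"
      using lim_chr[OF P(1)] e by (intro tendstoD) auto
    then show "\<forall>\<^sub>F t in at_top. dist (?I (indicator E) t) (?V * complex_of_real (measure (lam d) E)) < e"
    proof eventually_elim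
      case (elim t)
      have "norm (?I (indicator E) t - ?I P t) = norm (?I (\<lambda>x. indicator E x - P x) t)"
        using bI[OF EI] bI[OF PI] by (simp add: left_diff_distrib)
      also have "\<dots> \<le> (\<integral>x. norm ((indicator E x - P x) * ren k \<xi> t x) \<partial>lam d)" by (rule integral_norm_bound)
      also have "\<dots> \<le> (\<integral>x. norm (indicator E x - P x) * B \<partial>lam d)"
      proof (rule integral_mono')
        show "integrable (lam d) (\<lambda>x. norm (indicator E x - P x) * B)" using dI by simp
        show "norm ((indicator E x - P x) * ren k \<xi> t x) \<le> norm (indicator E x - P x) * B" for x
          unfolding norm_mult by (rule mult_left_mono[OF ren_bound[of k B, OF k_zero k_bound]]) auto
      qed (use B_nonneg in auto)
      also have "\<dots> \<le> \<delta> * B" using P(2) B_nonneg by (simp add: mult_right_mono)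
      finally have d1: "norm (?I (indicator E) t - ?I P t) \<le> \<delta> * B" .
      have "norm (?V * (\<integral>x. P x \<partial>lam d) - ?V * complex_of_real (measure (lam d) E)) = norm ?V * norm (\<integral>x. indicator E x - P x \<partial>lam d)"
        using EI PI by (simp only: intE[symmetric] right_diff_distrib[symmetric] norm_mult Bochner_Integration.integral_diff) (simp only: norm_minus_commute)
      also have "\<dots> \<le> norm ?V * \<delta>"
        using order_trans[OF integral_norm_bound less_imp_le[OF P(2)]] by (intro mult_left_mono) auto
      finally have d2: "norm (?V * (\<integral>x. P x \<partial>lam d) - ?V * complex_of_real (measure (lam d) E)) \<le> norm ?V * \<delta>" .
      have "norm (?I (indicator E) t - ?V * complex_of_real (measure (lam d) E)) \<le>
        norm (?I (indicator E) t - ?I P t) + norm (?I P t - ?V * (\<integral>x. P x \<partial>lam d)) + norm (?V * (\<integral>x. P x \<partial>lam d) - ?V * complex_of_real (measure (lam d) E))"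
        using dist_triangle[of "?I (indicator E) t" "?V * complex_of_real (measure (lam d) E)" "?I P t"]
          dist_triangle[of "?I P t" "?V * complex_of_real (measure (lam d) E)" "?V * (\<integral>x. P x \<partial>lam d)"]
        unfolding dist_norm by linarith
      then show ?case using d1 d2 elim \<delta>(2) unfolding dist_norm by (simp add: distrib_left mult.commute[of \<delta>])
    qed
  qed
  then show ?thesis by (simp only: mult.commute)
qed

end

section \<open>Renewal sums and mixing\<close>

context trig_suspension
begin

section \<open>Correlations as renewal sums and their stability in the mean\<close>

abbreviation XR :: "((nat \<Rightarrow> real) \<times> real) measure" where "XR \<equiv> lam d \<Otimes>\<^sub>M lborel"

abbreviation MM :: "((nat \<Rightarrow> real) \<times> real) set" where "MM \<equiv> susp_space d \<Psi>"

lemma Tn_cube: "x \<in> cube d \<Longrightarrow> (T ^^ n) x \<in> cube d"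
  using measurable_space[OF Tn_measurable, of x n] by simp

lemma MM_sets [measurable]: "MM \<in> sets XR"
proof -
  have "MM = {z \<in> space XR. 0 \<le> snd z \<and> snd z < \<Psi> (fst z)}"
    by (auto simp: susp_space_def space_pair_measure)
  moreover have "{z \<in> space XR. 0 \<le> snd z \<and> snd z < \<Psi> (fst z)} \<in> sets XR" by measurable
  ultimately show ?thesis by (simp only:)
qed

lemma MM_finite: "emeasure XR MM < \<infinity>"
proof -
  interpret Ld: prob_space "lam d" by simp
  have "emeasure XR MM \<le> emeasure XR (cube d \<times> {0..M1})"
  proof (rule emeasure_mono)
    show "MM \<subseteq> cube d \<times> {0..M1}"
    proof
      fix z assume "z \<in> MM"
      then show "z \<in> cube d \<times> {0..M1}" using Psi_upper[of "fst z"] by (cases z) (auto simp: susp_space_def)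
    qed
    show "cube d \<times> {0..M1} \<in> sets XR" using sets.top[of "lam d"] by (intro pair_measureI) auto
  qed
  also have "\<dots> = emeasure (lam d) (cube d) * emeasure lborel {0..M1}"
    using sets.top[of "lam d"] by (intro lborel.emeasure_pair_measure_Times) auto
  also have "\<dots> < \<infinity>" using Ld.emeasure_space_1 M1_pos by simp
  finally show ?thesis .
qed

lemma flow_term_measurable:
  assumes [measurable]: "f \<in> borel_measurable XR"
  shows "(\<lambda>z. f ((T ^^ n) (fst z), snd z + t - p n (fst z))) \<in> borel_measurable XR"
proof -
  have "(\<lambda>z. ((T ^^ n) (fst z), snd z + t - p n (fst z))) \<in> measurable XR XR"
    by (intro measurable_Pair) measurable
  from measurable_compose[OF this assms] show ?thesis .
qed

text \<open>The flow preserves the measure, expressed without the flow map. Partial sums are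
  computed by induction: invariance under \<open>T\<close> moves the part above level
  \<open>t - p k\<close> to the next return, where the new term fills the adjacent strip. Since
  \<open>N * m0\<close> is at least \<open>t\<close>, the whole fibre is covered in the end.\<close>

lemma renewal_nn_integral:
  fixes f :: "_ \<Rightarrow> ennreal"
  assumes [measurable]: "f \<in> borel_measurable XR" and f: "\<And>z. z \<notin> MM \<Longrightarrow> f z = 0"
    and t: "t \<ge> 0" "t \<le> real N * m0"
  shows "(\<Sum>n<Suc N. \<integral>\<^sup>+z. indicator MM z * f ((T ^^ n) (fst z), snd z + t - p n (fst z)) \<partial>XR) = (\<integral>\<^sup>+z. f z \<partial>XR)"
proof -
  note ft [measurable] = flow_term_measurable[OF assms(1)]
  define e where "e n = (\<integral>\<^sup>+x. \<integral>\<^sup>+s. indicator {t - p n x..<t - p n x + \<Psi> x} s * f ((T ^^ n) x, s) \<partial>lborel \<partial>lam d)" for n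
  \<comment> \<open>The part of the fibre over the \<open>n\<close>-th iterate above level
    \<open>t - p n x\<close>; its integral over the base turns out to be the sum of the first
    \<open>n + 1\<close> terms.\<close>
  define H where "H n x = (\<integral>\<^sup>+s. indicator {t - p n x..} s * f ((T ^^ n) x, s) \<partial>lborel)" for n x
  have fm [measurable]: "(\<lambda>s. f ((T ^^ n) x, s)) \<in> borel_measurable borel" if "x \<in> cube d" for n x
    using measurable_compose[OF measurable_Pair1'[of "(T ^^ n) x" "lam d" lborel] assms(1)] Tn_cube[OF that] by simp
  have gm: "(\<lambda>s. indicator A s * f ((T ^^ n) x, s)) \<in> borel_measurable lborel" if "A \<in> sets borel" "x \<in> cube d" for A n x
    using fm[OF that(2), of n] that(1) by (simp add: borel_measurable_times_ennreal)
  have fn [measurable]: "(\<lambda>z. f ((T ^^ n) (fst z), snd z)) \<in> borel_measurable XR" for n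
    by (rule measurable_compose[OF _ assms(1)]) (intro measurable_Pair; measurable)
  have Hm: "H n \<in> borel_measurable (lam d)" for n
  proof -
    have "(\<lambda>z. indicator {z. t - p n (fst z) \<le> snd z} z * f ((T ^^ n) (fst z), snd z)) \<in> borel_measurable XR" by measurable
    from lborel.borel_measurable_nn_integral_fst[OF this]
    show ?thesis unfolding H_def by (simp add: indicator_def)
  qed
  have em: "(\<lambda>x. \<integral>\<^sup>+s. indicator {t - p n x..<t - p n x + \<Psi> x} s * f ((T ^^ n) x, s) \<partial>lborel) \<in> borel_measurable (lam d)" for n
  proof -
    have "(\<lambda>z. indicator {z. t - p n (fst z) \<le> snd z \<and> snd z < t - p n (fst z) + \<Psi> (fst z)} z * f ((T ^^ n) (fst z), snd z)) \<in> borel_measurable XR" by measurable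
    from lborel.borel_measurable_nn_integral_fst[OF this]
    show ?thesis by (simp add: indicator_def)
  qed
  have e: "(\<integral>\<^sup>+z. indicator MM z * f ((T ^^ n) (fst z), snd z + t - p n (fst z)) \<partial>XR) = e n" for n
  proof -
    have "(\<integral>\<^sup>+z. indicator MM z * f ((T ^^ n) (fst z), snd z + t - p n (fst z)) \<partial>XR) =
       (\<integral>\<^sup>+x. \<integral>\<^sup>+r. indicator MM (x, r) * f ((T ^^ n) x, r + t - p n x) \<partial>lborel \<partial>lam d)"
    proof -
      have "(\<lambda>z. indicator MM z * f ((T ^^ n) (fst z), snd z + t - p n (fst z))) \<in> borel_measurable XR"
        by (intro borel_measurable_times_ennreal borel_measurable_indicator MM_sets ft)
      from lborel.nn_integral_fst[OF this, symmetric] show ?thesis by simp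
    qed
    also have "\<dots> = e n" unfolding e_def
    proof (rule nn_integral_cong)
      fix x assume "x \<in> space (lam d)"
      then have x: "x \<in> cube d" by simp
      let ?G = "\<lambda>s. indicator {t - p n x..<t - p n x + \<Psi> x} s * f ((T ^^ n) x, s)"
      have "?G \<in> borel_measurable borel" by (intro borel_measurable_times_ennreal borel_measurable_indicator fm x) auto
      from nn_integral_real_affine[OF this, of 1 "t - p n x"]
      have "(\<integral>\<^sup>+s. ?G s \<partial>lborel) = (\<integral>\<^sup>+r. ?G (t - p n x + r) \<partial>lborel)" by simp
      also have "\<dots> = (\<integral>\<^sup>+r. indicator MM (x, r) * f ((T ^^ n) x, r + t - p n x) \<partial>lborel)"
        by (intro nn_integral_cong) (auto simp: indicator_def susp_space_def x algebra_simps)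
      finally
      show "(\<integral>\<^sup>+r. indicator MM (x, r) * f ((T ^^ n) x, r + t - p n x) \<partial>lborel)
         = (\<integral>\<^sup>+s. indicator {t - p n x..<t - p n x + \<Psi> x} s * f ((T ^^ n) x, s) \<partial>lborel)"
        by (rule sym)
    qed
    finally show ?thesis .
  qed
  have "(\<Sum>n<Suc k. e n) = (\<integral>\<^sup>+x. H k x \<partial>lam d)" for k
  proof (induction k)
    case 0
    have "e 0 = (\<integral>\<^sup>+x. H 0 x \<partial>lam d)" unfolding e_def H_def
      using f t by (intro nn_integral_cong) (auto simp: indicator_def birkhoff_sum_def susp_space_def)
    then show ?case by simp
  next
    case (Suc k)
    have "(\<integral>\<^sup>+x. H k x \<partial>lam d) = (\<integral>\<^sup>+x. H k (T x) \<partial>lam d)"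
      using nn_integral_distr[OF T_measurable, of "H k"] Hm by (simp add: T_invariant)
    then have "(\<Sum>n<Suc (Suc k). e n) = (\<integral>\<^sup>+x. H k (T x) \<partial>lam d) + e (Suc k)" using Suc by simp
    also have "\<dots> = (\<integral>\<^sup>+x. H k (T x) + (\<integral>\<^sup>+s. indicator {t - p (Suc k) x..<t - p (Suc k) x + \<Psi> x} s * f ((T ^^ Suc k) x, s) \<partial>lborel) \<partial>lam d)"
      unfolding e_def by (rule nn_integral_add[symmetric, OF measurable_compose[OF T_measurable Hm] em])
    also have "\<dots> = (\<integral>\<^sup>+x. H (Suc k) x \<partial>lam d)"
    proof (rule nn_integral_cong)
      fix x assume "x \<in> space (lam d)"
      then have x: "x \<in> cube d" by simp
      have TT: "(T ^^ Suc k) x = (T ^^ k) (T x)" by (simp only: funpow_Suc_right comp_def)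
      have pp: "p (Suc k) x = \<Psi> x + p k (T x)"
        unfolding birkhoff_sum_def sum.lessThan_Suc_shift by (simp add: funpow_swap1)
      have pos: "\<Psi> x > 0" using Psi_lower[of x] m0 by linarith
      have "H k (T x) = (\<integral>\<^sup>+s. indicator {t - p k (T x)..} s * f ((T ^^ Suc k) x, s) \<partial>lborel)" unfolding H_def TT ..
      then have "H k (T x) + (\<integral>\<^sup>+s. indicator {t - p (Suc k) x..<t - p (Suc k) x + \<Psi> x} s * f ((T ^^ Suc k) x, s) \<partial>lborel)
        = (\<integral>\<^sup>+s. indicator {t - p k (T x)..} s * f ((T ^^ Suc k) x, s) + indicator {t - p (Suc k) x..<t - p (Suc k) x + \<Psi> x} s * f ((T ^^ Suc k) x, s) \<partial>lborel)"
        by (simp only:) (rule nn_integral_add[symmetric, OF gm gm], use x in auto)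
      also have "\<dots> = H (Suc k) x" unfolding H_def using pos
        by (intro nn_integral_cong) (auto simp: indicator_def pp)
      finally show "H k (T x) + (\<integral>\<^sup>+s. indicator {t - p (Suc k) x..<t - p (Suc k) x + \<Psi> x} s * f ((T ^^ Suc k) x, s) \<partial>lborel) = H (Suc k) x" .
    qed
    finally show ?case .
  qed
  then have "(\<Sum>n<Suc N. e n) = (\<integral>\<^sup>+x. H N x \<partial>lam d)" .
  also have "\<dots> = (\<integral>\<^sup>+x. (\<integral>\<^sup>+s. f ((T ^^ N) x, s) \<partial>lborel) \<partial>lam d)"
  proof (intro nn_integral_cong)
    fix x
    \<comment> \<open>At return \<open>N\<close> the level \<open>t - p N x\<close> is not positive,
      so \<open>H N\<close> sees the whole fibre.\<close>
    have "t \<le> p N x" using t p_lower[of N x] by linarith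
    then show "H N x = (\<integral>\<^sup>+s. f ((T ^^ N) x, s) \<partial>lborel)" unfolding H_def
      using f by (intro nn_integral_cong) (fastforce simp: indicator_def susp_space_def)
  qed
  also have "\<dots> = (\<integral>\<^sup>+x. (\<integral>\<^sup>+s. f (x, s) \<partial>lborel) \<partial>lam d)"
    using nn_integral_distr[OF Tn_measurable, of "\<lambda>x. \<integral>\<^sup>+s. f (x, s) \<partial>lborel" N] lborel.borel_measurable_nn_integral_fst[OF assms(1)]
    by (simp add: Tn_invariant)
  also have "\<dots> = (\<integral>\<^sup>+z. f z \<partial>XR)" by (rule lborel.nn_integral_fst) simp
  finally show ?thesis unfolding e .
qed

text \<open>Bounded measurable observables on the suspension, extended by zero to the product
  space.\<close>

definition adm :: "((nat \<Rightarrow> real) \<times> real \<Rightarrow> complex) \<Rightarrow> bool" where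
  "adm f \<longleftrightarrow> f \<in> borel_measurable XR \<and> (\<exists>K. \<forall>z. norm (f z) \<le> K) \<and> (\<forall>z. z \<notin> MM \<longrightarrow> f z = 0)"

text \<open>A point of height below \<open>M1\<close> makes at most \<open>(t + M1) / m0\<close>
  returns up to time \<open>t\<close>; this number of terms serves all starting points.\<close>

definition Nt :: "real \<Rightarrow> nat" where "Nt t = Suc (nat \<lceil>(t + M1) / m0\<rceil>)"

text \<open>Unnormalised correlation. The renewal sum stands for the composition with the flow: for
  indicators and \<open>t \<ge> 0\<close> the two agree by \<open>susp_flow_sum\<close>, and the sum
  is handled term by term.\<close>

definition Cor :: "((nat \<Rightarrow> real) \<times> real) set \<Rightarrow> real \<Rightarrow> ((nat \<Rightarrow> real) \<times> real \<Rightarrow> complex) \<Rightarrow> complex" where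
  "Cor S t f = (\<integral>z. indicator S z * (\<Sum>n<Nt t. f ((T ^^ n) (fst z), snd z + t - p n (fst z))) \<partial>XR)"

lemma bounded_on_MM_integrable:
  fixes f :: "_ \<Rightarrow> complex"
  assumes "f \<in> borel_measurable XR" "\<And>z. norm (f z) \<le> K" "\<And>z. z \<notin> MM \<Longrightarrow> f z = 0"
  shows "integrable XR f"
proof (rule Bochner_Integration.integrable_bound[of _ "\<lambda>z. K * indicator MM z"])
  show "integrable XR (\<lambda>z. K * indicator MM z)"
    using MM_finite by (intro integrable_mult_right integrable_real_indicator MM_sets) simp
  show "AE z in XR. norm (f z) \<le> norm (K * indicator MM z)"
  proof (rule AE_I2)
    fix z show "norm (f z) \<le> norm (K * indicator MM z)" using assms(2)[of z] assms(3)[of z] by (cases "z \<in> MM") auto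
  qed
qed (rule assms)

lemma adm_integrable: "adm f \<Longrightarrow> integrable XR f"
  unfolding adm_def using bounded_on_MM_integrable by blast

lemma adm_diff: "adm f \<Longrightarrow> adm h \<Longrightarrow> adm (\<lambda>z. f z - h z)"
proof -
  assume f: "adm f" and h: "adm h"
  obtain K K' where "\<And>z. norm (f z) \<le> K" "\<And>z. norm (h z) \<le> K'" using f h unfolding adm_def by blast
  then have "norm (f z - h z) \<le> K + K'" for z by (meson add_mono norm_triangle_ineq4 order_trans)
  then show ?thesis using f h unfolding adm_def by auto
qed

lemma adm_indicator: "A \<in> sets XR \<Longrightarrow> A \<subseteq> MM \<Longrightarrow> adm (indicator A)"
  unfolding adm_def by (auto simp: indicator_def intro!: exI[of _ 1])

lemma Cor_integrable:
  assumes f: "adm f" and S [measurable]: "S \<in> sets XR" and SM: "S \<subseteq> MM"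
  shows "integrable XR (\<lambda>z. indicator S z * (\<Sum>n<N. f ((T ^^ n) (fst z), snd z + t - p n (fst z))))"
proof -
  obtain K where K: "\<And>z. norm (f z) \<le> K" and fm: "f \<in> borel_measurable XR" using f unfolding adm_def by blast
  note [measurable] = flow_term_measurable[OF fm]
  show ?thesis
  proof (rule bounded_on_MM_integrable[of _ "real N * K"])
    fix z
    have K0: "K \<ge> 0" using K[of z] norm_ge_zero order_trans by blast
    have "norm (\<Sum>n<N. f ((T ^^ n) (fst z), snd z + t - p n (fst z))) \<le> real N * K"
      using sum_norm_bound[of "{..<N}" "\<lambda>n. f ((T ^^ n) (fst z), snd z + t - p n (fst z))" K] K by simp
    then show "norm (indicator S z * (\<Sum>n<N. f ((T ^^ n) (fst z), snd z + t - p n (fst z)))) \<le> real N * K"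
      using K0 by (auto simp: indicator_def)
  qed (use SM in \<open>auto simp: indicator_def\<close>)
qed

lemma Cor_diff:
  assumes "adm f" "adm h" "S \<in> sets XR" "S \<subseteq> MM"
  shows "Cor S t (\<lambda>z. f z - h z) = Cor S t f - Cor S t h"
  unfolding Cor_def
  using Cor_integrable[where N="Nt t" and t=t, OF assms(1,3,4)] Cor_integrable[where N="Nt t" and t=t, OF assms(2,3,4)]
  by (simp add: sum_subtractf right_diff_distrib)

lemma Nt_large:
  assumes "t \<ge> 0"
  shows "t + M1 \<le> real (nat \<lceil>(t + M1) / m0\<rceil>) * m0"
  using real_nat_ceiling_ge[of "(t + M1) / m0"] m0 by (simp add: field_simps)

text \<open>The bound is uniform in \<open>t\<close> because the flow preserves the measure; this
  makes the limit relation stable under approximation in the mean.\<close>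

lemma Cor_bound:
  assumes f: "adm f" and S [measurable]: "S \<in> sets XR" and SM: "S \<subseteq> MM" and t: "t \<ge> 0"
  shows "norm (Cor S t f) \<le> (\<integral>z. norm (f z) \<partial>XR)"
proof -
  have fm [measurable]: "f \<in> borel_measurable XR" and f0: "\<And>z. z \<notin> MM \<Longrightarrow> f z = 0" using f unfolding adm_def by blast+
  note [measurable] = flow_term_measurable[OF fm]
  let ?t = "\<lambda>n z. f ((T ^^ n) (fst z), snd z + t - p n (fst z))"
  have "ennreal (norm (Cor S t f)) \<le> (\<integral>\<^sup>+z. ennreal (norm (indicator S z * (\<Sum>n<Nt t. ?t n z))) \<partial>XR)"
    unfolding Cor_def by (rule integral_norm_bound_ennreal[OF Cor_integrable[OF f S SM]])
  also have "\<dots> \<le> (\<integral>\<^sup>+z. (\<Sum>n<Nt t. indicator MM z * ennreal (norm (?t n z))) \<partial>XR)"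
  proof (rule nn_integral_mono)
    fix z
    show "ennreal (norm (indicator S z * (\<Sum>n<Nt t. ?t n z))) \<le> (\<Sum>n<Nt t. indicator MM z * ennreal (norm (?t n z)))"
    proof (cases "z \<in> S")
      case True
      then have "indicator MM z = (1::ennreal)" using SM by auto
      then show ?thesis using True norm_sum[of "\<lambda>n. ?t n z" "{..<Nt t}"]
        by (simp only: mult_1 indicator_simps sum_ennreal norm_ge_zero ennreal_leI)
    qed simp
  qed
  also have "\<dots> = (\<Sum>n<Nt t. (\<integral>\<^sup>+z. indicator MM z * ennreal (norm (?t n z)) \<partial>XR))"
    by (rule nn_integral_sum) measurable
  also have "\<dots> = (\<integral>\<^sup>+z. ennreal (norm (f z)) \<partial>XR)"
    unfolding Nt_def
    by (rule renewal_nn_integral[where f="\<lambda>z. ennreal (norm (f z))"])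
      (use t f0 Nt_large[OF t] M1_pos in auto)
  also have "\<dots> = ennreal (\<integral>z. norm (f z) \<partial>XR)"
    using adm_integrable[OF f] by (intro nn_integral_eq_integral) auto
  finally show ?thesis by (simp add: ennreal_le_iff integral_nonneg_AE)
qed

text \<open>The number \<open>c\<close> is the total mass of the suspension; one further division by
  \<open>c\<close> turns the relation into the one for the normalised measure.\<close>

definition good :: "((nat \<Rightarrow> real) \<times> real) set \<Rightarrow> ((nat \<Rightarrow> real) \<times> real \<Rightarrow> complex) \<Rightarrow> bool" where
  "good S f \<longleftrightarrow> adm f \<and> ((\<lambda>t. Cor S t f) \<longlongrightarrow> of_real (measure XR S / c) * (\<integral>z. f z \<partial>XR)) at_top"

lemma good_approx:
  assumes S: "S \<in> sets XR" "S \<subseteq> MM" and f: "adm f"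
    and app: "\<And>e. e > 0 \<Longrightarrow> \<exists>h. good S h \<and> (\<integral>z. norm (f z - h z) \<partial>XR) < e"
  shows "good S f"
  unfolding good_def
proof (intro conjI f tendstoI)
  fix e :: real assume e: "e > 0"
  let ?v = "measure XR S / c"
  have v: "?v \<ge> 0" using c_pos by simp
  define \<delta> where "\<delta> = e / (2 * (1 + ?v))"
  have \<delta>: "\<delta> > 0" "\<delta> * (1 + ?v) \<le> e / 2" using e v by (auto simp: \<delta>_def field_simps add_pos_nonneg)
  obtain h where h: "good S h" "(\<integral>z. norm (f z - h z) \<partial>XR) < \<delta>" using app[OF \<delta>(1)] by blast
  have ah: "adm h" using h unfolding good_def by blast
  have J: "norm ((\<integral>z. f z \<partial>XR) - (\<integral>z. h z \<partial>XR)) \<le> \<delta>"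
    using h(2) integral_norm_bound[of XR "\<lambda>z. f z - h z"] adm_integrable[OF f] adm_integrable[OF ah] by simp
  have "\<forall>\<^sub>F t in at_top. dist (Cor S t h) (of_real ?v * (\<integral>z. h z \<partial>XR)) < e / 2"
    using h(1) e unfolding good_def by (intro tendstoD) auto
  then show "\<forall>\<^sub>F t in at_top. dist (Cor S t f) (of_real ?v * (\<integral>z. f z \<partial>XR)) < e"
    using eventually_ge_at_top[of 0]
  proof eventually_elim
    case (elim t)
    have 1: "norm (Cor S t f - Cor S t h) \<le> \<delta>"
      using Cor_bound[OF adm_diff[OF f ah] S elim(2)] h(2) by (simp add: Cor_diff[OF f ah S])
    have 2: "norm (of_real ?v * (\<integral>z. f z \<partial>XR) - of_real ?v * (\<integral>z. h z \<partial>XR)) \<le> ?v * \<delta>"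
      unfolding right_diff_distrib[symmetric] norm_mult norm_of_real using J v
      by (metis abs_of_nonneg mult_left_mono)
    have "norm (Cor S t f - of_real ?v * (\<integral>z. f z \<partial>XR)) \<le>
       norm (Cor S t f - Cor S t h) + norm (Cor S t h - of_real ?v * (\<integral>z. h z \<partial>XR)) + norm (of_real ?v * (\<integral>z. f z \<partial>XR) - of_real ?v * (\<integral>z. h z \<partial>XR))"
      using dist_triangle[of "Cor S t f" "of_real ?v * (\<integral>z. f z \<partial>XR)" "Cor S t h"]
        norm_minus_commute[of "of_real ?v * (\<integral>z. f z \<partial>XR)" "of_real ?v * (\<integral>z. h z \<partial>XR)"]
        dist_triangle[of "Cor S t h" "of_real ?v * (\<integral>z. f z \<partial>XR)" "of_real ?v * (\<integral>z. h z \<partial>XR)"]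
      unfolding dist_norm by linarith
    moreover have "\<delta> + ?v * \<delta> \<le> e / 2" using \<delta>(2) by (simp only: distrib_left mult_1_right mult.commute)
    ultimately show ?case using 1 2 elim(1) unfolding dist_norm by linarith
  qed
qed

lemma good_diff: "S \<in> sets XR \<Longrightarrow> S \<subseteq> MM \<Longrightarrow> good S f \<Longrightarrow> good S h \<Longrightarrow> good S (\<lambda>z. f z - h z)"
  unfolding good_def
  by (auto simp: adm_diff Cor_diff adm_integrable right_diff_distrib intro!: tendsto_diff simp del: of_real_divide)

lemma good_zero: "good S (\<lambda>z. 0)"
  unfolding good_def Cor_def adm_def by (auto intro: exI[of _ 0])

lemma good_sum:
  assumes S: "S \<in> sets XR" "S \<subseteq> MM"
  shows "finite I \<Longrightarrow> (\<And>i. i \<in> I \<Longrightarrow> good S (f i)) \<Longrightarrow> good S (\<lambda>z. \<Sum>i\<in>I. f i z)"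
proof (induction I rule: finite_induct)
  case empty show ?case by (simp add: good_zero)
next
  case (insert i I)
  have "good S (\<lambda>z. 0 - (\<Sum>i\<in>I. f i z))" by (rule good_diff[OF S good_zero insert.IH]) (use insert in auto)
  from good_diff[OF S insert.prems[of i] this] show ?case using insert by simp
qed

text \<open>The suspension has finite measure, so dominated convergence reduces bounded pointwise
  limits to approximation in the mean.\<close>

lemma good_dominated:
  assumes S: "S \<in> sets XR" "S \<subseteq> MM" and f: "\<And>i. good S (f i)" and lim: "\<And>z. (\<lambda>i. f i z) \<longlonglongrightarrow> h z"
    and K: "\<And>i z. norm (f i z) \<le> K"
  shows "good S h"
proof (rule good_approx[OF S])
  have fm: "f i \<in> borel_measurable XR" and f0: "z \<notin> MM \<Longrightarrow> f i z = 0" for i z using f[of i] unfolding good_def adm_def by blast+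
  have gm: "h \<in> borel_measurable XR" by (rule borel_measurable_LIMSEQ_metric[OF fm lim])
  have gK: "norm (h z) \<le> K" for z by (rule LIMSEQ_le_const2[OF tendsto_norm[OF lim]]) (use K in auto)
  have g0: "h z = 0" if "z \<notin> MM" for z using LIMSEQ_unique[OF lim[of z], of 0] f0[OF that] by simp
  show "adm h" unfolding adm_def using gm gK g0 by blast
  have "(\<lambda>i. \<integral>z. norm (h z - f i z) \<partial>XR) \<longlonglongrightarrow> (\<integral>z. 0 \<partial>XR)"
  proof (rule integral_dominated_convergence[where w="\<lambda>z. 2 * K * indicator MM z"])
    show "integrable XR (\<lambda>z. 2 * K * indicator MM z)"
      using MM_finite by (intro integrable_mult_right integrable_real_indicator MM_sets) simp
    show "AE z in XR. (\<lambda>i. norm (h z - f i z)) \<longlonglongrightarrow> 0"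
    proof (rule AE_I2)
      fix z
      have "(\<lambda>i. norm (h z - f i z)) \<longlonglongrightarrow> norm (h z - h z)" by (intro tendsto_intros lim)
      then show "(\<lambda>i. norm (h z - f i z)) \<longlonglongrightarrow> 0" by simp
    qed
    show "AE z in XR. norm (norm (h z - f i z)) \<le> 2 * K * indicator MM z" for i
    proof (rule AE_I2)
      fix z
      have "norm (h z - f i z) \<le> 2 * K" using norm_triangle_ineq4[of "h z" "f i z"] gK[of z] K[of i z] by linarith
      then show "norm (norm (h z - f i z)) \<le> 2 * K * indicator MM z" using g0 f0 by (auto simp: indicator_def)
    qed
  qed (use fm gm in measurable)
  then have ev: "\<forall>\<^sub>F i in sequentially. (\<integral>z. norm (h z - f i z) \<partial>XR) < e" if "e > 0" for e
    using that by (auto intro: order_tendstoD)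
  show "\<exists>u. good S u \<and> (\<integral>z. norm (h z - u z) \<partial>XR) < e" if "e > 0" for e
  proof -
    have "\<exists>N. (\<integral>z. norm (h z - f N z) \<partial>XR) < e" by (rule eventually_happens'[OF sequentially_bot ev[OF that]])
    then obtain N where N: "(\<integral>z. norm (h z - f N z) \<partial>XR) < e" by (rule exE)
    show ?thesis by (rule exI[of _ "f N"], rule conjI[OF f N])
  qed
qed

end

context trig_suspension
begin

lemma cube_sets [measurable]: "cube d \<in> sets (lam d)" using sets.top[of "lam d"] by simp

lemma good_scale: "good S f \<Longrightarrow> good S (\<lambda>z. w * f z)"
proof -
  assume f: "good S f"
  have C: "Cor S t (\<lambda>z. w * f z) = w * Cor S t f" for t
    unfolding Cor_def by (simp add: sum_distrib_left[symmetric] mult.left_commute)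
  obtain K where K: "\<And>z. norm (f z) \<le> K" using f unfolding good_def adm_def by blast
  have "norm (w * f z) \<le> norm w * K" for z using K[of z] by (simp add: norm_mult mult_left_mono)
  then have "adm (\<lambda>z. w * f z)" using f unfolding good_def adm_def by auto
  moreover have "((\<lambda>t. w * Cor S t f) \<longlongrightarrow> w * (of_real (measure XR S / c) * (\<integral>z. f z \<partial>XR))) at_top"
    using f unfolding good_def by (intro tendsto_mult_left) auto
  ultimately show ?thesis unfolding good_def C by (simp add: mult.left_commute)
qed

end

context cutoff
begin

section \<open>Convergence of correlations for product observables\<close>

lemma product_adm:
  fixes h :: "_ \<Rightarrow> complex"
  assumes [measurable]: "h \<in> borel_measurable (lam d)" and K: "\<And>x. norm (h x) \<le> K" and h0: "\<And>x. x \<notin> cube d \<Longrightarrow> h x = 0"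
  shows "adm (\<lambda>z. h (fst z) * of_real (k (snd z)))"
  unfolding adm_def
proof (intro conjI allI impI)
  have "K \<ge> 0" using K norm_ge_zero order_trans by blast
  then show "\<exists>K. \<forall>z. norm (h (fst z) * complex_of_real (k (snd z))) \<le> K"
    using K k_bound by (intro exI[of _ "K * B"]) (auto simp: norm_mult intro!: mult_mono)
  show "h (fst z) * complex_of_real (k (snd z)) = 0" if "z \<notin> MM" for z
    using that h0[of "fst z"] k_nonzero[of "snd z"] Psi_lower[of "fst z"] by (cases z) (force simp: susp_space_def)
qed measurable

lemma product_integral:
  fixes h :: "_ \<Rightarrow> complex"
  assumes h: "h \<in> borel_measurable (lam d)" "\<And>x. norm (h x) \<le> K" "\<And>x. x \<notin> cube d \<Longrightarrow> h x = 0"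
  shows "(\<integral>z. h (fst z) * of_real (k (snd z)) \<partial>XR) = (\<integral>x. h x \<partial>lam d) * of_real Kint"
    and "(\<integral>z. norm (h (fst z) * of_real (k (snd z))) \<partial>XR) = (\<integral>x. norm (h x) \<partial>lam d) * (\<integral>r. \<bar>k r\<bar> \<partial>lborel)"
proof -
  interpret Ld: prob_space "lam d" by simp
  interpret PS: pair_sigma_finite "lam d" lborel ..
  have i: "integrable XR (\<lambda>z. h (fst z) * of_real (k (snd z)))" by (rule adm_integrable[OF product_adm[OF h]])
  have ki: "(\<integral>r. complex_of_real (k r) \<partial>lborel) = of_real Kint" unfolding Kint_def by (rule integral_complex_of_real)
  have "(\<integral>z. h (fst z) * of_real (k (snd z)) \<partial>XR) = (\<integral>x. (\<integral>r. h x * of_real (k r) \<partial>lborel) \<partial>lam d)"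
    using PS.integral_fst[of "\<lambda>x r. h x * of_real (k r)"] i by (simp add: split_beta')
  also have "\<dots> = (\<integral>x. h x \<partial>lam d) * of_real Kint" by (simp only: integral_mult_right_zero ki integral_mult_left_zero)
  finally show "(\<integral>z. h (fst z) * of_real (k (snd z)) \<partial>XR) = (\<integral>x. h x \<partial>lam d) * of_real Kint" .
  have "(\<integral>z. norm (h (fst z) * of_real (k (snd z))) \<partial>XR) = (\<integral>x. (\<integral>r. norm (h x * of_real (k r)) \<partial>lborel) \<partial>lam d)"
    using PS.integral_fst[of "\<lambda>x r. norm (h x * of_real (k r))"] integrable_norm[OF i] by (simp add: split_beta')
  also have "\<dots> = (\<integral>x. norm (h x) \<partial>lam d) * (\<integral>r. \<bar>k r\<bar> \<partial>lborel)"
    by (simp only: norm_mult norm_of_real integral_mult_right_zero integral_mult_left_zero)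
  finally show "(\<integral>z. norm (h (fst z) * of_real (k (snd z))) \<partial>XR) = (\<integral>x. norm (h x) \<partial>lam d) * (\<integral>r. \<bar>k r\<bar> \<partial>lborel)" .
qed

text \<open>A starting height \<open>r\<close> only shifts the time from \<open>t\<close> to
  \<open>r + t\<close>. The set \<open>S\<close> is sliced horizontally; the limit for sets on the
  base applies to each slice, and the bound \<open>B\<close> on heights up to \<open>M1\<close>
  allows dominated convergence in \<open>r\<close>.\<close>

lemma good_chr:
  assumes S: "S \<in> sets XR" "S \<subseteq> MM"
  shows "good S (\<lambda>z. (indicator (cube d) (fst z) * chr d \<xi> (fst z)) * of_real (k (snd z)))"
proof -
  interpret Ld: prob_space "lam d" by simp
  interpret PS: pair_sigma_finite "lam d" lborel ..
  let ?h = "\<lambda>x. indicator (cube d) x * chr d \<xi> x"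
  let ?f = "\<lambda>z. ?h (fst z) * complex_of_real (k (snd z))"
  let ?V = "complex_of_real (if \<forall>j<d. \<xi> j = 0 then Kint / c else 0)"
  let ?R = "\<lambda>t x r. indicator S (x, r) * ren k \<xi> (r + t) x"
  let ?Ind = "\<lambda>x r. complex_of_real (indicator S (x, r))"
  have h: "?h \<in> borel_measurable (lam d)" "\<And>x. norm (?h x) \<le> 1" "\<And>x. x \<notin> cube d \<Longrightarrow> ?h x = 0"
    by (measurable, auto simp: indicator_def norm_mult)
  have adm: "adm ?f" by (rule product_adm[OF h])
  have J: "(\<integral>z. ?f z \<partial>XR) = of_real c * ?V"
  proof -
    have "(\<integral>x. ?h x \<partial>lam d) = (\<integral>x. chr d \<xi> x \<partial>lam d)"
      by (rule Bochner_Integration.integral_cong) (auto simp: indicator_def)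
    moreover have "(\<integral>z. ?f z \<partial>XR) = (\<integral>x. ?h x \<partial>lam d) * of_real Kint" by (rule product_integral(1)[OF h])
    ultimately have "(\<integral>z. ?f z \<partial>XR) = (if \<forall>j<d. \<xi> j = 0 then 1 else 0) * of_real Kint"
      by (simp only: integral_chr)
    then show ?thesis using c_pos by auto
  qed
  have eq: "indicator S z * (\<Sum>n<Nt t. ?f ((T ^^ n) (fst z), snd z + t - p n (fst z))) = ?R t (fst z) (snd z)" if t: "t \<ge> 0" for t z
  proof (cases "z \<in> S")
    case True
    then have z: "fst z \<in> cube d" "snd z < \<Psi> (fst z)" using S(2) by (auto simp: susp_space_def)
    have "(snd z + t) / m0 \<le> (t + M1) / m0" using z(2) Psi_upper[of "fst z"] m0 by (intro divide_right_mono) auto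
    then have "nat \<lceil>(snd z + t) / m0\<rceil> \<le> Nt t" unfolding Nt_def by (intro le_SucI nat_mono ceiling_mono)
    from ren_eq[OF _ this, of k \<xi> "fst z"] k_zero
    show ?thesis using True Tn_cube[OF z(1)] by simp
  qed simp
  have Sr [measurable]: "{x. (x, r) \<in> S} \<in> sets (lam d)" for r
    using sets_Pair2[OF S(1), of r] by (simp add: vimage_def)
  have Int: "(\<integral>x. ?Ind x r \<partial>lam d) = complex_of_real (measure (lam d) {x. (x, r) \<in> S})" for r
  proof -
    have "(\<integral>x. ?Ind x r \<partial>lam d) = complex_of_real (\<integral>x. indicator {x. (x, r) \<in> S} x \<partial>lam d)"
      unfolding integral_complex_of_real by (simp add: indicator_def)
    then show ?thesis using sets.sets_into_space[OF Sr] by (simp add: Int_absorb2)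
  qed
  have SI: "integrable XR (\<lambda>z. complex_of_real (indicator S z))"
    by (intro integrable_of_real integrable_real_indicator S(1) le_less_trans[OF emeasure_mono[OF S(2) MM_sets]] MM_finite)
  have L1: "((\<lambda>t. \<integral>r. (\<integral>x. ?R t x r \<partial>lam d) \<partial>lborel) \<longlongrightarrow> (\<integral>r. (\<integral>x. ?Ind x r \<partial>lam d) * ?V \<partial>lborel)) at_top"
  proof (rule integral_dominated_convergence_at_top[where w="\<lambda>r. B * indicator {0..M1} r"])
    show "(\<lambda>r. (\<integral>x. ?Ind x r \<partial>lam d) * ?V) \<in> borel_measurable lborel"
      using PS.integrable_snd[of ?Ind] SI by (intro borel_measurable_times borel_measurable_integrable) (auto simp: split_beta')
    show "\<forall>\<^sub>F t in at_top. AE r in lborel. norm (\<integral>x. ?R t x r \<partial>lam d) \<le> B * indicator {0..M1} r"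
    proof (intro always_eventually allI AE_I2)
      fix t r :: real
      have "norm (\<integral>x. ?R t x r \<partial>lam d) \<le> (\<integral>x. norm (?R t x r) \<partial>lam d)" by (rule integral_norm_bound)
      also have "\<dots> \<le> (\<integral>x. B * indicator {0..M1} r \<partial>lam d)"
      proof (rule integral_mono')
        fix x
        show "norm (?R t x r) \<le> B * indicator {0..M1} r"
        proof (cases "(x, r) \<in> S")
          case True
          then have "r \<in> {0..M1}" using S(2) Psi_upper[of x] by (fastforce simp: susp_space_def)
          then show ?thesis using True ren_bound[of k B \<xi> "r + t" x, OF k_zero k_bound] by simp
        qed (use B_nonneg in simp)
      qed (use B_nonneg in auto)
      also have "\<dots> = B * indicator {0..M1} r" using Ld.prob_space by simp
      finally show "norm (\<integral>x. ?R t x r \<partial>lam d) \<le> B * indicator {0..M1} r" .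
    qed
    show "integrable lborel (\<lambda>r. B * indicator {0..M1} r)"
      by (intro integrable_mult_right integrable_real_indicator) (use M1_pos in auto)
    show "AE r in lborel. ((\<lambda>t. \<integral>x. ?R t x r \<partial>lam d) \<longlongrightarrow> (\<integral>x. ?Ind x r \<partial>lam d) * ?V) at_top"
    proof (rule AE_I2)
      fix r :: real
      have "filterlim (\<lambda>t. r + t) at_top at_top" by (rule filterlim_tendsto_add_at_top[OF tendsto_const filterlim_ident])
      from filterlim_compose[OF correlation_limit_set[OF Sr[of r], of \<xi>] this]
      show "((\<lambda>t. \<integral>x. ?R t x r \<partial>lam d) \<longlongrightarrow> (\<integral>x. ?Ind x r \<partial>lam d) * ?V) at_top"
        unfolding Int by (simp add: indicator_def)
    qed
    show "(\<lambda>r. \<integral>x. ?R t x r \<partial>lam d) \<in> borel_measurable lborel" for t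
    proof -
      have [measurable]: "(\<lambda>z. chr d \<xi> ((T ^^ n) (fst z))) \<in> borel_measurable XR" for n
        by (rule measurable_compose[OF measurable_fst measurable_compose[OF Tn_measurable chr_measurable]])
      let ?N = "nat \<lceil>(\<bar>t\<bar> + M1) / m0\<rceil>"
      let ?G = "\<lambda>z. indicator S z * (\<Sum>n<?N. chr d \<xi> ((T ^^ n) (fst z)) * complex_of_real (k (snd z + t - p n (fst z))))"
      have e: "?R t x r = ?G (x, r)" for x r
      proof (cases "(x, r) \<in> S")
        case True
        then have "r < \<Psi> x" using S(2) by (auto simp: susp_space_def)
        then have "(r + t) / m0 \<le> (\<bar>t\<bar> + M1) / m0" using Psi_upper[of x] m0 by (intro divide_right_mono) auto
        then have "nat \<lceil>(r + t) / m0\<rceil> \<le> ?N" by (intro nat_mono ceiling_mono)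
        from ren_eq[OF _ this, of k \<xi> x] k_zero show ?thesis using True by simp
      qed simp
      have [measurable]: "S \<in> sets XR" by (rule S)
      have "?G \<in> borel_measurable XR" by measurable
      then have "(\<lambda>(r, x). ?G (x, r)) \<in> borel_measurable (lborel \<Otimes>\<^sub>M lam d)"
        using measurable_compose[OF measurable_pair_swap'] by (simp add: split_beta')
      then have "(\<lambda>r. \<integral>x. ?G (x, r) \<partial>lam d) \<in> borel_measurable lborel"
        by (rule Ld.borel_measurable_lebesgue_integral)
      then show ?thesis unfolding e .
    qed
  qed
  have L2: "(\<integral>r. (\<integral>x. ?Ind x r \<partial>lam d) * ?V \<partial>lborel) = of_real (measure XR S / c) * (\<integral>z. ?f z \<partial>XR)"
  proof -
    have "(\<integral>r. (\<integral>x. ?Ind x r \<partial>lam d) \<partial>lborel) = (\<integral>z. complex_of_real (indicator S z) \<partial>XR)"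
      using PS.integral_snd[of ?Ind] SI by (simp add: split_beta')
    also have "\<dots> = of_real (measure XR S)"
      unfolding integral_complex_of_real using sets.sets_into_space[OF S(1)] by (simp add: Int_absorb2)
    finally show ?thesis unfolding J using c_pos by (simp only: integral_mult_left_zero) simp
  qed
  have L3: "\<forall>\<^sub>F t in at_top. (\<integral>r. (\<integral>x. ?R t x r \<partial>lam d) \<partial>lborel) = Cor S t ?f"
    using eventually_ge_at_top[of 0]
  proof eventually_elim
    case (elim t)
    have "integrable XR (\<lambda>z. ?R t (fst z) (snd z))"
      using Cor_integrable[where N="Nt t" and t=t, OF adm S] unfolding eq[OF elim] .
    then have "(\<integral>r. (\<integral>x. ?R t x r \<partial>lam d) \<partial>lborel) = (\<integral>z. ?R t (fst z) (snd z) \<partial>XR)"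
      using PS.integral_snd[of "?R t"] by (simp add: split_beta')
    then show ?case unfolding Cor_def eq[OF elim] .
  qed
  show ?thesis unfolding good_def using adm Lim_transform_eventually[OF L1[unfolded L2] L3] by blast
qed

lemma good_tp:
  assumes S: "S \<in> sets XR" "S \<subseteq> MM" and P: "tp d P"
  shows "good S (\<lambda>z. (indicator (cube d) (fst z) * P (fst z)) * of_real (k (snd z)))"
  using P
proof induction
  case tp_zero show ?case by (simp add: good_zero)
next
  case (tp_step P w \<xi>)
  from good_diff[OF S tp_step.IH good_scale[OF good_chr[OF S, of \<xi>], of "- w"]]
  show ?case by (simp add: algebra_simps)
qed

lemma good_product:
  assumes S: "S \<in> sets XR" "S \<subseteq> MM" and E [measurable]: "E \<in> sets (lam d)"
  shows "good S (\<lambda>z. indicator E (fst z) * of_real (k (snd z)))"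
proof (rule good_approx[OF S])
  interpret Ld: prob_space "lam d" by simp
  interpret TM: torus_measures d "lam d" "lam d" by unfold_locales auto
  have EC: "E \<subseteq> cube d" using sets.sets_into_space[OF E] by simp
  show "adm (\<lambda>z. indicator E (fst z) * of_real (k (snd z)))"
    by (rule product_adm[of _ 1]) (use EC in \<open>auto simp: indicator_def\<close>)
  fix e :: real assume e: "e > 0"
  let ?K = "\<integral>r. \<bar>k r\<bar> \<partial>lborel"
  have K: "?K \<ge> 0" by simp
  \<comment> \<open>The product with the height profile multiplies the error on the base by
    \<open>?K\<close>; the summand 1 avoids division by zero and keeps the final inequality
    strict.\<close>
  have "e / (?K + 1) > 0" by (intro divide_pos_pos add_nonneg_pos K e) auto
  then obtain P where P: "tp d P" "(\<integral>x. norm (indicator E x - P x) \<partial>lam d) < e / (?K + 1)"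
    using TM.ap_approx[OF TM.ap_indicator[OF E]] by metis
  obtain M where M: "\<And>x. norm (P x) \<le> M" using tp_bounded[OF P(1)] by auto
  let ?h = "\<lambda>x. indicator E x - indicator (cube d) x * P x"
  have hb: "norm (?h x) \<le> 1 + M" for x
  proof -
    have "norm (?h x) \<le> norm (indicator E x :: complex) + norm (indicator (cube d) x * P x)" by (rule norm_triangle_ineq4)
    also have "\<dots> \<le> 1 + M" using M[of x] order_trans[OF norm_ge_zero M[of x]] by (intro add_mono) (auto simp: indicator_def)
    finally show ?thesis .
  qed
  have hm: "?h \<in> borel_measurable (lam d)" using tp_measurable[OF P(1)] by measurable
  have h0: "?h x = 0" if "x \<notin> cube d" for x using that EC by (auto simp: indicator_def)
  have "(\<integral>z. norm (indicator E (fst z) * of_real (k (snd z)) - (indicator (cube d) (fst z) * P (fst z)) * of_real (k (snd z))) \<partial>XR)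
     = (\<integral>z. norm (?h (fst z) * of_real (k (snd z))) \<partial>XR)" by (simp only: left_diff_distrib)
  also have "\<dots> = (\<integral>x. norm (?h x) \<partial>lam d) * ?K" by (rule product_integral(2)[OF hm hb h0])
  also have "(\<integral>x. norm (?h x) \<partial>lam d) = (\<integral>x. norm (indicator E x - P x) \<partial>lam d)"
    by (rule Bochner_Integration.integral_cong) auto
  also have "\<dots> * ?K \<le> e / (?K + 1) * ?K" using P(2) K by (intro mult_right_mono) auto
  also have "e / (?K + 1) * ?K < e"
  proof -
    have "x \<ge> 0 \<Longrightarrow> e / (x + 1) * x < e" for x using e by (simp add: field_simps)
    then show ?thesis using K by blast
  qed
  finally show "\<exists>g. good S g \<and> (\<integral>z. norm (indicator E (fst z) * of_real (k (snd z)) - g z) \<partial>XR) < e"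
    using good_tp[OF S P(1)] by blast
qed

end

section \<open>From smooth height profiles to measurable sets\<close>

lemma max_square_has_derivative:
  fixes u :: real
  shows "((\<lambda>u. (max 0 u)\<^sup>2) has_real_derivative 2 * max 0 u) (at u)"
proof -
  consider "u > 0" | "u < 0" | "u = 0" by linarith
  then show ?thesis
  proof cases
    case 1
    have "((\<lambda>u. u\<^sup>2) has_real_derivative 2 * max 0 u) (at u)" using 1 by (auto intro!: derivative_eq_intros)
    then show ?thesis
      by (rule has_field_derivative_transform_within_open[of _ _ _ "{0<..}"]) (use 1 in auto)
  next
    case 2
    have "((\<lambda>u. 0) has_real_derivative 2 * max 0 u) (at u)" using 2 by (auto intro!: derivative_eq_intros)
    then show ?thesis
      by (rule has_field_derivative_transform_within_open[of _ _ _ "{..<0}"]) (use 2 in auto)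
  next
    case 3
    have "(\<lambda>h::real. ((max 0 (0 + h))\<^sup>2 - (max 0 0)\<^sup>2) / h) \<midarrow>0\<rightarrow> 0"
    proof (rule Lim_null_comparison[of _ "\<lambda>h. \<bar>h\<bar>"])
      show "\<forall>\<^sub>F h::real in at 0. norm (((max 0 (0 + h))\<^sup>2 - (max 0 0)\<^sup>2) / h) \<le> \<bar>h\<bar>"
        by (intro always_eventually allI) (auto simp: max_def power2_eq_square)
      show "(\<lambda>h::real. \<bar>h\<bar>) \<midarrow>0\<rightarrow> 0" by (rule tendsto_rabs_zero[OF tendsto_ident_at])
    qed
    then show ?thesis using 3 by (simp add: DERIV_def)
  qed
qed

context trig_suspension
begin

text \<open>With \<open>W\<close> continuously differentiable and positive exactly on the interval,
  the profiles \<open>j * W / (1 + j * W)\<close> stay below 1, vanish where \<open>W\<close> does,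
  and tend to the indicator of the open interval.\<close>

lemma cutoff_sequence:
  assumes ab: "0 \<le> \<alpha>" "\<beta> \<le> m0"
  obtains k :: "nat \<Rightarrow> real \<Rightarrow> real" and k1 B1
  where "\<And>j. cutoff d a b F cf \<Psi> c m0 CU i0 sh (k j) (k1 j) 1 (B1 j)"
    "\<And>r. (\<lambda>j. k j r) \<longlonglongrightarrow> indicator {\<alpha><..<\<beta>} r"
proof -
  have "\<exists>W W1. continuous_on UNIV W1 \<and> (\<forall>r. (W has_real_derivative W1 r) (at r)) \<and> (\<forall>r. W r \<ge> 0) \<and>
     (\<forall>r. W r \<noteq> 0 \<longrightarrow> \<alpha> < r \<and> r < \<beta>) \<and> (\<forall>r. W1 r \<noteq> 0 \<longrightarrow> \<alpha> < r \<and> r < \<beta>) \<and> (\<forall>r. \<alpha> < r \<and> r < \<beta> \<longrightarrow> W r > 0)"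
  proof (intro exI conjI allI impI)
    \<comment> \<open>Squares of positive parts are continuously differentiable, which the positive
      parts themselves are not.\<close>
    let ?W = "\<lambda>r. (max 0 (r - \<alpha>))\<^sup>2 * (max 0 (\<beta> - r))\<^sup>2"
    let ?W1 = "\<lambda>r. 2 * max 0 (r - \<alpha>) * (max 0 (\<beta> - r))\<^sup>2 - (max 0 (r - \<alpha>))\<^sup>2 * (2 * max 0 (\<beta> - r))"
    show "continuous_on UNIV ?W1" by (intro continuous_intros)
    show "(?W has_real_derivative ?W1 r) (at r)" for r
    proof -
      have 1: "((\<lambda>r. (max 0 (r - \<alpha>))\<^sup>2) has_real_derivative 2 * max 0 (r - \<alpha>) * 1) (at r)"
        by (rule DERIV_chain2[OF max_square_has_derivative]) (auto intro!: derivative_eq_intros)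
      have 2: "((\<lambda>r. (max 0 (\<beta> - r))\<^sup>2) has_real_derivative 2 * max 0 (\<beta> - r) * (- 1)) (at r)"
        by (rule DERIV_chain2[OF max_square_has_derivative]) (auto intro!: derivative_eq_intros)
      show ?thesis using DERIV_mult[OF 1 2] by (simp add: mult_ac)
    qed
    show "?W r \<ge> 0" for r by simp
    have za: "max 0 (r - \<alpha>) = 0" if "\<not> \<alpha> < r" for r using that by simp
    have zb: "max 0 (\<beta> - r) = 0" if "\<not> r < \<beta>" for r using that by simp
    show "\<alpha> < r" if "?W r \<noteq> 0" for r
    proof (rule ccontr)
      assume "\<not> \<alpha> < r"
      then show False using that za[of r] by simp
    qed
    show "r < \<beta>" if "?W r \<noteq> 0" for r
    proof (rule ccontr)
      assume "\<not> r < \<beta>"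
      then show False using that zb[of r] by simp
    qed
    show "\<alpha> < r" if "?W1 r \<noteq> 0" for r
    proof (rule ccontr)
      assume "\<not> \<alpha> < r"
      then show False using that za[of r] by simp
    qed
    show "r < \<beta>" if "?W1 r \<noteq> 0" for r
    proof (rule ccontr)
      assume "\<not> r < \<beta>"
      then show False using that zb[of r] by simp
    qed
    show "?W r > 0" if "\<alpha> < r \<and> r < \<beta>" for r using that by (simp add: max_def)
  qed
  then obtain W W1 where W: "continuous_on UNIV W1" "\<And>r. (W has_real_derivative W1 r) (at r)" "\<And>r. W r \<ge> 0"
     "\<And>r. W r \<noteq> 0 \<Longrightarrow> \<alpha> < r \<and> r < \<beta>" "\<And>r. W1 r \<noteq> 0 \<Longrightarrow> \<alpha> < r \<and> r < \<beta>" "\<And>r. \<alpha> < r \<Longrightarrow> r < \<beta> \<Longrightarrow> W r > 0" by blast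
  define k where "k j r = real j * W r / (1 + real j * W r)" for j r
  define k1 where "k1 j r = real j * W1 r / (1 + real j * W r)\<^sup>2" for j r
  have pos: "1 + real j * W r > 0" for j r using W(3)[of r] by (simp add: add_pos_nonneg)
  have cW: "continuous_on UNIV W" using W(2) DERIV_continuous_on by blast
  have k1c: "continuous_on UNIV (k1 j)" for j
    unfolding k1_def by (intro continuous_intros W cW) (use pos in \<open>simp add: less_imp_neq[symmetric]\<close>)
  have kd: "(k j has_real_derivative k1 j r) (at r)" for j r
  proof -
    have n: "1 + real j * W r \<noteq> 0" using pos[of j r] by linarith
    have "((\<lambda>r. real j * W r / (1 + real j * W r)) has_real_derivative
       (real j * W1 r * (1 + real j * W r) - real j * W r * (real j * W1 r)) / ((1 + real j * W r) * (1 + real j * W r))) (at r)"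
    proof (rule DERIV_divide)
      show "((\<lambda>r. real j * W r) has_real_derivative real j * W1 r) (at r)" by (rule DERIV_cmult, rule W(2))
      show "((\<lambda>r. 1 + real j * W r) has_real_derivative real j * W1 r) (at r)"
        by (rule DERIV_cong, rule DERIV_add, rule DERIV_const, rule DERIV_cmult, rule W(2), simp)
    qed (rule n)
    then show ?thesis unfolding k_def k1_def by (simp add: algebra_simps power2_eq_square)
  qed
  have out: "r \<le> 0 \<or> r \<ge> m0 \<Longrightarrow> W r = 0" "r \<le> 0 \<or> r \<ge> m0 \<Longrightarrow> W1 r = 0" for r using W(4,5)[of r] ab by force+
  have "\<exists>B1. \<forall>r. \<bar>k1 j r\<bar> \<le> B1" for j
  proof -
    have "compact (k1 j ` {0..m0})" using k1c[of j] by (intro compact_continuous_image) (auto intro: continuous_on_subset)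
    then have "bounded (k1 j ` {0..m0})" by (rule compact_imp_bounded)
    then obtain C where "\<forall>y\<in>k1 j ` {0..m0}. norm y \<le> C" unfolding bounded_iff by (rule exE)
    then have C: "\<bar>k1 j r\<bar> \<le> C" if "r \<in> {0..m0}" for r using that by auto
    have "\<bar>k1 j r\<bar> \<le> C" for r
    proof (cases "r \<in> {0..m0}")
      case False
      then have "k1 j r = 0" using out(2)[of r] by (auto simp: k1_def)
      moreover have "C \<ge> 0" using order_trans[OF abs_ge_zero C[of 0]] m0 by simp
      ultimately show ?thesis by simp
    qed (rule C)
    then show ?thesis by blast
  qed
  then have "\<forall>j. \<exists>B1. \<forall>r. \<bar>k1 j r\<bar> \<le> B1" by (rule allI)
  from choice[OF this] obtain B1 where "\<forall>j r. \<bar>k1 j r\<bar> \<le> B1 j" by (rule exE)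
  then have B1: "\<bar>k1 j r\<bar> \<le> B1 j" for j r by simp
  show ?thesis
  proof (rule that[of k k1 B1])
    show "cutoff d a b F cf \<Psi> c m0 CU i0 sh (k j) (k1 j) 1 (B1 j)" for j
    proof unfold_locales
      show "\<bar>k j r\<bar> \<le> 1" for r
      proof -
        have "\<bar>u / (1 + u)\<bar> \<le> 1" if "u \<ge> 0" for u :: real using that by (simp add: divide_le_eq)
        moreover have "real j * W r \<ge> 0" using W(3)[of r] by simp
        ultimately show ?thesis unfolding k_def .
      qed
      show "(k j has_real_derivative k1 j r) (at r)" for r by (rule kd)
      show "continuous_on UNIV (k1 j)" by (rule k1c)
      show "\<bar>k1 j r\<bar> \<le> B1 j" for r by (rule B1)
      show "r \<le> 0 \<or> r \<ge> m0 \<Longrightarrow> k j r = 0" "r \<le> 0 \<or> r \<ge> m0 \<Longrightarrow> k1 j r = 0" for r using out[of r] by (auto simp: k_def k1_def)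
    qed
    fix r
    show "(\<lambda>j. k j r) \<longlonglongrightarrow> indicator {\<alpha><..<\<beta>} r"
    proof (cases "r \<in> {\<alpha><..<\<beta>}")
      case True
      then have Wp: "W r > 0" using W(6)[of r] by auto
      have "(\<lambda>j. real j * u / (1 + real j * u)) \<longlonglongrightarrow> 1" if "u > 0" for u :: real using that by real_asymp
      from this[OF Wp] have "(\<lambda>j. real j * W r / (1 + real j * W r)) \<longlonglongrightarrow> 1" .
      then show ?thesis using True by (simp add: k_def)
    next
      case False
      then have "W r = 0" using W(4)[of r] by auto
      then show ?thesis using False by (simp add: k_def)
    qed
  qed
qed

lemma good_rectangle:
  assumes S: "S \<in> sets XR" "S \<subseteq> MM" and E: "E \<in> sets (lam d)" and ab: "0 \<le> \<alpha>" "\<beta> \<le> m0"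
  shows "good S (indicator (E \<times> {\<alpha><..<\<beta>}))"
proof -
  obtain k k1 B1 where k: "\<And>j. cutoff d a b F cf \<Psi> c m0 CU i0 sh (k j) (k1 j) 1 (B1 j)"
    and lim: "\<And>r. (\<lambda>j. k j r) \<longlonglongrightarrow> indicator {\<alpha><..<\<beta>} r"
    by (rule cutoff_sequence[OF ab]) (rule that, assumption+)
  show ?thesis
  proof (rule good_dominated[OF S cutoff.good_product[OF k S E]])
    fix z
    have "(\<lambda>j. indicator E (fst z) * complex_of_real (k j (snd z))) \<longlonglongrightarrow> indicator E (fst z) * complex_of_real (indicator {\<alpha><..<\<beta>} (snd z))"
      by (intro tendsto_intros lim)
    then show "(\<lambda>j. indicator E (fst z) * complex_of_real (k j (snd z))) \<longlonglongrightarrow> indicator (E \<times> {\<alpha><..<\<beta>}) z"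
      by (cases z) (simp add: indicator_times of_real_indicator)
    show "norm (indicator E (fst z) * complex_of_real (k j (snd z))) \<le> 1" for j
      using cutoff.k_bound[OF k, of j "snd z"] by (simp add: norm_mult indicator_def)
  qed
qed

lemma good_UN:
  fixes A :: "nat \<Rightarrow> _"
  assumes S: "S \<in> sets XR" "S \<subseteq> MM" and disj: "disjoint_family A" and A: "\<And>i. good S (indicator (A i))"
  shows "good S (indicator (\<Union>i. A i))"
proof (rule good_dominated[OF S])
  show "good S (\<lambda>z. \<Sum>i<n. indicator (A i) z)" for n by (rule good_sum[OF S]) (use A in auto)
  have e: "(\<Sum>i<n. indicator (A i) z) = (indicator (\<Union>i<n. A i) z :: complex)" for n z
    by (rule indicator_UN_disjoint[symmetric]) (use disj in \<open>auto intro: disjoint_family_on_mono\<close>)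
  show "(\<lambda>n. \<Sum>i<n. indicator (A i) z) \<longlonglongrightarrow> (indicator (\<Union>i. A i) z :: complex)" for z
    unfolding e by (rule LIMSEQ_indicator_UN)
  show "norm (\<Sum>i<n. indicator (A i) z :: complex) \<le> 1" for n z unfolding e by (simp add: indicator_def)
qed

lemma good_empty: "good S (indicator {})"
proof -
  have "(indicator {} :: (nat \<Rightarrow> real) \<times> real \<Rightarrow> complex) = (\<lambda>z. 0)" by (rule ext) simp
  then show ?thesis using good_zero by (simp only:)
qed

abbreviation Om :: "((nat \<Rightarrow> real) \<times> real) set" where "Om \<equiv> cube d \<times> {0<..<m0}"

text \<open>A Dynkin argument in the height variable, relative to the strip of heights between 0 and
  \<open>m0\<close>: complements are taken inside the strip.\<close>

lemma good_strip_rectangle: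
  assumes S: "S \<in> sets XR" "S \<subseteq> MM" and E: "E \<in> sets (lam d)" and I: "I \<in> sets (borel :: real measure)"
  shows "good S (indicator (E \<times> (I \<inter> {0<..<m0})))"
proof -
  have gen: "sets (borel :: real measure) = sigma_sets UNIV (range greaterThan)"
    unfolding borel_Ioi by simp
  show ?thesis
  proof (rule sigma_sets_induct_disjoint[of "range greaterThan" UNIV I])
    show "Int_stable (range (greaterThan :: real \<Rightarrow> _))"
    proof (rule Int_stableI_image)
      fix a b :: real
      show "\<exists>c\<in>UNIV. {a<..} \<inter> {b<..} = {c<..}" by (intro bexI[of _ "max a b"]) auto
    qed
    show "I \<in> sigma_sets UNIV (range greaterThan)" using I gen by simp
    show "good S (indicator (E \<times> (A \<inter> {0<..<m0})))" if A: "A \<in> range greaterThan" for A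
    proof -
      obtain v where v: "A = {v<..}" using A by blast
      have "A \<inter> {0<..<m0} = {max v 0<..<m0}" unfolding v by auto
      then show ?thesis using good_rectangle[OF S E, of "max v 0" m0] by simp
    qed
    show "good S (indicator (E \<times> ({} \<inter> {0<..<m0})))" by (simp only: Int_empty_left Sigma_empty2 Times_empty good_empty)
    show "good S (indicator (E \<times> ((UNIV - A) \<inter> {0<..<m0})))" if "good S (indicator (E \<times> (A \<inter> {0<..<m0})))" for A
    proof -
      have "(\<lambda>z. indicator (E \<times> {0<..<m0}) z - indicator (E \<times> (A \<inter> {0<..<m0})) z) = (indicator (E \<times> ((UNIV - A) \<inter> {0<..<m0})) :: _ \<Rightarrow> complex)"
        by (auto simp: indicator_def fun_eq_iff)
      then show ?thesis using good_diff[OF S good_rectangle[OF S E, of 0 m0] that] by simp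
    qed
    fix A :: "nat \<Rightarrow> real set"
    assume "disjoint_family A" and g: "\<And>i. good S (indicator (E \<times> (A i \<inter> {0<..<m0})))"
    then have "good S (indicator (\<Union>i. E \<times> (A i \<inter> {0<..<m0})))"
      by (intro good_UN[OF S]) (auto simp: disjoint_family_on_def)
    moreover have "(\<Union>i. E \<times> (A i \<inter> {0<..<m0})) = E \<times> ((\<Union>i. A i) \<inter> {0<..<m0})" by auto
    ultimately show "good S (indicator (E \<times> ((\<Union>i. A i) \<inter> {0<..<m0})))" by simp
  qed simp
qed

lemma good_strip:
  assumes S: "S \<in> sets XR" "S \<subseteq> MM" and A: "A \<in> sets XR"
  shows "good S (indicator (A \<inter> Om))"
proof -
  let ?G = "{E \<times> I | E I. E \<in> sets (lam d) \<and> I \<in> sets (lborel :: real measure)}"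
  have Om: "good S (indicator Om)"
    using good_strip_rectangle[OF S cube_sets, of UNIV] by simp
  show ?thesis
  proof (rule sigma_sets_induct_disjoint[of ?G "space XR" A])
    show "Int_stable ?G" by (rule Int_stable_pair_measure_generator)
    show "?G \<subseteq> Pow (space XR)" using sets.sets_into_space by (fastforce simp: space_pair_measure)
    show "A \<in> sigma_sets (space XR) ?G" using A by (simp add: sets_pair_measure space_pair_measure)
    show "good S (indicator (X \<inter> Om))" if X: "X \<in> ?G" for X
    proof -
      obtain E I where X: "X = E \<times> I" "E \<in> sets (lam d)" "I \<in> sets borel" using X by auto
      have "X \<inter> Om = E \<times> (I \<inter> {0<..<m0})" using sets.sets_into_space[OF X(2)] X(1) by auto
      then show ?thesis using good_strip_rectangle[OF S X(2,3)] by simp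
    qed
    show "good S (indicator ({} \<inter> Om))" by (simp only: Int_empty_left good_empty)
    show "good S (indicator ((space XR - X) \<inter> Om))" if "good S (indicator (X \<inter> Om))" for X
    proof -
      have "(\<lambda>z. indicator Om z - indicator (X \<inter> Om) z) = (indicator ((space XR - X) \<inter> Om) :: _ \<Rightarrow> complex)"
        by (auto simp: indicator_def fun_eq_iff space_pair_measure)
      then show ?thesis using good_diff[OF S Om that] by simp
    qed
    fix X :: "nat \<Rightarrow> _ set"
    assume "disjoint_family X" and g: "\<And>i. good S (indicator (X i \<inter> Om))"
    then have "good S (indicator (\<Union>i. X i \<inter> Om))"
      by (intro good_UN[OF S]) (auto simp: disjoint_family_on_def)
    then show "good S (indicator ((\<Union>i. X i) \<inter> Om))" by simp
  qed
qed

text \<open>The profiles vanish at height 0, so only open strips are reached directly; the bottom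
  level is a null set.\<close>

lemma good_bottom:
  assumes S: "S \<in> sets XR" "S \<subseteq> MM" and A: "A \<in> sets XR" "A \<subseteq> cube d \<times> {0..<m0}"
  shows "good S (indicator A)"
proof (rule good_approx[OF S])
  have AM: "A \<subseteq> MM"
  proof
    fix z assume "z \<in> A"
    then show "z \<in> MM" using A(2) Psi_lower[of "fst z"] by (cases z) (force simp: susp_space_def)
  qed
  show "adm (indicator A)" by (rule adm_indicator[OF A(1) AM])
  fix e :: real assume e: "e > 0"
  have "emeasure XR (cube d \<times> {0}) = emeasure (lam d) (cube d) * emeasure lborel {0::real}"
    by (intro lborel.emeasure_pair_measure_Times) auto
  then have "AE z in XR. z \<notin> cube d \<times> {0}" by (intro AE_not_in) (auto simp: null_sets_def)
  then have "AE z in XR. norm (indicator A z - indicator (A \<inter> Om) z :: complex) = 0"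
  proof eventually_elim
    case (elim z)
    have "z \<in> Om" if "z \<in> A" using subsetD[OF A(2) that] elim by (cases z) auto
    then show ?case by (auto simp: indicator_def)
  qed
  then have "(\<integral>z. norm (indicator A z - indicator (A \<inter> Om) z :: complex) \<partial>XR) = 0" by (rule integral_eq_zero_AE)
  then show "\<exists>g. good S g \<and> (\<integral>z. norm (indicator A z - g z :: complex) \<partial>XR) < e"
    using good_strip[OF S A(1)] e by (intro exI[of _ "indicator (A \<inter> Om)"]) simp
qed

text \<open>A slice of thickness \<open>m0\<close> above height \<open>h\<close> is a set at the
  bottom carried upwards by the flow during time \<open>h\<close>. Its correlation at time
  \<open>t\<close> is that of the lowered set at time \<open>t - h\<close>, and lowering preserves
  the measure.\<close>

lemma good_slice:
  assumes S: "S \<in> sets XR" "S \<subseteq> MM" and A: "A \<in> sets XR" "A \<subseteq> MM" and h: "h \<ge> 0" "\<And>x r. (x, r) \<in> A \<Longrightarrow> h \<le> r \<and> r < h + m0"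
  shows "good S (indicator A)"
proof -
  let ?A = "(\<lambda>z. (fst z, snd z + h)) -` A \<inter> space XR"
  have tm: "(\<lambda>z. (fst z, snd z + h)) \<in> measurable XR XR" by (intro measurable_Pair) measurable
  have Am: "?A \<in> sets XR" by (rule measurable_sets[OF tm A(1)])
  have g: "good S (indicator ?A)"
    by (rule good_bottom[OF S Am]) (use h(2) in \<open>force simp: space_pair_measure\<close>)
  have ind: "indicator ?A (x, r) = (indicator A (x, r + h) :: 'z::zero_neq_one)" if "x \<in> cube d" for x r
    using that by (auto simp: indicator_def space_pair_measure)
  have m: "measure XR ?A = measure XR A"
  proof -
    have "emeasure XR ?A = (\<integral>\<^sup>+x. (\<integral>\<^sup>+r. indicator ?A (x, r) \<partial>lborel) \<partial>lam d)"
      using lborel.nn_integral_fst[of "indicator ?A" "lam d"] Am by simp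
    also have "\<dots> = (\<integral>\<^sup>+x. (\<integral>\<^sup>+r. indicator A (x, r) \<partial>lborel) \<partial>lam d)"
    proof (rule nn_integral_cong)
      fix x assume "x \<in> space (lam d)"
      then have x: "x \<in> cube d" by simp
      have "(\<lambda>r. indicator A (x, r)) \<in> borel_measurable borel"
        using measurable_compose[OF measurable_Pair1'[of x "lam d" lborel] borel_measurable_indicator[OF A(1)]] x by simp
      from nn_integral_real_affine[OF this, of 1 h]
      show "(\<integral>\<^sup>+r. indicator ?A (x, r) \<partial>lborel) = (\<integral>\<^sup>+r. indicator A (x, r) \<partial>lborel)"
        unfolding ind[OF x] by (simp add: add.commute)
    qed
    also have "\<dots> = emeasure XR A" using lborel.nn_integral_fst[of "indicator A" "lam d"] A(1) by simp
    finally show ?thesis by (simp add: measure_def)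
  qed
  have J: "(\<integral>z. indicator X z \<partial>XR) = complex_of_real (measure XR X)" if "X \<in> sets XR" for X
  proof -
    have "(\<integral>z. complex_of_real (indicator X z) \<partial>XR) = complex_of_real (measure XR X)"
      unfolding integral_complex_of_real using sets.sets_into_space[OF that] by (simp add: Int_absorb2)
    then show ?thesis by (simp add: of_real_indicator)
  qed
  have "filterlim (\<lambda>t. - h + t) at_top at_top" by (rule filterlim_tendsto_add_at_top[OF tendsto_const filterlim_ident])
  moreover have "((\<lambda>t. Cor S t (indicator ?A)) \<longlongrightarrow> of_real (measure XR S / c) * (\<integral>z. indicator ?A z \<partial>XR)) at_top"
    using g unfolding good_def by blast
  ultimately have L1: "((\<lambda>t. Cor S (- h + t) (indicator ?A)) \<longlongrightarrow> of_real (measure XR S / c) * (\<integral>z. indicator A z \<partial>XR)) at_top"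
    unfolding J[OF Am] J[OF A(1)] m by (rule filterlim_compose[rotated])
  have L2: "\<forall>\<^sub>F t in at_top. Cor S (- h + t) (indicator ?A) = Cor S t (indicator A)"
    using eventually_ge_at_top[of h]
  proof eventually_elim
    case (elim t)
    have "indicator S z * (\<Sum>n<Nt (- h + t). indicator ?A ((T ^^ n) (fst z), snd z + (- h + t) - p n (fst z)))
       = indicator S z * (\<Sum>n<Nt t. indicator A ((T ^^ n) (fst z), snd z + t - p n (fst z)) :: complex)" for z
    proof (cases "z \<in> S")
      case True
      then have z: "fst z \<in> cube d" "snd z < \<Psi> (fst z)" using S(2) by (auto simp: susp_space_def)
      have "(\<Sum>n<Nt (- h + t). indicator ?A ((T ^^ n) (fst z), snd z + (- h + t) - p n (fst z)))
         = (\<Sum>n<Nt (- h + t). indicator A ((T ^^ n) (fst z), snd z + t - p n (fst z)) :: complex)"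
        by (rule sum.cong[OF refl]) (subst ind[OF Tn_cube[OF z(1)]], simp add: algebra_simps)
      also have "\<dots> = (\<Sum>n<Nt t. indicator A ((T ^^ n) (fst z), snd z + t - p n (fst z)))"
      proof (rule sum.mono_neutral_left)
        have "(- h + t + M1) / m0 \<le> (t + M1) / m0" using h(1) m0 by (intro divide_right_mono) auto
        then have "nat \<lceil>(- h + t + M1) / m0\<rceil> \<le> nat \<lceil>(t + M1) / m0\<rceil>" by (intro nat_mono ceiling_mono)
        then have "Nt (- h + t) \<le> Nt t" unfolding Nt_def by (rule Suc_le_mono[THEN iffD2])
        then show "{..<Nt (- h + t)} \<subseteq> {..<Nt t}" by (simp only: lessThan_subset_iff)
        \<comment> \<open>The additional terms of the longer sum have heights
          \<open>snd z + t - p n (fst z)\<close> below \<open>h\<close>, hence below the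
          slice.\<close>
        show "\<forall>n\<in>{..<Nt t} - {..<Nt (- h + t)}. indicator A ((T ^^ n) (fst z), snd z + t - p n (fst z)) = (0::complex)"
        proof
          fix n assume "n \<in> {..<Nt t} - {..<Nt (- h + t)}"
          then have "Nt (- h + t) \<le> n" by (simp only: Diff_iff lessThan_iff not_less)
          then have le: "nat \<lceil>(- h + t + M1) / m0\<rceil> \<le> n" unfolding Nt_def by (rule Suc_leD)
          have "real (nat \<lceil>(- h + t + M1) / m0\<rceil>) * m0 \<le> real n * m0"
            by (rule mult_right_mono[OF of_nat_mono[OF le] less_imp_le[OF m0]])
          then have "- h + t + M1 \<le> p n (fst z)" using Nt_large[of "- h + t"] p_lower[of n "fst z"] elim by linarith
          then have "snd z + t - p n (fst z) < h" using z(2) Psi_upper[of "fst z"] by linarith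
          then show "indicator A ((T ^^ n) (fst z), snd z + t - p n (fst z)) = (0::complex)"
            using h(2) by (force simp: indicator_def)
        qed
      qed simp
      finally show ?thesis by simp
    qed simp
    then show ?case unfolding Cor_def by (simp only:)
  qed
  show ?thesis unfolding good_def by (rule conjI[OF adm_indicator[OF A] Lim_transform_eventually[OF L1 L2]])
qed

text \<open>Countably many disjoint slices of thickness \<open>m0\<close> exhaust the
  suspension.\<close>

lemma good_indicator:
  assumes S: "S \<in> sets XR" "S \<subseteq> MM" and A: "A \<in> sets XR" "A \<subseteq> MM"
  shows "good S (indicator A)"
proof -
  let ?A = "\<lambda>i::nat. A \<inter> {z \<in> space XR. real i * m0 \<le> snd z \<and> snd z < real i * m0 + m0}"
  have idx: "real i * m0 \<le> r \<and> r < real i * m0 + m0 \<longleftrightarrow> i = nat \<lfloor>r / m0\<rfloor>" if "r \<ge> 0" for i r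
  proof -
    have "real i * m0 \<le> r \<and> r < real i * m0 + m0 \<longleftrightarrow> real i \<le> r / m0 \<and> r / m0 < real i + 1" using m0 by (simp add: field_simps)
    also have "\<dots> \<longleftrightarrow> \<lfloor>r / m0\<rfloor> = int i" by (simp add: floor_eq_iff)
    also have "\<dots> \<longleftrightarrow> i = nat \<lfloor>r / m0\<rfloor>" using that m0 by auto
    finally show ?thesis .
  qed
  have nn: "(x, r) \<in> A \<Longrightarrow> r \<ge> 0" for x r using subsetD[OF A(2), of "(x, r)"] by (auto simp: susp_space_def)
  have "good S (indicator (\<Union>i. ?A i))"
  proof (rule good_UN[OF S, of ?A])
    show "disjoint_family ?A" unfolding disjoint_family_on_def
    proof (intro ballI impI)
      fix i j :: nat assume "i \<noteq> j"
      have "i = j" if z: "z \<in> ?A i" "z \<in> ?A j" for z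
      proof -
        have "snd z \<ge> 0" using nn[of "fst z" "snd z"] z by simp
        then show ?thesis using idx[of "snd z" i] idx[of "snd z" j] z by simp
      qed
      then show "?A i \<inter> ?A j = {}" using \<open>i \<noteq> j\<close> by blast
    qed
    show "good S (indicator (?A i))" for i
    proof (rule good_slice[OF S, where h="real i * m0"])
      have "{z \<in> space XR. real i * m0 \<le> snd z \<and> snd z < real i * m0 + m0} \<in> sets XR" by measurable
      then show "?A i \<in> sets XR" by (rule sets.Int[OF A(1)])
    qed (use A(2) m0 in auto)
  qed
  moreover have "(\<Union>i. ?A i) = A"
  proof
    show "A \<subseteq> (\<Union>i. ?A i)"
    proof
      fix z assume z: "z \<in> A"
      then have "snd z \<ge> 0" using nn[of "fst z" "snd z"] by simp
      then have "z \<in> ?A (nat \<lfloor>snd z / m0\<rfloor>)" using idx[of "snd z" "nat \<lfloor>snd z / m0\<rfloor>"] z sets.sets_into_space[OF A(1)] by blast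
      then show "z \<in> (\<Union>i. ?A i)" by blast
    qed
  qed blast
  ultimately show ?thesis by simp
qed

text \<open>Exactly one index brings the point back under the graph of \<Psi>, namely the least one
  in the definition of the flow; all other terms vanish because \<open>A\<close> lies in the
  suspension.\<close>

lemma susp_flow_sum:
  assumes z: "z \<in> MM" and t: "t \<ge> 0" and A: "A \<subseteq> MM"
  shows "(\<Sum>n<Nt t. indicator A ((T ^^ n) (fst z), snd z + t - p n (fst z))) = (indicator A (susp_flow T \<Psi> t z) :: complex)"
    and "susp_flow T \<Psi> t z \<in> MM"
proof -
  obtain x r where zx: "z = (x, r)" by (cases z)
  have x: "x \<in> cube d" "0 \<le> r" "r < \<Psi> x" using z by (auto simp: zx susp_space_def)
  define m where "m = (LEAST m. r + t < p (Suc m) x)"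
  obtain N :: nat where "(r + t) / m0 < real N" using reals_Archimedean2 by blast
  then have "r + t < p (Suc N) x" using p_lower[of "Suc N" x] m0 by (simp add: field_simps)
  then have m2: "r + t < p (Suc m) x" unfolding m_def by (rule LeastI)
  have m1: "p m x \<le> r + t"
  proof (cases m)
    case 0 then show ?thesis using x t by (simp add: birkhoff_sum_def)
  next
    case (Suc n)
    then show ?thesis using not_less_Least[of n "\<lambda>m. r + t < p (Suc m) x"] by (simp add: m_def)
  qed
  have fl: "susp_flow T \<Psi> t z = ((T ^^ m) x, r + t - p m x)" by (simp add: susp_flow_def zx Let_def m_def)
  show "susp_flow T \<Psi> t z \<in> MM" unfolding fl using m1 m2 Tn_cube[OF x(1), of m] by (simp add: susp_space_def p_Suc)
  have uniq: "n = m" if "((T ^^ n) x, r + t - p n x) \<in> MM" for n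
  proof (rule ccontr)
    have n: "p n x \<le> r + t" "r + t < p (Suc n) x" using that by (auto simp: susp_space_def p_Suc)
    assume "n \<noteq> m"
    then consider "Suc n \<le> m" | "Suc m \<le> n" by linarith
    then show False
    proof cases
      case 1 then show False using p_mono[of "Suc n" m x] m0 m1 n(2) by (cases "Suc n = m") auto
    next
      case 2 then show False using p_mono[of "Suc m" n x] m0 m2 n(1) by (cases "Suc m = n") auto
    qed
  qed
  have mN: "m < Nt t"
  proof -
    have "real m * m0 \<le> t + M1" using p_lower[of m x] m1 x(3) Psi_upper[of x] by linarith
    then have "real m \<le> (t + M1) / m0" using m0 by (simp add: field_simps)
    then have "real m \<le> real (nat \<lceil>(t + M1) / m0\<rceil>)" using real_nat_ceiling_ge[of "(t + M1) / m0"] by linarith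
    then have "m \<le> nat \<lceil>(t + M1) / m0\<rceil>" by (simp only: of_nat_le_iff)
    then show ?thesis unfolding Nt_def by (rule le_imp_less_Suc)
  qed
  have "(\<Sum>n<Nt t. indicator A ((T ^^ n) x, r + t - p n x)) = (\<Sum>n<Nt t. if n = m then indicator A ((T ^^ m) x, r + t - p m x) else (0::complex))"
  proof (rule sum.cong[OF refl])
    fix n show "indicator A ((T ^^ n) x, r + t - p n x) = (if n = m then indicator A ((T ^^ m) x, r + t - p m x) else (0::complex))"
    proof (cases "n = m")
      case False
      then have "((T ^^ n) x, r + t - p n x) \<notin> A" using uniq A by blast
      then show ?thesis using False by simp
    qed simp
  qed
  then show "(\<Sum>n<Nt t. indicator A ((T ^^ n) (fst z), snd z + t - p n (fst z))) = (indicator A (susp_flow T \<Psi> t z) :: complex)"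
    using mN by (simp add: zx fl[unfolded zx])
qed

text \<open>The return index is measurable with countably many values, and for each fixed index the
  map is measurable.\<close>

lemma susp_flow_measurable: "susp_flow T \<Psi> t \<in> measurable XR XR"
proof -
  let ?m = "\<lambda>z. LEAST m. snd z + t < p (Suc m) (fst z)"
  have g: "?m \<in> measurable XR (count_space UNIV)" by measurable
  have f: "(\<lambda>z. ((T ^^ m) (fst z), snd z + t - p m (fst z))) \<in> measurable XR XR" for m
    by (intro measurable_Pair) measurable
  have "(\<lambda>z. ((T ^^ ?m z) (fst z), snd z + t - p (?m z) (fst z))) \<in> measurable XR XR"
    by (rule measurable_compose_countable[OF f g])
  then show ?thesis by (simp add: susp_flow_def[abs_def] split_beta' Let_def)
qed

lemma measure_MM: "measure XR MM = c"
proof -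
  interpret Ld: prob_space "lam d" by simp
  have "emeasure XR MM = (\<integral>\<^sup>+x. emeasure lborel (Pair x -` MM) \<partial>lam d)"
    by (rule lborel.emeasure_pair_measure_alt[OF MM_sets])
  also have "\<dots> = (\<integral>\<^sup>+x. ennreal (\<Psi> x) \<partial>lam d)"
  proof (rule nn_integral_cong)
    fix x assume "x \<in> space (lam d)"
    then have "Pair x -` MM = {0..<\<Psi> x}" by (auto simp: susp_space_def)
    then show "emeasure lborel (Pair x -` MM) = ennreal (\<Psi> x)" using Psi_lower[of x] m0 by simp
  qed
  also have "\<dots> = ennreal (\<integral>x. \<Psi> x \<partial>lam d)"
  proof (rule nn_integral_eq_integral)
    have nn: "0 \<le> \<Psi> x" for x using Psi_lower[of x] m0 by linarith
    show "integrable (lam d) \<Psi>" by (rule Ld.integrable_const_bound[of _ M1]) (use nn Psi_upper in auto)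
    show "AE x in lam d. 0 \<le> \<Psi> x" using nn by simp
  qed
  finally show ?thesis using c_pos cf0 by (simp add: measure_def)
qed

theorem suspension_mixing: "susp_mixing d T \<Psi>"
  unfolding susp_mixing_def
proof (intro ballI)
  let ?\<mu> = "susp_measure d \<Psi>"
  fix A Q assume "A \<in> sets ?\<mu>" "Q \<in> sets ?\<mu>"
  then have A: "A \<in> sets XR" and Q: "Q \<in> sets XR" by (auto simp: susp_measure_def)
  have e: "emeasure XR MM \<noteq> 0" "emeasure XR MM \<noteq> \<infinity>"
    using measure_MM c_pos MM_finite by (auto simp: measure_def)
  have \<mu>: "measure ?\<mu> X = measure XR (MM \<inter> X) / c" if "X \<in> sets XR" for X
    unfolding susp_measure_def measure_uniform_measure[OF e that] measure_MM ..
  let ?A = "MM \<inter> A" and ?S = "MM \<inter> Q"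
  have AM: "?A \<in> sets XR" "?A \<subseteq> MM" and SM: "?S \<in> sets XR" "?S \<subseteq> MM" using A Q MM_sets by auto
  have J: "(\<integral>z. indicator X z \<partial>XR) = complex_of_real (measure XR X)" if "X \<in> sets XR" for X
  proof -
    have "(\<integral>z. complex_of_real (indicator X z) \<partial>XR) = complex_of_real (measure XR X)"
      unfolding integral_complex_of_real using sets.sets_into_space[OF that] by (simp add: Int_absorb2)
    then show ?thesis by (simp add: of_real_indicator)
  qed
  have "((\<lambda>t. Cor ?S t (indicator ?A)) \<longlongrightarrow> of_real (measure XR ?S / c) * of_real (measure XR ?A)) at_top"
    using good_indicator[OF SM AM] unfolding good_def J[OF AM(1)] by blast
  then have lim: "((\<lambda>t. Re (Cor ?S t (indicator ?A))) \<longlongrightarrow> measure XR ?S / c * measure XR ?A) at_top"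
    using tendsto_Re by fastforce
  have ev: "\<forall>\<^sub>F t in at_top. Re (Cor ?S t (indicator ?A)) / c = measure ?\<mu> (susp_flow T \<Psi> t -` A \<inter> Q)"
    using eventually_ge_at_top[of 0]
  proof eventually_elim
    case (elim t)
    let ?X = "susp_flow T \<Psi> t -` A \<inter> Q"
    have "?X = (susp_flow T \<Psi> t -` A \<inter> space XR) \<inter> Q" using sets.sets_into_space[OF Q] by auto
    then have X: "?X \<in> sets XR" using measurable_sets[OF susp_flow_measurable A] Q by auto
    have "indicator ?S z * (\<Sum>n<Nt t. indicator ?A ((T ^^ n) (fst z), snd z + t - p n (fst z))) = (indicator (MM \<inter> ?X) z :: complex)" for z
    proof (cases "z \<in> MM")
      case True
      then show ?thesis using susp_flow_sum(2)[OF True elim AM(2)]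
        unfolding susp_flow_sum(1)[OF True elim AM(2)] by (auto simp: indicator_def)
    qed (simp add: indicator_def)
    then have "Cor ?S t (indicator ?A) = of_real (measure XR (MM \<inter> ?X))"
      unfolding Cor_def by (simp only: J[OF sets.Int[OF MM_sets X]])
    then show ?case unfolding \<mu>[OF X] by simp
  qed
  have "((\<lambda>t. Re (Cor ?S t (indicator ?A)) / c) \<longlongrightarrow> measure XR ?S / c * measure XR ?A / c) at_top"
    using lim c_pos by (intro tendsto_divide) auto
  also have "measure XR ?S / c * measure XR ?A / c = measure ?\<mu> A * measure ?\<mu> Q"
    unfolding \<mu>[OF A] \<mu>[OF Q] by simp
  finally show "((\<lambda>t. measure ?\<mu> (susp_flow T \<Psi> t -` A \<inter> Q)) \<longlongrightarrow> measure ?\<mu> A * measure ?\<mu> Q) at_top"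
    by (rule Lim_transform_eventually[OF _ ev])
qed

end

section \<open>Reduction to trigonometric sums\<close>

definition red :: "nat \<Rightarrow> (nat \<Rightarrow> real) \<Rightarrow> nat \<Rightarrow> real" where
  "red n x = restrict (\<lambda>j. frac (x j)) {..<n}"

lemma red_in_cube: "red n x \<in> cube n"
  by (auto simp: red_def cube_def PiE_iff frac_ge_0 frac_lt_1)

lemma red_cube: "x \<in> cube n \<Longrightarrow> red n x = x"
  by (auto simp: red_def cube_def PiE_iff fun_eq_iff extensional_def frac_eq)

lemma chr_red: "chr n \<xi> (red n x) = chr n \<xi> x"
  by (rule chr_mod_int) (simp add: red_def frac_eq_add_int)

lemma chr_eq_exp: "chr n \<xi> x = exp (2 * of_real pi * \<i> * of_real (\<Sum>j<n. real_of_int (\<xi> j) * x j))"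
  by (simp add: chr_def cis_conv_exp mult_ac)

lemma chr_continuous: "continuous_on S (chr n \<xi>)"
  unfolding chr_def cis_conv_exp
  by (intro continuous_intros continuous_on_subset[OF continuous_on_product_coordinates subset_UNIV])

text \<open>The closed cube is represented by full sequences that vanish from \<open>n\<close> on;
  compactness in the product topology supplies minima and bounds for continuous functions on the
  torus.\<close>

lemma compact_closed_cube: "compact (PiE UNIV (\<lambda>i. if i < n then {0..1} else {0}) :: (nat \<Rightarrow> real) set)"
proof -
  have "compactin (product_topology (\<lambda>i. euclidean) UNIV) (PiE UNIV (\<lambda>i. if i < n then {0..1} else {0}) :: (nat \<Rightarrow> real) set)"
    by (subst compactin_PiE) (auto simp: compactin_euclidean_iff)
  then show ?thesis by (simp add: euclidean_product_topology compactin_euclidean_iff)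
qed

lemma susp_mixing_cong:
  assumes eq: "\<And>x. x \<in> cube n \<Longrightarrow> \<Psi> x = \<Psi>' x" and S: "\<And>x. S x \<in> cube n" and mix: "susp_mixing n S \<Psi>'"
  shows "susp_mixing n S \<Psi>"
proof -
  have sp: "susp_space n \<Psi> = susp_space n \<Psi>'" using eq by (auto simp: susp_space_def)
  have m: "susp_measure n \<Psi> = susp_measure n \<Psi>'" by (simp add: susp_measure_def sp)
  have orb: "(S ^^ i) x \<in> cube n" if "x \<in> cube n" for i x using that S by (cases i) auto
  have fl: "susp_flow S \<Psi> t z = susp_flow S \<Psi>' t z" if "fst z \<in> cube n" for t z
  proof -
    have "birkhoff_sum S \<Psi> k (fst z) = birkhoff_sum S \<Psi>' k (fst z)" for k
      unfolding birkhoff_sum_def by (rule sum.cong) (auto simp: eq orb[OF that])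
    then show ?thesis by (simp add: susp_flow_def split_beta')
  qed
  have "susp_flow S \<Psi> t -` A \<inter> B = susp_flow S \<Psi>' t -` A \<inter> B" if "B \<in> sets (susp_measure n \<Psi>')" for A B t
  proof -
    have "B \<subseteq> space (lam n \<Otimes>\<^sub>M lborel)" using sets.sets_into_space[OF that] by (simp add: susp_measure_def)
    then have "fst z \<in> cube n" if "z \<in> B" for z using that by (auto simp: space_pair_measure)
    then show ?thesis using fl by auto
  qed
  then show ?thesis using mix unfolding susp_mixing_def m by simp
qed

lemma meas_coh_const_cong:
  assumes eq: "\<And>x. x \<in> cube n \<Longrightarrow> \<Psi> x = \<Psi>' x" and coh: "meas_coh_const n S \<Psi>'"
  shows "meas_coh_const n S \<Psi>"
proof -
  have m: "(\<integral>y. \<Psi> y \<partial>lam n) = (\<integral>y. \<Psi>' y \<partial>lam n)" by (rule Bochner_Integration.integral_cong) (auto simp: eq)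
  obtain u where u: "u \<in> borel_measurable (lam n)" "AE x in lam n. \<Psi>' x - (\<integral>y. \<Psi>' y \<partial>lam n) = u (S x) - u x"
    using coh unfolding meas_coh_const_def by blast
  have "AE x in lam n. \<Psi> x - (\<integral>y. \<Psi> y \<partial>lam n) = u (S x) - u x"
    using u(2) AE_space[of "lam n"] by eventually_elim (simp add: eq m)
  then show ?thesis using u(1) unfolding meas_coh_const_def by blast
qed

text \<open>By triangularity the first coordinates of the image depend only on the first coordinates
  of the point, which yields the factor map.\<close>

lemma torus_map_restrict:
  assumes n: "m \<le> n" and lower: "\<And>i j. i < n \<Longrightarrow> j < n \<Longrightarrow> j < i \<Longrightarrow> a i j = 0"
  shows "restrict (torus_map n a b x) {..<m} = torus_map m a b (restrict x {..<m})"
proof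
  fix j
  show "restrict (torus_map n a b x) {..<m} j = torus_map m a b (restrict x {..<m}) j"
  proof (cases "j < m")
    case True
    have "(\<Sum>i<n. x i * real_of_int (a i j)) = (\<Sum>i<m. x i * real_of_int (a i j))"
      by (rule sum.mono_neutral_right) (use n lower[of _ j] True in auto)
    also have "\<dots> = (\<Sum>i<m. restrict x {..<m} i * real_of_int (a i j))" by simp
    finally show ?thesis using True n by (simp add: torus_map_def)
  qed (simp add: torus_map_def)
qed

text \<open>The given frequencies are extensional, hence \<open>undefined\<close> from
  \<open>d\<close> on. They are replaced by frequencies vanishing there, as the nilpotent action
  requires, and the coefficients are transported along this injection.\<close>

lemma trig_poly_representation:
  assumes "trig_poly d \<Psi>"
  obtains F cf where "finite F" "\<And>\<xi> i. \<xi> \<in> F \<Longrightarrow> i \<ge> d \<Longrightarrow> \<xi> i = 0"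
    "\<And>x. x \<in> cube d \<Longrightarrow> complex_of_real (\<Psi> x) = (\<Sum>\<xi>\<in>F. cf \<xi> * chr d \<xi> x)"
proof -
  obtain F0 c0 where F0: "finite F0" "F0 \<subseteq> PiE {..<d} (\<lambda>_. UNIV)"
    "\<And>x. x \<in> cube d \<Longrightarrow> complex_of_real (\<Psi> x) = (\<Sum>\<xi>\<in>F0. c0 \<xi> * chr d \<xi> x)"
    using assms unfolding trig_poly_def chr_eq_exp by blast
  let ?z = "\<lambda>(\<xi>::nat \<Rightarrow> int) i. if i < d then \<xi> i else 0"
  have inj: "inj_on ?z F0"
  proof (rule inj_onI)
    fix \<xi> \<eta> assume "\<xi> \<in> F0" "\<eta> \<in> F0" and e: "?z \<xi> = ?z \<eta>"
    then have "\<xi> \<in> extensional {..<d}" "\<eta> \<in> extensional {..<d}" using F0(2) by (auto simp: PiE_def)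
    moreover have "\<xi> i = \<eta> i" if "i \<in> {..<d}" for i using fun_cong[OF e, of i] that by simp
    ultimately show "\<xi> = \<eta>" by (rule extensionalityI)
  qed
  show ?thesis
  proof (rule that[of "?z ` F0" "\<lambda>\<xi>. c0 (the_inv_into F0 ?z \<xi>)"])
    show "finite (?z ` F0)" using F0(1) by simp
    show "\<xi> i = 0" if "\<xi> \<in> ?z ` F0" "i \<ge> d" for \<xi> i using that by auto
    fix x assume "x \<in> cube d"
    have "(\<Sum>\<xi>\<in>?z ` F0. c0 (the_inv_into F0 ?z \<xi>) * chr d \<xi> x) = (\<Sum>\<xi>\<in>F0. c0 (the_inv_into F0 ?z (?z \<xi>)) * chr d (?z \<xi>) x)"
      by (rule sum.reindex[OF inj, unfolded comp_def])
    also have "\<dots> = (\<Sum>\<xi>\<in>F0. c0 \<xi> * chr d \<xi> x)"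
    proof (rule sum.cong[OF refl])
      fix \<xi> assume "\<xi> \<in> F0"
      moreover have "chr d (?z \<xi>) x = chr d \<xi> x" by (rule chr_cong) auto
      ultimately show "c0 (the_inv_into F0 ?z (?z \<xi>)) * chr d (?z \<xi>) x = c0 \<xi> * chr d \<xi> x"
        by (simp only: the_inv_into_f_f[OF inj])
    qed
    finally show "complex_of_real (\<Psi> x) = (\<Sum>\<xi>\<in>?z ` F0. c0 (the_inv_into F0 ?z \<xi>) * chr d \<xi> x)"
      using F0(3)[OF \<open>x \<in> cube d\<close>] by (simp only:)
  qed
qed

text \<open>By periodicity, the minimum over the compact closed cube is a minimum over all
  points.\<close>

lemma positive_trig_sum_lower_bound:
  assumes Psi: "\<And>x. complex_of_real (\<Psi> x) = (\<Sum>\<xi>\<in>F. cf \<xi> * chr d \<xi> x)" and pos: "\<And>x. \<Psi> x > 0"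
  obtains m where "m > 0" "\<And>x. \<Psi> x \<ge> m"
proof -
  let ?Q = "PiE UNIV (\<lambda>i. if i < d then {0..1} else {0}) :: (nat \<Rightarrow> real) set"
  have P: "\<Psi> x = Re (\<Sum>\<xi>\<in>F. cf \<xi> * chr d \<xi> x)" for x unfolding Psi[symmetric] by simp
  have "continuous_on ?Q \<Psi>" unfolding P[abs_def] by (intro continuous_intros chr_continuous)
  moreover have "(\<lambda>_. 0) \<in> ?Q" by auto
  ultimately obtain x0 where x0: "\<And>x. x \<in> ?Q \<Longrightarrow> \<Psi> x0 \<le> \<Psi> x"
    using continuous_attains_inf[OF compact_closed_cube[of d], of \<Psi>] by blast
  have "\<Psi> x \<ge> \<Psi> x0" for x
  proof -
    let ?y = "\<lambda>j. if j < d then frac (x j) else 0"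
    have "chr d \<xi> ?y = chr d \<xi> x" for \<xi> by (rule chr_mod_int) (simp add: frac_eq_add_int)
    then have "\<Psi> ?y = \<Psi> x" unfolding P by simp
    moreover have "?y \<in> ?Q" by (auto simp: frac_ge_0 intro: less_imp_le[OF frac_lt_1])
    ultimately show ?thesis using x0 by metis
  qed
  then show ?thesis using that[of "\<Psi> x0"] pos by blast
qed

text \<open>The empty list of directions yields continuity of \<open>U\<close>, and the cube lies in
  the continuous image of a compact set.\<close>

lemma smooth_Rn_bounded_on_cube:
  assumes "smooth_Rn n U"
  obtains K where "\<And>y. y \<in> cube n \<Longrightarrow> \<bar>U y\<bar> \<le> K"
proof -
  have cU: "continuous_on (PiE {..<n} (\<lambda>_. UNIV)) U" using assms unfolding smooth_Rn_def by (metis empty_set empty_subsetI)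
  let ?Q = "PiE UNIV (\<lambda>i. if i < n then {0..1} else {0}) :: (nat \<Rightarrow> real) set"
  have cr: "continuous_on ?Q (\<lambda>x. restrict x {..<n})"
    unfolding restrict_def
  proof (rule continuous_on_coordinatewise_then_product)
    fix i show "continuous_on ?Q (\<lambda>x. if i \<in> {..<n} then x i else undefined)"
      by (cases "i \<in> {..<n}") (auto intro: continuous_on_subset[OF continuous_on_product_coordinates])
  qed
  have "continuous_on ?Q (\<lambda>x. U (restrict x {..<n}))"
    by (rule continuous_on_compose2[OF cU cr]) (auto split: if_splits)
  from compact_imp_bounded[OF compact_continuous_image[OF this compact_closed_cube]]
  obtain K where K: "\<And>x. x \<in> ?Q \<Longrightarrow> \<bar>U (restrict x {..<n})\<bar> \<le> K" by (auto simp: bounded_iff)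
  show ?thesis
  proof (rule that)
    fix y assume y: "y \<in> cube n"
    let ?x = "\<lambda>i. if i < n then y i else 0"
    have "?x \<in> ?Q" using y by (auto simp: cube_def PiE_iff less_imp_le)
    moreover have "restrict ?x {..<n} = y" using y by (auto simp: cube_def PiE_iff extensional_def fun_eq_iff)
    ultimately show "\<bar>U y\<bar> \<le> K" using K[of ?x] by simp
  qed
qed

text \<open>Orthogonality in the last variable; the gauge integral is first turned into a Lebesgue
  integral over the half-open interval.\<close>

lemma integral_last_coordinate:
  assumes d: "d > 0" and F: "finite F" and Psi: "\<And>x. complex_of_real (\<Psi> x) = (\<Sum>\<xi>\<in>F. cf \<xi> * chr d \<xi> x)"
  shows "complex_of_real (integral {0..1} (\<lambda>t. \<Psi> (x(d - 1 := t)))) = (\<Sum>\<xi>\<in>{\<xi>\<in>F. \<xi> (d - 1) = 0}. cf \<xi> * chr d \<xi> x)"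
proof -
  define x0 where "x0 = x(d - 1 := 0)"
  have d1: "d - 1 < d" using d by simp
  have c: "chr d \<xi> (x(d - 1 := t)) = chr d \<xi> x0 * cis (2 * pi * (real_of_int (\<xi> (d - 1)) * t))" for \<xi> t
    using chr_upd[OF d1, of \<xi> x0 t] by (simp add: x0_def)
  have "continuous_on UNIV (\<lambda>t. \<Sum>\<xi>\<in>F. cf \<xi> * (chr d \<xi> x0 * cis (2 * pi * (real_of_int (\<xi> (d - 1)) * t))))"
    unfolding cis_conv_exp by (intro continuous_intros)
  then have cont: "continuous_on UNIV (\<lambda>t. complex_of_real (\<Psi> (x(d - 1 := t))))" unfolding Psi c .
  have contR: "continuous_on UNIV (\<lambda>t. \<Psi> (x(d - 1 := t)))" using continuous_on_Re[OF cont] by simp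
  have "integral {0..1} (\<lambda>t. \<Psi> (x(d - 1 := t))) = (\<integral>t. \<Psi> (x(d - 1 := t)) \<partial>uI)"
  proof -
    have "integral {0..1} (\<lambda>t. \<Psi> (x(d - 1 := t))) = integral {0..<1} (\<lambda>t. \<Psi> (x(d - 1 := t)))"
      by (rule integral_subset_negligible[symmetric]) (auto intro: negligible_subset[of "{1}"])
    also have "\<dots> = (LINT t:{0..<1}|lborel. \<Psi> (x(d - 1 := t)))"
    proof (rule set_borel_integral_eq_integral(2)[symmetric])
      have "set_integrable lborel {0..1} (\<lambda>t. \<Psi> (x(d - 1 := t)))"
        unfolding set_integrable_def by (rule borel_integrable_compact, rule compact_Icc, rule continuous_on_subset[OF contR subset_UNIV])
      then show "set_integrable lborel {0..<1} (\<lambda>t. \<Psi> (x(d - 1 := t)))" by (rule set_integrable_subset) auto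
    qed
    also have "\<dots> = (\<integral>t. \<Psi> (x(d - 1 := t)) \<partial>uI)"
      by (subst integral_restrict_space) (auto simp: set_lebesgue_integral_def)
    finally show ?thesis .
  qed
  then have "complex_of_real (integral {0..1} (\<lambda>t. \<Psi> (x(d - 1 := t)))) = (\<integral>t. complex_of_real (\<Psi> (x(d - 1 := t))) \<partial>uI)"
    by (simp only: integral_complex_of_real)
  also have "\<dots> = (\<integral>t. (\<Sum>\<xi>\<in>F. cf \<xi> * chr d \<xi> x0 * cis (2 * pi * (real_of_int (\<xi> (d - 1)) * t))) \<partial>uI)"
    unfolding Psi c by (simp only: mult.assoc)
  also have "\<dots> = (\<Sum>\<xi>\<in>F. (\<integral>t. cf \<xi> * chr d \<xi> x0 * cis (2 * pi * (real_of_int (\<xi> (d - 1)) * t)) \<partial>uI))"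
    by (rule Bochner_Integration.integral_sum)
      (unfold cis_conv_exp, intro uI_integrable_continuous continuous_intros)
  also have "\<dots> = (\<Sum>\<xi>\<in>F. if \<xi> (d - 1) = 0 then cf \<xi> * chr d \<xi> x else 0)"
  proof (rule sum.cong[OF refl])
    fix \<xi>
    have "(\<integral>t. cf \<xi> * chr d \<xi> x0 * cis (2 * pi * (real_of_int (\<xi> (d - 1)) * t)) \<partial>uI)
      = cf \<xi> * chr d \<xi> x0 * (\<integral>t. cis (2 * pi * (real_of_int (\<xi> (d - 1)) * t)) \<partial>uI)" by (rule integral_mult_right_zero)
    moreover have "chr d \<xi> x = chr d \<xi> x0" if "\<xi> (d - 1) = 0" using c[of \<xi> "x (d - 1)"] that by simp
    ultimately show "(\<integral>t. cf \<xi> * chr d \<xi> x0 * cis (2 * pi * (real_of_int (\<xi> (d - 1)) * t)) \<partial>uI) = (if \<xi> (d - 1) = 0 then cf \<xi> * chr d \<xi> x else 0)"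
      using integral_cis_int[of "\<xi> (d - 1)"] prob_space.prob_space[OF prob_space_unit] by (cases "\<xi> (d - 1) = 0") simp_all
  qed
  also have "\<dots> = (\<Sum>\<xi>\<in>{\<xi>\<in>F. \<xi> (d - 1) = 0}. cf \<xi> * chr d \<xi> x)" using F by (rule sum.inter_filter[symmetric])
  finally show ?thesis .
qed

lemma integral_trig_sum:
  assumes "finite F"
  shows "(\<integral>x. (\<Sum>\<xi>\<in>F. cf \<xi> * chr n \<xi> x) \<partial>lam n) = (\<Sum>\<xi>\<in>{\<xi>\<in>F. \<forall>j<n. \<xi> j = 0}. cf \<xi>)"
proof -
  interpret L: prob_space "lam n" by simp
  have "integrable (lam n) (\<lambda>x. cf \<xi> * chr n \<xi> x)" for \<xi>
    by (intro integrable_mult_right L.integrable_const_bound[of _ 1]) auto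
  then have "(\<integral>x. (\<Sum>\<xi>\<in>F. cf \<xi> * chr n \<xi> x) \<partial>lam n) = (\<Sum>\<xi>\<in>F. if \<forall>j<n. \<xi> j = 0 then cf \<xi> else 0)"
    by (simp add: Bochner_Integration.integral_sum integral_chr if_distrib cong: if_cong)
  also have "\<dots> = (\<Sum>\<xi>\<in>{\<xi>\<in>F. \<forall>j<n. \<xi> j = 0}. cf \<xi>)" using assms by (rule sum.inter_filter[symmetric])
  finally show ?thesis .
qed

text \<open>The terms with last frequency zero form the fibre integral of \<Psi>, a function of the
  first \<open>d - 1\<close> coordinates. Its Birkhoff sums are those over the factor map, where the
  transfer function makes them telescope; continuity of that function bounds the result.\<close>

lemma (in skew) const_part_bounded:
  assumes F: "finite F" and Psi: "\<And>x. complex_of_real (\<Psi> x) = (\<Sum>\<xi>\<in>F. cf \<xi> * chr d \<xi> x)"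
    and coh: "smooth_coh_const (d - 1) (torus_map (d - 1) a b) (\<lambda>y. integral {0..1} (\<lambda>t. \<Psi> (y(d - 1 := t))))"
  obtains K where "\<And>n x. norm ((\<Sum>\<xi>\<in>{\<xi>\<in>F. \<xi> (d - 1) = 0}. cf \<xi> * csum \<xi> n x) - complex_of_real (real n * (\<integral>x. \<Psi> x \<partial>lam d))) \<le> K"
proof -
  let ?F0 = "{\<xi>\<in>F. \<xi> (d - 1) = 0}"
  let ?m = "d - 1"
  let ?S = "torus_map ?m a b"
  define \<psi> where "\<psi> y = integral {0..1} (\<lambda>t. \<Psi> (y(d - 1 := t)))" for y
  define R where "R x = restrict x {..<?m}" for x :: "nat \<Rightarrow> real"
  have d0: "d > 0" and dm: "d = Suc ?m" using d2 by auto
  have psi: "complex_of_real (\<psi> x) = (\<Sum>\<xi>\<in>?F0. cf \<xi> * chr d \<xi> x)" for x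
    unfolding \<psi>_def by (rule integral_last_coordinate[OF d0 F Psi])
  have chrR: "chr d \<xi> (R x) = chr d \<xi> x" "chr d \<xi> x = chr ?m \<xi> x" if "\<xi> (d - 1) = 0" for \<xi> x
  proof -
    have e: "chr d \<xi> x = chr ?m \<xi> x" for x unfolding chr_def by (subst dm, subst sum.lessThan_Suc) (simp add: that[simplified])
    then show "chr d \<xi> x = chr ?m \<xi> x" .
    show "chr d \<xi> (R x) = chr d \<xi> x" unfolding e by (rule chr_cong) (auto simp: R_def)
  qed
  have psiR: "\<psi> (R x) = \<psi> x" for x
  proof -
    have "complex_of_real (\<psi> (R x)) = complex_of_real (\<psi> x)" unfolding psi by (rule sum.cong) (auto simp: chrR(1))
    then show ?thesis by (simp only: of_real_eq_iff)
  qed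
  \<comment> \<open>Both means pick out the coefficients of the frequencies that vanish in all
    coordinates.\<close>
  have mean: "(\<integral>y. \<psi> y \<partial>lam ?m) = (\<integral>x. \<Psi> x \<partial>lam d)"
  proof -
    have "complex_of_real (\<integral>y. \<psi> y \<partial>lam ?m) = (\<integral>y. (\<Sum>\<xi>\<in>?F0. cf \<xi> * chr ?m \<xi> y) \<partial>lam ?m)"
      unfolding integral_complex_of_real[symmetric] psi by (intro Bochner_Integration.integral_cong sum.cong) (auto simp: chrR(2))
    also have "\<dots> = (\<Sum>\<xi>\<in>{\<xi>\<in>?F0. \<forall>j<?m. \<xi> j = 0}. cf \<xi>)" by (rule integral_trig_sum) (use F in auto)
    also have "{\<xi>\<in>?F0. \<forall>j<?m. \<xi> j = 0} = {\<xi>\<in>F. \<forall>j<d. \<xi> j = 0}"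
    proof -
      have "(\<forall>j<Suc m. \<xi> j = 0) \<longleftrightarrow> \<xi> m = 0 \<and> (\<forall>j<m. \<xi> j = 0)" for m and \<xi> :: "nat \<Rightarrow> int"
        by (auto simp: less_Suc_eq)
      from this[of ?m, folded dm] show ?thesis by blast
    qed
    also have "(\<Sum>\<xi>\<in>\<dots>. cf \<xi>) = complex_of_real (\<integral>x. \<Psi> x \<partial>lam d)"
      unfolding integral_complex_of_real[symmetric] Psi by (rule integral_trig_sum[OF F, symmetric])
    finally show ?thesis by (simp only: of_real_eq_iff)
  qed
  obtain U where U: "smooth_Rn ?m U" "\<And>y. y \<in> cube ?m \<Longrightarrow> \<psi> y - (\<integral>z. \<psi> z \<partial>lam ?m) = U (?S y) - U y"
    using coh unfolding smooth_coh_const_def \<psi>_def[symmetric] by blast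
  obtain K where K: "\<And>y. y \<in> cube ?m \<Longrightarrow> \<bar>U y\<bar> \<le> K" by (rule smooth_Rn_bounded_on_cube[OF U(1)]) (rule that)
  have Rc: "R x \<in> cube ?m" if "x \<in> cube d" for x using that by (auto simp: R_def cube_def PiE_iff)
  have RT: "R (T x) = ?S (R x)" for x unfolding R_def by (rule torus_map_restrict) (use lower in auto)
  have sums: "(\<Sum>\<xi>\<in>?F0. cf \<xi> * csum \<xi> n x) = complex_of_real (\<Sum>i<n. \<psi> ((T ^^ i) x))" for n x
    unfolding csum_def sum_distrib_left of_real_sum psi by (rule sum.swap)
  have Tc: "(T ^^ i) x \<in> cube d" if "x \<in> cube d" for i x using measurable_space[OF Tn_measurable, of x i] that by simp
  have tele: "(\<Sum>i<n. \<psi> ((T ^^ i) x)) - real n * (\<integral>x. \<Psi> x \<partial>lam d) = U (R ((T ^^ n) x)) - U (R x)" if x: "x \<in> cube d" for n x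
  proof (induction n)
    case (Suc n)
    have step: "R ((T ^^ Suc n) x) = ?S (R ((T ^^ n) x))" by (simp only: funpow.simps comp_apply RT)
    have "\<psi> ((T ^^ n) x) - (\<integral>x. \<Psi> x \<partial>lam d) = U (R ((T ^^ Suc n) x)) - U (R ((T ^^ n) x))"
      using U(2)[OF Rc[OF Tc[OF x, of n]]] unfolding psiR mean step .
    then show ?case using Suc by (simp add: algebra_simps)
  qed simp
  have bound: "norm ((\<Sum>\<xi>\<in>?F0. cf \<xi> * csum \<xi> n x) - complex_of_real (real n * (\<integral>x. \<Psi> x \<partial>lam d))) \<le> 2 * K" if x: "x \<in> cube d" for n x
  proof -
    have "norm ((\<Sum>\<xi>\<in>?F0. cf \<xi> * csum \<xi> n x) - complex_of_real (real n * (\<integral>x. \<Psi> x \<partial>lam d))) = \<bar>U (R ((T ^^ n) x)) - U (R x)\<bar>"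
      unfolding sums of_real_diff[symmetric] norm_of_real tele[OF x] ..
    also have "\<dots> \<le> 2 * K" using K[OF Rc[OF x]] K[OF Rc[OF Tc[OF x, of n]]] by linarith
    finally show ?thesis .
  qed
  \<comment> \<open>Character sums are periodic, so the bound extends from the cube to all
    points.\<close>
  have cs: "csum \<xi> n (red d x) = csum \<xi> n x" for \<xi> n x
  proof -
    have "chr d \<xi> ((T ^^ j) (red d x)) = chr d \<xi> ((T ^^ j) x)" for j
    proof -
      obtain w where w: "\<And>x. chr d \<xi> ((T ^^ j) x) = chr d ((act ^^ j) \<xi>) x * w" using chr_Tn by blast
      show ?thesis unfolding w chr_red ..
    qed
    then show ?thesis unfolding csum_def by simp
  qed
  show ?thesis
  proof (rule that[of "2 * K"])
    fix n x
    show "norm ((\<Sum>\<xi>\<in>?F0. cf \<xi> * csum \<xi> n x) - complex_of_real (real n * (\<integral>x. \<Psi> x \<partial>lam d))) \<le> 2 * K"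
      using bound[OF red_in_cube[of d x], of n] unfolding cs .
  qed
qed

theorem theorem2p6:
  fixes d :: nat and a :: "nat \<Rightarrow> nat \<Rightarrow> int" and b :: "nat \<Rightarrow> real"
    and \<Psi> :: "(nat \<Rightarrow> real) \<Rightarrow> real"
  assumes "d \<ge> 2"
    and "\<forall>i<d. a i i = 1"
    and "\<forall>i<d. \<forall>j<d. j < i \<longrightarrow> a i j = 0"
    and "\<exists>i<d. \<exists>j<d. i \<noteq> j \<and> a i j \<noteq> 0"
    and "b \<in> cube d"
    and "uniquely_ergodic d (torus_map d a b)"
    and "\<exists>k\<ge>1. \<not> mat_zero d (matpow d (minus_id a) k) \<and> mat_zero d (matpow d (minus_id a) (Suc k)) \<and>
           range (\<lambda>y. vecmat d y (matpow d (minus_id a) k)) =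
           range (\<lambda>c::real. restrict (\<lambda>j. if j = d - 1 then c else 0) {..<d})"
    and "trig_poly d \<Psi>"
    and "\<forall>x\<in>cube d. \<Psi> x > 0"
    and "\<not> meas_coh_const d (torus_map d a b) \<Psi>"
    and "smooth_coh_const (d - 1) (torus_map (d - 1) a b)
           (\<lambda>y. integral {0..1} (\<lambda>t. \<Psi> (y(d - 1 := t))))"
  shows "susp_mixing d (torus_map d a b) \<Psi>"
proof -
  interpret skew d a b by unfold_locales (use assms(1-3,6) in auto)
  obtain F cf where F: "finite F" "\<And>\<xi> i. \<xi> \<in> F \<Longrightarrow> i \<ge> d \<Longrightarrow> \<xi> i = 0"
    and PF: "\<And>x. x \<in> cube d \<Longrightarrow> complex_of_real (\<Psi> x) = (\<Sum>\<xi>\<in>F. cf \<xi> * chr d \<xi> x)"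
    by (rule trig_poly_representation[OF assms(8)]) (rule that, assumption+)
  \<comment> \<open>\<Psi> is constrained on the cube only; its periodic extension satisfies the
    trigonometric expansion everywhere, as translates in the last coordinate require.\<close>
  define \<Phi> where "\<Phi> x = \<Psi> (red d x)" for x
  have eq: "\<Psi> x = \<Phi> x" if "x \<in> cube d" for x using red_cube[OF that] by (simp add: \<Phi>_def)
  have Phi: "complex_of_real (\<Phi> x) = (\<Sum>\<xi>\<in>F. cf \<xi> * chr d \<xi> x)" for x
    unfolding \<Phi>_def PF[OF red_in_cube] chr_red ..
  have pos: "\<Phi> x > 0" for x unfolding \<Phi>_def using assms(9) red_in_cube by blast
  obtain m0 where m0: "m0 > 0" "\<And>x. \<Phi> x \<ge> m0"
    by (rule positive_trig_sum_lower_bound[OF Phi pos]) (rule that, assumption+)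
  have coh: "smooth_coh_const (d - 1) (torus_map (d - 1) a b) (\<lambda>y. integral {0..1} (\<lambda>t. \<Phi> (y(d - 1 := t))))"
  proof -
    have "integral {0..1} (\<lambda>t. \<Phi> (y(d - 1 := t))) = integral {0..1} (\<lambda>t. \<Psi> (y(d - 1 := t)))" if y: "y \<in> cube (d - 1)" for y
    \<comment> \<open>At \<open>t = 1\<close> the point leaves the cube and \<Psi> is unconstrained;
      a single point does not affect the integral.\<close>
    proof (rule integral_spike[of "{1}"])
      fix t :: real assume t: "t \<in> {0..1} - {1}"
      have "y(d - 1 := t) \<in> cube d"
        using y t assms(1) by (auto simp: cube_def PiE_iff extensional_def)
      then show "\<Psi> (y(d - 1 := t)) = \<Phi> (y(d - 1 := t))" by (rule eq)
    qed simp
    moreover from this have "(\<integral>y. integral {0..1} (\<lambda>t. \<Phi> (y(d - 1 := t))) \<partial>lam (d - 1)) = (\<integral>y. integral {0..1} (\<lambda>t. \<Psi> (y(d - 1 := t))) \<partial>lam (d - 1))"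
      by (intro Bochner_Integration.integral_cong) auto
    ultimately show ?thesis using assms(11) unfolding smooth_coh_const_def by simp
  qed
  obtain CU where CU: "\<And>n x. norm ((\<Sum>\<xi>\<in>{\<xi>\<in>F. \<xi> (d - 1) = 0}. cf \<xi> * csum \<xi> n x) - complex_of_real (real n * (\<integral>x. \<Phi> x \<partial>lam d))) \<le> CU"
    by (rule const_part_bounded[OF F(1) Phi coh]) (rule that)
  obtain i0 and s :: "nat \<Rightarrow> real" where s: "i0 < d" "s \<longlonglongrightarrow> (0::real)"
    "\<And>\<xi>. (\<And>i. i \<ge> d \<Longrightarrow> \<xi> i = 0) \<Longrightarrow> (\<lambda>n. s n * real_of_int ((unip_act d a ^^ n) \<xi> i0)) \<longlonglongrightarrow> real_of_int (\<xi> (d - 1))"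
    by (rule last_coordinate_translation[OF assms(7)]) (rule that, assumption, assumption, blast)
  interpret trig_suspension d a b F cf \<Phi> "\<integral>x. \<Phi> x \<partial>lam d" m0 CU i0 s
  proof unfold_locales
    show "\<not> meas_coh_const d (torus_map d a b) \<Phi>" using meas_coh_const_cong[of d \<Psi> \<Phi>] eq assms(10) by blast
  qed (use F Phi m0 CU s in auto)
  show ?thesis by (rule susp_mixing_cong[OF eq torus_map_in_cube suspension_mixing])
qed

end
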